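(* Let $d\ge3$ and suppose that the family of measures $(\mathbb{P}^u)_{u\in I}$ satisfies conditions (P1), (P2), (P3), (S1), (S2) and that the monotonicity and moment assumption (K) holds. Then, for any $u\in I$, there exist $c_{27}=c_{27}(u),c_{28}=c_{28}(u)\in(0,\infty)$ such that for $\mathbb{P}^u$-a.e. $\omega$ and all $x\in\mathcal C_\infty(\omega)$ there exists $N_{12}(\omega,x)<\infty$ such that for all $y\in\mathcal C_\infty(\omega)$ with $|x-y|>N_{12}(\omega,x)$ and all $h\in[0,1]$, $$g^\omega(x,y)\le c_{27}\,|x-y|^{2-d}\exp\big(-c_{28}\sqrt h\,|x-y|\big).$$
   Context: Setup. Let $E_d$ be the nearest-neighbour edges of $\mathbb{Z}^d$. Let $(\Omega_E,\mathcal F_E)$, $(\Omega_V,\mathcal F_V)$ be measurable, partially ordered spaces. For $e\in E_d$ (resp. $x\in\mathbb{Z}^d$) let $\Omega_e$ (resp. $\Omega_x$) be a copy of $\Omega_E$ (resp. $\Omega_V$), and let $\Omega=\prod_{e\in E_d}\Omega_e\times\prod_{x\in\mathbb{Z}^d}\Omega_x$ with product $\sigma$-algebra $\mathcal F$, coordinatewise partial order, and coordinates $\omega_{\bar e}$, $\bar e\in E_d\cup\mathbb{Z}^d$. Shifts: $(\tau_z\omega)_{\bar e}=\omega_{\bar e+z}$. Fix a finite set $\mathcal N\subset E_d\cup\mathbb{Z}^d$ around the origin, $\Omega_{\mathcal N}=\prod_{\bar e\in\mathcal N}\Omega_{\bar e}$; $\omega_{|\mathcal N+x}$ is viewed as an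 element of $\Omega_{\mathcal N}$ by translation. $I\subset\mathbb{R}$ is an open interval, $(\mathbb{P}^u)_{u\in I}$ are probability measures on $(\Omega,\mathcal F)$. "Monotone" means increasing or decreasing for the product order. $|\cdot|$ is the $\ell^1$-norm. Random conductances and killing rates. Let $\mathbf a:\Omega_{\mathcal N}\times\Omega_{\mathcal N}\times\Omega_E\to[0,\infty)$ be measurable, symmetric in its first two arguments, with $\mathbf 1_{\{\mathbf a>0\}}$ monotone, and $\boldsymbol\kappa:\Omega_{\mathcal N}\to(0,\infty)$ measurable. Set $a^\omega(x,y)=\mathbf a(\omega_{|\mathcal N+x},\omega_{|\mathcal N+y},\omega_e)$ for $e=\{x,y\}\in E_d$ (and $0$ for non-edges), $\kappa^\omega(x)=\boldsymbol\kappa(\omega_{|\mathcal N+x})$. An edge is open if $a^\omega(e)>0$; $\mathcal O(\omega)$ is the set of open edges and $x\sim y$ means $\{x,y\}\in\mathcal O(\omega)$. $\mathcal C_r(\omega)$, $r\in[0,\infty]$, is the set of vertices lying in connected components of $(\mathbb{Z}^d,\mathcal O(\omega))$ of $\ell^1$-diameter at least $r$; $\mathcal C_\infty(\omega)$ is the infinite cluster (a.s. unique under (S1)–(S2)). $\mathbb{P}^u_0=\mathbb{P}^u[\,\cdot\mid 0\in\mathcal C_\infty]$ with expectation $\mathbb{E}^u_0$. $\mu^\omega(x)=\sum_{y\sim x}a^\omega(x,y)$, $\nu^\omega(x)=\sum_{y\sim x}a^\omega(x,y)^{-1}$. For $h\in[0,1]$, $X$ is the continuous-time Markov chain on $\mathcal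 C_\infty(\omega)$ (with cemetery state) with generator $(\mathcal L^\omega f)(x)=\sum_{y\sim x}a^\omega(x,y)(f(y)-f(x))-h\kappa^\omega(x)f(x)$, i.e. jumping from $x$ to $y$ at rate $a^\omega(x,y)$ and killed at $x$ at rate $h\kappa^\omega(x)$, with killing time $\zeta$ and law $\mathrm P^\omega_x$. Green's function: $g^\omega(x,y)=\int_0^\infty\mathrm P^\omega_x[X_t=y,t<\zeta]\,dt$ (depending on $h$). Notation for the conditions. $Q(x,L)=\{y\in\mathbb{Z}^d:|x-y|_\infty\le L\}$; $\bar Q(x,L)$ is the union of $Q(x,L)$ and the edges with both endpoints in $Q(x,L)$. $d(A,B)$ is the minimal $\ell^\infty$-distance between vertices/endpoints of edges in $A$ and in $B$. $\hat{\mathbb{P}}^u=\mathbb{P}^u\otimes\mathbb{P}^u$ with coordinates $(\omega^{(1)},\omega^{(2)})$; $\omega_{|S}=(\omega_{\bar e})_{\bar e\in S}$. An event is increasing (decreasing) if its indicator is. (P1) For each $u\in I$, $\mathbb{P}^u\circ\tau_x^{-1}=\mathbb{P}^u$ for all $x\in\mathbb{Z}^d$, and for each $x\in\mathbb{Z}^d\setminus\{0\}$, $\mathbb{P}^u(A)\in\{0,1\}$ for every $A\in\mathcal F$ with $\tau_x(A)=A$. (P2) $\mathbb{E}^u[f]\le\mathbb{E}^{u'}[f]$ for all increasing $f:\Omega\to[0,1]$ and $u\le u'$ in $I$. (P3) There exist positive constants $R_P,L_P<\infty$, $\xi_P>1$, $\varepsilon_P,a_P,C_P,\chi_P>0$ and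 $f_P:[0,\infty)\to[0,\infty)$ with $f_P(L)\ge\exp(a_P(\log L)^{\varepsilon_P})$ such that for all $R\ge R_P$, $L\ge L_P$, $x_1,x_2\in\mathbb{Z}^d$ with, writing $\bar Q_i=\bar Q(x_i,L^{\xi_P})$, $d(\bar Q_1,\bar Q_2)\ge RL$, and all $u,\hat u\in I$ with $u\ge\hat u+R^{-\chi_P}$: there is an event $B$ (possibly on an extension of the probability space underlying $\mathbb{P}^{\hat u}$) with $\mathbb{P}^{\hat u}(B^c)\le\exp(-C_Pf_P(L))$ such that for all increasing events $A\subset\prod_{\bar e\in\bar Q_1}\Omega_{\bar e}\times\prod_{\bar e\in\bar Q_2}\Omega_{\bar e}$, $\mathbb{P}^{\hat u}(B,(\omega_{|\bar Q_1},\omega_{|\bar Q_2})\in A)\le\hat{\mathbb{P}}^u((\omega^{(1)}_{|\bar Q_1},\omega^{(2)}_{|\bar Q_2})\in A)$; and there is an event $B'$ (possibly on an extension of the space underlying $\mathbb{P}^u$) with $\mathbb{P}^u(B'^c)\le\exp(-C_Pf_P(L))$ such that for all decreasing such $A$, $\mathbb{P}^u(B',(\omega_{|\bar Q_1},\omega_{|\bar Q_2})\in A)\le\hat{\mathbb{P}}^{\hat u}((\omega^{(1)}_{|\bar Q_1},\omega^{(2)}_{|\bar Q_2})\in A)$. (S1) There is $f_S:I\times\mathbb{Z}_+\to\mathbb{R}$ such that for each $u\in I$ there exist $\Delta_S(u)>0$, $R_S(u)<\infty$ with $f_S(u,R)\ge(\log R)^{1+\Delta_S(u)}$ for all $R\ge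 R_S(u)$, and for all $u\in I$, $R\ge1$: $\mathbb{P}^u[\mathcal C_R\cap[-R,R]^d\ne\varnothing]\ge1-e^{-f_S(u,R)}$ and $\mathbb{P}^u[\forall x,y\in\mathcal C_{R/10}\cap[-R,R]^d:\ x\text{ is connected to }y\text{ by an open path in }[-2R,2R]^d]\ge1-e^{-f_S(u,R)}$. (S2) $u\mapsto\mathbb{P}^u[0\in\mathcal C_\infty]$ is positive and continuous on $I$. (K) (i) The map $\mathbf t:\Omega_{\mathcal N}\times\Omega_{\mathcal N}\times\Omega_E\to[0,\infty)\cup\{\infty\}$, $\mathbf t(\omega^1,\omega^2,\omega_E)=\big(1\wedge\frac{\boldsymbol\kappa(\omega^1)\wedge\boldsymbol\kappa(\omega^2)}{\mathbf a(\omega^1,\omega^2,\omega_E)}\big)^{1/2}$ if $\mathbf a(\omega^1,\omega^2,\omega_E)\ne0$ and $=\infty$ otherwise, is monotone. (ii) There exist $p,q\in(1,\infty]$ with $1/p+1/q<2/d$ such that for every $u\in I$ the quantities $\mathbb{E}^u_0[\mu^\omega(0)^p]$, $\mathbb{E}^u_0[\nu^\omega(0)^q]$, $\mathbb{E}^u_0[\kappa^\omega(0)]$, $\mathbb{E}^u_0[\kappa^\omega(0)^{-1}]$ are finite (essential suprema for infinite exponents). *)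

theory Defs
  imports "HOL-Probability.Probability"
begin

section \<open>Lattice and configurations\<close>

text \<open>Points of \<open>\<int>\<^sup>d\<close> are elements of \<^typ>\<open>int ^ 'd\<close>, where \<open>d = CARD('d)\<close>; edges are unordered pairs.\<close>

definition l1norm :: "int ^ 'd \<Rightarrow> int" where
  "l1norm x = (\<Sum>i\<in>UNIV. \<bar>x $ i\<bar>)"

definition linfnorm :: "int ^ 'd \<Rightarrow> int" where
  "linfnorm x = Max (range (\<lambda>i. \<bar>x $ i\<bar>))"

definition edges :: "(int ^ 'd) set set" where
  "edges = {{x, y} | x y. l1norm (x - y) = 1}"

text \<open>A subset of \<open>E\<^sub>d \<union> \<int>\<^sup>d\<close> is stored as the pair of its edges and its vertices, and a configuration
  as the pair of its edge and its vertex coordinates.\<close>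

type_synonym 'd region = "(int ^ 'd) set set \<times> (int ^ 'd) set"
type_synonym ('e, 'v, 'd) conf = "((int ^ 'd) set \<Rightarrow> 'e) \<times> (int ^ 'd \<Rightarrow> 'v)"

definition full_region :: "'d::finite region" where
  "full_region = (edges, UNIV)"

definition conf_space :: "'e measure \<Rightarrow> 'v measure \<Rightarrow> 'd::finite region \<Rightarrow> ('e, 'v, 'd) conf measure" where
  "conf_space ME MV S = PiM (fst S) (\<lambda>_. ME) \<Otimes>\<^sub>M PiM (snd S) (\<lambda>_. MV)"

abbreviation Omega :: "'e measure \<Rightarrow> 'v measure \<Rightarrow> ('e, 'v, 'd::finite) conf measure" where
  "Omega ME MV \<equiv> conf_space ME MV full_region"

definition conf_le ::
  "'d::finite region \<Rightarrow> ('e::order, 'v::order, 'd) conf \<Rightarrow> ('e, 'v, 'd) conf \<Rightarrow> bool" where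
  "conf_le S \<omega> \<omega>' \<longleftrightarrow>
     (\<forall>e\<in>fst S. fst \<omega> e \<le> fst \<omega>' e) \<and> (\<forall>x\<in>snd S. snd \<omega> x \<le> snd \<omega>' x)"

definition shift :: "int ^ 'd \<Rightarrow> ('e, 'v, 'd) conf \<Rightarrow> ('e, 'v, 'd) conf" where
  "shift z \<omega> = ((\<lambda>e. fst \<omega> ((\<lambda>x. x + z) ` e)), (\<lambda>x. snd \<omega> (x + z)))"

definition restr :: "'d::finite region \<Rightarrow> ('e, 'v, 'd) conf \<Rightarrow> ('e, 'v, 'd) conf" where
  "restr S \<omega> = (restrict (fst \<omega>) (fst S), restrict (snd \<omega>) (snd S))"

text \<open>\<open>\<omega>\<close> restricted to \<open>N + x\<close>, translated back to \<open>N\<close>.\<close>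

definition env :: "'d region \<Rightarrow> ('e, 'v, 'd) conf \<Rightarrow> int ^ 'd \<Rightarrow> ('e, 'v, 'd) conf" where
  "env N \<omega> x = restr N (shift x \<omega>)"

definition monotone_either ::
  "'a set \<Rightarrow> ('a \<Rightarrow> 'a \<Rightarrow> bool) \<Rightarrow> ('a \<Rightarrow> 'b::order) \<Rightarrow> bool" where
  "monotone_either S le f \<longleftrightarrow> monotone_on S le (\<le>) f \<or> monotone_on S le (\<ge>) f"

section \<open>Random conductances and killing rates\<close>

type_synonym ('e, 'v, 'd) cond_fun = "('e, 'v, 'd) conf \<Rightarrow> ('e, 'v, 'd) conf \<Rightarrow> 'e \<Rightarrow> real"
type_synonym ('e, 'v, 'd) kill_fun = "('e, 'v, 'd) conf \<Rightarrow> real"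

definition triple_space ::
  "'e measure \<Rightarrow> 'v measure \<Rightarrow> 'd::finite region
    \<Rightarrow> (('e, 'v, 'd) conf \<times> ('e, 'v, 'd) conf \<times> 'e) measure" where
  "triple_space ME MV N = conf_space ME MV N \<Otimes>\<^sub>M (conf_space ME MV N \<Otimes>\<^sub>M ME)"

fun triple_le :: "'d::finite region \<Rightarrow> ('e::order, 'v::order, 'd) conf \<times> ('e, 'v, 'd) conf \<times> 'e
    \<Rightarrow> ('e, 'v, 'd) conf \<times> ('e, 'v, 'd) conf \<times> 'e \<Rightarrow> bool" where
  "triple_le N (s, t, e) (s', t', e') \<longleftrightarrow> conf_le N s s' \<and> conf_le N t t' \<and> e \<le> e'"

definition conductance_function ::
  "'e::order measure \<Rightarrow> 'v::order measure \<Rightarrow> 'd::finite region \<Rightarrow> ('e, 'v, 'd) cond_fun \<Rightarrow> bool" where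
  "conductance_function ME MV N a \<longleftrightarrow>
     (\<lambda>(s, t, e). a s t e) \<in> borel_measurable (triple_space ME MV N) \<and>
     (\<forall>(s, t, e)\<in>space (triple_space ME MV N). 0 \<le> a s t e \<and> a s t e = a t s e) \<and>
     monotone_either (space (triple_space ME MV N)) (triple_le N)
       (\<lambda>(s, t, e). of_bool (0 < a s t e) :: real)"

definition killing_function ::
  "'e measure \<Rightarrow> 'v measure \<Rightarrow> 'd::finite region \<Rightarrow> ('e, 'v, 'd) kill_fun \<Rightarrow> bool" where
  "killing_function ME MV N \<kappa> \<longleftrightarrow>
     \<kappa> \<in> borel_measurable (conf_space ME MV N) \<and> (\<forall>s\<in>space (conf_space ME MV N). 0 < \<kappa> s)"

definition conductance :: "'d region \<Rightarrow> ('e, 'v, 'd) cond_fun \<Rightarrow> ('e, 'v, 'd) conf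
    \<Rightarrow> int ^ 'd \<Rightarrow> int ^ 'd \<Rightarrow> real" where
  "conductance N a \<omega> x y =
     (if {x, y} \<in> edges then a (env N \<omega> x) (env N \<omega> y) (fst \<omega> {x, y}) else 0)"

definition killing_rate :: "'d region \<Rightarrow> ('e, 'v, 'd) kill_fun \<Rightarrow> ('e, 'v, 'd) conf
    \<Rightarrow> int ^ 'd \<Rightarrow> real" where
  "killing_rate N \<kappa> \<omega> x = \<kappa> (env N \<omega> x)"

definition open_edges ::
  "'d region \<Rightarrow> ('e, 'v, 'd) cond_fun \<Rightarrow> ('e, 'v, 'd) conf \<Rightarrow> (int ^ 'd) set set" where
  "open_edges N a \<omega> = {{x, y} | x y. {x, y} \<in> edges \<and> 0 < conductance N a \<omega> x y}"

definition connected_in :: "'d region \<Rightarrow> ('e, 'v, 'd) cond_fun \<Rightarrow> ('e, 'v, 'd) conf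
    \<Rightarrow> (int ^ 'd) set \<Rightarrow> int ^ 'd \<Rightarrow> int ^ 'd \<Rightarrow> bool" where
  "connected_in N a \<omega> B x y \<longleftrightarrow>
     (x, y) \<in> {(v, w). v \<in> B \<and> w \<in> B \<and> {v, w} \<in> open_edges N a \<omega>}\<^sup>*"

definition component ::
  "'d region \<Rightarrow> ('e, 'v, 'd) cond_fun \<Rightarrow> ('e, 'v, 'd) conf \<Rightarrow> int ^ 'd \<Rightarrow> (int ^ 'd) set" where
  "component N a \<omega> x = {y. connected_in N a \<omega> UNIV x y}"

definition l1diam :: "(int ^ 'd) set \<Rightarrow> ereal" where
  "l1diam A = (SUP (x, y)\<in>A \<times> A. ereal (of_int (l1norm (x - y))))"

definition clusters ::
  "'d region \<Rightarrow> ('e, 'v, 'd) cond_fun \<Rightarrow> ereal \<Rightarrow> ('e, 'v, 'd) conf \<Rightarrow> (int ^ 'd) set" where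
  "clusters N a r \<omega> = {x. r \<le> l1diam (component N a \<omega> x)}"

abbreviation infinite_cluster ::
  "'d region \<Rightarrow> ('e, 'v, 'd) cond_fun \<Rightarrow> ('e, 'v, 'd) conf \<Rightarrow> (int ^ 'd) set" where
  "infinite_cluster N a \<equiv> clusters N a \<infinity>"

definition mu :: "'d region \<Rightarrow> ('e, 'v, 'd) cond_fun \<Rightarrow> ('e, 'v, 'd) conf \<Rightarrow> int ^ 'd \<Rightarrow> real" where
  "mu N a \<omega> x = (\<Sum>y | {x, y} \<in> open_edges N a \<omega>. conductance N a \<omega> x y)"

definition nu :: "'d region \<Rightarrow> ('e, 'v, 'd) cond_fun \<Rightarrow> ('e, 'v, 'd) conf \<Rightarrow> int ^ 'd \<Rightarrow> real" where
  "nu N a \<omega> x = (\<Sum>y | {x, y} \<in> open_edges N a \<omega>. inverse (conductance N a \<omega> x y))"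

section \<open>Conditions on the family of measures\<close>

definition Q :: "int ^ 'd \<Rightarrow> real \<Rightarrow> (int ^ 'd) set" where
  "Q x L = {y. of_int (linfnorm (x - y)) \<le> L}"

definition Qbar :: "int ^ 'd \<Rightarrow> real \<Rightarrow> 'd region" where
  "Qbar x L = ({e \<in> edges. e \<subseteq> Q x L}, Q x L)"

definition region_vertices :: "'d region \<Rightarrow> (int ^ 'd) set" where
  "region_vertices S = \<Union> (fst S) \<union> snd S"

definition region_dist :: "'d::finite region \<Rightarrow> 'd region \<Rightarrow> real" where
  "region_dist S T =
     (INF (x, y)\<in>region_vertices S \<times> region_vertices T. of_int (linfnorm (x - y)))"

definition cond_P1 ::
  "'e measure \<Rightarrow> 'v measure \<Rightarrow> real set \<Rightarrow> (real \<Rightarrow> ('e, 'v, 'd::finite) conf measure) \<Rightarrow> bool" where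
  "cond_P1 ME MV I P \<longleftrightarrow>
     (\<forall>u\<in>I. (\<forall>x. distr (P u) (Omega ME MV) (shift x) = P u) \<and>
        (\<forall>x. x \<noteq> 0 \<longrightarrow>
           (\<forall>A\<in>sets (Omega ME MV). shift x ` A = A \<longrightarrow> measure (P u) A \<in> {0, 1})))"

definition cond_P2 :: "'e::order measure \<Rightarrow> 'v::order measure \<Rightarrow> real set
    \<Rightarrow> (real \<Rightarrow> ('e, 'v, 'd::finite) conf measure) \<Rightarrow> bool" where
  "cond_P2 ME MV I P \<longleftrightarrow>
     (\<forall>u\<in>I. \<forall>u'\<in>I. u \<le> u' \<longrightarrow>
        (\<forall>f\<in>borel_measurable (Omega ME MV).
           (\<forall>\<omega>\<in>space (Omega ME MV). 0 \<le> f \<omega> \<and> f \<omega> \<le> (1::real)) \<longrightarrow>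
           monotone_on (space (Omega ME MV)) (conf_le full_region) (\<le>) f \<longrightarrow>
           (\<integral>\<omega>. f \<omega> \<partial>P u) \<le> (\<integral>\<omega>. f \<omega> \<partial>P u')))"

definition pair_le :: "'d::finite region \<Rightarrow> 'd region
    \<Rightarrow> ('e::order, 'v::order, 'd) conf \<times> ('e, 'v, 'd) conf
    \<Rightarrow> ('e, 'v, 'd) conf \<times> ('e, 'v, 'd) conf \<Rightarrow> bool" where
  "pair_le S T p p' \<longleftrightarrow> conf_le S (fst p) (fst p') \<and> conf_le T (snd p) (snd p')"

definition increasing_events :: "'e::order measure \<Rightarrow> 'v::order measure \<Rightarrow> 'd::finite region \<Rightarrow> 'd region
    \<Rightarrow> (('e, 'v, 'd) conf \<times> ('e, 'v, 'd) conf) set set" where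
  "increasing_events ME MV S T =
     {A \<in> sets (conf_space ME MV S \<Otimes>\<^sub>M conf_space ME MV T).
        monotone_on (space (conf_space ME MV S \<Otimes>\<^sub>M conf_space ME MV T)) (pair_le S T) (\<le>)
          (indicat_real A)}"

definition decreasing_events :: "'e::order measure \<Rightarrow> 'v::order measure \<Rightarrow> 'd::finite region \<Rightarrow> 'd region
    \<Rightarrow> (('e, 'v, 'd) conf \<times> ('e, 'v, 'd) conf) set set" where
  "decreasing_events ME MV S T =
     {A \<in> sets (conf_space ME MV S \<Otimes>\<^sub>M conf_space ME MV T).
        monotone_on (space (conf_space ME MV S \<Otimes>\<^sub>M conf_space ME MV T)) (pair_le S T) (\<ge>)
          (indicat_real A)}"

definition extension_of :: "'x measure \<Rightarrow> ('x \<Rightarrow> 'a) \<Rightarrow> 'a measure \<Rightarrow> bool" where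
  "extension_of M' \<pi> M \<longleftrightarrow> prob_space M' \<and> \<pi> \<in> M' \<rightarrow>\<^sub>M M \<and> distr M' M \<pi> = M"

text \<open>There is an event \<open>B\<close>, possibly on an extension of the space underlying \<open>M\<close>, with
  \<open>M(B\<^sup>c) \<le> \<delta>\<close> and \<open>M(B, (\<omega>|S, \<omega>|T) \<in> A) \<le> (M\<^sub>2 \<otimes> M\<^sub>2)((\<omega>\<^sub>1|S, \<omega>\<^sub>2|T) \<in> A)\<close> for all \<open>A \<in> \<A>\<close>.
  The sample points of the extension have type \<^typ>\<open>'x\<close>.\<close>

definition decoupled :: "'x itself \<Rightarrow> ('e, 'v, 'd::finite) conf measure \<Rightarrow> ('e, 'v, 'd) conf measure
    \<Rightarrow> 'd region \<Rightarrow> 'd region \<Rightarrow> (('e, 'v, 'd) conf \<times> ('e, 'v, 'd) conf) set set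
    \<Rightarrow> real \<Rightarrow> bool" where
  "decoupled X M M\<^sub>2 S T \<A> \<delta> \<longleftrightarrow>
     (\<exists>(M' :: 'x measure) \<pi>. \<exists>B\<in>sets M'. extension_of M' \<pi> M \<and>
        measure M' (space M' - B) \<le> \<delta> \<and>
        (\<forall>A\<in>\<A>.
           measure M' {\<xi> \<in> space M'. \<xi> \<in> B \<and> (restr S (\<pi> \<xi>), restr T (\<pi> \<xi>)) \<in> A}
           \<le> measure (M\<^sub>2 \<Otimes>\<^sub>M M\<^sub>2)
               {(\<omega>\<^sub>1, \<omega>\<^sub>2) \<in> space (M\<^sub>2 \<Otimes>\<^sub>M M\<^sub>2). (restr S \<omega>\<^sub>1, restr T \<omega>\<^sub>2) \<in> A}))"

text \<open>The type \<^typ>\<open>'x\<close> of the extensions occurs only in this condition. A theorem that assumes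
  \<open>cond_P3 TYPE('x)\<close> with a type variable \<^typ>\<open>'x\<close> therefore applies as soon as the extensions
  exist on some type. The lower bound on \<open>f\<close> is required where the real power of \<open>ln L\<close> makes
  sense, that is, for \<open>L \<ge> 1\<close>; the constant \<open>LP\<close> can be enlarged freely.\<close>

definition cond_P3 :: "'x itself \<Rightarrow> 'e::order measure \<Rightarrow> 'v::order measure \<Rightarrow> real set
    \<Rightarrow> (real \<Rightarrow> ('e, 'v, 'd::finite) conf measure) \<Rightarrow> bool" where
  "cond_P3 X ME MV I P \<longleftrightarrow>
     (\<exists>RP LP \<xi> \<epsilon> aP C \<eta> :: real. \<exists>f :: real \<Rightarrow> real.
        0 < RP \<and> 0 < LP \<and> 1 < \<xi> \<and> 0 < \<epsilon> \<and> 0 < aP \<and> 0 < C \<and> 0 < \<eta> \<and>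
        (\<forall>L\<ge>0. 0 \<le> f L) \<and> (\<forall>L\<ge>1. exp (aP * ln L powr \<epsilon>) \<le> f L) \<and>
        (\<forall>R\<ge>RP. \<forall>L\<ge>LP. \<forall>x\<^sub>1 x\<^sub>2 :: int ^ 'd.
           let Q\<^sub>1 = Qbar x\<^sub>1 (L powr \<xi>); Q\<^sub>2 = Qbar x\<^sub>2 (L powr \<xi>) in
           R * L \<le> region_dist Q\<^sub>1 Q\<^sub>2 \<longrightarrow>
           (\<forall>u\<in>I. \<forall>u'\<in>I. u' + R powr (- \<eta>) \<le> u \<longrightarrow>
              decoupled X (P u') (P u) Q\<^sub>1 Q\<^sub>2
                (increasing_events ME MV Q\<^sub>1 Q\<^sub>2) (exp (- C * f L)) \<and>
              decoupled X (P u) (P u') Q\<^sub>1 Q\<^sub>2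
                (decreasing_events ME MV Q\<^sub>1 Q\<^sub>2) (exp (- C * f L)))))"

definition cond_S1 :: "'d::finite region \<Rightarrow> ('e, 'v, 'd) cond_fun \<Rightarrow> real set
    \<Rightarrow> (real \<Rightarrow> ('e, 'v, 'd) conf measure) \<Rightarrow> bool" where
  "cond_S1 N a I P \<longleftrightarrow>
     (\<exists>fS :: real \<Rightarrow> nat \<Rightarrow> real.
        (\<forall>u\<in>I. \<exists>\<Delta>>0. \<exists>RS::real. \<forall>R::nat. RS \<le> real R \<longrightarrow> ln (real R) powr (1 + \<Delta>) \<le> fS u R) \<and>
        (\<forall>u\<in>I. \<forall>R\<ge>1.
           1 - exp (- fS u R)
             \<le> measure (P u) {\<omega> \<in> space (P u). clusters N a (ereal (real R)) \<omega> \<inter> Q 0 (real R) \<noteq> {}} \<and>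
           1 - exp (- fS u R)
             \<le> measure (P u) {\<omega> \<in> space (P u).
                  \<forall>x\<in>clusters N a (ereal (real R / 10)) \<omega> \<inter> Q 0 (real R).
                  \<forall>y\<in>clusters N a (ereal (real R / 10)) \<omega> \<inter> Q 0 (real R).
                    connected_in N a \<omega> (Q 0 (2 * real R)) x y}))"

definition cond_S2 :: "'d::finite region \<Rightarrow> ('e, 'v, 'd) cond_fun \<Rightarrow> real set
    \<Rightarrow> (real \<Rightarrow> ('e, 'v, 'd) conf measure) \<Rightarrow> bool" where
  "cond_S2 N a I P \<longleftrightarrow>
     (\<forall>u\<in>I. 0 < measure (P u) {\<omega> \<in> space (P u). 0 \<in> infinite_cluster N a \<omega>}) \<and>
     continuous_on I (\<lambda>u. measure (P u) {\<omega> \<in> space (P u). 0 \<in> infinite_cluster N a \<omega>})"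

text \<open>The measure \<open>M\<close> conditioned on the origin being in the infinite cluster.\<close>

definition conditioned :: "'d::finite region \<Rightarrow> ('e, 'v, 'd) cond_fun \<Rightarrow> ('e, 'v, 'd) conf measure
    \<Rightarrow> ('e, 'v, 'd) conf measure" where
  "conditioned N a M = uniform_measure M {\<omega> \<in> space M. 0 \<in> infinite_cluster N a \<omega>}"

text \<open>Finite \<open>p\<close>-th moment of a non-negative random variable.\<close>

definition finite_moment :: "'a measure \<Rightarrow> ereal \<Rightarrow> ('a \<Rightarrow> real) \<Rightarrow> bool" where
  "finite_moment M p X \<longleftrightarrow>
     (if p = \<infinity> then esssup M (\<lambda>\<omega>. ereal (X \<omega>)) < \<infinity>
      else integrable M (\<lambda>\<omega>. X \<omega> powr real_of_ereal p))"

definition edge_weight :: "('e, 'v, 'd::finite) cond_fun \<Rightarrow> ('e, 'v, 'd) kill_fun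
    \<Rightarrow> ('e, 'v, 'd) conf \<Rightarrow> ('e, 'v, 'd) conf \<Rightarrow> 'e \<Rightarrow> ereal" where
  "edge_weight a \<kappa> s t e =
     (if a s t e \<noteq> 0 then ereal (sqrt (min 1 (min (\<kappa> s) (\<kappa> t) / a s t e))) else \<infinity>)"

definition cond_K :: "'e::order measure \<Rightarrow> 'v::order measure \<Rightarrow> 'd::finite region
    \<Rightarrow> ('e, 'v, 'd) cond_fun \<Rightarrow> ('e, 'v, 'd) kill_fun \<Rightarrow> real set
    \<Rightarrow> (real \<Rightarrow> ('e, 'v, 'd) conf measure) \<Rightarrow> bool" where
  "cond_K ME MV N a \<kappa> I P \<longleftrightarrow>
     monotone_either (space (triple_space ME MV N)) (triple_le N)
       (\<lambda>(s, t, e). edge_weight a \<kappa> s t e) \<and>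
     (\<exists>p q :: ereal. 1 < p \<and> 1 < q \<and> 1 / p + 1 / q < ereal (2 / real CARD('d)) \<and>
        (\<forall>u\<in>I.
           finite_moment (conditioned N a (P u)) p (\<lambda>\<omega>. mu N a \<omega> 0) \<and>
           finite_moment (conditioned N a (P u)) q (\<lambda>\<omega>. nu N a \<omega> 0) \<and>
           integrable (conditioned N a (P u)) (\<lambda>\<omega>. killing_rate N \<kappa> \<omega> 0) \<and>
           integrable (conditioned N a (P u)) (\<lambda>\<omega>. inverse (killing_rate N \<kappa> \<omega> 0))))"

section \<open>Continuous-time Markov chain with killing, and its Green's function\<close>

text \<open>The chain with jump rates \<open>q z (Some y)\<close> and killing rates \<open>q z None\<close> is realised by competing
  exponential clocks: on arrival at its \<open>n\<close>-th state \<open>z\<close>, the clock of each target \<open>t\<close> with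
  \<open>q z t > 0\<close> is set to ring after an independent exponential time of rate \<open>q z t\<close>, namely
  \<open>\<xi> (n, t) / q z t\<close> with \<open>\<xi> (n, t)\<close> standard exponential; the chain moves to the target
  whose clock rings first. \<^term>\<open>None\<close> is the cemetery, where the chain also goes upon explosion.
  If no target has positive rate, the holding time is infinite, so the value that \<^const>\<open>arg_min_on\<close>
  takes on the empty set is irrelevant.\<close>

type_synonym 'a clocks = "nat \<times> 'a option \<Rightarrow> real"

definition clock_space :: "'a clocks measure" where
  "clock_space = PiM UNIV (\<lambda>_. density lborel (\<lambda>t. ennreal (exponential_density 1 t)))"

primrec jump_chain :: "('a \<Rightarrow> 'a option \<Rightarrow> real) \<Rightarrow> 'a \<Rightarrow> 'a clocks \<Rightarrow> nat \<Rightarrow> 'a option" where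
  "jump_chain q x \<xi> 0 = Some x"
| "jump_chain q x \<xi> (Suc n) =
     (case jump_chain q x \<xi> n of
        None \<Rightarrow> None
      | Some z \<Rightarrow> arg_min_on (\<lambda>t. \<xi> (n, t) / q z t) {t. 0 < q z t})"

definition holding_time :: "('a \<Rightarrow> 'a option \<Rightarrow> real) \<Rightarrow> 'a \<Rightarrow> 'a clocks \<Rightarrow> nat \<Rightarrow> ennreal" where
  "holding_time q x \<xi> n =
     (case jump_chain q x \<xi> n of
        None \<Rightarrow> \<infinity>
      | Some z \<Rightarrow> (INF t\<in>{t. 0 < q z t}. ennreal (\<xi> (n, t) / q z t)))"

definition jump_time :: "('a \<Rightarrow> 'a option \<Rightarrow> real) \<Rightarrow> 'a \<Rightarrow> 'a clocks \<Rightarrow> nat \<Rightarrow> ennreal" where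
  "jump_time q x \<xi> n = (\<Sum>k<n. holding_time q x \<xi> k)"

definition markov_chain :: "('a \<Rightarrow> 'a option \<Rightarrow> real) \<Rightarrow> 'a \<Rightarrow> real \<Rightarrow> 'a clocks \<Rightarrow> 'a option" where
  "markov_chain q x t \<xi> =
     (if \<exists>n. jump_time q x \<xi> n \<le> ennreal t \<and> ennreal t < jump_time q x \<xi> (Suc n)
      then jump_chain q x \<xi>
             (THE n. jump_time q x \<xi> n \<le> ennreal t \<and> ennreal t < jump_time q x \<xi> (Suc n))
      else None)"

definition killing_time :: "('a \<Rightarrow> 'a option \<Rightarrow> real) \<Rightarrow> 'a \<Rightarrow> 'a clocks \<Rightarrow> ennreal" where
  "killing_time q x \<xi> = (INF t\<in>{t. 0 \<le> t \<and> markov_chain q x t \<xi> = None}. ennreal t)"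

definition green :: "('a \<Rightarrow> 'a option \<Rightarrow> real) \<Rightarrow> 'a \<Rightarrow> 'a \<Rightarrow> ennreal" where
  "green q x y =
     (\<integral>\<^sup>+t\<in>{0..}. emeasure clock_space
        {\<xi> \<in> space clock_space. markov_chain q x t \<xi> = Some y \<and> ennreal t < killing_time q x \<xi>}
      \<partial>lborel)"

text \<open>The jump rates vanish between the infinite cluster and its complement, so that the chain
  started in the infinite cluster stays there until it is killed.\<close>

definition walk_rates :: "'d region \<Rightarrow> ('e, 'v, 'd) cond_fun \<Rightarrow> ('e, 'v, 'd) kill_fun
    \<Rightarrow> ('e, 'v, 'd) conf \<Rightarrow> real \<Rightarrow> int ^ 'd \<Rightarrow> (int ^ 'd) option \<Rightarrow> real" where
  "walk_rates N a \<kappa> \<omega> h x t =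
     (case t of Some y \<Rightarrow> conductance N a \<omega> x y | None \<Rightarrow> h * killing_rate N \<kappa> \<omega> x)"

definition green_function :: "'d region \<Rightarrow> ('e, 'v, 'd) cond_fun \<Rightarrow> ('e, 'v, 'd) kill_fun
    \<Rightarrow> real \<Rightarrow> ('e, 'v, 'd) conf \<Rightarrow> int ^ 'd \<Rightarrow> int ^ 'd \<Rightarrow> ennreal" where
  "green_function N a \<kappa> h \<omega> x y = green (walk_rates N a \<kappa> \<omega> h) x y"

end

(* Green's function is bounded by the increasing limit of Green's functions of the chain stopped after n jumps.
   Each of these has finite support and is a subsolution of the killed equation, so that only upper bounds for
   finitely supported subsolutions are needed.

   Such bounds come from De Giorgi's method on the infinite cluster. The Sobolev inequality is obtained by
   transporting level sets to the full lattice along paths of random length, whose moments are controlled by (S1),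
   and Hoelder's inequality with the moments of mu and nu. Applying the local maximum principle on dyadic annuli
   yields |x - y|^(2-d). The exponential factor is Agmon's estimate: the energy inequality is tested with
   u exp(2 psi), where psi is sqrt h times a potential with a (grad psi)^2 <= min kappa kappa.

   A potential of linear growth exists because the first passage percolation with weights t has positive
   speed: by (P3), passage events in distant boxes decouple up to a change of u of order R^(-chi), so the
   probability that a box of side L_k is crossed too fast decays by a multiscale recursion along a sequence
   u_k converging to u. The monotonicity of t decides whether u is approached from above or from below.
   Finally, (P1) turns moments into upper bounds for averages over boxes. *)
theory Submission
  imports Defs "HOL-Real_Asymp.Real_Asymp"
begin

section \<open>The lattice\<close>

text \<open>Only upper bounds enter, and each ingredient is arranged to need no more than that:
  one-step inequalities for visit probabilities, no decision about explosion, upper bounds for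
  averages in place of an ergodic theorem, and a Sobolev inequality that uses no lower bound on the
  density of the cluster.

  The obstacle is the order of quantifiers. The threshold may depend on x but not on y, whereas the
  local maximum principle works in boxes around y, where nothing is known at small scales. All
  averages are therefore taken over boxes around x, and an estimate around y borrows them from a box
  around x of comparable radius. Constants are then deterministic, and only the least admissible
  radius is random.

  The exponents fit as follows. Sobolev holds with s = 1 + 1/q - 2/d + 2/(d m), Hoelder for the
  conductances gives 1 - 1/p, and De Giorgi's recursion closes when s < 1 - 1/p. As 1/p + 1/q < 2/d
  is strict, there is room for a large finite m, the moment of the number of paths through a
  point.\<close>

lemma linfnorm_ge: "\<bar>x $ i\<bar> \<le> linfnorm x"
  unfolding linfnorm_def by (rule Max_ge) auto

lemma linfnorm_le_iff: "linfnorm x \<le> k \<longleftrightarrow> (\<forall>i. \<bar>x $ i\<bar> \<le> k)"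
  unfolding linfnorm_def by (subst Max_le_iff) auto

lemma linfnorm_nonneg [simp]: "0 \<le> linfnorm x"
  using linfnorm_ge[of x undefined] by linarith

lemma linfnorm_minus_commute: "linfnorm (x - y) = linfnorm (y - x)"
  by (simp add: linfnorm_def abs_minus_commute)

lemma linfnorm_zero [simp]: "linfnorm 0 = 0"
  by (simp add: linfnorm_def)

lemma linfnorm_eq_0_iff [simp]: "linfnorm x = 0 \<longleftrightarrow> x = 0"
proof
  assume "linfnorm x = 0"
  then have "x $ i = 0" for i using linfnorm_ge[of x i] by simp
  then show "x = 0" by (simp add: vec_eq_iff)
qed simp

lemma linfnorm_triangle: "linfnorm (x + y) \<le> linfnorm x + linfnorm y"
  unfolding linfnorm_le_iff
proof
  fix i show "\<bar>(x + y) $ i\<bar> \<le> linfnorm x + linfnorm y"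
    using linfnorm_ge[of x i] linfnorm_ge[of y i] by simp
qed

lemma linfnorm_triangle_diff: "linfnorm (x - z) \<le> linfnorm (x - y) + linfnorm (y - z)"
  using linfnorm_triangle[of "x - y" "y - z"] by simp

lemma linfnorm_le_l1norm: "linfnorm x \<le> l1norm x"
  unfolding linfnorm_le_iff l1norm_def
  by (metis abs_ge_zero finite_class.finite_UNIV iso_tuple_UNIV_I member_le_sum)

lemma l1norm_le: "l1norm (x :: int ^ 'd) \<le> int CARD('d) * linfnorm x"
  unfolding l1norm_def using sum_bounded_above[of UNIV "\<lambda>i. \<bar>x $ i\<bar>" "linfnorm x"]
  by (simp add: linfnorm_ge)

lemma edges_iff: "{x, y} \<in> edges \<longleftrightarrow> l1norm (x - y) = 1"
proof
  assume "{x, y} \<in> edges"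
  then obtain v w where "{x, y} = {v, w}" "l1norm (v - w) = 1" by (auto simp: edges_def)
  then show "l1norm (x - y) = 1" by (auto simp: doubleton_eq_iff l1norm_def abs_minus_commute)
qed (auto simp: edges_def)

lemma edges_dist: "{x, y} \<in> edges \<Longrightarrow> linfnorm (x - y) \<le> 1"
  using linfnorm_le_l1norm[of "x - y"] by (simp add: edges_iff)

lemma edges_neq: "{x, y} \<in> edges \<Longrightarrow> x \<noteq> y"
  by (auto simp: edges_iff l1norm_def)

lemma Q_iff: "z \<in> Q x R \<longleftrightarrow> real_of_int (linfnorm (z - x)) \<le> R"
  by (simp add: Q_def linfnorm_minus_commute)

lemma Q_nat_eq: "Q 0 (real n) = (\<lambda>f. \<chi> i. f i) ` (PiE UNIV (\<lambda>_. {- int n .. int n}))"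
proof -
  have "z \<in> Q 0 (real n) \<longleftrightarrow> (\<forall>i. \<bar>z $ i\<bar> \<le> int n)" for z :: "int ^ 'a"
    unfolding Q_iff linfnorm_le_iff[of z "int n", symmetric] by simp linarith
  moreover have "(\<forall>i. \<bar>z $ i\<bar> \<le> int n) \<longleftrightarrow> z \<in> (\<lambda>f. \<chi> i. f i) ` (PiE UNIV (\<lambda>_. {- int n .. int n}))"
    for z :: "int ^ 'a"
    by (auto simp: image_iff PiE_iff abs_le_iff intro!: bexI[of _ "\<lambda>i. z $ i"]) (metis minus_le_iff)+
  ultimately show ?thesis by blast
qed

lemma Q_floor: "0 \<le> R \<Longrightarrow> Q x R = Q x (real (nat \<lfloor>R\<rfloor>))"
  by (auto simp: Q_iff le_floor_iff)

lemma Q_translate: "Q (x + y) R = (+) y ` Q x R"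
proof -
  have "z \<in> Q (x + y) R \<longleftrightarrow> z - y \<in> Q x R" for z by (simp add: Q_iff algebra_simps)
  then show ?thesis
    by (simp add: set_eq_iff image_iff) (metis add_diff_cancel_left' diff_add_cancel add.commute)
qed

lemma card_Q_nat: "card (Q (x :: int ^ 'd) (real n)) = (2 * n + 1) ^ CARD('d)"
proof -
  have "card (Q (0 :: int ^ 'd) (real n)) = card (PiE (UNIV :: 'd set) (\<lambda>_. {- int n .. int n}))"
    unfolding Q_nat_eq by (rule card_image) (auto simp: inj_on_def vec_eq_iff)
  also have "\<dots> = (2 * n + 1) ^ CARD('d)" by (subst card_PiE) (auto simp: nat_add_distrib nat_mult_distrib)
  finally show ?thesis using Q_translate[of 0 x "real n"] by (simp add: card_image)
qed

lemma finite_Q [simp]: "finite (Q x R)"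
proof (cases "0 \<le> R")
  case True
  have "0 < card (Q x (real (nat \<lfloor>R\<rfloor>)))" by (simp only: card_Q_nat) simp
  then show ?thesis
    using Q_floor[OF True, of x] by (simp add: card_gt_0_iff)
next
  case False
  then have "Q x R = {}" by (auto simp: Q_iff) (smt (verit) linfnorm_nonneg of_int_nonneg)
  then show ?thesis by simp
qed

lemma card_Q_le: "0 \<le> R \<Longrightarrow> real (card (Q (x :: int ^ 'd) R)) \<le> (2 * R + 1) ^ CARD('d)"
  by (subst Q_floor, simp, subst card_Q_nat) (auto intro!: power_mono)

lemma Q_mono: "R \<le> R' \<Longrightarrow> Q x R \<subseteq> Q x R'"
  by (auto simp: Q_iff)

lemma Q_trans: "y \<in> Q x R \<Longrightarrow> z \<in> Q y R' \<Longrightarrow> z \<in> Q x (R + R')"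
  unfolding Q_iff using linfnorm_triangle_diff[of z x y] by linarith

lemma Q_self [simp]: "x \<in> Q x R \<longleftrightarrow> 0 \<le> R"
  by (simp add: Q_iff)

lemma Q_sym: "y \<in> Q x R \<longleftrightarrow> x \<in> Q y R"
  by (simp add: Q_iff linfnorm_minus_commute)


section \<open>Jump chain and Green's function\<close>

abbreviation std_exp :: "real measure" where
  "std_exp \<equiv> density lborel (\<lambda>t. ennreal (exponential_density 1 t))"

lemma prob_space_std_exp: "prob_space std_exp"
  by (rule prob_space_exponential_density) simp

lemma prob_space_clock_space: "prob_space clock_space"
  unfolding clock_space_def by (intro prob_space_PiM prob_space_std_exp)

lemma space_clock_space [simp]: "space clock_space = UNIV"
  by (simp add: clock_space_def space_PiM)

lemma indep_vars_clocks:
  "prob_space.indep_vars clock_space (\<lambda>_. std_exp) (\<lambda>i \<xi>. \<xi> i) UNIV"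
proof -
  interpret prob_space clock_space by (rule prob_space_clock_space)
  have "distr clock_space std_exp (\<lambda>\<xi>. \<xi> i) = std_exp" for i
    unfolding clock_space_def by (rule distr_PiM_component) (auto intro: prob_space_std_exp)
  then have "distr (PiM UNIV (\<lambda>_. std_exp)) std_exp (\<lambda>\<xi>. \<xi> i) = std_exp" for i :: "nat \<times> 'a option"
    by (simp add: clock_space_def)
  then show ?thesis
    by (subst indep_vars_iff_distr_eq_PiM)
       (auto simp: clock_space_def restrict_UNIV simp del: split_paired_All intro!: distr_id2)
qed

text \<open>This is the source of the Markov property: the n-th state is a function of the clocks of
  the earlier steps, while its holding time and the next target are functions of the clocks of step
  n. For these two disjoint index sets expectations factorise.\<close>

lemma nn_integral_clocks_indep:
  assumes F: "F \<in> borel_measurable (PiM A (\<lambda>_. std_exp))" and G: "G \<in> borel_measurable (PiM B (\<lambda>_. std_exp))"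
    and "A \<inter> B = {}"
  shows "(\<integral>\<^sup>+\<xi>. F (restrict \<xi> A) * G (restrict \<xi> B) \<partial>clock_space)
    = (\<integral>\<^sup>+\<xi>. F (restrict \<xi> A) \<partial>clock_space) * (\<integral>\<^sup>+\<xi>. (G (restrict \<xi> B) :: ennreal) \<partial>clock_space)"
proof -
  interpret prob_space clock_space by (rule prob_space_clock_space)
  have "indep_var (PiM A (\<lambda>_. std_exp)) (\<lambda>\<xi>. restrict \<xi> A) (PiM B (\<lambda>_. std_exp)) (\<lambda>\<xi>. restrict \<xi> B)"
    using indep_var_restrict[OF indep_vars_clocks, of A B] assms by simp
  from indep_var_compose[OF this F G]
  have "indep_var borel (F \<circ> (\<lambda>\<xi>. restrict \<xi> A)) borel (G \<circ> (\<lambda>\<xi>. restrict \<xi> B))" .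
  then have *: "indep_vars (\<lambda>_. borel) (case_bool (F \<circ> (\<lambda>\<xi>. restrict \<xi> A)) (G \<circ> (\<lambda>\<xi>. restrict \<xi> B))) UNIV"
    unfolding indep_var_def by (rule indep_vars_cong[THEN iffD1, rotated -1]) (auto split: bool.split)
  show ?thesis using indep_vars_nn_integral[OF _ *] by (simp add: UNIV_bool mult.commute comp_def)
qed

lemma distributed_clock:
  assumes "0 < r"
  shows "distributed clock_space lborel (\<lambda>\<xi>. \<xi> i / r) (\<lambda>x. ennreal (exponential_density r x))"
proof -
  interpret prob_space clock_space by (rule prob_space_clock_space)
  have 0: "distr clock_space std_exp (\<lambda>\<xi>. \<xi> i) = std_exp"
    unfolding clock_space_def by (rule distr_PiM_component) (auto intro: prob_space_std_exp)
  have "distributed clock_space lborel (\<lambda>\<xi>. \<xi> i) (\<lambda>x. ennreal (exponential_density 1 x))"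
    unfolding distributed_def
  proof (intro conjI)
    have "(\<lambda>\<xi>. \<xi> i) \<in> clock_space \<rightarrow>\<^sub>M std_exp" unfolding clock_space_def by measurable
    then show "(\<lambda>\<xi>. \<xi> i) \<in> clock_space \<rightarrow>\<^sub>M lborel" by simp
    show "distr clock_space lborel (\<lambda>\<xi>. \<xi> i) = std_exp"
      using 0 by (metis distr_cong sets_density)
  qed simp
  from erlang_distributed_mult_const[OF this, of "1 / r"] assms show ?thesis by simp
qed

lemma indep_vars_scaled_clocks:
  "prob_space.indep_vars clock_space (\<lambda>_. borel) (\<lambda>t \<xi>. \<xi> (n, t) / r t) S"
proof -
  interpret prob_space clock_space by (rule prob_space_clock_space)
  have "indep_vars (\<lambda>t. PiM {(n, t)} (\<lambda>_. std_exp)) (\<lambda>t \<xi>. \<lambda>i\<in>{(n, t)}. \<xi> i) S"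
    by (rule indep_vars_restrict[OF indep_vars_clocks]) (auto simp: disjoint_family_on_def)
  then have "indep_vars (\<lambda>_. borel) (\<lambda>t. (\<lambda>x. x (n, t) / r t) \<circ> (\<lambda>\<xi>. \<lambda>i\<in>{(n, t)}. \<xi> i)) S"
    by (rule indep_vars_compose) measurable
  then show ?thesis by (simp add: comp_def)
qed

lemma INF_ennreal_eq_Min:
  "finite S \<Longrightarrow> S \<noteq> {} \<Longrightarrow> (INF t\<in>S. ennreal (f t)) = ennreal (MIN t\<in>S. f t)"
proof (induction S rule: finite_ne_induct)
  case (insert x F)
  have "min (ennreal a) (ennreal b) = ennreal (min a b)" for a b
    by (metis ennreal_leI linorder_linear min.absorb1 min.absorb2)
  then show ?case using insert by (simp add: inf_min)
qed simp

lemma nn_integral_min_clocks: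
  assumes "finite S" "S \<noteq> {}" "\<And>t. t \<in> S \<Longrightarrow> 0 < r t"
  shows "(\<integral>\<^sup>+\<xi>. (INF t\<in>S. ennreal (\<xi> (n, t) / r t)) \<partial>clock_space) = ennreal (1 / sum r S)"
proof -
  interpret prob_space clock_space by (rule prob_space_clock_space)
  have pos: "0 < sum r S" using assms by (intro sum_pos) auto
  have D: "distributed clock_space lborel (\<lambda>\<xi>. MIN t\<in>S. \<xi> (n, t) / r t) (\<lambda>x. ennreal (exponential_density (sum r S) x))"
    using assms by (intro exponential_distributed_Min distributed_clock indep_vars_scaled_clocks) auto
  have "(\<integral>\<^sup>+\<xi>. (INF t\<in>S. ennreal (\<xi> (n, t) / r t)) \<partial>clock_space) = (\<integral>\<^sup>+\<xi>. ennreal (MIN t\<in>S. \<xi> (n, t) / r t) \<partial>clock_space)"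
    using assms by (simp add: INF_ennreal_eq_Min)
  also have "\<dots> = (\<integral>\<^sup>+x. ennreal (exponential_density (sum r S) x) * ennreal x \<partial>lborel)"
    by (rule distributed_nn_integral[OF D, symmetric]) simp
  also have "\<dots> = (\<integral>\<^sup>+x. ennreal (erlang_density 0 (sum r S) x * x ^ 1) \<partial>lborel)"
    using pos by (intro nn_integral_cong) (simp add: ennreal_mult' )
  also have "\<dots> = ennreal (1 / sum r S)"
    by (subst nn_integral_erlang_ith_moment) (use pos in auto)
  finally show ?thesis .
qed

text \<open>Clock s is compared with the minimum of the others, which is independent of it and
  exponential of rate m, so the probability is the integral of r_s exp(-r_s x) exp(-m x). The event
  includes ties and hence covers every way in which \<open>arg_min_on\<close> may break
  them.\<close>

lemma prob_first_clock_le: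
  assumes "finite S" "s \<in> S" "\<And>t. t \<in> S \<Longrightarrow> 0 < r t"
  shows "emeasure clock_space {\<xi>. \<forall>t\<in>S. \<xi> (n, s) / r s \<le> \<xi> (n, t) / r t} \<le> ennreal (r s / sum r S)"
proof (cases "S = {s}")
  case True
  interpret prob_space clock_space by (rule prob_space_clock_space)
  show ?thesis using True assms emeasure_le_1 by (simp add: less_imp_neq[THEN not_sym])
next
  case False
  interpret prob_space clock_space by (rule prob_space_clock_space)
  let ?X = "\<lambda>\<xi> :: 'a clocks. \<xi> (n, s) / r s" and ?Y = "\<lambda>\<xi> :: 'a clocks. MIN t\<in>S-{s}. \<xi> (n, t) / r t"
  have ne: "S - {s} \<noteq> {}" using False assms by auto
  define m where "m = sum r (S - {s})"
  have m: "0 < m" unfolding m_def using assms ne by (intro sum_pos) auto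
  have sum_eq: "sum r S = r s + m" unfolding m_def using assms by (simp add: sum.remove)
  have X: "distributed clock_space lborel ?X (\<lambda>x. ennreal (exponential_density (r s) x))"
    using assms by (intro distributed_clock) auto
  have Y: "distributed clock_space lborel ?Y (\<lambda>x. ennreal (exponential_density m x))"
    unfolding m_def using assms ne by (intro exponential_distributed_Min distributed_clock indep_vars_scaled_clocks) auto
  have ind: "indep_var borel ?X borel ?Y"
  proof -
    have "indep_vars (\<lambda>_. borel) (\<lambda>t \<xi>. \<xi> (n, t) / r t) (insert s (S - {s}))"
      by (rule indep_vars_scaled_clocks)
    from indep_vars_Min[OF _ _ this] show ?thesis using assms by simp
  qed
  have ind': "indep_var lborel ?X lborel ?Y"
    using indep_var_compose[OF ind, of "\<lambda>x. x" lborel "\<lambda>x. x" lborel] by (simp add: comp_def)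
  let ?f = "\<lambda>x. ennreal (exponential_density (r s) x)" and ?g = "\<lambda>x. ennreal (exponential_density m x)"
  have J: "distributed clock_space (lborel \<Otimes>\<^sub>M lborel) (\<lambda>\<xi>. (?X \<xi>, ?Y \<xi>)) (\<lambda>(x, y). ?f x * ?g y)"
    by (intro distributed_joint_indep X Y ind' sigma_finite_lborel)
  have tail: "(\<integral>\<^sup>+y. ?g y * indicator {x..} y \<partial>lborel) = ennreal (exp (- x * m))" if "0 \<le> x" for x
  proof -
    have "(\<integral>\<^sup>+y. ?g y * indicator {x..} y \<partial>lborel) = (\<integral>\<^sup>+y. ?g y * indicator {x<..} y \<partial>lborel)"
      by (rule nn_integral_cong_AE) (use AE_lborel_singleton[of x] in eventually_elim, auto split: split_indicator)
    also have "\<dots> = emeasure clock_space (?Y -` {x<..} \<inter> space clock_space)"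
      by (rule distributed_emeasure[OF Y, symmetric]) simp
    also have "?Y -` {x<..} \<inter> space clock_space = {\<xi> \<in> space clock_space. x < ?Y \<xi>}" by auto
    also have "emeasure clock_space \<dots> = ennreal (exp (- x * m))"
      using exponential_distributedD_gt[OF Y that m] by (simp add: emeasure_eq_measure)
    finally show ?thesis .
  qed
  have Min_iff: "x \<le> ?Y \<xi> \<longleftrightarrow> (\<forall>t\<in>S-{s}. x \<le> \<xi> (n, t) / r t)" for x \<xi>
    using assms ne by (subst Min_ge_iff) auto
  have le: "{p :: real \<times> real. fst p \<le> snd p} \<in> sets (lborel \<Otimes>\<^sub>M lborel)"
  proof -
    have "{p :: real \<times> real. fst p \<le> snd p} \<in> sets borel"
      by (intro borel_closed closed_Collect_le continuous_intros)
    then show ?thesis by (metis borel_prod sets_lborel sets_pair_measure_cong)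
  qed
  have "{\<xi>. \<forall>t\<in>S. \<xi> (n, s) / r s \<le> \<xi> (n, t) / r t} = (\<lambda>\<xi>. (?X \<xi>, ?Y \<xi>)) -` {p. fst p \<le> snd p} \<inter> space clock_space"
    unfolding vimage_def by (auto simp: Min_iff simp del: Min_ge_iff)
  then have "emeasure clock_space {\<xi>. \<forall>t\<in>S. \<xi> (n, s) / r s \<le> \<xi> (n, t) / r t}
      = (\<integral>\<^sup>+p. (case p of (x, y) \<Rightarrow> ?f x * ?g y) * indicator {p. fst p \<le> snd p} p \<partial>(lborel \<Otimes>\<^sub>M lborel))"
    by (simp only:, intro distributed_emeasure[OF J] le)
  also have "\<dots> = (\<integral>\<^sup>+x. \<integral>\<^sup>+y. (case (x, y) of (x, y) \<Rightarrow> ?f x * ?g y) * indicator {p. fst p \<le> snd p} (x, y) \<partial>lborel \<partial>lborel)"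
    using le by (intro lborel.nn_integral_fst[symmetric]) auto
  also have "\<dots> = (\<integral>\<^sup>+x. ?f x * (\<integral>\<^sup>+y. ?g y * indicator {x..} y \<partial>lborel) \<partial>lborel)"
    by (intro nn_integral_cong, subst nn_integral_cmult[symmetric]) (auto intro!: nn_integral_cong split: split_indicator simp: mult.assoc)
  also have "\<dots> = (\<integral>\<^sup>+x. ennreal (r s / sum r S) * ennreal (exponential_density (sum r S) x) \<partial>lborel)"
  proof (intro nn_integral_cong)
    fix x :: real
    show "?f x * (\<integral>\<^sup>+y. ?g y * indicator {x..} y \<partial>lborel) = ennreal (r s / sum r S) * ennreal (exponential_density (sum r S) x)"
    proof (cases "0 \<le> x")
      case True
      then show ?thesis
      proof -
        have rs: "0 < r s" using assms by auto
        have "exp (- x * r s) * exp (- x * m) = exp (- x * (r s + m))"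
          unfolding exp_add[symmetric] by (simp add: algebra_simps)
        moreover have "r s / (r s + m) * (r s + m) = r s" using rs m by simp
        ultimately have "exponential_density (r s) x * exp (- x * m) = r s / sum r S * exponential_density (sum r S) x"
          using True rs m unfolding sum_eq exponential_density_def by (simp add: mult.assoc)
        then show ?thesis
          unfolding tail[OF True] using rs m sum_eq by (simp add: ennreal_mult'[symmetric])
      qed
    qed (simp add: exponential_density_def)
  qed
  also have "\<dots> = ennreal (r s / sum r S) * emeasure (density lborel (\<lambda>x. ennreal (exponential_density (sum r S) x))) UNIV"
    by (subst nn_integral_cmult) (auto simp: emeasure_density)
  also have "emeasure (density lborel (\<lambda>x. ennreal (exponential_density (sum r S) x))) UNIV = 1"
    using prob_space.emeasure_space_1[OF prob_space_exponential_density[of "sum r S"]] assms m sum_eq by (simp add: add_pos_pos)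
  finally show ?thesis by simp
qed

text \<open>\<open>arg_min_on\<close> is a choice operator, but its choice depends on w only through
  the set of minimisers. That set is a measurable random variable with finitely many values, and
  every function on a discrete space is measurable.\<close>

lemma measurable_arg_min_on:
  fixes f :: "'b \<Rightarrow> 'a \<Rightarrow> real"
  assumes "finite S" and [measurable]: "\<And>t. t \<in> S \<Longrightarrow> f t \<in> borel_measurable M"
  shows "(\<lambda>w. arg_min_on (\<lambda>t. f t w) S) \<in> M \<rightarrow>\<^sub>M count_space UNIV"
proof -
  define mins where "mins w = {t \<in> S. \<forall>s\<in>S. f t w \<le> f s w}" for w
  have eq: "arg_min_on (\<lambda>t. f t w) S = (SOME t. t \<in> mins w)" for w
    unfolding arg_min_on_def arg_min_def is_arg_min_def mins_def
    by (rule arg_cong[where f = Eps]) (auto simp: fun_eq_iff not_less)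
  have "mins \<in> M \<rightarrow>\<^sub>M count_space (Pow S)"
  proof -
    have "mins -` {a} \<inter> space M \<in> sets M" if "a \<in> Pow S" for a
    proof -
      have "mins w = a \<longleftrightarrow> (\<forall>t\<in>S. t \<in> a \<longleftrightarrow> (\<forall>s\<in>S. f t w \<le> f s w))" for w
        using that by (auto simp: mins_def)
      then have "mins -` {a} \<inter> space M = {w \<in> space M. \<forall>t\<in>S. t \<in> a \<longleftrightarrow> (\<forall>s\<in>S. f t w \<le> f s w)}"
        by auto
      also have "\<dots> \<in> sets M"
      proof (rule sets.sets_Collect_finite_All[OF _ assms(1)])
        fix t assume t: "t \<in> S"
        have *: "{w \<in> space M. \<forall>s\<in>S. f t w \<le> f s w} \<in> sets M"
          using assms(1) t by (intro sets.sets_Collect_finite_All borel_measurable_le) auto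
        then show "{w \<in> space M. t \<in> a \<longleftrightarrow> (\<forall>s\<in>S. f t w \<le> f s w)} \<in> sets M"
          using sets.sets_Collect_neg[OF *] by (cases "t \<in> a") auto
      qed
      finally show "mins -` {a} \<inter> space M \<in> sets M" .
    qed
    moreover have "mins \<in> space M \<rightarrow> Pow S" by (auto simp: mins_def)
    ultimately show ?thesis using assms(1) by (simp add: measurable_count_space_eq2)
  qed
  then have "(\<lambda>w. SOME t. t \<in> mins w) \<in> M \<rightarrow>\<^sub>M count_space UNIV"
    by (rule measurable_compose) simp
  then show ?thesis by (simp add: eq)
qed

text \<open>C is a set that the chain cannot leave, the infinite cluster in the application.
  Nonempty target sets are required on C only, since sites outside may be isolated; finite target
  sets are required everywhere because the measurability argument runs through all states. Finitely
  many sources make the one-step bound a finite sum.\<close>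

locale jump_rates =
  fixes q :: "'a :: countable \<Rightarrow> 'a option \<Rightarrow> real" and C :: "'a set" and x :: 'a
  assumes start: "x \<in> C"
    and finite_targets: "finite {t. 0 < q z t}"
    and targets_nonempty: "z \<in> C \<Longrightarrow> {t. 0 < q z t} \<noteq> {}"
    and targets_closed: "z \<in> C \<Longrightarrow> 0 < q z (Some y) \<Longrightarrow> y \<in> C"
    and finite_sources: "finite {z \<in> C. 0 < q z (Some y)}"
begin

abbreviation "targets z \<equiv> {t. 0 < q z t}"
abbreviation "total_rate z \<equiv> sum (q z) (targets z)"
abbreviation "past n \<equiv> {..<n} \<times> (UNIV :: 'a option set)"
abbreviation "now n \<equiv> {n} \<times> (UNIV :: 'a option set)"

lemma jump_chain_cong:
  "(\<And>k t. k < n \<Longrightarrow> \<xi> (k, t) = \<xi>' (k, t)) \<Longrightarrow> jump_chain q x \<xi> n = jump_chain q x \<xi>' n"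
  by (induction n) (auto split: option.split)

lemma jump_chain_in: "jump_chain q x \<xi> n = Some z \<Longrightarrow> z \<in> C"
proof (induction n arbitrary: z)
  case (Suc n)
  then obtain w where w: "jump_chain q x \<xi> n = Some w"
    and z: "arg_min_on (\<lambda>t. \<xi> (n, t) / q w t) (targets w) = Some z" by (auto split: option.splits)
  then have "w \<in> C" using Suc by blast
  then show ?case
    using arg_min_if_finite(1)[OF finite_targets targets_nonempty] targets_closed z by (metis mem_Collect_eq)
qed (use start in auto)

lemma measurable_jump_chain:
  "past n \<subseteq> A \<Longrightarrow> (\<lambda>\<xi>. jump_chain q x \<xi> n) \<in> PiM A (\<lambda>_. std_exp) \<rightarrow>\<^sub>M count_space UNIV"
proof (induction n)
  case (Suc n)
  have m: "(\<lambda>\<xi>. jump_chain q x \<xi> n) \<in> PiM A (\<lambda>_. std_exp) \<rightarrow>\<^sub>M count_space UNIV"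
    using Suc by (intro Suc.IH) (auto intro: less_SucI)
  have c: "(\<lambda>\<xi>. \<xi> (n, t)) \<in> borel_measurable (PiM A (\<lambda>_. std_exp))" for t
  proof -
    have "(\<lambda>\<xi>. \<xi> (n, t)) \<in> PiM A (\<lambda>_. std_exp) \<rightarrow>\<^sub>M std_exp"
      using Suc.prems by (intro measurable_component_singleton) auto
    then show ?thesis by simp
  qed
  have "(\<lambda>\<xi>. case jump_chain q x \<xi> n of None \<Rightarrow> None | Some z \<Rightarrow> arg_min_on (\<lambda>t. \<xi> (n, t) / q z t) (targets z))
      \<in> PiM A (\<lambda>_. std_exp) \<rightarrow>\<^sub>M count_space UNIV"
  proof (rule measurable_compose_countable[OF _ m])
    fix z show "(\<lambda>\<xi>. case z of None \<Rightarrow> None | Some z \<Rightarrow> arg_min_on (\<lambda>t. \<xi> (n, t) / q z t) (targets z))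
        \<in> PiM A (\<lambda>_. std_exp) \<rightarrow>\<^sub>M count_space UNIV"
      by (cases z) (use c in \<open>auto intro!: measurable_arg_min_on finite_targets\<close>)
  qed
  then show ?case by simp
qed simp

lemma measurable_jump_chain_clock [measurable]:
  "(\<lambda>\<xi>. jump_chain q x \<xi> n) \<in> clock_space \<rightarrow>\<^sub>M count_space UNIV"
  unfolding clock_space_def by (rule measurable_jump_chain) simp

lemma sets_jump_chain [measurable, simp]: "{\<xi>. jump_chain q x \<xi> n = Some z} \<in> sets clock_space"
  using measurable_sets[OF measurable_jump_chain_clock, of "{Some z}" n] by (simp add: vimage_def)

lemma measurable_clock [measurable]: "(\<lambda>\<xi>. \<xi> i) \<in> borel_measurable clock_space"
proof -
  have "(\<lambda>\<xi>. \<xi> i) \<in> clock_space \<rightarrow>\<^sub>M std_exp" unfolding clock_space_def by measurable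
  then show ?thesis by simp
qed

definition visit :: "nat \<Rightarrow> 'a \<Rightarrow> ennreal" where
  "visit n z = emeasure clock_space {\<xi>. jump_chain q x \<xi> n = Some z}"

lemma nn_integral_visit:
  assumes G: "G \<in> borel_measurable (PiM (now n) (\<lambda>_. std_exp))"
  shows "(\<integral>\<^sup>+\<xi>. indicator {\<xi>. jump_chain q x \<xi> n = Some z} \<xi> * G (restrict \<xi> (now n)) \<partial>clock_space)
    = visit n z * (\<integral>\<^sup>+\<xi>. G (restrict \<xi> (now n)) \<partial>clock_space)"
proof -
  let ?F = "\<lambda>\<eta>. indicator {\<eta>. jump_chain q x \<eta> n = Some z} \<eta> :: ennreal"
  have F: "?F \<in> borel_measurable (PiM (past n) (\<lambda>_. std_exp))"
    using measurable_sets[OF measurable_jump_chain[of n "past n"], of "{Some z}"]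
    by (subst borel_measurable_indicator_iff) (simp add: vimage_def Int_def conj_commute)
  have "jump_chain q x (restrict \<xi> (past n)) n = jump_chain q x \<xi> n" for \<xi>
    by (rule jump_chain_cong) auto
  then have eq: "?F (restrict \<xi> (past n)) = ?F \<xi>" for \<xi> by (simp add: indicator_def)
  have "visit n z = (\<integral>\<^sup>+\<xi>. ?F \<xi> \<partial>clock_space)"
    unfolding visit_def by (subst nn_integral_indicator) auto
  then show ?thesis
    using nn_integral_clocks_indep[OF F G] unfolding eq by (auto simp: lessThan_def)
qed

lemma visit_0: "visit 0 z = indicator {x} z"
  using prob_space.emeasure_space_1[OF prob_space_clock_space]
  by (auto simp: visit_def split: split_indicator)

lemma visit_eq_0: "z \<notin> C \<Longrightarrow> visit n z = 0"
proof -
  assume "z \<notin> C"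
  then have "{\<xi>. jump_chain q x \<xi> n = Some z} = {}" using jump_chain_in by blast
  then show ?thesis by (simp add: visit_def)
qed

text \<open>A chain at y after n + 1 jumps came from some z in C whose clock for y rang no later
  than the others. Subadditivity over z and independence of step n give the Chapman-Kolmogorov
  relation as an inequality, which is all that a subsolution requires.\<close>

lemma visit_Suc_le:
  "visit (Suc n) y \<le> (\<Sum>z\<in>{z \<in> C. 0 < q z (Some y)}. visit n z * ennreal (q z (Some y) / total_rate z))"
proof -
  let ?E = "\<lambda>z. {\<xi>. \<forall>t\<in>targets z. \<xi> (n, Some y) / q z (Some y) \<le> \<xi> (n, t) / q z t}"
  let ?D = "{z \<in> C. 0 < q z (Some y)}"
  let ?V = "\<lambda>z. {\<xi>. jump_chain q x \<xi> n = Some z}"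
  \<comment> \<open>The event is needed on the full clock space and on the coordinates of step n
    alone, hence the variable index set \<open>A'\<close>.\<close>
  have meas: "?E z \<inter> A \<in> sets (PiM A' (\<lambda>_. std_exp))"
    if "now n \<subseteq> A'" "A = space (PiM A' (\<lambda>_. std_exp))" for z A A'
  proof -
    have "(\<lambda>\<xi>. \<xi> (n, t)) \<in> PiM A' (\<lambda>_. std_exp) \<rightarrow>\<^sub>M std_exp" for t
      using that by (intro measurable_component_singleton) auto
    then have [measurable]: "(\<lambda>\<xi>. \<xi> (n, t)) \<in> borel_measurable (PiM A' (\<lambda>_. std_exp))" for t by simp
    have "{\<xi> \<in> space (PiM A' (\<lambda>_. std_exp)). \<forall>t\<in>targets z. \<xi> (n, Some y) / q z (Some y) \<le> \<xi> (n, t) / q z t} \<in> sets (PiM A' (\<lambda>_. std_exp))"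
      using finite_targets by (intro sets.sets_Collect_finite_All borel_measurable_le) auto
    moreover have "?E z \<inter> A = {\<xi> \<in> space (PiM A' (\<lambda>_. std_exp)). \<forall>t\<in>targets z. \<xi> (n, Some y) / q z (Some y) \<le> \<xi> (n, t) / q z t}"
      using that by auto
    ultimately show ?thesis by (simp only:)
  qed
  have E[measurable]: "?E z \<in> sets clock_space" for z
    using meas[of UNIV UNIV z]
    unfolding clock_space_def by (simp only: space_PiM space_density space_lborel space_borel PiE_UNIV_domain UNIV_I Pi_UNIV top_greatest Int_UNIV_right simp_thms)
  have "{\<xi>. jump_chain q x \<xi> (Suc n) = Some y} \<subseteq> (\<Union>z\<in>?D. ?V z \<inter> ?E z)"
  proof safe
    fix \<xi> assume "jump_chain q x \<xi> (Suc n) = Some y"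
    then obtain z where z: "jump_chain q x \<xi> n = Some z"
      and y: "arg_min_on (\<lambda>t. \<xi> (n, t) / q z t) (targets z) = Some y" by (auto split: option.splits)
    have zC: "z \<in> C" by (rule jump_chain_in[OF z])
    note am = arg_min_if_finite[OF finite_targets targets_nonempty[OF zC], of "\<lambda>t. \<xi> (n, t) / q z t"]
    have "0 < q z (Some y)" using am(1) y by simp
    moreover have "\<xi> \<in> ?E z" using am(2) unfolding y by (auto simp: not_less) (meson not_le)
    ultimately show "\<xi> \<in> (\<Union>z\<in>?D. ?V z \<inter> ?E z)" using z zC by blast
  qed
  then have "visit (Suc n) y \<le> emeasure clock_space (\<Union>z\<in>?D. ?V z \<inter> ?E z)"
    unfolding visit_def by (rule emeasure_mono) (intro sets.finite_UN finite_sources sets.Int sets_jump_chain E)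
  also have "\<dots> \<le> (\<Sum>z\<in>?D. emeasure clock_space (?V z \<inter> ?E z))"
    by (intro emeasure_subadditive_finite finite_sources image_subsetI sets.Int sets_jump_chain E)
  also have "\<dots> \<le> (\<Sum>z\<in>?D. visit n z * ennreal (q z (Some y) / total_rate z))"
  proof (rule sum_mono)
    fix z assume z: "z \<in> ?D"
    have G: "(indicator (?E z) :: _ \<Rightarrow> ennreal) \<in> borel_measurable (PiM (now n) (\<lambda>_. std_exp))"
      by (rule borel_measurable_indicator_iff[THEN iffD2], rule meas) (rule subset_refl, rule refl)
    have eq: "indicator (?E z) (restrict \<xi> (now n)) = (indicator (?E z) \<xi> :: ennreal)" for \<xi>
      by (simp add: indicator_def)
    have "emeasure clock_space (?V z \<inter> ?E z) = (\<integral>\<^sup>+\<xi>. indicator (?V z) \<xi> * indicator (?E z) \<xi> \<partial>clock_space)"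
      unfolding indicator_inter_arith[symmetric] by (intro nn_integral_indicator[symmetric] sets.Int sets_jump_chain E)
    also have "\<dots> = visit n z * emeasure clock_space (?E z)"
      using nn_integral_visit[OF G, of z] unfolding eq by (simp only: nn_integral_indicator[OF E])
    also have "\<dots> \<le> visit n z * ennreal (q z (Some y) / total_rate z)"
      by (intro mult_left_mono prob_first_clock_le finite_targets) (use z in auto)
    finally show "emeasure clock_space (?V z \<inter> ?E z) \<le> visit n z * ennreal (q z (Some y) / total_rate z)" .
  qed
  finally show ?thesis .
qed

end


section \<open>Expected time spent at a site\<close>

context jump_rates begin

lemma measurable_holding_time [measurable]: "(\<lambda>\<xi>. holding_time q x \<xi> n) \<in> borel_measurable clock_space"
  unfolding holding_time_def
proof (rule measurable_compose_countable[OF _ measurable_jump_chain_clock])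
  fix o' :: "'a option"
  show "(\<lambda>\<xi>. case o' of None \<Rightarrow> \<infinity> | Some z \<Rightarrow> INF t\<in>targets z. ennreal (\<xi> (n, t) / q z t)) \<in> borel_measurable clock_space"
    by (cases o') (auto intro!: borel_measurable_INF countable_finite finite_targets)
qed

lemma measurable_jump_time [measurable]: "(\<lambda>\<xi>. jump_time q x \<xi> n) \<in> borel_measurable clock_space"
  unfolding jump_time_def by measurable

lemma nn_integral_visit_holding:
  assumes "y \<in> C"
  shows "(\<integral>\<^sup>+\<xi>. indicator {\<xi>. jump_chain q x \<xi> n = Some y} \<xi> * holding_time q x \<xi> n \<partial>clock_space)
    = visit n y * ennreal (1 / total_rate y)"
proof -
  let ?G = "\<lambda>\<xi>. INF t\<in>targets y. ennreal (\<xi> (n, t) / q y t)"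
  have "(\<lambda>\<xi>. \<xi> (n, t)) \<in> borel_measurable (PiM (now n) (\<lambda>_. std_exp))" for t
  proof -
    have "(\<lambda>\<xi>. \<xi> (n, t)) \<in> PiM (now n) (\<lambda>_. std_exp) \<rightarrow>\<^sub>M std_exp" by measurable
    then show ?thesis by simp
  qed
  then have G: "?G \<in> borel_measurable (PiM (now n) (\<lambda>_. std_exp))"
    by (intro borel_measurable_INF countable_finite finite_targets measurable_compose[OF _ measurable_ennreal]) simp
  have "(\<integral>\<^sup>+\<xi>. indicator {\<xi>. jump_chain q x \<xi> n = Some y} \<xi> * holding_time q x \<xi> n \<partial>clock_space)
      = (\<integral>\<^sup>+\<xi>. indicator {\<xi>. jump_chain q x \<xi> n = Some y} \<xi> * ?G (restrict \<xi> (now n)) \<partial>clock_space)"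
    by (intro nn_integral_cong) (auto simp: holding_time_def split: split_indicator)
  also have "\<dots> = visit n y * (\<integral>\<^sup>+\<xi>. ?G \<xi> \<partial>clock_space)"
    by (subst nn_integral_visit[OF G]) simp
  also have "(\<integral>\<^sup>+\<xi>. ?G \<xi> \<partial>clock_space) = ennreal (1 / total_rate y)"
    by (rule nn_integral_min_clocks) (use finite_targets targets_nonempty assms in auto)
  finally show ?thesis .
qed

lemma nn_integral_lborel_segment_le:
  "(\<integral>\<^sup>+t. indicator {t. 0 \<le> t \<and> j \<le> ennreal t \<and> ennreal t < j + k} t \<partial>lborel) \<le> (k :: ennreal)"
proof (cases "j = \<infinity> \<or> k = \<infinity>")
  case True
  then show ?thesis
  proof
    assume "j = \<infinity>"
    then have "{t. 0 \<le> t \<and> j \<le> ennreal t \<and> ennreal t < j + k} = {}" by (auto simp: top_unique)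
    then show ?thesis by simp
  qed simp
next
  case False
  then obtain j' k' where jk: "j = ennreal j'" "0 \<le> j'" "k = ennreal k'" "0 \<le> k'"
    by (cases j; cases k) auto
  have "(\<integral>\<^sup>+t. indicator {t. 0 \<le> t \<and> j \<le> ennreal t \<and> ennreal t < j + k} t \<partial>lborel)
      \<le> (\<integral>\<^sup>+t. indicator {j'..<j' + k'} t \<partial>lborel)"
    unfolding jk using jk(2,4)
    by (intro nn_integral_mono) (auto split: split_indicator simp: ennreal_plus[symmetric] ennreal_less_iff simp del: ennreal_plus)
  also have "\<dots> = ennreal k'" using jk(4) by (subst nn_integral_indicator) auto
  finally show ?thesis unfolding jk .
qed

text \<open>If the chain is at y at time t, then t lies in the holding interval of some n-th state
  equal to y; after explosion the state is \<open>None\<close>, which contributes nothing.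
  Integrating over t by Tonelli leaves the mean holding times, and each is independent of the event
  that the n-th state is y.\<close>

theorem green_le_visits:
  assumes "y \<in> C"
  shows "green q x y \<le> (\<Sum>n. visit n y * ennreal (1 / total_rate y))"
proof -
  let ?J = "jump_time q x" and ?V = "\<lambda>n. {\<xi>. jump_chain q x \<xi> n = Some y}"
  let ?S = "\<lambda>n t. {\<xi>. jump_chain q x \<xi> n = Some y \<and> ?J \<xi> n \<le> ennreal t \<and> ennreal t < ?J \<xi> (Suc n)}"
  let ?f = "\<lambda>n t \<xi>. indicator {t. 0 \<le> t \<and> ?J \<xi> n \<le> ennreal t \<and> ennreal t < ?J \<xi> (Suc n)} t * indicator (?V n) \<xi> :: ennreal"
  have S: "?S n t \<in> sets clock_space" for n t
  proof -
    have "{\<xi> \<in> space clock_space. ?J \<xi> n \<le> ennreal t} \<inter> {\<xi> \<in> space clock_space. ennreal t < ?J \<xi> (Suc n)} \<inter> ?V n \<in> sets clock_space"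
      by (intro sets.Int sets_jump_chain borel_measurable_le borel_measurable_less measurable_jump_time measurable_const) auto
    then show ?thesis by (rule back_subst) auto
  qed
  have f: "(\<lambda>(t, \<xi>). ?f n t \<xi>) \<in> borel_measurable (lborel \<Otimes>\<^sub>M clock_space)" for n
  proof -
    have "(\<lambda>p. indicator (?V n) (snd p) :: ennreal) \<in> borel_measurable (lborel \<Otimes>\<^sub>M clock_space)"
      by (intro measurable_compose[OF measurable_snd] borel_measurable_indicator sets_jump_chain)
    moreover have "{p \<in> space (lborel \<Otimes>\<^sub>M clock_space). 0 \<le> fst p \<and> ?J (snd p) n \<le> ennreal (fst p) \<and> ennreal (fst p) < ?J (snd p) (Suc n)} \<in> sets (lborel \<Otimes>\<^sub>M clock_space)"
      by (intro sets.sets_Collect_conj borel_measurable_le borel_measurable_less measurable_compose[OF measurable_snd measurable_jump_time]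
          measurable_compose[OF measurable_fst measurable_ennreal] measurable_const)
         (auto intro!: measurable_compose[OF measurable_fst])
    then have "(\<lambda>p. indicator {p \<in> space (lborel \<Otimes>\<^sub>M clock_space). 0 \<le> fst p \<and> ?J (snd p) n \<le> ennreal (fst p) \<and> ennreal (fst p) < ?J (snd p) (Suc n)} p :: ennreal) \<in> borel_measurable (lborel \<Otimes>\<^sub>M clock_space)"
      by (rule borel_measurable_indicator)
    ultimately have "(\<lambda>p. indicator {p \<in> space (lborel \<Otimes>\<^sub>M clock_space). 0 \<le> fst p \<and> ?J (snd p) n \<le> ennreal (fst p) \<and> ennreal (fst p) < ?J (snd p) (Suc n)} p * indicator (?V n) (snd p) :: ennreal) \<in> borel_measurable (lborel \<Otimes>\<^sub>M clock_space)"
      by (intro borel_measurable_times_ennreal)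
    then show ?thesis
      by (rule measurable_cong[THEN iffD1, rotated]) (auto simp: space_pair_measure split: split_indicator)
  qed
  interpret CS: prob_space clock_space by (rule prob_space_clock_space)
  interpret pair_sigma_finite lborel "clock_space :: 'a clocks measure" ..
  have "green q x y \<le> (\<integral>\<^sup>+t\<in>{0..}. (\<Sum>n. emeasure clock_space (?S n t)) \<partial>lborel)"
    unfolding green_def
  proof (intro nn_integral_mono mult_right_mono)
    fix t :: real
    \<comment> \<open>A measurable cover is enough for an upper bound: the condition on the killing
      time is dropped, and the \<open>THE\<close> in \<open>markov_chain\<close> is resolved by
      monotonicity of the jump times.\<close>
    have "{\<xi> \<in> space clock_space. markov_chain q x t \<xi> = Some y \<and> ennreal t < killing_time q x \<xi>} \<subseteq> (\<Union>n. ?S n t)"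
    proof safe
      fix \<xi> assume m: "markov_chain q x t \<xi> = Some y"
      let ?P = "\<lambda>n. ?J \<xi> n \<le> ennreal t \<and> ennreal t < ?J \<xi> (Suc n)"
      have ex: "\<exists>n. ?P n" using m by (auto simp: markov_chain_def split: if_splits)
      have mono: "mono (?J \<xi>)" by (auto simp: jump_time_def mono_iff_le_Suc)
      have uniq: "n = n'" if "?P n" "?P n'" for n n'
        using that monoD[OF mono, of "Suc n" n'] monoD[OF mono, of "Suc n'" n] by (metis leD le_less_trans not_less_eq_eq order.trans nat_neq_iff Suc_leI)
      define m0 where "m0 = (THE n. ?P n)"
      have P: "?P m0" unfolding m0_def by (rule theI'[of ?P]) (use ex uniq in blast)
      have "jump_chain q x \<xi> m0 = Some y"
        using m ex unfolding markov_chain_def m0_def by (simp only: if_True)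
      then show "\<xi> \<in> (\<Union>n. ?S n t)" using P by blast
    qed
    then have "emeasure clock_space {\<xi> \<in> space clock_space. markov_chain q x t \<xi> = Some y \<and> ennreal t < killing_time q x \<xi>}
        \<le> emeasure clock_space (\<Union>n. ?S n t)"
      by (rule emeasure_mono) (rule sets.countable_UN, rule image_subsetI, rule S)
    also have "\<dots> \<le> (\<Sum>n. emeasure clock_space (?S n t))"
      by (rule emeasure_subadditive_countably) (rule image_subsetI, rule S)
    finally show "emeasure clock_space {\<xi> \<in> space clock_space. markov_chain q x t \<xi> = Some y \<and> ennreal t < killing_time q x \<xi>}
        \<le> (\<Sum>n. emeasure clock_space (?S n t))" .
  qed simp
  also have "\<dots> = (\<integral>\<^sup>+t. (\<Sum>n. (\<integral>\<^sup>+\<xi>. ?f n t \<xi> \<partial>clock_space)) \<partial>lborel)"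
  proof (intro nn_integral_cong)
    fix t :: real
    have "(\<integral>\<^sup>+\<xi>. ?f n t \<xi> \<partial>clock_space) = emeasure clock_space (?S n t) * indicator {0..} t" for n
    proof -
      have "(\<integral>\<^sup>+\<xi>. ?f n t \<xi> \<partial>clock_space) = (\<integral>\<^sup>+\<xi>. indicator (?S n t) \<xi> * indicator {0..} t \<partial>clock_space)"
        by (intro nn_integral_cong) (auto split: split_indicator)
      then show ?thesis using S by (simp add: nn_integral_multc)
    qed
    then show "(\<Sum>n. emeasure clock_space (?S n t)) * indicator {0..} t = (\<Sum>n. (\<integral>\<^sup>+\<xi>. ?f n t \<xi> \<partial>clock_space))"
      by (simp add: ennreal_suminf_multc)
  qed
  also have "\<dots> = (\<Sum>n. \<integral>\<^sup>+t. \<integral>\<^sup>+\<xi>. ?f n t \<xi> \<partial>clock_space \<partial>lborel)"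
    by (rule nn_integral_suminf) (rule CS.borel_measurable_nn_integral[OF f])
  also have "\<dots> = (\<Sum>n. \<integral>\<^sup>+\<xi>. \<integral>\<^sup>+t. ?f n t \<xi> \<partial>lborel \<partial>clock_space)"
    by (rule suminf_cong, rule Fubini'[symmetric], rule f)
  also have "\<dots> \<le> (\<Sum>n. visit n y * ennreal (1 / total_rate y))"
  proof (rule suminf_le)
    fix n
    have "(\<integral>\<^sup>+\<xi>. \<integral>\<^sup>+t. ?f n t \<xi> \<partial>lborel \<partial>clock_space) \<le> (\<integral>\<^sup>+\<xi>. indicator (?V n) \<xi> * holding_time q x \<xi> n \<partial>clock_space)"
    proof (rule nn_integral_mono)
      fix \<xi> :: "'a clocks"
      have "?J \<xi> (Suc n) = ?J \<xi> n + holding_time q x \<xi> n" by (simp add: jump_time_def)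
      then show "(\<integral>\<^sup>+t. ?f n t \<xi> \<partial>lborel) \<le> indicator (?V n) \<xi> * holding_time q x \<xi> n"
        using nn_integral_lborel_segment_le[of "?J \<xi> n" "holding_time q x \<xi> n"]
        by (cases "\<xi> \<in> ?V n") auto
    qed
    then show "(\<integral>\<^sup>+\<xi>. \<integral>\<^sup>+t. ?f n t \<xi> \<partial>lborel \<partial>clock_space) \<le> visit n y * ennreal (1 / total_rate y)"
      by (simp only: nn_integral_visit_holding[OF assms])
  qed auto
  finally show ?thesis .
qed

lemma visit_le_1: "visit n z \<le> 1"
  unfolding visit_def by (rule prob_space.emeasure_le_1[OF prob_space_clock_space])

lemma total_rate_pos: "z \<in> C \<Longrightarrow> 0 < total_rate z"
  using targets_nonempty[of z] finite_targets[of z] by (intro sum_pos) auto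

definition green_upto :: "nat \<Rightarrow> 'a \<Rightarrow> real" where
  "green_upto m y = (\<Sum>n\<le>m. enn2real (visit n y)) / total_rate y"

lemma green_upto_nonneg [simp]: "0 \<le> green_upto m y"
  unfolding green_upto_def by (intro divide_nonneg_nonneg sum_nonneg) auto

lemma green_upto_eq_0: "y \<notin> C \<Longrightarrow> green_upto m y = 0"
  by (simp add: green_upto_def visit_eq_0)

lemma finite_visit_support: "finite {z. visit n z \<noteq> 0}"
proof (induction n)
  case 0
  have "{z. visit 0 z \<noteq> 0} \<subseteq> {x}" by (auto simp: visit_0 split: split_indicator)
  then show ?case by (rule finite_subset) simp
next
  case (Suc n)
  have "{y. visit (Suc n) y \<noteq> 0} \<subseteq> (\<Union>z\<in>{z. visit n z \<noteq> 0}. Some -` targets z)"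
  proof safe
    fix y assume "visit (Suc n) y \<noteq> 0"
    then have "(\<Sum>z\<in>{z \<in> C. 0 < q z (Some y)}. visit n z * ennreal (q z (Some y) / total_rate z)) \<noteq> 0"
      using visit_Suc_le[of n y] by auto
    then obtain z where "0 < q z (Some y)" "visit n z \<noteq> 0"
      by (metis (mono_tags, lifting) mem_Collect_eq mult_zero_left sum.neutral)
    then show "y \<in> (\<Union>z\<in>{z. visit n z \<noteq> 0}. Some -` targets z)" by auto
  qed
  moreover have "finite (\<Union>z\<in>{z. visit n z \<noteq> 0}. Some -` targets z)"
    using Suc by (intro finite_UN_I finite_vimageI finite_targets) auto
  ultimately show ?case by (rule finite_subset)
qed

lemma finite_green_upto_support: "finite {z. green_upto m z \<noteq> 0}"
proof -
  have "{z. green_upto m z \<noteq> 0} \<subseteq> (\<Union>n\<le>m. {z. visit n z \<noteq> 0})"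
    by (auto simp: green_upto_def intro: ccontr)
  then show ?thesis by (rule finite_subset) (use finite_visit_support in auto)
qed

lemma green_le_SUP: "y \<in> C \<Longrightarrow> green q x y \<le> (SUP m. ennreal (green_upto m y))"
proof -
  assume y: "y \<in> C"
  have "(\<Sum>n\<le>m. visit n y * ennreal (1 / total_rate y)) = ennreal (green_upto m y)" for m
  proof -
    have "visit n y = ennreal (enn2real (visit n y))" for n
      using visit_le_1[of n y] by (intro ennreal_enn2real[symmetric]) (auto intro: le_less_trans)
    then have "(\<Sum>n\<le>m. visit n y * ennreal (1 / total_rate y))
        = (\<Sum>n\<le>m. ennreal (enn2real (visit n y) * (1 / total_rate y)))"
      using total_rate_pos[OF y] by (intro sum.cong refl) (metis ennreal_mult' enn2real_nonneg)
    also have "\<dots> = ennreal (\<Sum>n\<le>m. enn2real (visit n y) * (1 / total_rate y))"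
      using total_rate_pos[OF y] by (intro sum_ennreal) auto
    finally show ?thesis by (simp add: green_upto_def sum_divide_distrib)
  qed
  then have "(\<Sum>n. visit n y * ennreal (1 / total_rate y)) \<le> (SUP m. ennreal (green_upto m y))"
    unfolding suminf_eq_SUP
    by (intro SUP_mono) (metis UNIV_I bot.extremum finite_atMost lessThan_subset_iff order_less_imp_le sum_mono2 zero_le lessThan_Suc_atMost lessI)
  then show ?thesis using green_le_visits[OF y] by simp
qed

text \<open>Summation of \<open>visit_Suc_le\<close> over n < m. The right-hand side then contains
  visits up to time m - 1 only; enlarging it to m gives an inequality in which the same function
  stands on both sides.\<close>

lemma green_upto_subsolution:
  assumes y: "y \<in> C"
  shows "total_rate y * green_upto m y
    \<le> of_bool (y = x) + (\<Sum>z\<in>{z \<in> C. 0 < q z (Some y)}. q z (Some y) * green_upto m z)"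
proof -
  let ?D = "{z \<in> C. 0 < q z (Some y)}"
  have fin: "visit n z \<noteq> \<top>" for n z using visit_le_1[of n z] by (auto simp: top_unique)
  have sum_Suc: "(\<Sum>n\<le>m. f n) = f 0 + (\<Sum>n<m. f (Suc n))" for f :: "nat \<Rightarrow> real"
    by (metis lessThan_Suc_atMost sum.lessThan_Suc_shift)
  have step: "enn2real (visit (Suc n) y) \<le> (\<Sum>z\<in>?D. enn2real (visit n z) * (q z (Some y) / total_rate z))" for n
  proof -
    have lt: "visit n z * ennreal r < \<top>" for z r
      using fin[of n z] by (intro ennreal_mult_less_top[THEN iffD2] disjI2 conjI) (auto simp: top.not_eq_extremum)
    have "enn2real (visit (Suc n) y) \<le> enn2real (\<Sum>z\<in>?D. visit n z * ennreal (q z (Some y) / total_rate z))"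
      by (rule enn2real_mono[OF visit_Suc_le])
        (use lt finite_sources in auto)
    also have "\<dots> = (\<Sum>z\<in>?D. enn2real (visit n z * ennreal (q z (Some y) / total_rate z)))"
      by (subst enn2real_sum) (use lt in auto)
    also have "\<dots> = (\<Sum>z\<in>?D. enn2real (visit n z) * (q z (Some y) / total_rate z))"
      using total_rate_pos by (intro sum.cong refl) (auto simp: enn2real_mult less_imp_le)
    finally show ?thesis .
  qed
  have "total_rate y * green_upto m y = (\<Sum>n\<le>m. enn2real (visit n y))"
    using total_rate_pos[OF y] by (simp add: green_upto_def)
  also have "\<dots> = enn2real (visit 0 y) + (\<Sum>n<m. enn2real (visit (Suc n) y))"
    by (rule sum_Suc)
  also have "\<dots> \<le> of_bool (y = x) + (\<Sum>n<m. \<Sum>z\<in>?D. enn2real (visit n z) * (q z (Some y) / total_rate z))"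
    by (intro add_mono sum_mono step) (simp add: visit_0 split: split_indicator)
  also have "(\<Sum>n<m. \<Sum>z\<in>?D. enn2real (visit n z) * (q z (Some y) / total_rate z))
      = (\<Sum>z\<in>?D. (\<Sum>n<m. enn2real (visit n z)) * (q z (Some y) / total_rate z))"
    by (subst sum.swap) (simp only: sum_distrib_right)
  also have "\<dots> \<le> (\<Sum>z\<in>?D. q z (Some y) * green_upto m z)"
  proof (rule sum_mono)
    fix z assume z: "z \<in> ?D"
    have "(\<Sum>n<m. enn2real (visit n z)) \<le> (\<Sum>n\<le>m. enn2real (visit n z))"
      by (rule sum_mono2) auto
    then show "(\<Sum>n<m. enn2real (visit n z)) * (q z (Some y) / total_rate z) \<le> q z (Some y) * green_upto m z"
      using z total_rate_pos[of z] by (simp add: green_upto_def field_simps mult_left_mono)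
  qed
  finally show ?thesis by simp
qed

end


section \<open>Energy estimates on finite networks\<close>

locale network =
  fixes W :: "'v set" and a :: "'v \<Rightarrow> 'v \<Rightarrow> real"
  assumes finite_W: "finite W" and a_sym: "a z y = a y z" and a_nonneg: "0 \<le> a z y"
begin

text \<open>The sum runs over ordered pairs, so this is twice the Dirichlet form; the factors 1/2
  and 2 below come from here.\<close>

definition energy :: "('v \<Rightarrow> real) \<Rightarrow> real" where
  "energy f = (\<Sum>z\<in>W. \<Sum>y\<in>W. a z y * (f z - f y)\<^sup>2)"

definition subsolution :: "('v \<Rightarrow> real) \<Rightarrow> ('v \<Rightarrow> real) \<Rightarrow> ('v \<Rightarrow> real) \<Rightarrow> bool" where
  "subsolution u k g \<longleftrightarrow> (\<forall>z\<in>W. (\<Sum>y\<in>W. a z y * (u z - u y)) + k z * u z \<le> g z)"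

lemma energy_nonneg [simp]: "0 \<le> energy f"
  unfolding energy_def by (intro sum_nonneg mult_nonneg_nonneg a_nonneg) auto

lemma energy_mono:
  assumes "\<And>z y. z \<in> W \<Longrightarrow> y \<in> W \<Longrightarrow> \<bar>f z - f y\<bar> \<le> \<bar>g z - g y\<bar>"
  shows "energy f \<le> energy g"
  unfolding energy_def using assms
  by (intro sum_mono mult_left_mono a_nonneg) (auto simp: abs_le_square_iff)

lemma sum_by_parts:
  "(\<Sum>z\<in>W. \<phi> z * (\<Sum>y\<in>W. a z y * (u z - u y))) = (\<Sum>z\<in>W. \<Sum>y\<in>W. a z y * ((\<phi> z - \<phi> y) * (u z - u y))) / 2"
proof -
  let ?S = "\<Sum>z\<in>W. \<Sum>y\<in>W. a z y * (\<phi> z * (u z - u y))"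
  have "?S = (\<Sum>z\<in>W. \<Sum>y\<in>W. a z y * (\<phi> y * (u y - u z)))"
    by (subst sum.swap) (simp add: a_sym)
  then have "?S + ?S = (\<Sum>z\<in>W. \<Sum>y\<in>W. a z y * (\<phi> z * (u z - u y)) + a z y * (\<phi> y * (u y - u z)))"
    by (simp add: sum.distrib)
  also have "\<dots> = (\<Sum>z\<in>W. \<Sum>y\<in>W. a z y * ((\<phi> z - \<phi> y) * (u z - u y)))"
    by (intro sum.cong refl) (simp add: algebra_simps)
  finally show ?thesis by (simp add: sum_distrib_left algebra_simps)
qed

lemma subsolution_test:
  assumes "subsolution u k g" and "\<And>z. z \<in> W \<Longrightarrow> 0 \<le> \<phi> z"
  shows "(\<Sum>z\<in>W. \<Sum>y\<in>W. a z y * ((\<phi> z - \<phi> y) * (u z - u y))) / 2 + (\<Sum>z\<in>W. k z * u z * \<phi> z) \<le> (\<Sum>z\<in>W. g z * \<phi> z)"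
proof -
  have "(\<Sum>z\<in>W. \<phi> z * ((\<Sum>y\<in>W. a z y * (u z - u y)) + k z * u z)) \<le> (\<Sum>z\<in>W. \<phi> z * g z)"
    using assms by (intro sum_mono mult_left_mono) (auto simp: subsolution_def)
  then show ?thesis
    unfolding sum_by_parts[symmetric] by (simp add: distrib_left sum.distrib mult_ac)
qed

lemma subsolution_mono_rate:
  assumes "subsolution u k g" "\<And>z. z \<in> W \<Longrightarrow> k' z * u z \<le> k z * u z"
  shows "subsolution u k' g"
  using assms unfolding subsolution_def by (smt (verit, best))

lemma sq_le_of_monotone_lipschitz:
  fixes p q :: real
  assumes "\<And>p q. p \<le> q \<Longrightarrow> 0 \<le> F q - F p \<and> F q - F p \<le> q - p"
  shows "(F p - F q)\<^sup>2 \<le> (F p - F q) * (p - q)"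
proof (cases "p \<le> q")
  case True
  then have "(F q - F p) * (F q - F p) \<le> (F q - F p) * (q - p)"
    using assms[OF True] by (intro mult_left_mono) auto
  then show ?thesis by (simp add: power2_eq_square algebra_simps)
next
  case False
  then have "(F p - F q) * (F p - F q) \<le> (F p - F q) * (p - q)"
    using assms[of q p] by (intro mult_left_mono) auto
  then show ?thesis by (simp add: power2_eq_square)
qed

text \<open>Tested with the truncation itself: it is monotone and 1-Lipschitz in u, so its squared
  gradient is at most its gradient times that of u, and the unit source contributes at most t. The
  linear growth in t is what later yields weak-type tails.\<close>

lemma energy_truncation_le:
  assumes "subsolution u (\<lambda>_. 0) (\<lambda>z. of_bool (z = x))" "0 \<le> t"
  shows "energy (\<lambda>z. min (max (u z - l) 0) t) \<le> 2 * t"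
proof -
  let ?F = "\<lambda>p. min (max (p - l) 0) t"
  have "energy (\<lambda>z. ?F (u z)) \<le> (\<Sum>z\<in>W. \<Sum>y\<in>W. a z y * ((?F (u z) - ?F (u y)) * (u z - u y)))"
    unfolding energy_def by (intro sum_mono mult_left_mono a_nonneg sq_le_of_monotone_lipschitz) auto
  also have "\<dots> \<le> 2 * (\<Sum>z\<in>W. of_bool (z = x) * ?F (u z))"
    using subsolution_test[OF assms(1), of "\<lambda>z. ?F (u z)"] assms(2) by (simp add: field_simps)
  also have "(\<Sum>z\<in>W. of_bool (z = x) * ?F (u z)) \<le> t"
  proof -
    have "(\<Sum>z\<in>W. of_bool (z = x) * ?F (u z)) = (\<Sum>z\<in>W. if z = x then ?F (u x) else 0)"
      by (intro sum.cong) auto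
    then show ?thesis using assms(2) finite_W by (simp add: sum.delta)
  qed
  finally show ?thesis by simp
qed

text \<open>The test function is eta^2 w with w = (u - l)^+. By the identity for the square of eta_z
  w_z - eta_y w_y the error carries the product w_z w_y: nothing has to be absorbed, and the term
  vanishes unless both ends lie above the level.\<close>

lemma caccioppoli:
  assumes "subsolution u (\<lambda>_. 0) (\<lambda>z. of_bool (z = x))" "\<eta> x = 0"
  shows "energy (\<lambda>z. \<eta> z * max (u z - l) 0)
    \<le> (\<Sum>z\<in>W. \<Sum>y\<in>W. a z y * (max (u z - l) 0 * max (u y - l) 0 * (\<eta> z - \<eta> y)\<^sup>2))"
proof -
  define w where "w z = max (u z - l) 0" for z
  let ?\<phi> = "\<lambda>z. (\<eta> z)\<^sup>2 * w z"
  have g: "(\<Sum>z\<in>W. of_bool (z = x) * ?\<phi> z) = 0"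
    by (rule sum.neutral) (use assms(2) in auto)
  have "0 \<le> w z" for z by (simp add: w_def)
  then have "(\<Sum>z\<in>W. \<Sum>y\<in>W. a z y * ((?\<phi> z - ?\<phi> y) * (u z - u y))) \<le> 0"
    using subsolution_test[OF assms(1), of ?\<phi>] g by (simp add: field_simps)
  moreover have "a z y * (\<eta> z * w z - \<eta> y * w y)\<^sup>2 \<le> a z y * ((?\<phi> z - ?\<phi> y) * (u z - u y)) + a z y * (w z * w y * (\<eta> z - \<eta> y)\<^sup>2)" for z y
  proof -
    have "(?\<phi> z - ?\<phi> y) * (w z - w y) \<le> (?\<phi> z - ?\<phi> y) * (u z - u y)"
    proof -
      have *: "0 \<le> ?\<phi> z * ((u z - u y) - (w z - w y))" for z y
      proof (cases "u z \<le> l")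
        case True then show ?thesis by (simp add: w_def)
      next
        case False
        then show ?thesis by (intro mult_nonneg_nonneg) (auto simp: w_def)
      qed
      show ?thesis using *[of z y] *[of y z] by (simp add: algebra_simps)
    qed
    moreover have "(\<eta> z * w z - \<eta> y * w y)\<^sup>2 = (?\<phi> z - ?\<phi> y) * (w z - w y) + w z * w y * (\<eta> z - \<eta> y)\<^sup>2"
      by (simp add: power2_eq_square algebra_simps)
    ultimately have "(\<eta> z * w z - \<eta> y * w y)\<^sup>2 \<le> (?\<phi> z - ?\<phi> y) * (u z - u y) + w z * w y * (\<eta> z - \<eta> y)\<^sup>2" by simp
    from mult_left_mono[OF this a_nonneg[of z y]] show ?thesis by (simp add: distrib_left)
  qed
  then have "energy (\<lambda>z. \<eta> z * w z) \<le> (\<Sum>z\<in>W. \<Sum>y\<in>W. a z y * ((?\<phi> z - ?\<phi> y) * (u z - u y)) + a z y * (w z * w y * (\<eta> z - \<eta> y)\<^sup>2))"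
    unfolding energy_def by (intro sum_mono)
  ultimately show ?thesis unfolding w_def[symmetric] by (simp add: sum.distrib)
qed

end

text \<open>Hoelder up to a factor 2: X <= t + X^q t^(1-q) for every t > 0, and at t = (M /
  |A|)^(1/q) both terms have the same bound after summation.\<close>

lemma sum_le_via_power:
  fixes X :: "'a \<Rightarrow> real"
  assumes "finite A" "\<And>z. z \<in> A \<Longrightarrow> 0 \<le> X z" "1 < q" "(\<Sum>z\<in>A. X z powr q) \<le> M" "0 \<le> M"
  shows "(\<Sum>z\<in>A. X z) \<le> 2 * M powr (1 / q) * real (card A) powr (1 - 1 / q)"
proof (cases "A = {} \<or> M = 0")
  case True
  moreover have "(\<Sum>z\<in>A. X z) = 0" if "M = 0"
  proof -
    have "(\<Sum>z\<in>A. X z powr q) = 0" using assms that by (intro antisym sum_nonneg) auto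
    then show ?thesis using assms by (auto simp: sum_nonneg_eq_0_iff intro!: sum.neutral)
  qed
  ultimately show ?thesis by auto
next
  case False
  then have M: "0 < M" and c: "0 < real (card A)" using assms by (auto simp: card_gt_0_iff)
  define t where "t = (M / card A) powr (1 / q)"
  have t: "0 < t" using M c by (simp add: t_def)
  have "X z \<le> t + X z powr q * t powr (1 - q)" if "z \<in> A" for z
  proof (cases "X z \<le> t")
    case False
    then have Xz: "0 < X z" using t by simp
    have "X z powr (1 - q) \<le> t powr (1 - q)"
      using False t assms(3) by (intro powr_mono2') auto
    then have "X z powr q * X z powr (1 - q) \<le> X z powr q * t powr (1 - q)" by (intro mult_left_mono) auto
    moreover have "X z powr q * X z powr (1 - q) = X z" using Xz by (simp add: powr_add[symmetric])
    ultimately show ?thesis using t by simp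
  qed (use assms(2)[OF that] in \<open>auto intro: add_increasing2\<close>)
  then have "(\<Sum>z\<in>A. X z) \<le> (\<Sum>z\<in>A. t + X z powr q * t powr (1 - q))" by (rule sum_mono)
  also have "\<dots> = card A * t + (\<Sum>z\<in>A. X z powr q) * t powr (1 - q)"
    by (simp add: sum.distrib sum_distrib_right)
  also have "\<dots> \<le> card A * t + M * t powr (1 - q)"
    using assms by (intro add_left_mono mult_right_mono) auto
  also have "M * t powr (1 - q) = card A * t"
  proof -
    have "t powr q = M / card A" using M c assms(3) by (simp add: t_def powr_powr)
    then have "M = card A * t powr q" using c by simp
    then have "M * t powr (1 - q) = card A * (t powr q * t powr (1 - q))" by simp
    then show ?thesis using t by (simp add: powr_add[symmetric])
  qed
  also have "card A * t = M powr (1 / q) * real (card A) powr (1 - 1 / q)"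
    using M c by (simp add: t_def powr_divide powr_diff)
  finally show ?thesis by simp
qed


section \<open>A weak Sobolev inequality\<close>

definition tvar :: "(int ^ 'd \<Rightarrow> real) \<Rightarrow> int ^ 'd \<Rightarrow> ennreal" where
  "tvar f v = (\<integral>\<^sup>+z. ennreal \<bar>f (z + v) - f z\<bar> \<partial>count_space UNIV)"

lemma tvar_0 [simp]: "tvar f 0 = 0"
  by (simp add: tvar_def)

lemma tvar_add_le: "tvar f (v + w) \<le> tvar f v + tvar f w"
proof -
  have "tvar f (v + w) \<le> (\<integral>\<^sup>+z. ennreal \<bar>f ((z + w) + v) - f (z + w)\<bar> + ennreal \<bar>f (z + w) - f z\<bar> \<partial>count_space UNIV)"
    unfolding tvar_def
    by (intro nn_integral_mono) (simp add: ennreal_plus[symmetric] add_ac del: ennreal_plus)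
  also have "\<dots> = (\<integral>\<^sup>+z. ennreal \<bar>f ((z + w) + v) - f (z + w)\<bar> \<partial>count_space UNIV) + tvar f w"
    unfolding tvar_def by (rule nn_integral_add) auto
  also have "(\<integral>\<^sup>+z. ennreal \<bar>f ((z + w) + v) - f (z + w)\<bar> \<partial>count_space UNIV) = tvar f v"
  proof -
    have "bij_betw (\<lambda>z. z + w) UNIV (UNIV :: (int ^ 'a) set)"
      by (rule bij_betwI[where g = "\<lambda>z. z - w"]) auto
    from nn_integral_bij_count_space[OF this, of "\<lambda>z. ennreal \<bar>f (z + v) - f z\<bar>"]
    show ?thesis by (simp add: tvar_def)
  qed
  finally show ?thesis .
qed

lemma tvar_sum_le: "finite I \<Longrightarrow> tvar f (\<Sum>i\<in>I. g i) \<le> (\<Sum>i\<in>I. tvar f (g i))"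
proof (induction I rule: finite_induct)
  case (insert i I)
  then show ?case using tvar_add_le[of f "g i" "sum g I"] by (simp add: add_left_mono order_trans)
qed simp

lemma tvar_axis_le: "tvar f (axis i (int k)) \<le> of_nat k * tvar f (axis i 1)"
proof (induction k)
  case (Suc k)
  have "axis i (int (Suc k)) = axis i (int k) + axis i 1" by (auto simp: vec_eq_iff axis_def)
  then have "tvar f (axis i (int (Suc k))) \<le> tvar f (axis i (int k)) + tvar f (axis i 1)"
    by (simp only: tvar_add_le)
  also have "\<dots> \<le> of_nat k * tvar f (axis i 1) + tvar f (axis i 1)" by (intro add_right_mono Suc)
  finally show ?case by (simp add: distrib_right add.commute)
qed (simp add: axis_def zero_vec_def[symmetric])

lemma tvar_le:
  fixes v :: "int ^ 'd"
  assumes "\<And>i. 0 \<le> v $ i" "\<And>i. v $ i \<le> int r"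
  shows "tvar f v \<le> of_nat r * (\<Sum>i\<in>UNIV. tvar f (axis i 1))"
proof -
  have "v = (\<Sum>i\<in>UNIV. axis i (v $ i))"
    by (simp add: vec_eq_iff axis_def sum.delta)
  then have "tvar f v \<le> (\<Sum>i\<in>UNIV. tvar f (axis i (v $ i)))"
    using tvar_sum_le[of UNIV f "\<lambda>i. axis i (v $ i)"] by simp
  also have "\<dots> \<le> (\<Sum>i\<in>UNIV. of_nat r * tvar f (axis i 1))"
  proof (rule sum_mono)
    fix i
    have "tvar f (axis i (int (nat (v $ i)))) \<le> of_nat (nat (v $ i)) * tvar f (axis i 1)" by (rule tvar_axis_le)
    also have "\<dots> \<le> of_nat r * tvar f (axis i 1)"
      using assms(2)[of i] by (intro mult_right_mono) auto
    finally show "tvar f (axis i (v $ i)) \<le> of_nat r * tvar f (axis i 1)" using assms(1)[of i] by simp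
  qed
  finally show ?thesis by (simp add: sum_distrib_left)
qed

lemma card_half_open_box:
  "card {v :: int ^ 'd. \<forall>i. 0 \<le> v $ i \<and> v $ i < int r} = r ^ CARD('d)" (is ?card)
  and finite_half_open_box: "finite {v :: int ^ 'd. \<forall>i. 0 \<le> v $ i \<and> v $ i < int r}" (is ?fin)
proof -
  have eq: "{v :: int ^ 'd. \<forall>i. 0 \<le> v $ i \<and> v $ i < int r} = (\<lambda>f. \<chi> i. f i) ` (PiE UNIV (\<lambda>_. {0..<int r}))"
    by (auto simp: image_iff PiE_iff intro!: bexI[of _ "\<lambda>i. _ $ i"])
  have "card {v :: int ^ 'd. \<forall>i. 0 \<le> v $ i \<and> v $ i < int r} = card (PiE (UNIV :: 'd set) (\<lambda>_. {0..<int r}))"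
    unfolding eq by (rule card_image) (auto simp: inj_on_def vec_eq_iff)
  then show ?card by (subst (asm) card_PiE) auto
  show ?fin unfolding eq by (intro finite_imageI finite_PiE) auto
qed

text \<open>Averaging over the r^d translations v: for fixed z at most |S| of them, that is at most
  half, map z into S. Hence some v moves at least half of A out of S.\<close>

lemma exists_translation_leaving:
  fixes A S :: "(int ^ 'd) set"
  assumes "finite A" "finite S" "2 * card S \<le> r ^ CARD('d)" "0 < r"
  shows "\<exists>v. (\<forall>i. 0 \<le> v $ i \<and> v $ i < int r) \<and> card A \<le> 2 * card {z \<in> A. z + v \<notin> S}"
proof -
  let ?B = "{v :: int ^ 'd. \<forall>i. 0 \<le> v $ i \<and> v $ i < int r}"
  show ?thesis
  proof (rule ccontr)
    assume neg: "\<not> ?thesis"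
    have "card A + 1 \<le> 2 * card {z \<in> A. z + v \<in> S}" if "v \<in> ?B" for v
    proof -
      have "card A = card {z \<in> A. z + v \<in> S} + card {z \<in> A. z + v \<notin> S}"
        using assms by (subst card_Un_disjoint[symmetric]) (auto intro: arg_cong[where f = card])
      then show ?thesis using neg that by force
    qed
    then have "(\<Sum>v\<in>?B. card A + 1) \<le> (\<Sum>v\<in>?B. 2 * card {z \<in> A. z + v \<in> S})" by (intro sum_mono) auto
    also have "\<dots> = 2 * (\<Sum>v\<in>?B. \<Sum>z\<in>A. of_bool (z + v \<in> S))"
      using assms by (simp add: sum_distrib_left Int_def)
    also have "(\<Sum>v\<in>?B. \<Sum>z\<in>A. of_bool (z + v \<in> S)) = (\<Sum>z\<in>A. card {v \<in> ?B. z + v \<in> S})"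
      using finite_half_open_box[of r]
      by (subst sum.swap, intro sum.cong refl) (subst sum_of_bool_eq, auto intro: arg_cong[where f = card])
    also have "\<dots> \<le> (\<Sum>z\<in>A. card S)"
    proof (rule sum_mono)
      fix z
      show "card {v \<in> ?B. z + v \<in> S} \<le> card S"
        by (rule card_inj_on_le[where f = "(+) z"]) (use assms in auto)
    qed
    finally have "r ^ CARD('d) * (card A + 1) \<le> 2 * (card A * card S)"
      by (simp add: card_half_open_box)
    also have "\<dots> \<le> r ^ CARD('d) * card A" using assms(3) by (simp add: mult.left_commute)
    finally show False using assms(4) by simp
  qed
qed

text \<open>Each point of A that v moves out of S contributes \<tau> to \<open>tvar f v\<close>, and
  v splits into at most r unit steps in each direction. With r of order |S|^(1/d) this is an
  isoperimetric inequality for functions with plateau A.\<close>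

lemma level_set_isoperimetry:
  fixes f :: "int ^ 'd \<Rightarrow> real"
  assumes "finite A" "finite S" "2 * card S \<le> r ^ CARD('d)" "0 < r"
    and "\<And>z. z \<in> A \<Longrightarrow> f z = \<tau>" "\<And>z. z \<notin> S \<Longrightarrow> f z = 0" "0 \<le> \<tau>"
  shows "ennreal (\<tau> * card A) \<le> 2 * of_nat r * (\<Sum>i\<in>UNIV. tvar f (axis i 1))"
proof -
  obtain v where v: "\<forall>i. 0 \<le> v $ i \<and> v $ i < int r" and c: "card A \<le> 2 * card {z \<in> A. z + v \<notin> S}"
    using exists_translation_leaving[OF assms(1-4)] by blast
  let ?L = "{z \<in> A. z + v \<notin> S}"
  have "ennreal (\<tau> * card A) \<le> ennreal (\<tau> * (2 * card ?L))"
    using c assms(7) by (intro ennreal_leI mult_left_mono) auto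
  also have "\<dots> = 2 * (of_nat (card ?L) * ennreal \<tau>)"
    using assms(7) by (simp add: ennreal_mult' ennreal_of_nat_eq_real_of_nat mult_ac)
  finally have 1: "ennreal (\<tau> * card A) \<le> 2 * (of_nat (card ?L) * ennreal \<tau>)" .
  have "of_nat (card ?L) * ennreal \<tau> = (\<integral>\<^sup>+z. ennreal \<tau> * indicator ?L z \<partial>count_space UNIV)"
    using assms(1) by (subst nn_integral_cmult_indicator) (auto simp: mult.commute)
  also have "\<dots> \<le> tvar f v"
    unfolding tvar_def using assms(5-7) by (intro nn_integral_mono) (auto split: split_indicator)
  also have "tvar f v \<le> of_nat r * (\<Sum>i\<in>UNIV. tvar f (axis i 1))"
    using v by (intro tvar_le) (auto intro: less_imp_le)
  finally have 2: "2 * (of_nat (card ?L) * ennreal \<tau>) \<le> 2 * (of_nat r * (\<Sum>i\<in>UNIV. tvar f (axis i 1)))"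
    by (intro mult_left_mono) auto
  show ?thesis unfolding mult.assoc by (rule order_trans[OF 1 2])
qed

text \<open>Loop erasure at the starting point: a connection from p can be taken never to return to
  p. Removing p from B makes an induction on |B| possible.\<close>

lemma rtrancl_avoiding:
  assumes "(p, q) \<in> {(v, w). v \<in> B \<and> w \<in> B \<and> r v w}\<^sup>*" "p \<noteq> q"
  shows "p \<in> B \<and> (\<exists>p'. p' \<in> B - {p} \<and> r p p' \<and> (p', q) \<in> {(v, w). v \<in> B - {p} \<and> w \<in> B - {p} \<and> r v w}\<^sup>*)"
  using assms
proof (induction rule: rtrancl_induct)
  case (step y z)
  show ?case
  proof (cases "y = p")
    case True
    then show ?thesis using step by auto
  next
    case False
    then obtain p' where "p \<in> B" "p' \<in> B - {p}" "r p p'" and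
      *: "(p', y) \<in> {(v, w). v \<in> B - {p} \<and> w \<in> B - {p} \<and> r v w}\<^sup>*" using step by blast
    moreover have "(y, z) \<in> {(v, w). v \<in> B - {p} \<and> w \<in> B - {p} \<and> r v w}" using step False by auto
    ultimately show ?thesis by (meson rtrancl.rtrancl_into_rtrancl)
  qed
qed simp

text \<open>All pairs in B are summed, not just those on a path, so that no path has to be chosen.
  The loss is absorbed later in the count of the sets B that contain a given point.\<close>

lemma abs_diff_le_sum_over_path:
  fixes f :: "'v \<Rightarrow> real"
  assumes "finite B" "(p, q) \<in> {(v, w). v \<in> B \<and> w \<in> B \<and> r v w}\<^sup>*"
  shows "\<bar>f p - f q\<bar> \<le> (\<Sum>b\<in>B. \<Sum>b'\<in>B. of_bool (r b b') * \<bar>f b - f b'\<bar>)"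
  using assms
proof (induction "card B" arbitrary: B p rule: less_induct)
  case less
  show ?case
  proof (cases "p = q")
    case False
    then obtain p' where p: "p \<in> B" "p' \<in> B - {p}" "r p p'"
      and *: "(p', q) \<in> {(v, w). v \<in> B - {p} \<and> w \<in> B - {p} \<and> r v w}\<^sup>*"
      using rtrancl_avoiding[OF less.prems(2)] by blast
    have c: "card (B - {p}) < card B" using p less.prems by (meson card_Diff1_less)
    have "\<bar>f p' - f q\<bar> \<le> (\<Sum>b\<in>B - {p}. \<Sum>b'\<in>B - {p}. of_bool (r b b') * \<bar>f b - f b'\<bar>)"
      using less.hyps[OF c _ *] less.prems by simp
    also have "\<dots> \<le> (\<Sum>b\<in>B - {p}. \<Sum>b'\<in>B. of_bool (r b b') * \<bar>f b - f b'\<bar>)"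
      using less.prems by (intro sum_mono sum_mono2) auto
    finally have 1: "\<bar>f p' - f q\<bar> \<le> \<dots>" .
    have "\<bar>f p - f p'\<bar> = of_bool (r p p') * \<bar>f p - f p'\<bar>" using p by simp
    also have "\<dots> \<le> (\<Sum>b'\<in>B. of_bool (r p b') * \<bar>f p - f b'\<bar>)"
      using p less.prems by (intro member_le_sum) auto
    finally have 2: "\<bar>f p - f p'\<bar> \<le> \<dots>" .
    have "\<bar>f p - f q\<bar> \<le> \<bar>f p - f p'\<bar> + \<bar>f p' - f q\<bar>" by simp
    then show ?thesis using 1 2 p less.prems by (subst sum.remove[of B p]) auto
  qed (simp add: sum_nonneg)
qed

context network begin

definition nuW :: "'v \<Rightarrow> real" where
  "nuW b = (\<Sum>b'\<in>W. if 0 < a b b' then inverse (a b b') else 0)"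

text \<open>Cauchy-Schwarz after inserting sqrt a times its inverse; the inverse conductances, and
  hence the moment of nu, enter here.\<close>

lemma weighted_gradient_le:
  assumes "S \<subseteq> W"
  shows "(\<Sum>b\<in>S. T b * (\<Sum>b'\<in>W. of_bool (0 < a b b') * \<bar>f b - f b'\<bar>)) \<le> sqrt (energy f) * sqrt (\<Sum>b\<in>S. (T b)\<^sup>2 * nuW b)"
proof -
  let ?x = "\<lambda>(b, b'). sqrt (a b b') * \<bar>f b - f b'\<bar>" and ?y = "\<lambda>(b, b'). if 0 < a b b' then T b / sqrt (a b b') else 0"
  have fin: "finite S" using assms finite_W finite_subset by blast
  have "(\<Sum>b\<in>S. T b * (\<Sum>b'\<in>W. of_bool (0 < a b b') * \<bar>f b - f b'\<bar>)) = (\<Sum>p\<in>S\<times>W. ?x p * ?y p)"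
    unfolding sum.cartesian_product' sum_distrib_left by (intro sum.cong refl) auto
  also have "\<dots> \<le> sqrt (\<Sum>p\<in>S\<times>W. (?x p)\<^sup>2) * sqrt (\<Sum>p\<in>S\<times>W. (?y p)\<^sup>2)"
    unfolding real_sqrt_mult[symmetric] by (rule real_le_rsqrt, rule Cauchy_Schwarz_ineq_sum)
  also have "\<dots> \<le> sqrt (energy f) * sqrt (\<Sum>p\<in>S\<times>W. (?y p)\<^sup>2)"
  proof (intro mult_right_mono real_sqrt_le_mono real_sqrt_ge_zero sum_nonneg zero_le_power2)
  have "(\<Sum>p\<in>S\<times>W. (?x p)\<^sup>2) = (\<Sum>b\<in>S. \<Sum>b'\<in>W. a b b' * (f b - f b')\<^sup>2)"
    unfolding sum.cartesian_product'
    by (intro sum.cong refl) (simp add: power_mult_distrib a_nonneg)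
  also have "\<dots> \<le> energy f"
    unfolding energy_def using assms fin finite_W by (intro sum_mono2) (auto intro!: sum_nonneg mult_nonneg_nonneg a_nonneg)
  finally show "(\<Sum>p\<in>S\<times>W. (?x p)\<^sup>2) \<le> energy f" .
  qed
  also have "(\<Sum>p\<in>S\<times>W. (?y p)\<^sup>2) = (\<Sum>b\<in>S. (T b)\<^sup>2 * nuW b)"
    unfolding sum.cartesian_product' nuW_def sum_distrib_left
    by (intro sum.cong refl) (auto simp: power_mult_distrib power_inverse divide_inverse real_sqrt_pow2 a_nonneg)
  finally show ?thesis .
qed

end


text \<open>\<open>\<pi> z\<close> is a point of the cluster near \<open>z\<close>; the projections of the two ends of an edge at \<open>z\<close> are joined by
  an open path in the finite set \<open>B z\<close>. Since \<open>Z b\<close> contains all \<open>z\<close> with \<open>b \<in> B z\<close>, the number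
  \<open>T b\<close> bounds how often \<open>b\<close> is used by these paths.\<close>

locale network_geometry = network W a for W :: "(int ^ 'd::finite) set" and a +
  fixes \<pi> :: "int ^ 'd \<Rightarrow> int ^ 'd" and B Z :: "int ^ 'd \<Rightarrow> (int ^ 'd) set"
    and T :: "int ^ 'd \<Rightarrow> real" and C :: "(int ^ 'd) set"
  assumes proj: "z \<in> C \<Longrightarrow> \<pi> z = z"
    and proj_in: "\<pi> z \<in> B z"
    and path: "(\<pi> z, \<pi> (z + axis i 1)) \<in> {(v, w). v \<in> B z \<and> w \<in> B z \<and> 0 < a v w}\<^sup>*"
    and finite_B: "finite (B z)"
    and B_subset: "b \<in> B z \<Longrightarrow> z \<in> Z b \<and> b \<in> C"
    and finite_Z: "b \<in> C \<Longrightarrow> finite (Z b)"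
    and card_Z: "b \<in> C \<Longrightarrow> real (card (Z b)) \<le> T b"
begin

lemma T_nonneg: "b \<in> C \<Longrightarrow> 0 \<le> T b"
  using card_Z[of b] by linarith

text \<open>The increment of f between the projections of neighbours is spread over the pairs of B
  z. After exchanging the sums, the gradient at b is counted once for each z in Z b, at most T b
  times.\<close>

lemma tvar_proj_le:
  assumes S: "finite S" "S \<subseteq> W" "S \<subseteq> C" "\<And>b b'. b \<in> S \<Longrightarrow> 0 < a b b' \<Longrightarrow> b' \<in> W"
    and f0: "\<And>b. b \<notin> S \<Longrightarrow> f b = (0 :: real)"
  shows "tvar (\<lambda>z. f (\<pi> z)) (axis i 1) \<le> ennreal (2 * (\<Sum>b\<in>S. T b * (\<Sum>b'\<in>W. of_bool (0 < a b b') * \<bar>f b - f b'\<bar>)))"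
proof -
  define D where "D b = (\<Sum>b'\<in>W. of_bool (0 < a b b') * \<bar>f b - f b'\<bar>)" for b
  have D0: "0 \<le> D b" for b unfolding D_def by (intro sum_nonneg) auto
  have pt: "\<bar>f (\<pi> (z + axis i 1)) - f (\<pi> z)\<bar> \<le> (\<Sum>b\<in>S. 2 * D b * of_bool (z \<in> Z b))" for z
  proof -
    define F where "F b b' = of_bool (0 < a b b') * \<bar>f b - f b'\<bar>" for b b'
    have F0: "0 \<le> F b b'" and Fs: "F b b' = F b' b" for b b' by (auto simp: F_def a_sym abs_minus_commute)
    have "\<bar>f (\<pi> (z + axis i 1)) - f (\<pi> z)\<bar> = \<bar>f (\<pi> z) - f (\<pi> (z + axis i 1))\<bar>" by simp
    also have "\<dots> \<le> (\<Sum>b\<in>B z. \<Sum>b'\<in>B z. F b b')"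
      unfolding F_def by (rule abs_diff_le_sum_over_path[OF finite_B path])
    \<comment> \<open>Pairs with both ends outside S contribute nothing, as f vanishes there. The
      two indicator sums agree by symmetry, which is the factor 2.\<close>
    also have "\<dots> \<le> (\<Sum>b\<in>B z. \<Sum>b'\<in>B z. of_bool (b \<in> S) * F b b' + of_bool (b' \<in> S) * F b b')"
      by (intro sum_mono) (auto simp: F_def f0)
    also have "\<dots> = (\<Sum>b\<in>B z. \<Sum>b'\<in>B z. of_bool (b \<in> S) * F b b') + (\<Sum>b\<in>B z. \<Sum>b'\<in>B z. of_bool (b' \<in> S) * F b b')"
      by (simp add: sum.distrib)
    also have "(\<Sum>b\<in>B z. \<Sum>b'\<in>B z. of_bool (b' \<in> S) * F b b') = (\<Sum>b\<in>B z. \<Sum>b'\<in>B z. of_bool (b \<in> S) * F b b')"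
      by (subst sum.swap) (simp add: Fs)
    also have "(\<Sum>b\<in>B z. \<Sum>b'\<in>B z. of_bool (b \<in> S) * F b b') = (\<Sum>b\<in>B z \<inter> S. \<Sum>b'\<in>B z. F b b')"
      using finite_B by (subst sum.inter_restrict) (auto intro!: sum.cong)
    also have "\<dots> \<le> (\<Sum>b\<in>B z \<inter> S. D b)"
    proof (rule sum_mono)
      fix b assume b: "b \<in> B z \<inter> S"
      have "(\<Sum>b'\<in>B z. F b b') = (\<Sum>b'\<in>B z \<inter> W. F b b')"
        using b S(4) finite_B by (intro sum.mono_neutral_right) (auto simp: F_def)
      also have "\<dots> \<le> (\<Sum>b'\<in>W. F b b')" using F0 finite_W by (intro sum_mono2) auto
      finally show "(\<Sum>b'\<in>B z. F b b') \<le> D b" by (simp add: D_def F_def)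
    qed
    also have "\<dots> \<le> (\<Sum>b\<in>S. D b * of_bool (z \<in> Z b))"
    proof -
      have "(\<Sum>b\<in>B z \<inter> S. D b) = (\<Sum>b\<in>B z \<inter> S. D b * of_bool (z \<in> Z b))"
        using B_subset by (intro sum.cong) auto
      also have "\<dots> \<le> (\<Sum>b\<in>S. D b * of_bool (z \<in> Z b))" using S D0 by (intro sum_mono2) auto
      finally show ?thesis .
    qed
    finally show ?thesis by (simp add: sum_distrib_left mult.assoc)
  qed
  have "tvar (\<lambda>z. f (\<pi> z)) (axis i 1) \<le> (\<integral>\<^sup>+z. (\<Sum>b\<in>S. ennreal (2 * D b) * indicator (Z b) z) \<partial>count_space UNIV)"
    unfolding tvar_def
  proof (rule nn_integral_mono)
    fix z
    have "ennreal \<bar>f (\<pi> (z + axis i 1)) - f (\<pi> z)\<bar> \<le> ennreal (\<Sum>b\<in>S. 2 * D b * of_bool (z \<in> Z b))"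
      using pt by (rule ennreal_leI)
    also have "\<dots> = (\<Sum>b\<in>S. ennreal (2 * D b * of_bool (z \<in> Z b)))"
      using D0 by (intro sum_ennreal[symmetric]) auto
    also have "\<dots> = (\<Sum>b\<in>S. ennreal (2 * D b) * indicator (Z b) z)"
      by (intro sum.cong) (auto split: split_indicator)
    finally show "ennreal \<bar>f (\<pi> (z + axis i 1)) - f (\<pi> z)\<bar> \<le> \<dots>" .
  qed
  also have "\<dots> = (\<Sum>b\<in>S. ennreal (2 * D b) * of_nat (card (Z b)))"
    using S finite_Z by (subst nn_integral_sum) (auto intro!: sum.cong simp: nn_integral_cmult_indicator subset_iff)
  also have "\<dots> \<le> (\<Sum>b\<in>S. ennreal (2 * D b * T b))"
    using S card_Z D0 by (intro sum_mono) (auto simp: ennreal_of_nat_eq_real_of_nat ennreal_mult'[symmetric] intro!: ennreal_leI mult_left_mono)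
  also have "\<dots> = ennreal (2 * (\<Sum>b\<in>S. T b * D b))"
    using S D0 T_nonneg by (subst sum_ennreal) (auto simp: sum_distrib_left mult_ac)
  finally show ?thesis unfolding D_def .
qed

text \<open>The truncation of f between t/2 and t is constant on A, vanishes off S and does not
  increase the energy. Composed with \<pi> it becomes a lattice function supported in the union S'
  of the sets Z b over b in S, whose size is at most the sum of T over S.\<close>

lemma level_set_energy:
  fixes t :: real and r :: nat
  assumes U: "finite U" "U \<subseteq> C" "U \<subseteq> W" "\<And>b b'. b \<in> U \<Longrightarrow> 0 < a b b' \<Longrightarrow> b' \<in> W"
    and f: "\<And>b. b \<notin> U \<Longrightarrow> f b = 0" "\<And>b. 0 \<le> f b" and t: "0 < t"
    and r: "2 * (\<Sum>b\<in>{b \<in> U. t / 2 < f b}. T b) \<le> real r ^ CARD('d)" "0 < r"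
  shows "t * card {b \<in> U. t \<le> f b}
    \<le> 8 * real CARD('d) * r * (sqrt (energy f) * sqrt (\<Sum>b\<in>{b \<in> U. t / 2 < f b}. (T b)\<^sup>2 * nuW b))"
proof -
  define S where "S = {b \<in> U. t / 2 < f b}"
  define A where "A = {b \<in> U. t \<le> f b}"
  define g where "g b = max (min (f b) t - t / 2) 0" for b
  have S: "finite S" "S \<subseteq> W" "S \<subseteq> C" "\<And>b b'. b \<in> S \<Longrightarrow> 0 < a b b' \<Longrightarrow> b' \<in> W"
    using U by (auto simp: S_def)
  have g0: "g b = 0" if "b \<notin> S" for b using that f t by (cases "b \<in> U") (auto simp: g_def S_def)
  define S' where "S' = (\<Union>b\<in>S. Z b)"
  have finS': "finite S'" using S finite_Z by (auto simp: S'_def)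
  have "real (card S') \<le> (\<Sum>b\<in>S. real (card (Z b)))"
    unfolding S'_def of_nat_sum[symmetric] of_nat_le_iff by (rule card_UN_le[OF S(1)])
  also have "\<dots> \<le> (\<Sum>b\<in>S. T b)" using S card_Z by (intro sum_mono) auto
  finally have "2 * real (card S') \<le> real r ^ CARD('d)" using r by (simp add: S_def)
  then have cS': "2 * card S' \<le> r ^ CARD('d)" by (metis of_nat_le_iff of_nat_mult of_nat_numeral of_nat_power)
  have gS': "g (\<pi> z) = 0" if "z \<notin> S'" for z
  proof (rule g0)
    show "\<pi> z \<notin> S" using that B_subset[OF proj_in[of z]] by (auto simp: S'_def)
  qed
  have gA: "g (\<pi> z) = t / 2" if "z \<in> A" for z
    using that U t proj[of z] by (auto simp: A_def g_def)
  define D where "D = (\<Sum>b\<in>S. T b * (\<Sum>b'\<in>W. of_bool (0 < a b b') * \<bar>g b - g b'\<bar>))"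
  have D0: "0 \<le> D" unfolding D_def using S T_nonneg by (intro sum_nonneg mult_nonneg_nonneg) auto
  have "ennreal (t / 2 * card A) \<le> 2 * of_nat r * (\<Sum>i\<in>(UNIV :: 'd set). tvar (\<lambda>z. g (\<pi> z)) (axis i 1))"
    using finS' cS' r t U gA gS' by (intro level_set_isoperimetry) (auto simp: A_def)
  also have "\<dots> \<le> 2 * of_nat r * (\<Sum>i\<in>(UNIV :: 'd set). ennreal (2 * D))"
    unfolding D_def by (intro mult_left_mono sum_mono tvar_proj_le S g0) auto
  also have "\<dots> = ennreal (2 * r * (CARD('d) * (2 * D)))"
    using D0 by (simp add: ennreal_mult' ennreal_of_nat_eq_real_of_nat mult_ac)
  finally have "t / 2 * card A \<le> 2 * r * (CARD('d) * (2 * D))"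
    using D0 by (subst (asm) ennreal_le_iff) auto
  moreover have "D \<le> sqrt (energy g) * sqrt (\<Sum>b\<in>S. (T b)\<^sup>2 * nuW b)"
    unfolding D_def by (rule weighted_gradient_le) (rule S)
  moreover have "energy g \<le> energy f" by (rule energy_mono) (auto simp: g_def)
  then have "sqrt (energy g) * sqrt (\<Sum>b\<in>S. (T b)\<^sup>2 * nuW b) \<le> sqrt (energy f) * sqrt (\<Sum>b\<in>S. (T b)\<^sup>2 * nuW b)"
    by (intro mult_right_mono) (auto intro!: sum_nonneg mult_nonneg_nonneg simp: nuW_def)
  ultimately have "t / 2 * card A \<le> 2 * r * (CARD('d) * (2 * (sqrt (energy f) * sqrt (\<Sum>b\<in>S. (T b)\<^sup>2 * nuW b))))"
    by (smt (verit) mult_left_mono of_nat_0_le_iff)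
  then show ?thesis by (simp add: A_def S_def field_simps)
qed

end


lemma powr_le_self_of_ge_1: "1 \<le> (c :: real) \<Longrightarrow> e \<le> 1 \<Longrightarrow> c powr e \<le> c"
  using powr_mono[of e 1 c] by simp

lemma sum_le_via_power_normalized:
  fixes X :: "'a \<Rightarrow> real"
  assumes "finite A" "\<And>z. z \<in> A \<Longrightarrow> 0 \<le> X z" "1 < q" "(\<Sum>z\<in>A. X z powr q) \<le> c * V"
    and "1 \<le> c" "1 \<le> K" "0 < V" "0 \<le> n" "real (card A) \<le> K * n"
  shows "(\<Sum>z\<in>A. X z) \<le> 2 * c * K * V * (n / V) powr (1 - 1 / q)"
proof -
  have q: "1 / q \<le> 1" "0 < 1 / q" using assms by auto
  have "(\<Sum>z\<in>A. X z) \<le> 2 * (c * V) powr (1 / q) * real (card A) powr (1 - 1 / q)"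
    using assms by (intro sum_le_via_power) auto
  also have "\<dots> \<le> 2 * (c * V) powr (1 / q) * (K * n) powr (1 - 1 / q)"
    using assms q by (intro mult_left_mono powr_mono2) auto
  also have "\<dots> = 2 * c powr (1 / q) * K powr (1 - 1 / q) * (V powr (1 / q) * n powr (1 - 1 / q))"
    using assms by (simp add: powr_mult)
  also have "V powr (1 / q) * n powr (1 - 1 / q) = V * (n / V) powr (1 - 1 / q)"
    using assms by (simp add: powr_divide powr_diff)
  also have "2 * c powr (1 / q) * K powr (1 - 1 / q) * (V * (n / V) powr (1 - 1 / q)) \<le> 2 * c * K * (V * (n / V) powr (1 - 1 / q))"
    using assms q by (intro mult_right_mono mult_mono powr_le_self_of_ge_1) auto
  finally show ?thesis by (simp add: mult.assoc)
qed

lemma exists_nat_root_ge: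
  assumes "1 \<le> (P :: real)" "0 < d"
  shows "\<exists>r :: nat. 0 < r \<and> P \<le> real r ^ d \<and> real r \<le> 2 * P powr (1 / d)"
proof -
  define y where "y = P powr (1 / d)"
  have y: "1 \<le> y" unfolding y_def using assms by (intro ge_one_powr_ge_zero) auto
  have yd: "y ^ d = P" using assms by (simp add: y_def powr_power)
  have ge: "y \<le> real (nat \<lceil>y\<rceil>)" by linarith
  have "P \<le> real (nat \<lceil>y\<rceil>) ^ d" unfolding yd[symmetric] using y ge by (intro power_mono) auto
  moreover have "real (nat \<lceil>y\<rceil>) \<le> 2 * y" using y by linarith
  ultimately show ?thesis using y unfolding y_def[symmetric] by (intro exI[of _ "nat \<lceil>y\<rceil>"]) auto
qed

context network_geometry begin

text \<open>It suffices to treat the \<open>t\<close> that maximises \<open>t\<^sup>2 |{f \<ge> t}|\<^sup>s\<close>: there the level sets at \<open>t\<close> and \<open>t / 2\<close>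
  have comparable sizes, so that one isoperimetric estimate for the truncation of \<open>f\<close> between these levels is enough.\<close>

lemma weak_sobolev:
  assumes U: "finite U" "U \<subseteq> C" "U \<subseteq> W" "\<And>b b'. b \<in> U \<Longrightarrow> 0 < a b b' \<Longrightarrow> b' \<in> W"
    and f: "\<And>b. b \<notin> U \<Longrightarrow> f b = 0" "\<And>b. 0 \<le> f b" and t0: "0 < t0"
    and d: "2 \<le> CARD('d)" and V: "0 < V" and c: "1 \<le> c" and m: "1 < m" and q: "1 < q"
    and T1: "\<And>b. b \<in> U \<Longrightarrow> 1 \<le> T b"
    and Tm: "(\<Sum>b\<in>U. T b powr m) \<le> c * V" and Tnu: "(\<Sum>b\<in>U. ((T b)\<^sup>2 * nuW b) powr q) \<le> c * V"
    and s_def: "s = 1 + 1 / q - 2 / real CARD('d) + 2 / (real CARD('d) * m)"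
  shows "t0\<^sup>2 * (real (card {b \<in> U. t0 \<le> f b}) / V) powr s
    \<le> 2048 * (real CARD('d))\<^sup>2 * c\<^sup>2 * 16 powr (1 / s) * V powr (2 / real CARD('d) - 1) * energy f"
proof -
  let ?d = "real CARD('d)"
  define N where "N t = real (card {b \<in> U. t \<le> f b})" for t
  define g where "g t = t\<^sup>2 * N t powr s" for t
  have d2: "2 / ?d \<le> 1" "0 < 2 / ?d" using d by (auto simp: divide_simps)
  have s0: "0 < s"
  proof -
    have "0 < 1 / q" "0 \<le> 2 / (?d * m)" using q m by auto
    then show ?thesis unfolding s_def using d2 by linarith
  qed
  show ?thesis
  proof (cases "N t0 = 0")
    case True
    then show ?thesis unfolding N_def using V by simp
  next
    case False
    define F where "F = f ` {b \<in> U. 0 < f b}"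
    have finF: "finite F" using U by (simp add: F_def)
    \<comment> \<open>Raising t to the least value of f on its level set leaves the level set
      unchanged and increases g. So the supremum over all t is a maximum over the finite set
      F.\<close>
    have up: "\<exists>t'\<in>F. g t \<le> g t'" if t: "0 < t" "N t \<noteq> 0" for t
    proof -
      let ?A = "{b \<in> U. t \<le> f b}"
      define t' where "t' = Min (f ` ?A)"
      have fin: "finite (f ` ?A)" and ne: "f ` ?A \<noteq> {}" using U t by (auto simp: N_def)
      then have t'in: "t' \<in> f ` ?A" unfolding t'_def by (rule Min_in)
      then have "t \<le> t'" by auto
      have "{b \<in> U. t' \<le> f b} = ?A"
      proof -
        have "t' \<le> f b" if "b \<in> ?A" for b unfolding t'_def using that fin by (intro Min_le) auto
        then show ?thesis using \<open>t \<le> t'\<close> by auto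
      qed
      then have "N t' = N t" by (simp add: N_def)
      then have "g t \<le> g t'" using \<open>t \<le> t'\<close> t by (auto simp: g_def intro!: mult_right_mono power_mono)
      moreover have "t' \<in> F" using t'in t by (auto simp: F_def)
      ultimately show ?thesis by blast
    qed
    have Fne: "F \<noteq> {}" using up[OF t0 False] by auto
    obtain ts where ts: "ts \<in> F" "\<And>t. t \<in> F \<Longrightarrow> g t \<le> g ts"
    proof -
      have "Max (g ` F) \<in> g ` F" using finF Fne by (intro Max_in) auto
      then obtain ts where "ts \<in> F" "g ts = Max (g ` F)" by auto
      then show ?thesis using that[of ts] finF by (metis Max_ge finite_imageI image_eqI)
    qed
    have gmax: "g t \<le> g ts" if "0 < t" for t
    proof (cases "N t = 0")
      case True
      then show ?thesis by (simp add: g_def)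
    next
      case False then show ?thesis using up[OF that] ts(2) by force
    qed
    have ts0: "0 < ts" using ts by (auto simp: F_def)
    define n where "n = N ts"
    have n1: "1 \<le> n"
    proof -
      obtain b where "b \<in> U" "f b = ts" using ts(1) by (auto simp: F_def)
      then have "card {b \<in> U. ts \<le> f b} \<noteq> 0" using U by auto
      then show ?thesis unfolding n_def N_def by linarith
    qed
    \<comment> \<open>Maximality compared with ts / 2 gives N(ts/2)^s <= 4 N(ts)^s, hence the
      doubling constant 4^(1/s).\<close>
    define K where "K = (4 :: real) powr (1 / s)"
    have K1: "1 \<le> K" unfolding K_def using s0 by (intro ge_one_powr_ge_zero) auto
    define S where "S = {b \<in> U. ts / 2 < f b}"
    have finS: "finite S" using U by (simp add: S_def)
    have cS: "real (card S) \<le> K * n"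
    proof -
      have "real (card S) \<le> N (ts / 2)" unfolding S_def N_def using U by (auto intro!: card_mono)
      also have "N (ts / 2) \<le> K * n"
      proof -
        have "N (ts / 2) powr s \<le> 4 * n powr s"
          using gmax[of "ts / 2"] ts0 by (simp add: g_def n_def power_divide field_simps)
        then have "(N (ts / 2) powr s) powr (1 / s) \<le> (4 * n powr s) powr (1 / s)"
          using s0 by (intro powr_mono2) auto
        then show ?thesis using s0 n1 by (simp add: powr_powr powr_mult K_def N_def)
      qed
      finally show ?thesis .
    qed
    define \<alpha> where "\<alpha> = n / V"
    have \<alpha>: "0 < \<alpha>" using n1 V by (simp add: \<alpha>_def)
    define P where "P = (\<Sum>b\<in>S. T b)"
    have P: "P \<le> 2 * c * K * V * \<alpha> powr (1 - 1 / m)"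
    proof -
      have "(\<Sum>b\<in>S. T b powr m) \<le> c * V"
        using U by (intro order_trans[OF sum_mono2 Tm]) (auto simp: S_def)
      moreover have "0 \<le> T b" if "b \<in> S" for b using T1[of b] that by (simp add: S_def)
      ultimately show ?thesis unfolding P_def \<alpha>_def
        using finS m c K1 V n1 cS by (intro sum_le_via_power_normalized) auto
    qed
    define Y where "Y = (\<Sum>b\<in>S. (T b)\<^sup>2 * nuW b)"
    have nu0: "0 \<le> nuW b" for b unfolding nuW_def by (intro sum_nonneg) auto
    have Y: "Y \<le> 2 * c * K * V * \<alpha> powr (1 - 1 / q)"
    proof -
      have "(\<Sum>b\<in>S. ((T b)\<^sup>2 * nuW b) powr q) \<le> c * V"
        using U by (intro order_trans[OF sum_mono2 Tnu]) (auto simp: S_def)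
      then show ?thesis unfolding Y_def \<alpha>_def
        using finS q c K1 V n1 cS nu0 by (intro sum_le_via_power_normalized) auto
    qed
    have Y0: "0 \<le> Y" unfolding Y_def using nu0 by (intro sum_nonneg) auto
    have P1: "1 \<le> P"
    proof -
      have "n \<le> real (card S)" unfolding n_def N_def S_def using U ts0 by (auto intro!: card_mono)
      also have "real (card S) \<le> P" unfolding P_def using T1 sum_mono[of S "\<lambda>_. 1" T] by (auto simp: S_def)
      finally show ?thesis using n1 by simp
    qed
    \<comment> \<open>The box of translations must have volume at least twice the number of lattice
      points projecting into S, which P bounds. Rounding its side up to an integer loses at most a
      factor 2 because P >= 1.\<close>
    obtain r :: nat where r: "0 < r" "2 * P \<le> real r ^ CARD('d)" "real r \<le> 2 * (2 * P) powr (1 / CARD('d))"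
      using exists_nat_root_ge[of "2 * P" "CARD('d)"] P1 by auto
    have r2: "(real r)\<^sup>2 \<le> 16 * c * K * (V powr (2 / ?d) * \<alpha> powr ((1 - 1 / m) * (2 / ?d)))"
    proof -
      have "(real r)\<^sup>2 \<le> (2 * (2 * P) powr (1 / ?d))\<^sup>2" using r by (intro power_mono) auto
      also have "\<dots> = 4 * (2 * P) powr (2 / ?d)"
        using P1 by (simp add: power_mult_distrib powr_power)
      also have "(2 * P) powr (2 / ?d) \<le> (4 * c * K * (V * \<alpha> powr (1 - 1 / m))) powr (2 / ?d)"
        using P P1 d2 by (intro powr_mono2) (auto simp: mult_ac)
      also have "\<dots> = (4 * c * K) powr (2 / ?d) * (V powr (2 / ?d) * \<alpha> powr ((1 - 1 / m) * (2 / ?d)))"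
        using c K1 V by (simp add: powr_mult powr_powr)
      also have "\<dots> \<le> (4 * c * K) * (V powr (2 / ?d) * \<alpha> powr ((1 - 1 / m) * (2 / ?d)))"
      proof (intro mult_right_mono powr_le_self_of_ge_1)
        have "1 \<le> c * K" using c K1 mult_mono[of 1 c 1 K] by simp
        then show "1 \<le> 4 * c * K" by simp
      qed (use d2 in auto)
      finally show ?thesis by simp
    qed
    have "ts * n \<le> 8 * ?d * r * (sqrt (energy f) * sqrt Y)"
      unfolding n_def N_def Y_def S_def
      by (rule level_set_energy[OF U f ts0]) (use r in \<open>auto simp: P_def S_def\<close>)
    then have "(ts * n)\<^sup>2 \<le> (8 * ?d * r * (sqrt (energy f) * sqrt Y))\<^sup>2"
      using ts0 n1 by (intro power_mono) auto
    also have "\<dots> = 64 * ?d\<^sup>2 * (energy f * ((real r)\<^sup>2 * Y))"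
      using Y0 by (simp add: power_mult_distrib)
    also have "\<dots> \<le> 64 * ?d\<^sup>2 * (energy f * ((16 * c * K * (V powr (2 / ?d) * \<alpha> powr ((1 - 1 / m) * (2 / ?d)))) * (2 * c * K * V * \<alpha> powr (1 - 1 / q))))"
      using r2 Y Y0 c K1 V by (intro mult_left_mono mult_mono) auto
    also have "\<dots> = 2048 * ?d\<^sup>2 * c\<^sup>2 * K\<^sup>2 * (V powr (2 / ?d) * V) * energy f * \<alpha> powr ((1 - 1 / m) * (2 / ?d) + (1 - 1 / q))"
      by (simp add: powr_add power2_eq_square)
    \<comment> \<open>Here s is determined: (1 - 1/m)(2/d) + (1 - 1/q) = 2 - s.\<close>
    finally have main: "ts\<^sup>2 * n\<^sup>2 \<le> 2048 * ?d\<^sup>2 * c\<^sup>2 * K\<^sup>2 * (V powr (2 / ?d) * V) * energy f * \<alpha> powr (2 - s)"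
      using d by (simp add: power_mult_distrib s_def field_simps)
    have nV: "n\<^sup>2 = \<alpha>\<^sup>2 * V\<^sup>2" using V by (simp add: \<alpha>_def power_divide)
    have Vp: "V powr (2 / ?d) * V = V powr (2 / ?d - 1) * V\<^sup>2"
      using V by (simp add: powr_diff power2_eq_square)
    have \<alpha>2: "\<alpha>\<^sup>2 = \<alpha> powr s * \<alpha> powr (2 - s)"
      using \<alpha> by (simp add: powr_add[symmetric])
    have "ts\<^sup>2 * \<alpha> powr s * (\<alpha> powr (2 - s) * V\<^sup>2) \<le> (2048 * ?d\<^sup>2 * c\<^sup>2 * K\<^sup>2 * V powr (2 / ?d - 1) * energy f) * (\<alpha> powr (2 - s) * V\<^sup>2)"
      using main unfolding nV Vp \<alpha>2 by (simp add: mult_ac)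
    then have "ts\<^sup>2 * \<alpha> powr s \<le> 2048 * ?d\<^sup>2 * c\<^sup>2 * K\<^sup>2 * V powr (2 / ?d - 1) * energy f"
      using \<alpha> V by (subst (asm) mult_le_cancel_right_pos) auto
    moreover have "K\<^sup>2 = 16 powr (1 / s)"
      unfolding K_def by (simp add: power2_eq_square powr_mult[symmetric])
    moreover have "t0\<^sup>2 * (N t0 / V) powr s \<le> ts\<^sup>2 * \<alpha> powr s"
      using gmax[OF t0] V n1 by (simp add: g_def \<alpha>_def n_def powr_divide divide_right_mono N_def)
    ultimately show ?thesis unfolding N_def by simp
  qed
qed

end


section \<open>De Giorgi iteration and local maximum principle\<close>

text \<open>The ratio 2^(-4/(\<sigma>-s)) is the one whose power \<sigma> - s is 1/16, which cancels
  16^j. Smallness of \<alpha> 0 pays for the factor 2^(-4s/(\<sigma>-s)) by which the s-th power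
  must shrink in each step.\<close>

lemma fast_recursion_decay:
  fixes \<alpha> :: "nat \<Rightarrow> real"
  assumes "\<And>j. 0 \<le> \<alpha> j" "0 < s" "s < \<sigma>" "0 \<le> D"
    and rec: "\<And>j. \<alpha> (Suc j) powr s \<le> D * 16 ^ j * \<alpha> j powr \<sigma>"
    and small: "D * \<alpha> 0 powr (\<sigma> - s) \<le> 2 powr (- 4 * s / (\<sigma> - s))"
  shows "\<alpha> j \<le> \<alpha> 0 * 2 powr (- 4 * real j / (\<sigma> - s))"
proof (induction j)
  case (Suc j)
  define \<theta> where "\<theta> = \<sigma> - s"
  have \<theta>: "0 < \<theta>" using assms by (simp add: \<theta>_def)
  let ?b = "\<alpha> 0 * 2 powr (- 4 * real j / \<theta>)"
  have IH: "\<alpha> j \<le> ?b" using Suc by (simp add: \<theta>_def)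
  have "\<alpha> (Suc j) powr s \<le> D * 16 ^ j * \<alpha> j powr \<sigma>" by (rule rec)
  also have "\<dots> \<le> D * 16 ^ j * ?b powr \<sigma>"
    using assms IH by (intro mult_left_mono powr_mono2) auto
  also have "?b powr \<sigma> = ?b powr s * (\<alpha> 0 powr \<theta> * 2 powr (- 4 * real j))"
  proof -
    have "?b powr \<sigma> = ?b powr s * ?b powr \<theta>" by (simp add: powr_add[symmetric] \<theta>_def)
    also have "?b powr \<theta> = \<alpha> 0 powr \<theta> * 2 powr (- 4 * real j)"
      using \<theta> assms(1) by (simp add: powr_mult powr_powr)
    finally show ?thesis .
  qed
  also have "2 powr (- 4 * real j) = 1 / 16 ^ j"
  proof -
    have "2 powr (- 4 * real j) = inverse (2 powr (4 * real j))" by (simp add: powr_minus)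
    also have "2 powr (4 * real j) = (2 :: real) powr real (4 * j)" by simp
    also have "\<dots> = 2 ^ (4 * j)" by (rule powr_realpow) simp
    also have "\<dots> = 16 ^ j" by (simp add: power_mult)
    finally show ?thesis by (simp add: divide_inverse)
  qed
  also have "D * 16 ^ j * (?b powr s * (\<alpha> 0 powr \<theta> * (1 / 16 ^ j))) = (D * \<alpha> 0 powr \<theta>) * ?b powr s"
    by simp
  also have "\<dots> \<le> 2 powr (- 4 * s / \<theta>) * ?b powr s"
    using small by (intro mult_right_mono) (auto simp: \<theta>_def)
  also have "\<dots> = (\<alpha> 0 * 2 powr (- 4 * real (Suc j) / \<theta>)) powr s"
    using \<theta> assms(1) by (simp add: powr_mult powr_powr powr_add[symmetric] field_simps add_divide_distrib)
  finally have "(\<alpha> (Suc j) powr s) powr (1 / s) \<le> ((\<alpha> 0 * 2 powr (- 4 * real (Suc j) / \<theta>)) powr s) powr (1 / s)"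
    by (rule powr_mono2[rotated 2]) (use assms(2) in auto)
  then show ?case using assms(1)[of 0] assms(1)[of "Suc j"] assms(2) by (simp add: powr_powr \<theta>_def)
qed simp

text \<open>Boxes shrink from radius r1 to r1/2 while levels rise from l/2 to l. If v y > l, then y
  belongs to every level set, so the densities stay above 1/V, against their decay. S bounds v on
  the box enlarged by one because edges at the rim of the cut-off stick out by one.\<close>

lemma de_giorgi:
  fixes y :: "int ^ 'd" and W' :: "(int ^ 'd) set"
  assumes net: "network W' A"
    and U: "finite U"
    and sob: "\<And>f t. (\<And>b. b \<notin> U \<Longrightarrow> f b = 0) \<Longrightarrow> (\<And>b. 0 \<le> f b) \<Longrightarrow> 0 < t \<Longrightarrow>
      t\<^sup>2 * (real (card {b \<in> U. t \<le> f b}) / V) powr s \<le> Bs * network.energy W' A f"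
    and mu: "\<And>G. G \<subseteq> U \<Longrightarrow> (\<Sum>z\<in>G. \<Sum>w\<in>W'. A z w) \<le> Km * V * (real (card G) / V) powr \<sigma>"
    and v0: "\<And>z. 0 \<le> v z" and vU: "\<And>z. v z \<noteq> 0 \<Longrightarrow> z \<in> Q y r1 \<Longrightarrow> z \<in> U"
    and vS: "\<And>z. z \<in> Q y (r1 + 1) \<Longrightarrow> v z \<le> S"
    and edge: "\<And>z w. 0 < A z w \<Longrightarrow> linfnorm (z - w) \<le> 1"
    and cacc: "\<And>\<eta> l. 0 \<le> l \<Longrightarrow> (\<And>z. \<eta> z \<noteq> 0 \<Longrightarrow> z \<in> Q y r1) \<Longrightarrow>
      network.energy W' A (\<lambda>z. \<eta> z * max (v z - l) 0)
        \<le> (\<Sum>z\<in>W'. \<Sum>w\<in>W'. A z w * (max (v z - l) 0 * max (v w - l) 0 * (\<eta> z - \<eta> w)\<^sup>2))"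
    and "0 < s" "s < \<sigma>" and l: "0 < l" and r1: "0 < r1" and V: "0 < V" and nn: "0 \<le> Bs" "0 \<le> Km"
    and small: "512 * Bs * Km * V * (S / (r1 * l))\<^sup>2 * (real (card {b \<in> U. b \<in> Q y r1 \<and> l / 2 \<le> v b}) / V) powr (\<sigma> - s)
      \<le> 2 powr (- 4 * s / (\<sigma> - s))"
  shows "v y \<le> l"
proof (rule ccontr)
  assume neg: "\<not> v y \<le> l"
  interpret N: network W' A by (rule net)
  define r where "r j = r1 / 2 * (1 + (1/2) ^ j)" for j :: nat
  define L where "L j = l * (1 - (1/2) ^ Suc j)" for j :: nat
  define G where "G j = {b \<in> U. b \<in> Q y (r j) \<and> L j \<le> v b}" for j
  define \<alpha> where "\<alpha> j = real (card (G j)) / V" for j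
  have S: "0 \<le> S" using vS[of y] v0[of y] r1 by force
  have half: "(1/2 :: real) ^ j \<le> 1" for j by (rule power_le_one) auto
  have L0: "0 \<le> L j" for j
    using l half[of "Suc j"] unfolding L_def by (intro mult_nonneg_nonneg) auto
  have rr1: "r j \<le> r1" for j
  proof -
    have "(1/2 :: real) ^ j \<le> 1" by (rule power_le_one) auto
    then show ?thesis using r1 by (simp add: r_def field_simps)
  qed
  have r0: "0 < r j" for j using r1 by (auto simp: r_def intro!: mult_pos_pos add_pos_pos)
  have rec: "\<alpha> (Suc j) powr s \<le> (512 * Bs * Km * V * (S / (r1 * l))\<^sup>2) * 16 ^ j * \<alpha> j powr \<sigma>" for j
  proof -
    define h where "h = (1/2 :: real) ^ (j + 2)"
    define \<delta> where "\<delta> = r1 * h"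
    define t where "t = l * h"
    have h: "0 < h" by (simp add: h_def)
    have \<delta>: "0 < \<delta>" "r j - r (Suc j) = \<delta>" using h r1 by (auto simp: \<delta>_def r_def h_def field_simps)
    have t: "0 < t" "L (Suc j) - L j = t" using h l by (auto simp: t_def L_def h_def field_simps)
    define \<eta> where "\<eta> z = max 0 (min 1 ((r j - real_of_int (linfnorm (z - y))) / \<delta>))" for z
    have \<eta>_supp: "z \<in> Q y (r j)" if "\<eta> z \<noteq> 0" for z
    proof (rule ccontr)
      assume "z \<notin> Q y (r j)"
      then have "(r j - real_of_int (linfnorm (z - y))) / \<delta> \<le> 0" using \<delta> by (auto simp: Q_iff divide_nonpos_pos)
      then show False using that by (auto simp: \<eta>_def)
    qed
    have \<eta>_1: "\<eta> z = 1" if "z \<in> Q y (r (Suc j))" for z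
      using that \<delta> by (auto simp: \<eta>_def Q_iff min_def field_simps)
    have \<eta>_nn: "0 \<le> \<eta> z" for z by (simp add: \<eta>_def)
    have lip: "(\<eta> z - \<eta> w)\<^sup>2 \<le> 1 / \<delta>\<^sup>2" if "linfnorm (z - w) \<le> 1" for z w
    proof -
      have "\<bar>linfnorm (z - y) - linfnorm (w - y)\<bar> \<le> 1"
        using linfnorm_triangle_diff[of z y w] linfnorm_triangle_diff[of w y z] linfnorm_minus_commute[of z w] that by linarith
      then have "\<bar>real_of_int (linfnorm (z - y)) - real_of_int (linfnorm (w - y))\<bar> \<le> 1" by linarith
      then have "\<bar>(r j - real_of_int (linfnorm (z - y))) / \<delta> - (r j - real_of_int (linfnorm (w - y))) / \<delta>\<bar> \<le> 1 / \<delta>"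
        using \<delta> by (simp add: diff_divide_distrib[symmetric] divide_right_mono abs_divide abs_minus_commute)
      then have "\<bar>\<eta> z - \<eta> w\<bar> \<le> 1 / \<delta>" unfolding \<eta>_def by linarith
      then have "\<bar>\<eta> z - \<eta> w\<bar>\<^sup>2 \<le> (1 / \<delta>)\<^sup>2" by (intro power_mono) auto
      then show ?thesis by (simp add: power_divide)
    qed
    define w where "w z = max (v z - L j) 0" for z
    have w0: "0 \<le> w z" for z by (simp add: w_def)
    have wS: "w z \<le> S" if "z \<in> Q y (r1 + 1)" for z using vS[OF that] L0[of j] S by (simp add: w_def)
    have wG: "z \<in> G j" if "w z \<noteq> 0" "z \<in> Q y (r j)" for z
    proof -
      have "L j < v z" using that by (auto simp: w_def max_def split: if_splits)
      moreover have "z \<in> Q y r1" using that rr1 Q_mono by blast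
      ultimately show ?thesis using that vU[of z] L0[of j] by (auto simp: G_def)
    qed
    have "t\<^sup>2 * \<alpha> (Suc j) powr s \<le> t\<^sup>2 * (real (card {b \<in> U. t \<le> \<eta> b * w b}) / V) powr s"
    proof -
      have "G (Suc j) \<subseteq> {b \<in> U. t \<le> \<eta> b * w b}" using t by (auto simp: G_def \<eta>_1 w_def)
      then have "card (G (Suc j)) \<le> card {b \<in> U. t \<le> \<eta> b * w b}" using U by (intro card_mono) auto
      then show ?thesis using V \<open>0 < s\<close> unfolding \<alpha>_def
        by (intro mult_left_mono powr_mono2 divide_right_mono) auto
    qed
    also have "\<dots> \<le> Bs * N.energy (\<lambda>z. \<eta> z * w z)"
    proof (rule sob)
      show "\<eta> b * w b = 0" if "b \<notin> U" for b using that wG[of b] \<eta>_supp[of b] by (auto simp: G_def)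
    qed (use t \<eta>_nn w0 in auto)
    also have "\<dots> \<le> Bs * (\<Sum>z\<in>W'. \<Sum>x\<in>W'. A z x * (w z * w x * (\<eta> z - \<eta> x)\<^sup>2))"
      unfolding w_def using nn L0 \<eta>_supp rr1 Q_mono by (intro mult_left_mono cacc) blast+
    also have "\<dots> \<le> Bs * (\<Sum>z\<in>W'. \<Sum>x\<in>W'. A z x * (S\<^sup>2 / \<delta>\<^sup>2) * (of_bool (z \<in> G j) + of_bool (x \<in> G j)))"
    proof (intro mult_left_mono sum_mono nn)
      fix z x
      show "A z x * (w z * w x * (\<eta> z - \<eta> x)\<^sup>2) \<le> A z x * (S\<^sup>2 / \<delta>\<^sup>2) * (of_bool (z \<in> G j) + of_bool (x \<in> G j))"
      proof (cases "A z x = 0 \<or> w z = 0 \<or> w x = 0 \<or> \<eta> z = \<eta> x")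
        case True
        then show ?thesis using N.a_nonneg[of z x] by auto
      next
        case False
        then have Apos: "0 < A z x" using N.a_nonneg[of z x] by simp
        note e = edge[OF Apos]
        have "\<eta> z \<noteq> 0 \<or> \<eta> x \<noteq> 0" using False by auto
        then have in1: "z \<in> Q y (r j) \<or> x \<in> Q y (r j)" using \<eta>_supp by blast
        then have G1: "z \<in> G j \<or> x \<in> G j" using wG False by blast
        have "z \<in> Q y (r j + 1)" "x \<in> Q y (r j + 1)"
          using in1 Q_trans[of z y "r j" x 1] Q_trans[of x y "r j" z 1] e Q_mono[of "r j" "r j + 1" y]
          by (auto simp: Q_iff linfnorm_minus_commute[of x z])
        then have "w z \<le> S" "w x \<le> S" using wS rr1[of j] Q_mono[of "r j + 1" "r1 + 1" y] by auto
        then have "w z * w x * (\<eta> z - \<eta> x)\<^sup>2 \<le> S * S * (1 / \<delta>\<^sup>2)"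
          using w0 S lip[OF e] by (intro mult_mono) auto
        then have "A z x * (w z * w x * (\<eta> z - \<eta> x)\<^sup>2) \<le> A z x * (S\<^sup>2 / \<delta>\<^sup>2)"
          using Apos by (intro mult_left_mono) (auto simp: power2_eq_square)
        also have "\<dots> \<le> A z x * (S\<^sup>2 / \<delta>\<^sup>2) * (of_bool (z \<in> G j) + of_bool (x \<in> G j))"
          using G1 Apos by (intro mult_le_cancel_left1[THEN iffD2]) (auto simp: not_less divide_nonneg_nonneg)
        finally show ?thesis .
      qed
    qed
    also have "(\<Sum>z\<in>W'. \<Sum>x\<in>W'. A z x * (S\<^sup>2 / \<delta>\<^sup>2) * (of_bool (z \<in> G j) + of_bool (x \<in> G j)))
       = (S\<^sup>2 / \<delta>\<^sup>2) * (2 * (\<Sum>z\<in>W'. \<Sum>x\<in>W'. A z x * of_bool (z \<in> G j)))"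
    proof -
      have *: "(\<Sum>z\<in>W'. \<Sum>x\<in>W'. A z x * of_bool (x \<in> G j)) = (\<Sum>z\<in>W'. \<Sum>x\<in>W'. A z x * of_bool (z \<in> G j))"
        by (subst sum.swap) (simp add: N.a_sym)
      have **: "(\<Sum>z\<in>W'. \<Sum>x\<in>W'. A z x * c * (of_bool (z \<in> G j) + of_bool (x \<in> G j)))
          = c * (\<Sum>z\<in>W'. \<Sum>x\<in>W'. A z x * of_bool (z \<in> G j)) + c * (\<Sum>z\<in>W'. \<Sum>x\<in>W'. A z x * of_bool (x \<in> G j))" for c
        unfolding sum_distrib_left sum.distrib[symmetric] by (intro sum.cong refl) (simp add: algebra_simps)
      show ?thesis unfolding ** * by simp
    qed
    also have "Bs * ((S\<^sup>2 / \<delta>\<^sup>2) * (2 * (\<Sum>z\<in>W'. \<Sum>x\<in>W'. A z x * of_bool (z \<in> G j)))) \<le> Bs * ((S\<^sup>2 / \<delta>\<^sup>2) * (2 * (Km * V * \<alpha> j powr \<sigma>)))"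
    proof (intro mult_left_mono nn)
      have "(\<Sum>z\<in>W'. \<Sum>x\<in>W'. A z x * of_bool (z \<in> G j)) = (\<Sum>z\<in>W' \<inter> G j. \<Sum>x\<in>W'. A z x)"
        using N.finite_W by (subst sum.inter_restrict) (auto intro!: sum.cong)
      also have "\<dots> \<le> (\<Sum>z\<in>G j. \<Sum>x\<in>W'. A z x)"
        using U by (intro sum_mono2) (auto simp: G_def intro!: sum_nonneg N.a_nonneg)
      also have "(\<Sum>z\<in>G j. \<Sum>x\<in>W'. A z x) \<le> Km * V * \<alpha> j powr \<sigma>"
        unfolding \<alpha>_def by (rule mu) (auto simp: G_def)
      finally show "(\<Sum>z\<in>W'. \<Sum>x\<in>W'. A z x * of_bool (z \<in> G j)) \<le> Km * V * \<alpha> j powr \<sigma>" .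
    qed auto
    finally have "t\<^sup>2 * \<alpha> (Suc j) powr s \<le> Bs * ((S\<^sup>2 / \<delta>\<^sup>2) * (2 * (Km * V * \<alpha> j powr \<sigma>)))"
      .
    then have "\<alpha> (Suc j) powr s \<le> Bs * ((S\<^sup>2 / \<delta>\<^sup>2) * (2 * (Km * V * \<alpha> j powr \<sigma>))) / t\<^sup>2"
      using t(1) by (subst pos_le_divide_eq) (auto simp: mult.commute)
    also have "\<dots> = (2 * Bs * Km * V * (S / (r1 * l))\<^sup>2) * (1 / h ^ 4) * \<alpha> j powr \<sigma>"
      using h r1 l by (simp add: \<delta>_def t_def field_simps power2_eq_square power4_eq_xxxx)
    \<comment> \<open>Both \<delta>^2 and t^2 carry h^2 with h = 2^-(j+2); the 2 from the two
      indicator sums makes 512 out of 256.\<close>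
    also have "1 / h ^ 4 = 256 * 16 ^ j"
      by (simp add: h_def power_mult[symmetric] power_divide power_add) (simp add: power_mult mult.commute[of j])
    finally show ?thesis by (simp add: mult_ac)
  qed
  have \<alpha>_nn: "0 \<le> \<alpha> j" for j using V by (simp add: \<alpha>_def)
  have G0: "G 0 = {b \<in> U. b \<in> Q y r1 \<and> l / 2 \<le> v b}" by (simp add: G_def r_def L_def)
  have dec: "\<alpha> j \<le> \<alpha> 0 * 2 powr (- 4 * real j / (\<sigma> - s))" for j
    by (rule fast_recursion_decay[OF \<alpha>_nn _ _ _ rec]) (use assms G0 in \<open>auto simp: \<alpha>_def\<close>)
  have "1 / V \<le> \<alpha> j" for j
  proof -
    have "y \<in> G j"
    proof -
      have "L j \<le> l" using l by (simp add: L_def field_simps)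
      moreover have "y \<in> U" using vU[of y] neg l r1 by auto
      ultimately show ?thesis using neg r0[of j] by (auto simp: G_def)
    qed
    moreover have "finite (G j)" using U by (simp add: G_def)
    ultimately have "card (G j) \<noteq> 0" by auto
    then show ?thesis using V by (simp add: \<alpha>_def divide_right_mono)
  qed
  then have *: "1 / V \<le> \<alpha> 0 * 2 powr (- 4 * real j / (\<sigma> - s))" for j using dec order_trans by blast
  have "(\<lambda>j. \<alpha> 0 * 2 powr (- 4 * real j / (\<sigma> - s))) \<longlonglongrightarrow> \<alpha> 0 * 0"
  proof (intro tendsto_mult tendsto_const)
    have "(\<lambda>j. 2 powr (- 4 * real j / (\<sigma> - s))) = (\<lambda>j. (2 powr (- 4 / (\<sigma> - s))) ^ j)"
      by (auto simp: powr_power mult.commute)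
    moreover have "(\<lambda>j. (2 powr (- 4 / (\<sigma> - s))) ^ j) \<longlonglongrightarrow> (0 :: real)"
      using \<open>s < \<sigma>\<close> by (intro LIMSEQ_power_zero) (auto simp: powr_less_one divide_neg_pos)
    ultimately show "(\<lambda>j. 2 powr (- 4 * real j / (\<sigma> - s))) \<longlonglongrightarrow> 0" by simp
  qed
  then have "1 / V \<le> \<alpha> 0 * 0" by (rule LIMSEQ_le_const) (use * in auto)
  then show False using V by simp
qed


text \<open>The constant is explicit so that it is visibly independent of the environment. The
  exponent of the boundary weight must dominate two powers of R: d / b when the maximum sits near
  the boundary, and 2 / (b (\<sigma> - s)) from the gradient of the cut-off in the interior.\<close>

definition lmp_const :: "real \<Rightarrow> real \<Rightarrow> real \<Rightarrow> real \<Rightarrow> real \<Rightarrow> real \<Rightarrow> real" where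
  "lmp_const Cb Cr d s \<sigma> b = (let \<gamma> = max (2 / (b * (\<sigma> - s))) (d / b) in
     (4 powr \<gamma> + 4 * (64 * Cb * 4 powr \<gamma> / 2 powr (- 4 * s / (\<sigma> - s))) powr (1 / (b * (\<sigma> - s)))) * Cr powr \<gamma>)"

lemma lmp_const_nonneg: "0 \<le> lmp_const Cb Cr d s \<sigma> b"
  by (simp add: lmp_const_def Let_def)

text \<open>The maximum of \<open>v\<close> weighted by a power of the distance to the boundary of the box
  turns the supremum \<open>S\<close> in \<open>de_giorgi\<close> into a multiple of the value at the maximal point.\<close>

lemma local_maximum_principle:
  fixes y :: "int ^ 'd" and W' :: "(int ^ 'd) set"
  assumes net: "network W' A"
    and U: "finite U"
    and sob: "\<And>f t. (\<And>b. b \<notin> U \<Longrightarrow> f b = 0) \<Longrightarrow> (\<And>b. 0 \<le> f b) \<Longrightarrow> 0 < t \<Longrightarrow>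
      t\<^sup>2 * (real (card {b \<in> U. t \<le> f b}) / R ^ CARD('d)) powr s \<le> Bs * network.energy W' A f"
    and mu: "\<And>G. G \<subseteq> U \<Longrightarrow> (\<Sum>z\<in>G. \<Sum>w\<in>W'. A z w) \<le> Km * R ^ CARD('d) * (real (card G) / R ^ CARD('d)) powr \<sigma>"
    and v0: "\<And>z. 0 \<le> v z" and vU: "\<And>z. v z \<noteq> 0 \<Longrightarrow> z \<in> Q y \<rho> \<Longrightarrow> z \<in> U"
    and edge: "\<And>z w. 0 < A z w \<Longrightarrow> linfnorm (z - w) \<le> 1"
    and cacc: "\<And>\<eta> l. 0 \<le> l \<Longrightarrow> (\<And>z. \<eta> z \<noteq> 0 \<Longrightarrow> z \<in> Q y \<rho>) \<Longrightarrow>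
      network.energy W' A (\<lambda>z. \<eta> z * max (v z - l) 0)
        \<le> (\<Sum>z\<in>W'. \<Sum>w\<in>W'. A z w * (max (v z - l) 0 * max (v w - l) 0 * (\<eta> z - \<eta> w)\<^sup>2))"
    and tail: "\<And>t. 0 < t \<Longrightarrow> real (card {b \<in> U. b \<in> Q y \<rho> \<and> t \<le> v b}) \<le> R ^ CARD('d) * (T / t) powr b"
    and s: "0 < s" "s < \<sigma>" and b: "0 < b" and T: "0 \<le> T" and \<rho>: "0 \<le> \<rho>"
    and R: "\<rho> + 1 \<le> R" "R \<le> Cr * (\<rho> + 1)" and nn: "0 \<le> Bs" "0 \<le> Km"
    and Cb: "512 * Bs * Km * R ^ CARD('d) \<le> Cb * R\<^sup>2"
  shows "v y \<le> lmp_const Cb Cr CARD('d) s \<sigma> b * T"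
proof -
  define \<theta> where "\<theta> = \<sigma> - s"
  define \<gamma> where "\<gamma> = max (2 / (b * \<theta>)) (real CARD('d) / b)"
  define \<epsilon> where "\<epsilon> = 2 powr (- 4 * s / \<theta>)"
  define E where "E = 64 * Cb * 4 powr \<gamma> / \<epsilon>"
  define e1 where "e1 = 1 / (b * \<theta>)"
  define C1 where "C1 = 4 powr \<gamma> + 4 * E powr e1"
  define V where "V = R ^ CARD('d)"
  have \<theta>: "0 < \<theta>" using s by (simp add: \<theta>_def)
  have \<epsilon>: "0 < \<epsilon>" by (simp add: \<epsilon>_def)
  have \<gamma>: "2 / (b * \<theta>) \<le> \<gamma>" "CARD('d) / b \<le> \<gamma>" "0 \<le> \<gamma>" using b by (auto simp: \<gamma>_def le_max_iff_disj)
  have R1: "1 \<le> R" using R \<rho> by linarith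
  have V1: "0 < V" using R1 by (simp add: V_def)
  have "0 \<le> Cb * R\<^sup>2" using nn R1 by (intro order_trans[OF _ Cb]) auto
  then have Cb0: "0 \<le> Cb" using R1 by (simp add: zero_le_mult_iff)
  \<comment> \<open>The distance to the boundary plus one, so that the weight is at least 1 on the
    whole box.\<close>
  define dd where "dd z = \<rho> + 1 - real_of_int (linfnorm (z - y))" for z
  have dd1: "1 \<le> dd z" if "z \<in> Q y \<rho>" for z using that by (simp add: dd_def Q_iff)
  define \<Phi> where "\<Phi> z = dd z powr \<gamma> * v z" for z
  have "Max (\<Phi> ` Q y \<rho>) \<in> \<Phi> ` Q y \<rho>" using \<rho> by (intro Max_in) (auto intro!: exI[of _ y] simp flip: ex_in_conv)
  then obtain z0 where z0: "z0 \<in> Q y \<rho>" "\<Phi> z0 = Max (\<Phi> ` Q y \<rho>)" by auto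
  then have z0max: "\<Phi> z \<le> \<Phi> z0" if "z \<in> Q y \<rho>" for z using that by simp
  define d0 where "d0 = dd z0"
  have "0 \<le> real_of_int (linfnorm (z0 - y))" by simp
  then have d0: "1 \<le> d0" "d0 \<le> R"
    using dd1[OF z0(1)] R(1) unfolding d0_def dd_def by linarith+
  have claim: "\<Phi> z0 \<le> C1 * T * R powr \<gamma>"
  proof (cases "v z0 = 0")
    case True
    then show ?thesis using T by (simp add: \<Phi>_def C1_def)
  next
    case False
    then have vz: "0 < v z0" using v0[of z0] by simp
    have z0U: "z0 \<in> U" using vU False z0 by auto
    show ?thesis
    \<comment> \<open>Near the boundary there is no room for a smaller box, but the tail bound is
      enough: the level set at height \<open>v z0\<close> contains \<open>z0\<close>, so its
      cardinality is at least 1.\<close>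
    proof (cases "d0 < 4")
      case True
      have "{b \<in> U. b \<in> Q y \<rho> \<and> v z0 \<le> v b} \<noteq> {}" using z0U z0 by auto
      then have "1 \<le> real (card {b \<in> U. b \<in> Q y \<rho> \<and> v z0 \<le> v b})"
        using U by (simp add: Suc_le_eq card_gt_0_iff)
      also have "\<dots> \<le> R ^ CARD('d) * (T / v z0) powr b" using vz by (rule tail)
      finally have "1 \<le> (R ^ CARD('d) * (T / v z0) powr b) powr (1 / b)"
        using b by (intro ge_one_powr_ge_zero) auto
      also have "\<dots> = R powr (CARD('d) / b) * (T / v z0)"
        using b R1 T vz by (simp add: powr_mult powr_powr powr_realpow[symmetric])
      finally have "v z0 \<le> R powr (CARD('d) / b) * T" using vz by (simp add: field_simps)
      also have "\<dots> \<le> R powr \<gamma> * T" using R1 T \<gamma> by (intro mult_right_mono powr_mono) auto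
      finally have "v z0 \<le> R powr \<gamma> * T" .
      moreover have "d0 powr \<gamma> \<le> 4 powr \<gamma>" using True d0 \<gamma> by (intro powr_mono2) auto
      ultimately have "d0 powr \<gamma> * v z0 \<le> 4 powr \<gamma> * (R powr \<gamma> * T)" using vz by (intro mult_mono) auto
      also have "\<dots> \<le> C1 * T * R powr \<gamma>" using T by (simp add: C1_def algebra_simps)
      finally show ?thesis by (simp add: \<Phi>_def d0_def)
    next
      case False
      \<comment> \<open>Half the distance to the boundary, less one: even the box enlarged by one
        keeps distance at least d0 / 2 in the sense of \<open>dd\<close>, and maximality of \<Phi>
        bounds v there by 2^\<gamma> times \<open>v z0\<close>.\<close>
      define r1 where "r1 = d0 / 2 - 1"
      have r1: "d0 / 4 \<le> r1" "0 < r1" using False by (auto simp: r1_def)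
      define S where "S = 2 powr \<gamma> * v z0"
      define l where "l = v z0 / 2"
      have tri: "real_of_int (linfnorm (z - y)) \<le> real_of_int (linfnorm (z - z0)) + real_of_int (linfnorm (z0 - y))" for z
        using linfnorm_triangle_diff[of z y z0] by (metis of_int_add of_int_le_iff)
      have sub: "Q z0 r1 \<subseteq> Q y \<rho>"
      proof
        fix z assume "z \<in> Q z0 r1"
        then show "z \<in> Q y \<rho>" using tri[of z] False
          unfolding Q_iff r1_def d0_def dd_def by (simp add: field_simps)
      qed
      have sub1: "z \<in> Q y \<rho> \<and> v z \<le> S" if z: "z \<in> Q z0 (r1 + 1)" for z
      proof -
        have dz: "d0 / 2 \<le> dd z"
          using z tri[of z] unfolding Q_iff r1_def d0_def dd_def by (simp add: field_simps)
        then have zQ: "z \<in> Q y \<rho>" using False by (auto simp: Q_iff dd_def)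
        have "(d0 / 2) powr \<gamma> * v z \<le> dd z powr \<gamma> * v z"
          using dz d0 \<gamma> v0[of z] by (intro mult_right_mono powr_mono2) auto
        also have "\<dots> \<le> d0 powr \<gamma> * v z0" using z0max[OF zQ] by (simp add: \<Phi>_def d0_def)
        finally have "v z \<le> 2 powr \<gamma> * v z0" using d0 by (simp add: powr_divide field_simps)
        then show ?thesis using zQ by (simp add: S_def)
      qed
      define \<alpha>0 where "\<alpha>0 = real (card {b \<in> U. b \<in> Q z0 r1 \<and> l / 2 \<le> v b}) / V"
      \<comment> \<open>For l half of \<open>v z0\<close> the conclusion of \<open>de_giorgi\<close>
        is absurd. So its smallness condition fails, and this failure is an upper bound for
        \<open>v z0\<close>.\<close>
      have "\<not> (512 * Bs * Km * V * (S / (r1 * l))\<^sup>2 * \<alpha>0 powr (\<sigma> - s) \<le> 2 powr (- 4 * s / (\<sigma> - s)))"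
      proof
        assume small: "512 * Bs * Km * V * (S / (r1 * l))\<^sup>2 * \<alpha>0 powr (\<sigma> - s) \<le> 2 powr (- 4 * s / (\<sigma> - s))"
        have "v z0 \<le> l"
        proof (rule de_giorgi[OF net U])
          show "t\<^sup>2 * (real (card {b \<in> U. t \<le> f b}) / V) powr s \<le> Bs * network.energy W' A f"
            if "\<And>b. b \<notin> U \<Longrightarrow> f b = 0" "\<And>b. 0 \<le> f b" "0 < t" for f t
            unfolding V_def by (rule sob[OF that])
          show "(\<Sum>z\<in>G. \<Sum>w\<in>W'. A z w) \<le> Km * V * (real (card G) / V) powr \<sigma>" if "G \<subseteq> U" for G
            unfolding V_def by (rule mu[OF that])
          show "z \<in> U" if "v z \<noteq> 0" "z \<in> Q z0 r1" for z using vU[OF that(1)] sub that(2) by blast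
          show "v z \<le> S" if "z \<in> Q z0 (r1 + 1)" for z using sub1[OF that] by blast
          show "network.energy W' A (\<lambda>z. \<eta> z * max (v z - l) 0)
            \<le> (\<Sum>z\<in>W'. \<Sum>w\<in>W'. A z w * (max (v z - l) 0 * max (v w - l) 0 * (\<eta> z - \<eta> w)\<^sup>2))"
            if "0 \<le> l" "\<And>z. \<eta> z \<noteq> 0 \<Longrightarrow> z \<in> Q z0 r1" for \<eta> l
            using that sub by (intro cacc) blast+
          show "512 * Bs * Km * V * (S / (r1 * l))\<^sup>2 * (real (card {b \<in> U. b \<in> Q z0 r1 \<and> l / 2 \<le> v b}) / V) powr (\<sigma> - s)
            \<le> 2 powr (- 4 * s / (\<sigma> - s))" using small by (simp only: \<alpha>0_def)
        qed (use v0 edge s vz r1 V1 nn in \<open>auto simp: l_def\<close>)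
        then show False using vz by (simp add: l_def)
      qed
      then have "\<epsilon> < 512 * Bs * Km * V * (S / (r1 * l))\<^sup>2 * \<alpha>0 powr \<theta>" by (simp add: \<epsilon>_def \<theta>_def)
      also have "\<dots> \<le> (Cb * R\<^sup>2) * (16 * 2 powr \<gamma> / d0)\<^sup>2 / 4 * 1 * ((4 * T / v z0) powr b) powr \<theta>"
      proof -
        have "S / (r1 * l) = 2 * 2 powr \<gamma> / r1" using vz by (simp add: S_def l_def)
        also have "\<dots> \<le> 2 * 2 powr \<gamma> / (d0 / 4)" using r1 d0 by (intro divide_left_mono) auto
        finally have "S / (r1 * l) \<le> 8 * 2 powr \<gamma> / d0" by simp
        then have "(S / (r1 * l))\<^sup>2 \<le> (8 * 2 powr \<gamma> / d0)\<^sup>2"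
          using vz r1 by (intro power_mono) (auto simp: S_def l_def)
        also have "\<dots> = (16 * 2 powr \<gamma> / d0)\<^sup>2 / 4" by (simp add: power_divide power_mult_distrib)
        finally have 1: "(S / (r1 * l))\<^sup>2 \<le> \<dots>" .
        have "card {b \<in> U. b \<in> Q z0 r1 \<and> l / 2 \<le> v b} \<le> card {b \<in> U. b \<in> Q y \<rho> \<and> v z0 / 4 \<le> v b}"
          using U sub by (intro card_mono) (auto simp: l_def)
        also have "real (card {b \<in> U. b \<in> Q y \<rho> \<and> v z0 / 4 \<le> v b}) \<le> V * (T / (v z0 / 4)) powr b"
          unfolding V_def using vz by (intro tail) auto
        finally have "\<alpha>0 \<le> (4 * T / v z0) powr b" using V1 by (simp add: \<alpha>0_def field_simps)
        then have 2: "\<alpha>0 powr \<theta> \<le> ((4 * T / v z0) powr b) powr \<theta>"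
          using \<theta> V1 by (intro powr_mono2) (auto simp: \<alpha>0_def)
        show ?thesis
          using mult_mono[OF mult_mono[OF Cb 1] 2] Cb0 by (simp add: V_def)
      qed
      also have "\<dots> = (64 * Cb * 4 powr \<gamma>) * (R / d0)\<^sup>2 * (4 * T / v z0) powr (b * \<theta>)"
        by (simp add: power_divide power_mult_distrib powr_powr power2_eq_square[of "2 powr \<gamma>"] powr_mult[symmetric] mult_ac)
      finally have "\<epsilon> / \<epsilon> < (64 * Cb * 4 powr \<gamma>) * (R / d0)\<^sup>2 * (4 * T / v z0) powr (b * \<theta>) / \<epsilon>"
        using \<epsilon> by (intro divide_strict_right_mono)
      then have "1 < E * (R / d0)\<^sup>2 * (4 * T / v z0) powr (b * \<theta>)"
        using \<epsilon> by (simp add: E_def)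
      then have "1 powr e1 \<le> (E * (R / d0)\<^sup>2 * (4 * T / v z0) powr (b * \<theta>)) powr e1"
        using b \<theta> by (intro powr_mono2) (auto simp: e1_def)
      also have "\<dots> = E powr e1 * (R / d0) powr (2 / (b * \<theta>)) * (4 * T / v z0)"
      proof -
        have "0 \<le> E" using Cb0 \<epsilon> by (simp add: E_def)
        moreover have "((R / d0)\<^sup>2) powr e1 = (R / d0) powr (2 / (b * \<theta>))"
        proof -
          have "(R / d0)\<^sup>2 = (R / d0) powr 2" using R1 d0 by simp
          then show ?thesis by (simp only: powr_powr) (simp add: e1_def)
        qed
        moreover have "((4 * T / v z0) powr (b * \<theta>)) powr e1 = 4 * T / v z0"
          using b \<theta> T vz by (simp add: powr_powr e1_def)
        ultimately show ?thesis using T vz by (simp add: powr_mult)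
      qed
      finally have "v z0 \<le> E powr e1 * (R / d0) powr (2 / (b * \<theta>)) * (4 * T)"
        using vz by (simp add: field_simps)
      also have "\<dots> \<le> E powr e1 * (R / d0) powr \<gamma> * (4 * T)"
        using T d0 \<gamma> by (intro mult_right_mono mult_left_mono powr_mono) auto
      finally have "d0 powr \<gamma> * v z0 \<le> d0 powr \<gamma> * (E powr e1 * (R / d0) powr \<gamma> * (4 * T))"
        by (intro mult_left_mono) auto
      also have "\<dots> = 4 * E powr e1 * T * R powr \<gamma>" using d0 R1 by (simp add: powr_divide)
      also have "\<dots> \<le> C1 * T * R powr \<gamma>" using T by (simp add: C1_def algebra_simps)
      finally show ?thesis by (simp add: \<Phi>_def d0_def)
    qed
  qed
  have "(\<rho> + 1) powr \<gamma> * v y \<le> C1 * T * R powr \<gamma>"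
    using z0max[of y] claim \<rho> by (simp add: \<Phi>_def dd_def)
  then have "v y \<le> C1 * T * (R / (\<rho> + 1)) powr \<gamma>"
    using \<rho> R1 by (simp add: powr_divide field_simps)
  also have "\<dots> \<le> C1 * T * Cr powr \<gamma>"
    using \<rho> R R1 T \<gamma> by (intro mult_left_mono powr_mono2) (auto simp: C1_def field_simps)
  also have "C1 * T * Cr powr \<gamma> = lmp_const Cb Cr CARD('d) s \<sigma> b * T"
    by (simp add: lmp_const_def Let_def C1_def \<gamma>_def E_def \<epsilon>_def e1_def \<theta>_def)
  finally show ?thesis .
qed


section \<open>Decay of killed subsolutions\<close>

definition sobolev_const :: "real \<Rightarrow> real \<Rightarrow> real \<Rightarrow> real" where
  "sobolev_const d c s = 2048 * d\<^sup>2 * c\<^sup>2 * 16 powr (1 / s)"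

text \<open>The properties of one configuration, seen from one point x, that force the decay;
  nothing random remains. Increments of the potential are bounded by 1 because
  \<open>exp_diff_squared_le\<close> linearises exponentials only in that range.\<close>

locale good_environment =
  fixes A :: "int ^ 'd::finite \<Rightarrow> int ^ 'd \<Rightarrow> real" and \<kappa> :: "int ^ 'd \<Rightarrow> real" and C :: "(int ^ 'd) set"
    and T :: "int ^ 'd \<Rightarrow> real" and \<pi> :: "int ^ 'd \<Rightarrow> int ^ 'd" and B Z :: "int ^ 'd \<Rightarrow> (int ^ 'd) set"
    and x :: "int ^ 'd" and c R0 m p q s cpsi d :: real
  assumes d_eq: "d = real CARD('d)" and A_sym: "A z w = A w z" and A_nonneg: "0 \<le> A z w"
    and A_edge: "0 < A z w \<Longrightarrow> linfnorm (z - w) \<le> 1"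
    and A_closed: "z \<in> C \<Longrightarrow> 0 < A z w \<Longrightarrow> w \<in> C"
    and \<kappa>_pos: "0 < \<kappa> z"
    and proj: "z \<in> C \<Longrightarrow> \<pi> z = z"
    and proj_in: "\<pi> z \<in> B z"
    and path: "(\<pi> z, \<pi> (z + axis i 1)) \<in> {(v, w). v \<in> B z \<and> w \<in> B z \<and> 0 < A v w}\<^sup>*"
    and finite_B: "finite (B z)"
    and B_subset: "b \<in> B z \<Longrightarrow> z \<in> Z b \<and> b \<in> C"
    and finite_Z: "b \<in> C \<Longrightarrow> finite (Z b)"
    and card_Z: "b \<in> C \<Longrightarrow> real (card (Z b)) \<le> T b"
    and T_ge_1: "b \<in> C \<Longrightarrow> 1 \<le> T b"
    and dim: "3 \<le> CARD('d)"
    and exponents: "1 < m" "1 < p" "1 < q" "s = 1 + 1 / q - 2 / real CARD('d) + 2 / (real CARD('d) * m)" "s < 1 - 1 / p"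
    and c: "1 \<le> c" and R0: "4 \<le> R0"
    and avg_T: "R0 \<le> R \<Longrightarrow> (\<Sum>z\<in>C \<inter> Q x R. T z powr m) \<le> c * R ^ CARD('d)"
    and avg_nu: "R0 \<le> R \<Longrightarrow> (\<Sum>z\<in>C \<inter> Q x R. ((T z)\<^sup>2 * (\<Sum>w\<in>Q z 1. if 0 < A z w then inverse (A z w) else 0)) powr q) \<le> c * R ^ CARD('d)"
    and avg_mu: "R0 \<le> R \<Longrightarrow> (\<Sum>z\<in>C \<inter> Q x R. (\<Sum>w\<in>Q z 1. A z w) powr p) \<le> c * R ^ CARD('d)"
    and avg_kappa: "R0 \<le> R \<Longrightarrow> (\<Sum>z\<in>C \<inter> Q x R. inverse (\<kappa> z)) \<le> c * R ^ CARD('d)"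
    and cpsi: "0 < cpsi"
    and potential: "R0 \<le> R \<Longrightarrow> \<exists>\<psi>. (\<forall>z\<in>Q x R. \<psi> z = 0) \<and> (\<forall>z. z \<notin> Q x (2 * R) \<longrightarrow> cpsi * R \<le> \<psi> z) \<and>
      (\<forall>z w. 0 < A z w \<longrightarrow> \<bar>\<psi> z - \<psi> w\<bar> \<le> 1 \<and> A z w * (\<psi> z - \<psi> w)\<^sup>2 \<le> min (\<kappa> z) (\<kappa> w))"
begin

abbreviation "Cbox R \<equiv> C \<inter> Q x R"

abbreviation "Bs R \<equiv> sobolev_const d c s * R powr (2 - d)"
abbreviation "Cb \<equiv> 1024 * c * sobolev_const d c s"

lemma network: "finite W \<Longrightarrow> network W A"
  by unfold_locales (auto intro: A_sym A_nonneg)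

lemma network_geometry: "finite W \<Longrightarrow> network_geometry W A \<pi> B Z T C"
proof -
  assume "finite W"
  then interpret network W A by (rule network)
  show ?thesis
    by unfold_locales (use proj proj_in path finite_B B_subset finite_Z card_Z in auto)
qed

lemma s_pos: "0 < s"
proof -
  have "2 / d \<le> 2 / 3" unfolding d_eq using dim by (intro divide_left_mono) auto
  moreover have "0 < 1 / q" "0 \<le> 2 / (d * m)" unfolding d_eq using exponents(1,3) by auto
  ultimately show ?thesis unfolding exponents(4) d_eq by linarith
qed

lemma Bs_nonneg: "0 \<le> Bs R"
  by (auto simp: sobolev_const_def)

lemma finite_Cbox [simp]: "finite (Cbox R)" by simp

lemma Cbox_nbr: "z \<in> Cbox R \<Longrightarrow> 0 < A z w \<Longrightarrow> w \<in> Q x (R + 1)"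
  using A_edge[of z w] Q_trans[of z x R w 1] by (simp add: Q_iff linfnorm_minus_commute)

lemma sobolev:
  assumes R: "R0 \<le> R" and W: "finite W" "Q x (R + 1) \<subseteq> W"
    and f: "\<And>b. b \<notin> Cbox R \<Longrightarrow> f b = 0" "\<And>b. 0 \<le> f b" "0 < t"
  shows "t\<^sup>2 * (real (card {b \<in> Cbox R. t \<le> f b}) / R ^ CARD('d)) powr s \<le> Bs R * network.energy W A f"
proof -
  interpret network_geometry W A \<pi> B Z T C by (rule network_geometry[OF W(1)])
  have R1: "1 \<le> R" using R R0 by simp
  have CboxW: "Cbox R \<subseteq> W" using W(2) Q_mono[of R "R + 1" x] by auto
  \<comment> \<open>W contains one layer more than the box, so no neighbour of a point of the box is
    lost and \<open>nuW\<close> is the full sum.\<close>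
  have nu: "nuW b = (\<Sum>w\<in>Q b 1. if 0 < A b w then inverse (A b w) else 0)" if "b \<in> Cbox R" for b
    unfolding nuW_def
  proof (rule sum.mono_neutral_cong[OF _ W(1)])
    show "(if 0 < A b i then inverse (A b i) else 0) = 0" if "i \<in> W - Q b 1" for i
      using that A_edge[of b i] by (auto simp: Q_iff linfnorm_minus_commute)
    show "(if 0 < A b i then inverse (A b i) else 0) = 0" if "i \<in> Q b 1 - W" for i
      using that Cbox_nbr[OF \<open>b \<in> Cbox R\<close>, of i] W(2) by auto
  qed auto
  have "t\<^sup>2 * (real (card {b \<in> Cbox R. t \<le> f b}) / R ^ CARD('d)) powr s
    \<le> 2048 * (real CARD('d))\<^sup>2 * c\<^sup>2 * 16 powr (1 / s) * (R ^ CARD('d)) powr (2 / real CARD('d) - 1) * energy f"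
  proof (rule weak_sobolev[OF _ _ CboxW])
    show "b' \<in> W" if "b \<in> Cbox R" "0 < A b b'" for b b' using Cbox_nbr[OF that] W(2) by auto
    show "(\<Sum>b\<in>Cbox R. T b powr m) \<le> c * R ^ CARD('d)" by (rule avg_T[OF R])
    have "(\<Sum>b\<in>Cbox R. ((T b)\<^sup>2 * nuW b) powr q) = (\<Sum>z\<in>Cbox R. ((T z)\<^sup>2 * (\<Sum>w\<in>Q z 1. if 0 < A z w then inverse (A z w) else 0)) powr q)"
      by (intro sum.cong refl) (simp only: nu)
    then show "(\<Sum>b\<in>Cbox R. ((T b)\<^sup>2 * nuW b) powr q) \<le> c * R ^ CARD('d)" using avg_nu[OF R] by simp
  qed (use f dim R1 c exponents T_ge_1 in auto)
  moreover have "(R ^ CARD('d)) powr (2 / real CARD('d) - 1) = R powr (2 - d)"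
  proof -
    have "real CARD('d) * (2 / real CARD('d) - 1) = 2 - d" using dim by (simp add: d_eq right_diff_distrib)
    then show ?thesis using R1 by (simp add: powr_realpow[symmetric] powr_powr)
  qed
  ultimately show ?thesis by (simp add: sobolev_const_def d_eq)
qed

text \<open>Hoelder with the p-th moment. The exponent 1 - 1/p of the density becomes \<sigma> in De
  Giorgi's recursion.\<close>

lemma conductance_sum_le:
  assumes R: "R0 \<le> R" and W: "finite W" and G: "G \<subseteq> Cbox R"
  shows "(\<Sum>z\<in>G. \<Sum>w\<in>W. A z w) \<le> 2 * c * R ^ CARD('d) * (real (card G) / R ^ CARD('d)) powr (1 - 1 / p)"
proof -
  have R1: "1 \<le> R" using R R0 by simp
  have fG: "finite G" using G finite_subset finite_Cbox by blast
  have "(\<Sum>z\<in>G. \<Sum>w\<in>W. A z w) \<le> (\<Sum>z\<in>G. \<Sum>w\<in>Q z 1. A z w)"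
  proof (rule sum_mono)
    fix z
    have "(\<Sum>w\<in>W. A z w) = (\<Sum>w\<in>W \<inter> Q z 1. A z w)"
      using W by (intro sum.mono_neutral_right) (auto simp: Q_iff linfnorm_minus_commute[of _ z] dest!: A_edge intro!: antisym[OF _ A_nonneg] simp: not_less[symmetric])
    also have "\<dots> \<le> (\<Sum>w\<in>Q z 1. A z w)" by (intro sum_mono2) (auto intro: A_nonneg)
    finally show "(\<Sum>w\<in>W. A z w) \<le> (\<Sum>w\<in>Q z 1. A z w)" .
  qed
  also have "\<dots> \<le> 2 * c * 1 * R ^ CARD('d) * (real (card G) / R ^ CARD('d)) powr (1 - 1 / p)"
  proof (rule sum_le_via_power_normalized[OF fG])
    show "(\<Sum>z\<in>G. (\<Sum>w\<in>Q z 1. A z w) powr p) \<le> c * R ^ CARD('d)"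
      using G by (intro order_trans[OF sum_mono2 avg_mu[OF R]]) auto
  qed (use exponents c R1 A_nonneg in \<open>auto intro!: sum_nonneg\<close>)
  finally show ?thesis by simp
qed

text \<open>The scaling balance: R^(2-d) from Sobolev times the volume R^d is R^2, which the squared
  gradient of the cut-off compensates. The 512 is that of \<open>de_giorgi\<close>, and 2 c is the
  Hoelder constant.\<close>

lemma constants_bound: "R0 \<le> R \<Longrightarrow> 512 * Bs R * (2 * c) * R ^ CARD('d) \<le> Cb * R\<^sup>2"
proof -
  assume R: "R0 \<le> R"
  then have "R powr (2 - d) * R ^ CARD('d) = R powr (2 - d) * R powr d" using R0 by (simp add: powr_realpow d_eq)
  also have "\<dots> = R\<^sup>2" using R R0 by (simp add: powr_add[symmetric])
  finally have *: "R powr (2 - d) * R ^ CARD('d) = R\<^sup>2" .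
  have "512 * Bs R * (2 * c) * R ^ CARD('d) = Cb * (R powr (2 - d) * R ^ CARD('d))"
    by simp
  then show ?thesis by (simp only: *)
qed

text \<open>Subtracting M is harmless: the positive part of (u - M)^+ - l is (u - (M + l))^+. The
  source is invisible because every cut-off vanishes at the pole x.\<close>

lemma local_maximum:
  fixes y :: "int ^ 'd"
  assumes R: "R0 \<le> R" and W: "finite W" "Q x (R + 1) \<subseteq> W"
    and sub: "network.subsolution W A u (\<lambda>_. 0) (\<lambda>z. of_bool (z = x))"
    and M: "0 \<le> M" and vU: "\<And>z. M < u z \<Longrightarrow> z \<in> Q y \<rho> \<Longrightarrow> z \<in> Cbox R"
    and pole: "x \<notin> Q y \<rho>" and \<rho>: "0 \<le> \<rho>" "\<rho> + 1 \<le> R" "R \<le> Cr * (\<rho> + 1)" and b: "0 < b" and \<Theta>: "0 \<le> \<Theta>"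
    and tail: "\<And>t. 0 < t \<Longrightarrow> real (card {b \<in> Cbox R. b \<in> Q y \<rho> \<and> t \<le> max (u b - M) 0}) \<le> R ^ CARD('d) * (\<Theta> / t) powr b"
  shows "max (u y - M) 0 \<le> lmp_const Cb Cr d s (1 - 1 / p) b * \<Theta>"
proof -
  have "max (u y - M) 0 \<le> lmp_const Cb Cr (real CARD('d)) s (1 - 1 / p) b * \<Theta>"
proof (rule local_maximum_principle[where v = "\<lambda>z. max (u z - M) 0" and U = "Cbox R" and W' = W and A = A and Km = "2 * c" and Bs = "Bs R"])
  interpret network W A by (rule network[OF W(1)])
  show "t\<^sup>2 * (real (card {b \<in> Cbox R. t \<le> f b}) / R ^ CARD('d)) powr s \<le> Bs R * network.energy W A f"
    if "\<And>b. b \<notin> Cbox R \<Longrightarrow> f b = 0" "\<And>b. 0 \<le> f b" "0 < t" for f t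
    by (rule sobolev[OF R W that])
  show "energy (\<lambda>z. \<eta> z * max (max (u z - M) 0 - l) 0)
        \<le> (\<Sum>z\<in>W. \<Sum>w\<in>W. A z w * (max (max (u z - M) 0 - l) 0 * max (max (u w - M) 0 - l) 0 * (\<eta> z - \<eta> w)\<^sup>2))"
    if l: "0 \<le> l" and \<eta>: "\<And>z. \<eta> z \<noteq> 0 \<Longrightarrow> z \<in> Q y \<rho>" for \<eta> l
  proof -
    have "max (max (u z - M) 0 - l) 0 = max (u z - (M + l)) 0" for z using l by auto
    moreover have "\<eta> x = 0" using \<eta> pole by blast
    ultimately show ?thesis using caccioppoli[OF sub, of \<eta> "M + l"] by simp
  qed
  show "z \<in> Cbox R" if "max (u z - M) 0 \<noteq> 0" "z \<in> Q y \<rho>" for z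
    using that by (intro vU) (auto simp: max_def split: if_splits)
qed (use network W conductance_sum_le[OF R W(1)] A_edge tail s_pos exponents(1-3,5) b \<Theta> \<rho> Bs_nonneg c constants_bound[OF R] in auto)
  then show ?thesis by (simp only: d_eq[symmetric])
qed

end


definition decay_step_const :: "real \<Rightarrow> real \<Rightarrow> real \<Rightarrow> real \<Rightarrow> real" where
  "decay_step_const d c s p = lmp_const (1024 * c * sobolev_const d c s) 4 d s (1 - 1 / p) (1 / s) * (2 * sobolev_const d c s)"

locale killed_subsolution = good_environment A \<kappa> C T \<pi> B Z x c R0 m p q s cpsi d
  for A :: "int ^ 'd::finite \<Rightarrow> int ^ 'd \<Rightarrow> real" and \<kappa> C T \<pi> B Z x c R0 m p q s cpsi d +
  fixes u :: "int ^ 'd::finite \<Rightarrow> real" and h :: real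
  assumes u_nonneg: "0 \<le> u z" and u_support: "finite {z. u z \<noteq> 0}" and u_C: "u z \<noteq> 0 \<Longrightarrow> z \<in> C"
    and h: "0 \<le> h"
    and subsol: "(\<Sum>w\<in>Q z 1. A z w * (u z - u w)) + h * \<kappa> z * u z \<le> of_bool (z = x)"
begin

lemma subsolution_on:
  assumes W: "finite W" "\<And>z. u z \<noteq> 0 \<Longrightarrow> Q z 1 \<subseteq> W"
  shows "network.subsolution W A u (\<lambda>z. h * \<kappa> z) (\<lambda>z. of_bool (z = x))"
proof -
  interpret network W A by (rule network[OF W(1)])
  show ?thesis unfolding subsolution_def
  proof
    fix z assume "z \<in> W"
    have A0: "A z w = 0" if "w \<notin> Q z 1" for w
      using that A_edge[of z w] A_nonneg[of z w] by (auto simp: Q_iff linfnorm_minus_commute[of w] not_less order.order_iff_strict)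
    have "(\<Sum>w\<in>W. A z w * (u z - u w)) = (\<Sum>w\<in>Q z 1. A z w * (u z - u w))"
    proof (rule sum.mono_neutral_cong[OF _ W(1)])
      show "A z w * (u z - u w) = 0" if "w \<in> Q z 1 - W" for w
      proof -
        have "u z = 0" using that W(2)[of z] by auto
        moreover have "u w = 0"
        proof (rule ccontr)
          assume "u w \<noteq> 0"
          moreover have "w \<in> Q w 1" by simp
          ultimately show False using W(2)[of w] that by blast
        qed
        ultimately show ?thesis by simp
      qed
    qed (use A0 in auto)
    then show "(\<Sum>w\<in>W. A z w * (u z - u w)) + h * \<kappa> z * u z \<le> of_bool (z = x)" using subsol[of z] by simp
  qed
qed

text \<open>The domain has to contain the support of u, whose size is beyond control. Constants
  never depend on W, only on the box around x.\<close>

lemma exists_domain: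
  obtains W where "finite W" "Q x (R + 1) \<subseteq> W" "\<And>z. u z \<noteq> 0 \<Longrightarrow> Q z 1 \<subseteq> W"
    "network.subsolution W A u (\<lambda>z. h * \<kappa> z) (\<lambda>z. of_bool (z = x))"
    "network.subsolution W A u (\<lambda>_. 0) (\<lambda>z. of_bool (z = x))"
proof -
  define W where "W = Q x (R + 1) \<union> (\<Union>z\<in>{z. u z \<noteq> 0}. Q z 1)"
  have W: "finite W" "Q x (R + 1) \<subseteq> W" "\<And>z. u z \<noteq> 0 \<Longrightarrow> Q z 1 \<subseteq> W"
    using u_support by (auto simp: W_def)
  note sub = subsolution_on[OF W(1,3)]
  have "0 * u z \<le> h * \<kappa> z * u z" for z using h \<kappa>_pos[of z] u_nonneg[of z] by simp
  then have "network.subsolution W A u (\<lambda>_. 0) (\<lambda>z. of_bool (z = x))"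
    by (intro network.subsolution_mono_rate[OF network[OF W(1)] sub]) auto
  then show thesis using that W sub by blast
qed

abbreviation "ndist z \<equiv> real_of_int (linfnorm (z - x))"
abbreviation "D1 \<equiv> decay_step_const d c s p"

lemma D1_nonneg: "0 \<le> D1"
  by (auto simp: decay_step_const_def sobolev_const_def intro!: mult_nonneg_nonneg lmp_const_nonneg)

text \<open>Above level M the function lives in the box of radius R. The truncation energy 2 t and
  Sobolev give a tail with exponent 1/s and scale of order R^(2-d); the local maximum principle on
  the box of radius R / 4 around y, which misses the pole, makes this pointwise.\<close>

lemma dyadic_step:
  assumes R: "R0 \<le> R" and M: "0 \<le> M" "\<And>z. R \<le> ndist z \<Longrightarrow> u z \<le> M"
    and y: "R / 2 \<le> ndist y"
  shows "u y \<le> M + D1 * R powr (2 - d)"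
proof (cases "R \<le> ndist y")
  case True
  then show ?thesis using M(2)[OF True] D1_nonneg by (simp add: add_increasing2)
next
  case False
  obtain W where W: "finite W" "Q x (R + 1) \<subseteq> W" "\<And>z. u z \<noteq> 0 \<Longrightarrow> Q z 1 \<subseteq> W"
    "network.subsolution W A u (\<lambda>_. 0) (\<lambda>z. of_bool (z = x))" using exists_domain[of R] by metis
  interpret network W A by (rule network[OF W(1)])
  have R4: "4 \<le> R" using R R0 by simp
  define S where "S = sobolev_const d c s"
  have S0: "0 \<le> S" by (simp add: S_def sobolev_const_def)
  have inC: "z \<in> Cbox R" if "M < u z" for z
  proof -
    have "u z \<noteq> 0" using that M by auto
    moreover have "ndist z \<le> R" using M(2)[of z] that by linarith
    ultimately show ?thesis using u_C[of z] by (auto simp: Q_iff)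
  qed
  have "max (u y - M) 0 \<le> lmp_const Cb 4 d s (1 - 1 / p) (1 / s) * (2 * Bs R)"
  proof (rule local_maximum[OF R W(1,2,4) M(1)])
    show "x \<notin> Q y (R / 4)" using y R4 by (simp add: Q_iff linfnorm_minus_commute[of x])
    show "real (card {b \<in> Cbox R. b \<in> Q y (R / 4) \<and> t \<le> max (u b - M) 0}) \<le> R ^ CARD('d) * (2 * Bs R / t) powr (1 / s)"
      if t: "0 < t" for t
    proof -
      let ?f = "\<lambda>z. min (max (u z - M) 0) t"
      define N where "N = real (card {b \<in> Cbox R. t \<le> ?f b})"
      define V where "V = R ^ CARD('d)"
      have V: "0 < V" using R4 by (simp add: V_def)
      have "t\<^sup>2 * (N / V) powr s \<le> Bs R * energy ?f"
        unfolding N_def V_def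
      proof (rule sobolev[OF R W(1,2)])
        show "?f b = 0" if "b \<notin> Cbox R" for b using inC[of b] that t by force
      qed (use t in auto)
      also have "\<dots> \<le> Bs R * (2 * t)"
        using energy_truncation_le[OF W(4), of t M] t Bs_nonneg[of R] by (intro mult_left_mono) auto
      finally have "(N / V) powr s \<le> 2 * Bs R / t" using t by (simp add: field_simps power2_eq_square)
      then have "((N / V) powr s) powr (1 / s) \<le> (2 * Bs R / t) powr (1 / s)"
        using s_pos by (intro powr_mono2[rotated 2]) auto
      then have "N / V \<le> (2 * Bs R / t) powr (1 / s)" using s_pos V by (simp add: powr_powr N_def)
      then have "N \<le> V * (2 * Bs R / t) powr (1 / s)" using V by (simp add: field_simps)
      moreover have "real (card {b \<in> Cbox R. b \<in> Q y (R / 4) \<and> t \<le> max (u b - M) 0}) \<le> N"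
        unfolding N_def by (auto intro!: card_mono)
      ultimately show ?thesis by (simp add: V_def)
    qed
  qed (use R4 s_pos Bs_nonneg[of R] inC in auto)
  also have "\<dots> = D1 * R powr (2 - d)" by (simp add: decay_step_const_def)
  finally show ?thesis by simp
qed

text \<open>Induction inwards from beyond the finite support, where u vanishes. The increments form
  a geometric series because 2^(2-d) <= 1/2, which is where d >= 3 enters; its sum accounts for the
  2 in 2 D1.\<close>

lemma dyadic_decay:
  assumes "R0 \<le> 2 ^ k * r" "0 < r" "2 ^ k * r / 2 \<le> ndist y"
  shows "u y \<le> 2 * D1 * (2 ^ k * r) powr (2 - d)"
proof -
  obtain n where n: "\<And>z. 2 ^ n * r / 2 \<le> ndist z \<Longrightarrow> u z = 0"
  proof -
    have fin: "finite (ndist ` {z. u z \<noteq> 0})" using u_support by simp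
    define M where "M = Max (insert 0 (ndist ` {z. u z \<noteq> 0}))"
    have M: "ndist z \<le> M" if "u z \<noteq> 0" for z unfolding M_def using fin that by (intro Max_ge) auto
    obtain n where "2 * M / r < 2 ^ n" using real_arch_pow[of 2 "2 * M / r"] by auto
    then have "M < 2 ^ n * r / 2" using assms(2) by (simp add: field_simps)
    then show thesis using M that by (metis leD le_less_trans)
  qed
  have "\<forall>z. 2 ^ j * r / 2 \<le> ndist z \<longrightarrow> u z \<le> 2 * D1 * (2 ^ j * r) powr (2 - d)" if "k \<le> j" "j \<le> max k n" for j
    using that(2) that(1)
  proof (induction j rule: inc_induct)
    case base
    have "2 ^ n * r / 2 \<le> 2 ^ max k n * r / 2" using assms(2) by (intro divide_right_mono mult_right_mono) auto
    then show ?case using n D1_nonneg by (smt (verit) mult_nonneg_nonneg powr_ge_zero)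
  next
    case (step j)
    let ?R = "2 ^ j * r"
    have R: "R0 \<le> ?R"
    proof -
      have "2 ^ k * r \<le> ?R" using step.prems assms(2) by (intro mult_right_mono) auto
      then show ?thesis using assms(1) by simp
    qed
    show ?case
    proof (intro allI impI)
      fix z assume z: "2 ^ j * r / 2 \<le> ndist z"
      have IH: "u w \<le> 2 * D1 * (2 ^ Suc j * r) powr (2 - d)" if "?R \<le> ndist w" for w
        using step that by simp
      have "u z \<le> 2 * D1 * (2 ^ Suc j * r) powr (2 - d) + D1 * ?R powr (2 - d)"
        by (rule dyadic_step[OF R _ IH z]) (use D1_nonneg in auto)
      also have "(2 ^ Suc j * r) powr (2 - d) = 2 powr (2 - d) * ?R powr (2 - d)"
        using assms(2) by (simp add: powr_mult)
      also have "2 * D1 * (2 powr (2 - d) * ?R powr (2 - d)) \<le> 2 * D1 * (1 / 2 * ?R powr (2 - d))"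
      proof (intro mult_left_mono mult_right_mono)
        have "2 powr (2 - d) \<le> (2 :: real) powr (- 1)" using dim by (intro powr_mono) (auto simp: d_eq)
        then show "2 powr (2 - d) \<le> (1 / 2 :: real)" by (simp add: powr_minus)
      qed (use D1_nonneg in auto)
      finally show "u z \<le> 2 * D1 * ?R powr (2 - d)" by simp
    qed
  qed
  from this[of k] assms(3) show ?thesis by simp
qed

lemma polynomial_decay:
  assumes "R0 \<le> ndist y"
  shows "u y \<le> 2 * D1 * ndist y powr (2 - d)"
proof -
  have 1: "u y \<le> 2 * D1 * (2 ^ 1 * ndist y) powr (2 - d)"
    using assms R0 by (intro dyadic_decay) auto
  have "(2 ^ 1 * ndist y) powr (2 - d) \<le> ndist y powr (2 - d)"
    using assms R0 dim by (intro powr_mono2') (auto simp: d_eq)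
  then have "2 * D1 * (2 ^ 1 * ndist y) powr (2 - d) \<le> 2 * D1 * ndist y powr (2 - d)"
    using D1_nonneg by (intro mult_left_mono) auto
  with 1 show ?thesis by simp
qed

end


section \<open>Agmon's exponentially weighted energy estimate\<close>

lemma exp_diff_squared_le:
  fixes p q :: real
  assumes "\<bar>p - q\<bar> \<le> 1"
  shows "(exp p - exp q)\<^sup>2 \<le> 3 * (p - q)\<^sup>2 * (exp p * exp q)"
proof -
  have *: "(exp p - exp q)\<^sup>2 \<le> 3 * (p - q)\<^sup>2 * (exp p * exp q)" if "q \<le> p" "p - q \<le> 1" for p q :: real
  proof -
    have "1 - (p - q) \<le> exp (- (p - q))" using exp_ge_add_one_self[of "- (p - q)"] by linarith
    then have "exp p * (1 - (p - q)) \<le> exp p * exp (- (p - q))" by (intro mult_left_mono) auto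
    then have "exp p - exp q \<le> exp p * (p - q)" by (simp add: algebra_simps mult_exp_exp)
    then have "(exp p - exp q)\<^sup>2 \<le> (exp p * (p - q))\<^sup>2" using that by (intro power_mono) auto
    also have "\<dots> = (p - q)\<^sup>2 * (exp q * exp (p - q)) * exp p"
      by (simp add: power2_eq_square mult_exp_exp)
    also have "\<dots> \<le> (p - q)\<^sup>2 * (exp q * 3) * exp p"
    proof (intro mult_right_mono mult_left_mono)
      have "exp (p - q) \<le> exp 1" using that by simp
      then show "exp (p - q) \<le> 3" using exp_le by linarith
    qed auto
    finally show ?thesis by (simp add: mult_ac)
  qed
  show ?thesis
  proof (cases "q \<le> p")
    case True then show ?thesis using assms by (intro *) auto
  next
    case False
    then have "(exp q - exp p)\<^sup>2 \<le> 3 * (q - p)\<^sup>2 * (exp q * exp p)" using assms by (intro *) auto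
    then show ?thesis by (simp add: power2_commute mult.commute)
  qed
qed

context killed_subsolution begin

text \<open>Chosen so that 3 lam^2 3^d = h: one 3 from \<open>exp_diff_squared_le\<close>, where it
  stands for e, and 3^d for the number of points at distance at most 1. The gradient of the weight
  then uses up half of the killing term.\<close>

abbreviation "lam \<equiv> sqrt (h / 3 powr (d + 1))"
abbreviation "agmon_const \<equiv> 128 * c * 3 powr d * 4 powr (2 * d - 4) * D1\<^sup>2"

text \<open>The test function is \<theta>^2 u, where \<theta> is a cut-off times exp(lam \<psi>).
  The two gradients never interact: on edges inside Q x R the potential is zero and only the cut-off
  varies, where polynomial decay bounds u; on all other edges the cut-off is 1 and the killing term
  absorbs the exponential.\<close>

lemma weighted_norm_bound:
  assumes R: "4 * R0 \<le> R" and h1: "h \<le> 1"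
    and psi0: "\<And>z. z \<in> Q x R \<Longrightarrow> \<psi> z = 0"
    and psi: "\<And>z w. 0 < A z w \<Longrightarrow> \<bar>\<psi> z - \<psi> w\<bar> \<le> 1 \<and> A z w * (\<psi> z - \<psi> w)\<^sup>2 \<le> min (\<kappa> z) (\<kappa> w)"
    and F: "finite F" "F \<inter> Q x R = {}"
  shows "h * (\<Sum>z\<in>F. \<kappa> z * (exp (lam * \<psi> z) * u z)\<^sup>2) \<le> agmon_const * R powr (2 - d)"
proof -
  obtain W0 where W0: "finite W0" "Q x (R + 1) \<subseteq> W0" "\<And>z. u z \<noteq> 0 \<Longrightarrow> Q z 1 \<subseteq> W0"
    "network.subsolution W0 A u (\<lambda>z. h * \<kappa> z) (\<lambda>z. of_bool (z = x))" using exists_domain[of R] by metis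
  define W where "W = W0 \<union> F"
  have W: "finite W" "\<And>z. u z \<noteq> 0 \<Longrightarrow> Q z 1 \<subseteq> W" using W0 F by (auto simp: W_def)
  interpret network W A by (rule network[OF W(1)])
  have sub: "subsolution u (\<lambda>z. h * \<kappa> z) (\<lambda>z. of_bool (z = x))" by (rule subsolution_on[OF W])
  have R16: "16 \<le> R" using R R0 by simp
  \<comment> \<open>The cut-off reaches 1 already at R - 1, so it is 1 at both ends of every edge
    that leaves Q x R.\<close>
  define \<eta> where "\<eta> z = max 0 (min 1 ((ndist z - R / 2) / (R / 2 - 1)))" for z
  define \<theta> where "\<theta> z = \<eta> z * exp (lam * \<psi> z)" for z
  define E where "E = (2 * D1 * (R / 4) powr (2 - d))\<^sup>2 * (4 / R)\<^sup>2"
  have E0: "0 \<le> E" by (simp add: E_def)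
  have \<eta>0: "\<eta> z = 0" if "ndist z \<le> R / 2" for z
  proof -
    have "(ndist z - R / 2) / (R / 2 - 1) \<le> 0" using R16 that by (intro divide_nonpos_pos) auto
    then show ?thesis unfolding \<eta>_def by linarith
  qed
  have \<eta>x: "\<eta> x = 0" using R16 by (intro \<eta>0) simp
  have \<eta>1: "\<eta> z = 1" if "R - 1 \<le> ndist z" for z
    using that R16 by (simp add: \<eta>_def min_def field_simps)
  have ndiff: "\<bar>ndist z - ndist w\<bar> \<le> 1" if "0 < A z w" for z w
    using linfnorm_triangle_diff[of z x w] linfnorm_triangle_diff[of w x z] A_edge[OF that] linfnorm_minus_commute[of z w] by linarith
  have p3: "3 powr d = (3 :: real) ^ CARD('d)" by (simp add: d_eq powr_realpow)
  then have p31: "3 powr (d + 1) = (3 :: real) * 3 ^ CARD('d)" by (simp add: powr_add)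
  have "1 \<le> (3 :: real) ^ CARD('d)" by (rule one_le_power) simp
  then have "h \<le> 3 * 3 ^ CARD('d)" using h1 by linarith
  then have lam: "0 \<le> lam" "lam \<le> 1" "lam\<^sup>2 = h / (3 * 3 ^ CARD('d))"
    using h unfolding p31 by (auto simp: divide_le_eq)
  let ?X = "\<Sum>z\<in>W. \<kappa> z * (\<theta> z * u z)\<^sup>2"
  have "(\<Sum>z\<in>W. \<Sum>w\<in>W. A z w * (((\<theta> z)\<^sup>2 * u z - (\<theta> w)\<^sup>2 * u w) * (u z - u w))) / 2 + (\<Sum>z\<in>W. h * \<kappa> z * u z * ((\<theta> z)\<^sup>2 * u z))
      \<le> (\<Sum>z\<in>W. of_bool (z = x) * ((\<theta> z)\<^sup>2 * u z))"
    by (rule subsolution_test[OF sub]) (use u_nonneg in auto)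
  also have "(\<Sum>z\<in>W. of_bool (z = x) * ((\<theta> z)\<^sup>2 * u z)) = 0"
    by (rule sum.neutral) (auto simp: \<theta>_def \<eta>x)
  finally have t1: "(\<Sum>z\<in>W. \<Sum>w\<in>W. A z w * (((\<theta> z)\<^sup>2 * u z - (\<theta> w)\<^sup>2 * u w) * (u z - u w))) / 2 + h * ?X \<le> 0"
    by (simp add: sum_distrib_left power2_eq_square mult_ac)
  have "(\<Sum>z\<in>W. \<Sum>w\<in>W. A z w * (((\<theta> z)\<^sup>2 * u z - (\<theta> w)\<^sup>2 * u w) * (u z - u w)))
      \<ge> (\<Sum>z\<in>W. \<Sum>w\<in>W. - (A z w * (u z * u w * (\<theta> z - \<theta> w)\<^sup>2)))"
  proof (intro sum_mono)
    fix z w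
    have "((\<theta> z)\<^sup>2 * u z - (\<theta> w)\<^sup>2 * u w) * (u z - u w) = (\<theta> z * u z - \<theta> w * u w)\<^sup>2 - u z * u w * (\<theta> z - \<theta> w)\<^sup>2"
      by (simp add: power2_eq_square algebra_simps)
    then have "- (u z * u w * (\<theta> z - \<theta> w)\<^sup>2) \<le> ((\<theta> z)\<^sup>2 * u z - (\<theta> w)\<^sup>2 * u w) * (u z - u w)" by simp
    from mult_left_mono[OF this A_nonneg[of z w]]
    show "- (A z w * (u z * u w * (\<theta> z - \<theta> w)\<^sup>2)) \<le> A z w * (((\<theta> z)\<^sup>2 * u z - (\<theta> w)\<^sup>2 * u w) * (u z - u w))" by simp
  qed
  with t1 have t2: "2 * (h * ?X) \<le> (\<Sum>z\<in>W. \<Sum>w\<in>W. A z w * (u z * u w * (\<theta> z - \<theta> w)\<^sup>2))"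
    by (simp add: sum_negf)
  let ?k = "\<lambda>z. \<kappa> z * (\<theta> z * u z)\<^sup>2"
  have pt: "A z w * (u z * u w * (\<theta> z - \<theta> w)\<^sup>2)
     \<le> A z w * E * of_bool (z \<in> Cbox R) + (3 / 2 * lam\<^sup>2) * (of_bool (w \<in> Q z 1) * ?k z + of_bool (z \<in> Q w 1) * ?k w)" for z w
  proof (cases "A z w = 0 \<or> u z = 0 \<or> u w = 0 \<or> \<theta> z = \<theta> w")
    case True
    then have "A z w * (u z * u w * (\<theta> z - \<theta> w)\<^sup>2) = 0" by auto
    moreover have "0 \<le> A z w * E * of_bool (z \<in> Cbox R)" using A_nonneg E0 by simp
    moreover have "0 \<le> (3 / 2 * lam\<^sup>2) * (of_bool (w \<in> Q z 1) * ?k z + of_bool (z \<in> Q w 1) * ?k w)"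
      using \<kappa>_pos[of z] \<kappa>_pos[of w] by (intro mult_nonneg_nonneg add_nonneg_nonneg) (auto simp: less_imp_le)
    ultimately show ?thesis by linarith
  next
    case False
    then have Ap: "0 < A z w" and uz: "0 < u z" "0 < u w"
      using A_nonneg[of z w] u_nonneg[of z] u_nonneg[of w] by (auto simp: less_le)
    have nb: "w \<in> Q z 1" "z \<in> Q w 1" using A_edge[OF Ap] by (auto simp: Q_iff linfnorm_minus_commute[of w])
    show ?thesis
    proof (cases "z \<in> Q x R \<and> w \<in> Q x R")
      case True
      then have th: "\<theta> z = \<eta> z" "\<theta> w = \<eta> w" by (auto simp: \<theta>_def psi0)
      have "\<bar>ndist z - ndist w\<bar> / (R / 2 - 1) \<le> 1 / (R / 2 - 1)"
        using ndiff[OF Ap] R16 by (intro divide_right_mono) auto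
      also have "\<dots> \<le> 4 / R" using R16 by (simp add: field_simps)
      finally have "\<bar>(ndist z - R / 2) / (R / 2 - 1) - (ndist w - R / 2) / (R / 2 - 1)\<bar> \<le> 4 / R"
        using R16 by (simp add: diff_divide_distrib[symmetric] abs_divide)
      then have "\<bar>\<eta> z - \<eta> w\<bar> \<le> 4 / R" unfolding \<eta>_def by linarith
      then have e: "(\<eta> z - \<eta> w)\<^sup>2 \<le> (4 / R)\<^sup>2" by (metis abs_ge_zero power2_abs power_mono)
      have "R / 2 < ndist z \<or> R / 2 < ndist w"
      proof (rule ccontr)
        assume "\<not> ?thesis"
        then have "\<eta> z = 0" "\<eta> w = 0" by (simp_all add: \<eta>0)
        then show False using False th by simp
      qed
      then have nn: "R / 4 \<le> ndist z" "R / 4 \<le> ndist w" using ndiff[OF Ap] R16 by linarith+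
      have ub: "u v \<le> 2 * D1 * (R / 4) powr (2 - d)" if "R / 4 \<le> ndist v" for v
      proof -
        have "u v \<le> 2 * D1 * ndist v powr (2 - d)" using that R by (intro polynomial_decay) auto
        also have "\<dots> \<le> 2 * D1 * (R / 4) powr (2 - d)"
          using that R16 dim D1_nonneg by (intro mult_left_mono powr_mono2') (auto simp: d_eq)
        finally show ?thesis .
      qed
      have "u z * u w * (\<eta> z - \<eta> w)\<^sup>2 \<le> (2 * D1 * (R / 4) powr (2 - d)) * (2 * D1 * (R / 4) powr (2 - d)) * (4 / R)\<^sup>2"
        using ub[OF nn(1)] ub[OF nn(2)] uz e D1_nonneg by (intro mult_mono) auto
      then have "A z w * (u z * u w * (\<theta> z - \<theta> w)\<^sup>2) \<le> A z w * E"
        using Ap unfolding th E_def by (intro mult_left_mono) (auto simp: power2_eq_square)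
      moreover have "z \<in> Cbox R" using u_C[of z] uz True by auto
      moreover have "0 \<le> (3 / 2 * lam\<^sup>2) * (of_bool (w \<in> Q z 1) * ?k z + of_bool (z \<in> Q w 1) * ?k w)"
        using \<kappa>_pos[of z] \<kappa>_pos[of w] by (intro mult_nonneg_nonneg add_nonneg_nonneg) (auto simp: less_imp_le)
      ultimately show ?thesis by simp
    next
      case out: False
      then have "R - 1 \<le> ndist z" "R - 1 \<le> ndist w" using ndiff[OF Ap] by (auto simp: Q_iff)
      then have e1: "\<eta> z = 1" "\<eta> w = 1" by (simp_all add: \<eta>1)
      have "\<bar>lam * \<psi> z - lam * \<psi> w\<bar> = lam * \<bar>\<psi> z - \<psi> w\<bar>"
        using lam by (simp add: right_diff_distrib[symmetric] abs_mult)
      also have "\<dots> \<le> 1 * 1" using lam psi[OF Ap] by (intro mult_mono) auto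
      finally have "(exp (lam * \<psi> z) - exp (lam * \<psi> w))\<^sup>2 \<le> 3 * (lam * \<psi> z - lam * \<psi> w)\<^sup>2 * (exp (lam * \<psi> z) * exp (lam * \<psi> w))"
        by (intro exp_diff_squared_le) simp
      then have "(\<theta> z - \<theta> w)\<^sup>2 \<le> 3 * lam\<^sup>2 * (\<psi> z - \<psi> w)\<^sup>2 * (\<theta> z * \<theta> w)"
        unfolding \<theta>_def e1 by (simp only: right_diff_distrib[symmetric] power_mult_distrib mult_1_left mult.assoc)
      then have "A z w * (u z * u w) * (\<theta> z - \<theta> w)\<^sup>2 \<le> A z w * (u z * u w) * (3 * lam\<^sup>2 * (\<psi> z - \<psi> w)\<^sup>2 * (\<theta> z * \<theta> w))"
        using Ap uz by (intro mult_left_mono) auto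
      also have "\<dots> = 3 * lam\<^sup>2 * (A z w * (\<psi> z - \<psi> w)\<^sup>2) * ((\<theta> z * u z) * (\<theta> w * u w))" by (simp add: mult_ac)
      also have "\<dots> \<le> 3 * lam\<^sup>2 * (A z w * (\<psi> z - \<psi> w)\<^sup>2) * (((\<theta> z * u z)\<^sup>2 + (\<theta> w * u w)\<^sup>2) / 2)"
      proof (intro mult_left_mono)
        show "\<theta> z * u z * (\<theta> w * u w) \<le> ((\<theta> z * u z)\<^sup>2 + (\<theta> w * u w)\<^sup>2) / 2"
          using sum_squares_bound[of "\<theta> z * u z" "\<theta> w * u w"] by simp
      qed (use Ap in auto)
      also have "\<dots> = 3 / 2 * lam\<^sup>2 * ((A z w * (\<psi> z - \<psi> w)\<^sup>2) * (\<theta> z * u z)\<^sup>2 + (A z w * (\<psi> z - \<psi> w)\<^sup>2) * (\<theta> w * u w)\<^sup>2)"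
        by (simp add: algebra_simps)
      also have "\<dots> \<le> 3 / 2 * lam\<^sup>2 * (\<kappa> z * (\<theta> z * u z)\<^sup>2 + \<kappa> w * (\<theta> w * u w)\<^sup>2)"
        using psi[OF Ap] by (intro mult_left_mono add_mono mult_right_mono) auto
      finally have "A z w * (u z * u w * (\<theta> z - \<theta> w)\<^sup>2) \<le> 3 / 2 * lam\<^sup>2 * (?k z + ?k w)" by (simp add: mult.assoc)
      moreover have "0 \<le> A z w * E * of_bool (z \<in> Cbox R)" using A_nonneg E0 by simp
      ultimately show ?thesis using nb by simp
    qed
  qed
  have "(\<Sum>z\<in>W. \<Sum>w\<in>W. A z w * (u z * u w * (\<theta> z - \<theta> w)\<^sup>2))
      \<le> (\<Sum>z\<in>W. \<Sum>w\<in>W. A z w * E * of_bool (z \<in> Cbox R) + (3 / 2 * lam\<^sup>2) * (of_bool (w \<in> Q z 1) * ?k z + of_bool (z \<in> Q w 1) * ?k w))"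
    by (intro sum_mono pt)
  also have "\<dots> = E * (\<Sum>z\<in>W. \<Sum>w\<in>W. A z w * of_bool (z \<in> Cbox R)) + (3 / 2 * lam\<^sup>2) * ((\<Sum>z\<in>W. \<Sum>w\<in>W. of_bool (w \<in> Q z 1) * ?k z) + (\<Sum>z\<in>W. \<Sum>w\<in>W. of_bool (z \<in> Q w 1) * ?k w))"
    unfolding sum_distrib_left sum.distrib[symmetric] distrib_left by (intro sum.cong refl) (simp only: mult_ac)
  also have "(\<Sum>z\<in>W. \<Sum>w\<in>W. of_bool (z \<in> Q w 1) * ?k w) = (\<Sum>z\<in>W. \<Sum>w\<in>W. of_bool (w \<in> Q z 1) * ?k z)"
    by (rule sum.swap)
  finally have t3: "2 * (h * ?X) \<le> E * (\<Sum>z\<in>W. \<Sum>w\<in>W. A z w * of_bool (z \<in> Cbox R)) + (3 * lam\<^sup>2) * (\<Sum>z\<in>W. \<Sum>w\<in>W. of_bool (w \<in> Q z 1) * ?k z)"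
    using t2 by simp
  have b1: "(\<Sum>z\<in>W. \<Sum>w\<in>W. of_bool (w \<in> Q z 1) * ?k z) \<le> 3 ^ CARD('d) * ?X"
  proof -
    have "(\<Sum>w\<in>W. of_bool (w \<in> Q z 1) * ?k z) \<le> 3 ^ CARD('d) * ?k z" for z
    proof -
      have "(\<Sum>w\<in>W. of_bool (w \<in> Q z 1) * ?k z) = real (card (W \<inter> Q z 1)) * ?k z"
        using W(1) by (simp add: sum_distrib_right[symmetric] sum_of_bool_eq)
      also have "\<dots> \<le> 3 ^ CARD('d) * ?k z"
      proof (rule mult_right_mono)
        have "real (card (W \<inter> Q z 1)) \<le> real (card (Q z 1))" by (auto intro!: card_mono)
        also have "\<dots> \<le> (2 * 1 + 1) ^ CARD('d)" by (rule card_Q_le) simp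
        finally show "real (card (W \<inter> Q z 1)) \<le> 3 ^ CARD('d)" by simp
      qed (use \<kappa>_pos[of z] in simp)
      finally show ?thesis .
    qed
    then show ?thesis unfolding sum_distrib_left by (intro sum_mono)
  qed
  have b2: "(\<Sum>z\<in>W. \<Sum>w\<in>W. A z w * of_bool (z \<in> Cbox R)) \<le> 2 * c * R ^ CARD('d) * 3 ^ CARD('d)"
  proof -
    have "(\<Sum>z\<in>W. \<Sum>w\<in>W. A z w * of_bool (z \<in> Cbox R)) = (\<Sum>z\<in>W \<inter> Cbox R. \<Sum>w\<in>W. A z w)"
      using W(1) by (subst sum.inter_restrict) (auto intro!: sum.cong)
    also have "\<dots> \<le> 2 * c * R ^ CARD('d) * (real (card (W \<inter> Cbox R)) / R ^ CARD('d)) powr (1 - 1 / p)"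
      by (rule conductance_sum_le[OF _ W(1)]) (use R R0 in auto)
    also have "\<dots> \<le> 2 * c * R ^ CARD('d) * 3 ^ CARD('d)"
    proof (intro mult_left_mono)
      have "real (card (W \<inter> Cbox R)) \<le> real (card (Q x R))" by (auto intro!: card_mono)
      also have "\<dots> \<le> (2 * R + 1) ^ CARD('d)" using R16 by (intro card_Q_le) auto
      also have "\<dots> \<le> (3 * R) ^ CARD('d)" using R16 by (intro power_mono) auto
      finally have "real (card (W \<inter> Cbox R)) / R ^ CARD('d) \<le> 3 ^ CARD('d)"
        using R16 by (simp add: power_mult_distrib field_simps)
      then have "(real (card (W \<inter> Cbox R)) / R ^ CARD('d)) powr (1 - 1 / p) \<le> (3 ^ CARD('d)) powr (1 - 1 / p)"
        using exponents(2) R16 by (intro powr_mono2) auto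
      also have "\<dots> \<le> 3 ^ CARD('d)" using exponents(2) by (intro powr_le_self_of_ge_1) auto
      finally show "(real (card (W \<inter> Cbox R)) / R ^ CARD('d)) powr (1 - 1 / p) \<le> 3 ^ CARD('d)" .
    qed (use c R16 in auto)
    finally show ?thesis .
  qed
  have "2 * (h * ?X) \<le> E * (2 * c * R ^ CARD('d) * 3 ^ CARD('d)) + (3 * lam\<^sup>2) * (3 ^ CARD('d) * ?X)"
    using t3 mult_left_mono[OF b2 E0] mult_left_mono[OF b1, of "3 * lam\<^sup>2"] by simp
  \<comment> \<open>By the choice of \<open>lam\<close> this is exactly half of the left-hand
    side.\<close>
  also have "(3 * lam\<^sup>2) * (3 ^ CARD('d) * ?X) = h * ?X" unfolding lam(3) by simp
  finally have "h * ?X \<le> 2 * c * 3 ^ CARD('d) * (E * R ^ CARD('d))" by (simp add: mult_ac)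
  also have "E * R ^ CARD('d) = 64 * 4 powr (2 * d - 4) * D1\<^sup>2 * R powr (2 - d)"
  proof -
    have "((R / 4) powr (2 - d))\<^sup>2 = R powr (4 - 2 * d) * 4 powr (2 * d - 4)"
      using R16 by (simp add: powr_power powr_divide powr_minus_divide[symmetric] divide_powr_uminus algebra_simps)
    moreover have "R powr (4 - 2 * d) * R ^ CARD('d) = R powr (2 - d) * R\<^sup>2"
    proof -
      have "R ^ CARD('d) = R powr d" "R\<^sup>2 = R powr 2" using R16 by (simp_all add: powr_realpow d_eq)
      then show ?thesis by (simp only: powr_add[symmetric]) simp
    qed
    ultimately show ?thesis using R16 by (simp add: E_def power_mult_distrib power_divide field_simps)
  qed
  finally have "h * ?X \<le> agmon_const * R powr (2 - d)" by (simp add: p3)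
  moreover have "h * (\<Sum>z\<in>F. \<kappa> z * (exp (lam * \<psi> z) * u z)\<^sup>2) \<le> h * ?X"
  proof (rule mult_left_mono[OF _ h])
    have "(\<Sum>z\<in>F. \<kappa> z * (exp (lam * \<psi> z) * u z)\<^sup>2) = (\<Sum>z\<in>F. ?k z)"
    proof (intro sum.cong refl)
      fix z assume "z \<in> F"
      then have "R - 1 \<le> ndist z" using F by (auto simp: Q_iff disjoint_iff)
      then show "\<kappa> z * (exp (lam * \<psi> z) * u z)\<^sup>2 = ?k z" by (simp add: \<theta>_def \<eta>1)
    qed
    also have "\<dots> \<le> ?X" using W(1) \<kappa>_pos by (intro sum_mono2) (auto simp: W_def less_imp_le)
    finally show "(\<Sum>z\<in>F. \<kappa> z * (exp (lam * \<psi> z) * u z)\<^sup>2) \<le> ?X" .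
  qed
  ultimately show ?thesis by linarith
qed

end


text \<open>The exponent lam cpsi R at R = l / 4, divided by sqrt h times l.\<close>

definition decay_rate :: "real \<Rightarrow> real \<Rightarrow> real" where
  "decay_rate d cpsi = cpsi / (4 * sqrt (3 powr (d + 1)))"

text \<open>One summand for each of the two regimes of h in \<open>exponential_decay\<close>; the
  final 1 makes the constant positive.\<close>

definition decay_const :: "real \<Rightarrow> real \<Rightarrow> real \<Rightarrow> real \<Rightarrow> real \<Rightarrow> real" where
  "decay_const d c s p cpsi = 2 * decay_step_const d c s p * exp (decay_rate d cpsi)
     + lmp_const (1024 * c * sobolev_const d c s) 8 d s (1 - 1 / p) 1
       * sqrt (c * (128 * c * 3 powr d * 4 powr (2 * d - 4) * (decay_step_const d c s p)\<^sup>2) * 8 powr (d - 2)) + 1"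

lemma decay_const_pos: "0 \<le> c \<Longrightarrow> 0 < decay_const d c s p cpsi"
  unfolding decay_const_def
  by (intro add_nonneg_pos add_nonneg_nonneg mult_nonneg_nonneg lmp_const_nonneg)
     (auto simp: decay_step_const_def sobolev_const_def intro!: mult_nonneg_nonneg lmp_const_nonneg)

context killed_subsolution begin

theorem exponential_decay:
  assumes l: "16 * R0 \<le> ndist y" and h1: "h \<le> 1"
  shows "u y \<le> decay_const d c s p cpsi * ndist y powr (2 - d) * exp (- decay_rate d cpsi * sqrt h * ndist y)"
proof -
  define K2 where "K2 = decay_rate d cpsi"
  define l where "l = ndist y"
  define K3 where "K3 = sqrt (c * agmon_const * 8 powr (d - 2))"
  define L where "L = lmp_const Cb 8 d s (1 - 1 / p) 1"
  have K2: "0 < K2" using cpsi by (simp add: K2_def decay_rate_def)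
  have l64: "64 \<le> l" "16 * R0 \<le> l" using l R0 by (auto simp: l_def)
  have L0: "0 \<le> L" by (simp add: L_def lmp_const_nonneg)
  have K30: "0 \<le> K3" using c by (simp add: K3_def)
  have DC: "decay_const d c s p cpsi = 2 * D1 * exp K2 + L * K3 + 1"
    by (simp add: decay_const_def K2_def K3_def L_def)
  have "u y \<le> (2 * D1 * exp K2 + L * K3 + 1) * (l powr (2 - d) * exp (- (K2 * sqrt h * l)))"
  \<comment> \<open>If h l^2 < 1/4, the exponential factor is bounded below and the polynomial bound
    suffices. Otherwise h R'^2 >= 1, and h can be divided out of the weighted bound at the price of
    R'^2.\<close>
  proof (cases "h * (2 * l)\<^sup>2 < 1")
    case True
    have "sqrt h * l \<le> 1"
    proof -
      have "sqrt (h * (2 * l)\<^sup>2) \<le> 1" using True by simp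
      then have "sqrt h * (2 * l) \<le> 1" using l64 by (simp add: real_sqrt_mult)
      moreover have "0 \<le> sqrt h * l" using h l64 by simp
      ultimately show ?thesis by simp
    qed
    then have "K2 * (sqrt h * l) \<le> K2 * 1" using K2 by (intro mult_left_mono) auto
    then have "1 \<le> exp K2 * exp (- (K2 * sqrt h * l))" by (simp add: mult_exp_exp mult.assoc)
    have "u y \<le> 2 * D1 * l powr (2 - d) * 1"
      using polynomial_decay[of y] l64 R0 by (simp add: l_def)
    also have "\<dots> \<le> 2 * D1 * l powr (2 - d) * (exp K2 * exp (- (K2 * sqrt h * l)))"
      using \<open>1 \<le> _\<close> D1_nonneg by (intro mult_left_mono) auto
    also have "\<dots> = (2 * D1 * exp K2) * (l powr (2 - d) * exp (- (K2 * sqrt h * l)))" by simp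
    also have "\<dots> \<le> (2 * D1 * exp K2 + L * K3 + 1) * (l powr (2 - d) * exp (- (K2 * sqrt h * l)))"
      using L0 K30 by (intro mult_right_mono) auto
    finally show ?thesis .
  next
    case False
    \<comment> \<open>The box Q y R lies outside Q x (2 R), where the potential is large, and inside
      Q x R', whose averages are used.\<close>
    define R where "R = l / 4"
    define R' where "R' = 2 * l"
    have hR: "1 \<le> h * R'\<^sup>2" using False by (simp add: R'_def)
    have h0: "0 < h" using hR h by (metis less_eq_real_def mult_zero_left not_one_le_zero)
    have RR: "4 * R0 \<le> R" "R0 \<le> R" "R0 \<le> R'" "R = R' / 8" "0 < R" "0 < R'" using l64 R0 by (auto simp: R_def R'_def)
    obtain \<psi> where psi0: "\<And>z. z \<in> Q x R \<Longrightarrow> \<psi> z = 0" and psi1: "\<And>z. z \<notin> Q x (2 * R) \<Longrightarrow> cpsi * R \<le> \<psi> z"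
      and psi2: "\<And>z w. 0 < A z w \<Longrightarrow> \<bar>\<psi> z - \<psi> w\<bar> \<le> 1 \<and> A z w * (\<psi> z - \<psi> w)\<^sup>2 \<le> min (\<kappa> z) (\<kappa> w)"
      using potential[OF RR(2)] by blast
    define F where "F = {z \<in> Cbox R'. z \<in> Q y R}"
    define X where "X = exp (K2 * sqrt h * l)"
    have X0: "0 < X" by (simp add: X_def)
    have finF: "finite F" by (simp add: F_def)
    have far: "2 * R < ndist z" if "z \<in> Q y R" for z
    proof -
      have "l \<le> real_of_int (linfnorm (y - z)) + ndist z"
        unfolding l_def using linfnorm_triangle_diff[of y x z] by (metis of_int_add of_int_le_iff)
      then show ?thesis using that l64 by (simp add: Q_iff linfnorm_minus_commute[of y] R_def)
    qed
    have lamX: "exp (lam * (cpsi * R)) = X"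
      unfolding X_def K2_def decay_rate_def R_def by (simp add: real_sqrt_divide mult_ac)
    have "h * (\<Sum>z\<in>F. \<kappa> z * (exp (lam * \<psi> z) * u z)\<^sup>2) \<le> agmon_const * R powr (2 - d)"
    proof (rule weighted_norm_bound[OF RR(1) h1 psi0 psi2 finF])
      show "F \<inter> Q x R = {}" using far RR(5) by (fastforce simp: F_def Q_iff)
    qed
    moreover have "X\<^sup>2 * (\<Sum>z\<in>F. \<kappa> z * (u z)\<^sup>2) \<le> (\<Sum>z\<in>F. \<kappa> z * (exp (lam * \<psi> z) * u z)\<^sup>2)"
      unfolding sum_distrib_left
    proof (rule sum_mono)
      fix z assume "z \<in> F"
      then have "cpsi * R \<le> \<psi> z" using far[of z] by (intro psi1) (auto simp: F_def Q_iff)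
      then have "X \<le> exp (lam * \<psi> z)" unfolding lamX[symmetric] using h by (simp add: mult_left_mono)
      then have "(X * u z)\<^sup>2 \<le> (exp (lam * \<psi> z) * u z)\<^sup>2"
        using X0 u_nonneg[of z] by (intro power_mono mult_right_mono) auto
      then have "\<kappa> z * (X * u z)\<^sup>2 \<le> \<kappa> z * (exp (lam * \<psi> z) * u z)\<^sup>2" using \<kappa>_pos[of z] by (intro mult_left_mono) auto
      then show "X\<^sup>2 * (\<kappa> z * (u z)\<^sup>2) \<le> \<kappa> z * (exp (lam * \<psi> z) * u z)\<^sup>2" by (simp add: power_mult_distrib mult_ac)
    qed
    ultimately have "h * (X\<^sup>2 * (\<Sum>z\<in>F. \<kappa> z * (u z)\<^sup>2)) \<le> agmon_const * R powr (2 - d)"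
      using mult_left_mono[OF _ h] order_trans by blast
    then have kb: "(\<Sum>z\<in>F. \<kappa> z * (u z)\<^sup>2) \<le> agmon_const * R powr (2 - d) * R'\<^sup>2 / X\<^sup>2"
    proof -
      assume a: "h * (X\<^sup>2 * (\<Sum>z\<in>F. \<kappa> z * (u z)\<^sup>2)) \<le> agmon_const * R powr (2 - d)"
      define Y where "Y = X\<^sup>2 * (\<Sum>z\<in>F. \<kappa> z * (u z)\<^sup>2)"
      have Y0: "0 \<le> Y" unfolding Y_def using \<kappa>_pos by (intro mult_nonneg_nonneg sum_nonneg) (auto simp: less_imp_le)
      have "Y \<le> h * R'\<^sup>2 * Y" using mult_right_mono[OF hR Y0] by simp
      also have "\<dots> = h * Y * R'\<^sup>2" by simp
      also have "\<dots> \<le> agmon_const * R powr (2 - d) * R'\<^sup>2" using a by (intro mult_right_mono) (auto simp: Y_def)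
      finally show ?thesis using X0 unfolding Y_def by (simp add: field_simps)
    qed
    \<comment> \<open>Cauchy-Schwarz against the inverse killing rates turns the weighted L2 bound
      into an L1 bound, from which Markov's inequality gives a tail with exponent b = 1. This is the
      use of the moment of 1/\<kappa>.\<close>
    have su: "(\<Sum>z\<in>F. u z) \<le> K3 * R'\<^sup>2 / X"
    proof -
      have "(\<Sum>z\<in>F. u z) = (\<Sum>z\<in>F. sqrt (inverse (\<kappa> z)) * (sqrt (\<kappa> z) * u z))"
        using \<kappa>_pos by (intro sum.cong refl) (simp add: real_sqrt_inverse less_imp_neq[THEN not_sym])
      then have "(\<Sum>z\<in>F. u z)\<^sup>2 \<le> (\<Sum>z\<in>F. (sqrt (inverse (\<kappa> z)))\<^sup>2) * (\<Sum>z\<in>F. (sqrt (\<kappa> z) * u z)\<^sup>2)"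
        using Cauchy_Schwarz_ineq_sum[of "\<lambda>z. sqrt (inverse (\<kappa> z))" "\<lambda>z. sqrt (\<kappa> z) * u z" F] by simp
      also have "(\<Sum>z\<in>F. (sqrt (inverse (\<kappa> z)))\<^sup>2) = (\<Sum>z\<in>F. inverse (\<kappa> z))"
        using \<kappa>_pos by (intro sum.cong refl real_sqrt_pow2) (simp add: less_imp_le)
      also have "(\<Sum>z\<in>F. (sqrt (\<kappa> z) * u z)\<^sup>2) = (\<Sum>z\<in>F. \<kappa> z * (u z)\<^sup>2)"
        using \<kappa>_pos by (intro sum.cong refl) (simp add: power_mult_distrib less_imp_le)
      also have "(\<Sum>z\<in>F. inverse (\<kappa> z)) * (\<Sum>z\<in>F. \<kappa> z * (u z)\<^sup>2) \<le> (c * R' ^ CARD('d)) * (agmon_const * R powr (2 - d) * R'\<^sup>2 / X\<^sup>2)"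
      proof (intro mult_mono kb)
        have "(\<Sum>z\<in>F. inverse (\<kappa> z)) \<le> (\<Sum>z\<in>Cbox R'. inverse (\<kappa> z))"
          using \<kappa>_pos by (intro sum_mono2) (auto simp: F_def less_imp_le)
        then show "(\<Sum>z\<in>F. inverse (\<kappa> z)) \<le> c * R' ^ CARD('d)" using avg_kappa[OF RR(3)] by linarith
      qed (use c RR \<kappa>_pos in \<open>auto intro!: sum_nonneg mult_nonneg_nonneg simp: less_imp_le\<close>)
      also have "\<dots> = (c * agmon_const * 8 powr (d - 2)) * (R'\<^sup>2)\<^sup>2 / X\<^sup>2"
      proof -
        have "R powr (2 - d) = R' powr (2 - d) * 8 powr (d - 2)"
          unfolding RR(4) using RR(6) by (simp add: powr_divide divide_powr_uminus)
        moreover have "R' ^ CARD('d) * R' powr (2 - d) = R'\<^sup>2"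
        proof -
          have "R' ^ CARD('d) = R' powr d" using RR(6) by (simp add: powr_realpow d_eq)
          then have "R' ^ CARD('d) * R' powr (2 - d) = R' powr 2" by (simp only: powr_add[symmetric]) simp
          then show ?thesis using RR(6) by simp
        qed
        then have "(R' ^ CARD('d) * R' powr (2 - d)) * R'\<^sup>2 * y = (R'\<^sup>2)\<^sup>2 * y" for y
          by (simp only: power2_eq_square[of "R'\<^sup>2"])
        then have "R' ^ CARD('d) * (R' powr (2 - d) * (R'\<^sup>2 * y)) = (R'\<^sup>2)\<^sup>2 * y" for y
          by (simp only: mult.assoc)
        ultimately show ?thesis by (simp add: mult_ac)
      qed
      also have "\<dots> = (K3 * R'\<^sup>2 / X)\<^sup>2" using c by (simp add: K3_def power_mult_distrib power_divide)
      finally show ?thesis by (rule power2_le_imp_le) (use K30 X0 in simp)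
    qed
    define \<Theta> where "\<Theta> = K3 * R' powr (2 - d) / X"
    have \<Theta>0: "0 \<le> \<Theta>" using K30 X0 by (simp add: \<Theta>_def)
    obtain W where W: "finite W" "Q x (R' + 1) \<subseteq> W"
      "network.subsolution W A u (\<lambda>_. 0) (\<lambda>z. of_bool (z = x))" using exists_domain[of R'] by metis
    have "max (u y - 0) 0 \<le> lmp_const Cb 8 d s (1 - 1 / p) 1 * \<Theta>"
    proof (rule local_maximum[OF RR(3) W])
      show "z \<in> Cbox R'" if "0 < u z" "z \<in> Q y R" for z
      proof -
        have "ndist z \<le> real_of_int (linfnorm (z - y)) + l"
          unfolding l_def using linfnorm_triangle_diff[of z x y] by (metis of_int_add of_int_le_iff)
        then show ?thesis using that u_C[of z] l64 by (auto simp: Q_iff R_def R'_def)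
      qed
      show "x \<notin> Q y R" using l64 by (auto simp: Q_iff linfnorm_minus_commute[of x] l_def R_def)
      show "real (card {b \<in> Cbox R'. b \<in> Q y R \<and> t \<le> max (u b - 0) 0}) \<le> R' ^ CARD('d) * (\<Theta> / t) powr 1" if t: "0 < t" for t
      proof -
        let ?G = "{b \<in> Cbox R'. b \<in> Q y R \<and> t \<le> max (u b - 0) 0}"
        have "real (card ?G) * t = (\<Sum>z\<in>?G. t)" by simp
        also have "\<dots> \<le> (\<Sum>z\<in>?G. u z)" using t by (intro sum_mono) auto
        also have "\<dots> \<le> (\<Sum>z\<in>F. u z)" using finF u_nonneg by (intro sum_mono2) (auto simp: F_def)
        also have "\<dots> \<le> K3 * R'\<^sup>2 / X" by (rule su)
        also have "R'\<^sup>2 = R' ^ CARD('d) * R' powr (2 - d)"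
        proof -
          have "R' ^ CARD('d) = R' powr d" using RR(6) by (simp add: powr_realpow d_eq)
          then have "R' ^ CARD('d) * R' powr (2 - d) = R' powr 2" by (simp only: powr_add[symmetric]) simp
          then show ?thesis using RR(6) by simp
        qed
        finally have "real (card ?G) * t \<le> R' ^ CARD('d) * \<Theta>" by (simp add: \<Theta>_def mult_ac)
        then show ?thesis using t \<Theta>0 by (simp add: field_simps)
      qed
    qed (use l64 \<Theta>0 in \<open>auto simp: R_def R'_def\<close>)
    then have "u y \<le> L * \<Theta>" using u_nonneg[of y] by (simp add: L_def)
    also have "\<Theta> \<le> K3 * (l powr (2 - d) * exp (- (K2 * sqrt h * l)))"
    proof -
      have "R' powr (2 - d) \<le> l powr (2 - d)"
        unfolding R'_def using l64 dim by (intro powr_mono2') (auto simp: d_eq)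
      then have "K3 * R' powr (2 - d) / X \<le> K3 * l powr (2 - d) / X"
        using K30 X0 by (intro divide_right_mono mult_left_mono) auto
      then show ?thesis by (simp add: \<Theta>_def X_def exp_minus divide_inverse mult.assoc)
    qed
    then have "L * \<Theta> \<le> L * (K3 * (l powr (2 - d) * exp (- (K2 * sqrt h * l))))" using L0 by (intro mult_left_mono)
    also have "\<dots> = (L * K3) * (l powr (2 - d) * exp (- (K2 * sqrt h * l)))" by simp
    also have "\<dots> \<le> (2 * D1 * exp K2 + L * K3 + 1) * (l powr (2 - d) * exp (- (K2 * sqrt h * l)))"
      using D1_nonneg by (intro mult_right_mono) auto
    finally show ?thesis .
  qed
  then show ?thesis unfolding DC[symmetric] by (simp add: l_def K2_def mult.assoc)
qed

end


section \<open>Shifts and the percolation model\<close>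

definition translate_region :: "int ^ 'd \<Rightarrow> 'd region \<Rightarrow> 'd region" where
  "translate_region x S = ((\<lambda>e. (\<lambda>y. y + x) ` e) ` fst S, (\<lambda>y. y + x) ` snd S)"

definition region_le :: "'d region \<Rightarrow> 'd region \<Rightarrow> bool" where
  "region_le S S' \<longleftrightarrow> fst S \<subseteq> fst S' \<and> snd S \<subseteq> snd S'"

lemma space_conf_space:
  "space (conf_space ME MV S) = PiE (fst S) (\<lambda>_. space ME) \<times> PiE (snd S) (\<lambda>_. space MV)"
  by (simp add: conf_space_def space_pair_measure space_PiM)

lemma measurable_fst_component:
  "e \<in> fst S \<Longrightarrow> (\<lambda>\<omega>. fst \<omega> e) \<in> conf_space ME MV S \<rightarrow>\<^sub>M ME"
  unfolding conf_space_def by (rule measurable_compose[OF measurable_fst measurable_component_singleton])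

lemma measurable_snd_component:
  "x \<in> snd S \<Longrightarrow> (\<lambda>\<omega>. snd \<omega> x) \<in> conf_space ME MV S \<rightarrow>\<^sub>M MV"
  unfolding conf_space_def by (rule measurable_compose[OF measurable_snd measurable_component_singleton])

lemma measurable_into_conf_space:
  assumes "\<And>e. e \<in> fst S \<Longrightarrow> (\<lambda>w. f w e) \<in> M \<rightarrow>\<^sub>M ME" "\<And>x. x \<in> snd S \<Longrightarrow> (\<lambda>w. g w x) \<in> M \<rightarrow>\<^sub>M MV"
  shows "(\<lambda>w. (restrict (f w) (fst S), restrict (g w) (snd S))) \<in> M \<rightarrow>\<^sub>M conf_space ME MV S"
  unfolding conf_space_def using assms by (intro measurable_Pair measurable_restrict) auto

lemma measurable_restr:
  "region_le S S' \<Longrightarrow> restr S \<in> conf_space ME MV S' \<rightarrow>\<^sub>M conf_space ME MV S"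
  unfolding restr_def region_le_def
  by (intro measurable_into_conf_space measurable_fst_component measurable_snd_component) auto

lemma measurable_env:
  "region_le (translate_region x N) S \<Longrightarrow> (\<lambda>\<omega>. env N \<omega> x) \<in> conf_space ME MV S \<rightarrow>\<^sub>M conf_space ME MV N"
  unfolding env_def restr_def shift_def fst_conv snd_conv region_le_def translate_region_def
  by (intro measurable_into_conf_space measurable_fst_component measurable_snd_component) auto

lemma edges_translate: "(\<lambda>y. y + x) ` e \<in> edges \<longleftrightarrow> e \<in> edges"
proof -
  have *: "(\<lambda>y. y + x) ` e \<in> edges" if "e \<in> edges" for e x
  proof -
    obtain v w where "e = {v, w}" "l1norm (v - w) = 1" using \<open>e \<in> edges\<close> by (auto simp: edges_def)
    then show ?thesis by (auto simp: edges_iff)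
  qed
  have "(\<lambda>y. y + (- x)) ` (\<lambda>y. y + x) ` e = e" by (auto simp: image_image)
  then show ?thesis using *[of e x] *[of "(\<lambda>y. y + x) ` e" "- x"] by auto
qed

lemma region_le_full: "fst N \<subseteq> edges \<Longrightarrow> region_le (translate_region x N) full_region"
  by (auto simp: region_le_def translate_region_def full_region_def edges_translate)

lemma shift_shift: "shift x (shift z \<omega>) = shift (x + z) \<omega>"
  by (simp add: shift_def image_image add.assoc)

lemma shift_0 [simp]: "shift 0 \<omega> = \<omega>"
  by (simp add: shift_def)

lemma env_shift: "env N (shift z \<omega>) x = env N \<omega> (x + z)"
  by (simp add: env_def shift_shift)

lemma shift_in_space: "\<omega> \<in> space (Omega ME MV) \<Longrightarrow> shift z \<omega> \<in> space (Omega ME MV)"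
  unfolding space_conf_space full_region_def shift_def
  by (auto simp: PiE_iff extensional_def edges_translate)

lemma measurable_shift:
  fixes z :: "int ^ 'd::finite" and ME :: "'e measure" and MV :: "'v measure"
  shows "shift z \<in> Omega ME MV \<rightarrow>\<^sub>M Omega ME MV"
proof -
  have "(\<lambda>\<omega>. (restrict (\<lambda>e. fst \<omega> ((\<lambda>x. x + z) ` e)) (fst full_region), restrict (\<lambda>x. snd \<omega> (x + z)) (snd full_region)))
      \<in> Omega ME MV \<rightarrow>\<^sub>M Omega ME MV"
    by (intro measurable_into_conf_space measurable_fst_component measurable_snd_component)
      (auto simp: full_region_def edges_translate)
  then show ?thesis
  proof (rule measurable_cong[THEN iffD1, rotated])
    fix \<omega> :: "('e, 'v, 'd) conf" assume "\<omega> \<in> space (Omega ME MV)"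
    then show "(restrict (\<lambda>e. fst \<omega> ((\<lambda>x. x + z) ` e)) (fst full_region), restrict (\<lambda>x. snd \<omega> (x + z)) (snd full_region)) = shift z \<omega>"
      by (auto simp: shift_def full_region_def space_conf_space PiE_iff extensional_def edges_translate fun_eq_iff)
  qed
qed

lemma shift_image_eq:
  assumes "\<And>\<omega>. \<omega> \<in> A \<Longrightarrow> shift x \<omega> \<in> A" "\<And>\<omega>. \<omega> \<in> A \<Longrightarrow> shift (- x) \<omega> \<in> A"
  shows "shift x ` A = A"
proof
  show "A \<subseteq> shift x ` A"
  proof
    fix \<omega> assume "\<omega> \<in> A"
    then have "shift (- x) \<omega> \<in> A" "\<omega> = shift x (shift (- x) \<omega>)" using assms by (auto simp: shift_shift)
    then show "\<omega> \<in> shift x ` A" by blast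
  qed
qed (use assms in auto)

lemma conductance_shift: "conductance N a (shift z \<omega>) x y = conductance N a \<omega> (x + z) (y + z)"
proof -
  have "{x + z, y + z} \<in> edges \<longleftrightarrow> {x, y} \<in> edges" by (simp add: edges_iff)
  then show ?thesis by (simp add: conductance_def env_shift) (simp add: shift_def)
qed

lemma killing_rate_shift: "killing_rate N \<kappa> (shift z \<omega>) x = killing_rate N \<kappa> \<omega> (x + z)"
  by (simp add: killing_rate_def env_shift)

lemma edge_image_iff: "{v, w} = {x, y} \<longleftrightarrow> {v + z, w + z} = {x + z, y + (z :: int ^ 'd)}"
  by (auto simp: doubleton_eq_iff)

lemma open_edges_shift: "{v, w} \<in> open_edges N a (shift z \<omega>) \<longleftrightarrow> {v + z, w + z} \<in> open_edges N a \<omega>"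
proof -
  have *: "{v + z, w + z} \<in> open_edges N a \<omega>" if o: "{v, w} \<in> open_edges N a (shift z \<omega>)" for v w z \<omega>
  proof -
  from o obtain x y where "{v, w} = {x, y}" "{x, y} \<in> edges" "0 < conductance N a \<omega> (x + z) (y + z)"
    by (auto simp: open_edges_def conductance_shift)
  then show "{v + z, w + z} \<in> open_edges N a \<omega>"
    unfolding open_edges_def using edge_image_iff[of v w x y z] edges_iff[of x y] edges_iff[of "x + z" "y + z"] by auto
  qed
  show ?thesis using *[of v w z \<omega>] *[of "v + z" "w + z" "- z" "shift z \<omega>"] by (auto simp: shift_shift)
qed

lemma connected_in_shift:
  "connected_in N a (shift z \<omega>) B x y \<longleftrightarrow> connected_in N a \<omega> ((\<lambda>v. v + z) ` B) (x + z) (y + z)"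
proof -
  let ?R = "{(v, w). v \<in> B \<and> w \<in> B \<and> {v, w} \<in> open_edges N a (shift z \<omega>)}"
  let ?S = "{(v, w). v \<in> (\<lambda>v. v + z) ` B \<and> w \<in> (\<lambda>v. v + z) ` B \<and> {v, w} \<in> open_edges N a \<omega>}"
  have 1: "(x, y) \<in> ?R\<^sup>* \<Longrightarrow> (x + z, y + z) \<in> ?S\<^sup>*" for x y
  proof (induction rule: rtrancl_induct)
    case (step y w)
    then have "(y + z, w + z) \<in> ?S" by (auto simp: open_edges_shift)
    with step.IH show ?case by (rule rtrancl_into_rtrancl)
  qed simp
  have 2: "(x', y') \<in> ?S\<^sup>* \<Longrightarrow> (x' - z, y' - z) \<in> ?R\<^sup>*" for x' y'
  proof (induction rule: rtrancl_induct)
    case (step y w)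
    then have "(y - z, w - z) \<in> ?R" by (auto simp: open_edges_shift)
    with step.IH show ?case by (rule rtrancl_into_rtrancl)
  qed simp
  show ?thesis unfolding connected_in_def using 1[of x y] 2[of "x + z" "y + z"] by auto
qed

lemma component_shift: "component N a (shift z \<omega>) x = (\<lambda>y. y - z) ` component N a \<omega> (x + z)"
proof -
  have "(\<lambda>v. v + z) ` UNIV = UNIV" by (metis surj_plus_right)
  then show ?thesis
    by (auto simp: component_def connected_in_shift image_iff intro!: exI[of _ "_ + z"])
qed

lemma l1diam_translate: "l1diam ((\<lambda>y. y - z) ` A) = l1diam A"
proof -
  have "(\<lambda>y. y - z) ` A \<times> (\<lambda>y. y - z) ` A = map_prod (\<lambda>y. y - z) (\<lambda>y. y - z) ` (A \<times> A)" by (auto simp: map_prod_def)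
  then show ?thesis by (simp add: l1diam_def image_image case_prod_unfold)
qed

lemma clusters_shift: "x \<in> clusters N a r (shift z \<omega>) \<longleftrightarrow> x + z \<in> clusters N a r \<omega>"
  by (simp add: clusters_def component_shift l1diam_translate)

lemma connected_in_mono:
  assumes "connected_in N a \<omega> B x y" "B \<subseteq> B'"
  shows "connected_in N a \<omega> B' x y"
proof -
  have "{(v, w). v \<in> B \<and> w \<in> B \<and> {v, w} \<in> open_edges N a \<omega>} \<subseteq> {(v, w). v \<in> B' \<and> w \<in> B' \<and> {v, w} \<in> open_edges N a \<omega>}"
    using assms(2) by auto
  from rtrancl_mono[OF this] show ?thesis using assms(1) by (auto simp: connected_in_def)
qed

lemma connected_in_sym: "connected_in N a \<omega> B x y \<Longrightarrow> connected_in N a \<omega> B y x"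
proof -
  have "sym {(v, w). v \<in> B \<and> w \<in> B \<and> {v, w} \<in> open_edges N a \<omega>}" by (auto simp: sym_def insert_commute)
  then show "connected_in N a \<omega> B x y \<Longrightarrow> connected_in N a \<omega> B y x"
    unfolding connected_in_def by (rule symD[OF sym_rtrancl])
qed

lemma connected_in_trans: "connected_in N a \<omega> B x y \<Longrightarrow> connected_in N a \<omega> B y z \<Longrightarrow> connected_in N a \<omega> B x z"
  unfolding connected_in_def by (rule rtrancl_trans)

lemma component_eq: "connected_in N a \<omega> UNIV x y \<Longrightarrow> component N a \<omega> x = component N a \<omega> y"
  unfolding component_def using connected_in_trans connected_in_sym by blast

lemma clusters_connected: "connected_in N a \<omega> UNIV x y \<Longrightarrow> x \<in> clusters N a r \<omega> \<longleftrightarrow> y \<in> clusters N a r \<omega>"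
  using component_eq[of N a \<omega> x y] by (simp add: clusters_def)

lemma clusters_mono: "r \<le> r' \<Longrightarrow> clusters N a r' \<omega> \<subseteq> clusters N a r \<omega>"
  by (auto simp: clusters_def)


section \<open>The percolation model: measurability and clusters\<close>

locale percolation_model =
  fixes ME :: "'e::order measure" and MV :: "'v::order measure" and N :: "'d::finite region"
    and a :: "('e, 'v, 'd) cond_fun" and \<kappa> :: "('e, 'v, 'd) kill_fun"
  assumes N_edges: "fst N \<subseteq> edges"
    and cond_fun: "conductance_function ME MV N a" and kill_fun: "killing_function ME MV N \<kappa>"
begin

abbreviation "Om \<equiv> Omega ME MV :: ('e, 'v, 'd) conf measure"

lemma measurable_conductance_on:
  assumes "region_le (translate_region x N) S" "region_le (translate_region y N) S" "{x, y} \<in> edges \<Longrightarrow> {x, y} \<in> fst S"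
  shows "(\<lambda>\<omega>. conductance N a \<omega> x y) \<in> borel_measurable (conf_space ME MV S)"
proof (cases "{x, y} \<in> edges")
  case True
  have "(\<lambda>\<omega>. (env N \<omega> x, env N \<omega> y, fst \<omega> {x, y})) \<in> conf_space ME MV S \<rightarrow>\<^sub>M triple_space ME MV N"
    unfolding triple_space_def using assms True by (intro measurable_Pair measurable_env measurable_fst_component) auto
  moreover have "(\<lambda>(s, t, e). a s t e) \<in> borel_measurable (triple_space ME MV N)"
    using cond_fun by (simp add: conductance_function_def)
  ultimately have "(\<lambda>\<omega>. (\<lambda>(s, t, e). a s t e) (env N \<omega> x, env N \<omega> y, fst \<omega> {x, y})) \<in> borel_measurable (conf_space ME MV S)"
    by (rule measurable_compose)
  then show ?thesis using True by (simp add: conductance_def)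
qed (simp add: conductance_def)

lemma measurable_killing_rate_on:
  assumes "region_le (translate_region x N) S"
  shows "(\<lambda>\<omega>. killing_rate N \<kappa> \<omega> x) \<in> borel_measurable (conf_space ME MV S)"
  unfolding killing_rate_def using kill_fun
  by (intro measurable_compose[OF measurable_env[OF assms]]) (simp add: killing_function_def)

lemma measurable_conductance [measurable]: "(\<lambda>\<omega>. conductance N a \<omega> x y) \<in> borel_measurable Om"
  by (intro measurable_conductance_on region_le_full N_edges) (auto simp: full_region_def)

lemma measurable_killing_rate [measurable]: "(\<lambda>\<omega>. killing_rate N \<kappa> \<omega> x) \<in> borel_measurable Om"
  by (intro measurable_killing_rate_on region_le_full N_edges)

lemma triple_in_space:
  assumes "\<omega> \<in> space Om" "{x, y} \<in> edges"
  shows "(env N \<omega> x, env N \<omega> y, fst \<omega> {x, y}) \<in> space (triple_space ME MV N)"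
proof -
  have "(\<lambda>\<omega>. (env N \<omega> x, env N \<omega> y, fst \<omega> {x, y})) \<in> Om \<rightarrow>\<^sub>M triple_space ME MV N"
    unfolding triple_space_def using assms
    by (intro measurable_Pair measurable_env measurable_fst_component region_le_full N_edges) (auto simp: full_region_def)
  then show ?thesis using assms(1) by (rule measurable_space)
qed

lemma conductance_nonneg: "\<omega> \<in> space Om \<Longrightarrow> 0 \<le> conductance N a \<omega> x y"
  using triple_in_space[of \<omega> x y] cond_fun by (auto simp: conductance_def conductance_function_def)

lemma conductance_sym: "\<omega> \<in> space Om \<Longrightarrow> conductance N a \<omega> x y = conductance N a \<omega> y x"
  using triple_in_space[of \<omega> x y] cond_fun by (auto simp: conductance_def conductance_function_def insert_commute)

lemma killing_rate_pos: "\<omega> \<in> space Om \<Longrightarrow> 0 < killing_rate N \<kappa> \<omega> x"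
  using measurable_space[OF measurable_env[OF region_le_full[OF N_edges]], of \<omega> ME MV x] kill_fun
  by (auto simp: killing_rate_def killing_function_def)

lemma conductance_pos_edge: "0 < conductance N a \<omega> x y \<Longrightarrow> {x, y} \<in> edges"
  by (auto simp: conductance_def split: if_splits)

lemma open_edges_iff: "\<omega> \<in> space Om \<Longrightarrow> {x, y} \<in> open_edges N a \<omega> \<longleftrightarrow> 0 < conductance N a \<omega> x y"
proof -
  assume \<omega>: "\<omega> \<in> space Om"
  have "0 < conductance N a \<omega> x y" if o: "{x, y} \<in> open_edges N a \<omega>"
    using o conductance_sym[OF \<omega>, of x y] unfolding open_edges_def by (auto simp: doubleton_eq_iff)
  moreover have "{x, y} \<in> open_edges N a \<omega>" if "0 < conductance N a \<omega> x y"
    unfolding open_edges_def using that conductance_pos_edge[OF that] by blast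
  ultimately show ?thesis by blast
qed

lemma conductance_eq_0: "\<omega> \<in> space Om \<Longrightarrow> y \<notin> Q x 1 \<Longrightarrow> conductance N a \<omega> x y = 0"
  using edges_dist[of x y] by (auto simp: conductance_def Q_iff linfnorm_minus_commute[of y])

lemma open_nbrs_subset: "\<omega> \<in> space Om \<Longrightarrow> {y. {x, y} \<in> open_edges N a \<omega>} = {y \<in> Q x 1. 0 < conductance N a \<omega> x y}"
  using conductance_eq_0[of \<omega> _ x] by (auto simp: open_edges_iff) (metis less_irrefl)

lemma mu_eq: "\<omega> \<in> space Om \<Longrightarrow> mu N a \<omega> x = (\<Sum>y\<in>Q x 1. conductance N a \<omega> x y)"
  unfolding mu_def open_nbrs_subset
  using conductance_nonneg[of \<omega> x] by (intro sum.mono_neutral_left) (auto simp: not_less intro: antisym)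

lemma nu_eq: "\<omega> \<in> space Om \<Longrightarrow> nu N a \<omega> x = (\<Sum>y\<in>Q x 1. if 0 < conductance N a \<omega> x y then inverse (conductance N a \<omega> x y) else 0)"
  unfolding nu_def open_nbrs_subset by (intro sum.mono_neutral_cong_left) auto

lemma measurable_mu [measurable]: "(\<lambda>\<omega>. mu N a \<omega> x) \<in> borel_measurable Om"
proof -
  have "(\<lambda>\<omega>. \<Sum>y\<in>Q x 1. conductance N a \<omega> x y) \<in> borel_measurable Om" by measurable
  then show ?thesis by (rule measurable_cong[THEN iffD1, rotated]) (simp add: mu_eq)
qed

lemma measurable_nu [measurable]: "(\<lambda>\<omega>. nu N a \<omega> x) \<in> borel_measurable Om"
proof -
  have "(\<lambda>\<omega>. \<Sum>y\<in>Q x 1. if 0 < conductance N a \<omega> x y then inverse (conductance N a \<omega> x y) else 0) \<in> borel_measurable Om"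
    by measurable
  then show ?thesis by (rule measurable_cong[THEN iffD1, rotated]) (simp add: nu_eq)
qed

lemma sets_connected_in [measurable]: "{\<omega> \<in> space Om. connected_in N a \<omega> B x y} \<in> sets Om"
proof -
  let ?R = "\<lambda>\<omega>. {(v, w). v \<in> B \<and> w \<in> B \<and> {v, w} \<in> open_edges N a \<omega>}"
  have R: "{\<omega> \<in> space Om. (v, w) \<in> ?R \<omega>} \<in> sets Om" for v w
  proof -
    have "{\<omega> \<in> space Om. (v, w) \<in> ?R \<omega>} = (if v \<in> B \<and> w \<in> B then {\<omega> \<in> space Om. 0 < conductance N a \<omega> v w} else {})"
      by (auto simp: open_edges_iff)
    also have "\<dots> \<in> sets Om" by (auto intro!: borel_measurable_less)
    finally show ?thesis .
  qed
  have pow: "{\<omega> \<in> space Om. (x, w) \<in> (?R \<omega>) ^^ n} \<in> sets Om" for n w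
  proof (induction n arbitrary: w)
    case (Suc n)
    have "{\<omega> \<in> space Om. (x, w) \<in> (?R \<omega>) ^^ Suc n} = {\<omega> \<in> space Om. \<exists>v. (x, v) \<in> (?R \<omega>) ^^ n \<and> (v, w) \<in> ?R \<omega>}"
      by (simp only: relpow.simps) (auto simp del: mem_Collect_eq)
    also have "\<dots> \<in> sets Om"
      by (intro sets.sets_Collect_countable_Ex sets.sets_Collect_conj Suc R)
    finally show ?case .
  qed simp
  have "{\<omega> \<in> space Om. connected_in N a \<omega> B x y} = {\<omega> \<in> space Om. \<exists>n. (x, y) \<in> (?R \<omega>) ^^ n}"
    unfolding connected_in_def by (simp only: rtrancl_power)
  also have "\<dots> \<in> sets Om" by (intro sets.sets_Collect_countable_Ex pow)
  finally show ?thesis .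
qed

lemma sets_clusters [measurable]: "{\<omega> \<in> space Om. x \<in> clusters N a r \<omega>} \<in> sets Om"
proof -
  \<comment> \<open>The supremum over a random set of pairs becomes one over all pairs, with value
    -\<infinity> off the component: a countable supremum of measurable functions.\<close>
  let ?f = "\<lambda>p \<omega>. if connected_in N a \<omega> UNIV x (fst p) \<and> connected_in N a \<omega> UNIV x (snd p)
      then ereal (of_int (l1norm (fst p - snd p))) else - \<infinity>"
  have f: "?f p \<in> borel_measurable Om" for p by measurable
  have "l1diam (component N a \<omega> x) = (SUP p. ?f p \<omega>)" for \<omega>
    unfolding l1diam_def
  proof (rule antisym)
    show "(SUP (y, z)\<in>component N a \<omega> x \<times> component N a \<omega> x. ereal (of_int (l1norm (y - z)))) \<le> (SUP p. ?f p \<omega>)"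
    proof (intro SUP_least, safe)
      fix y z assume "y \<in> component N a \<omega> x" "z \<in> component N a \<omega> x"
      then show "ereal (of_int (l1norm (y - z))) \<le> (SUP p. ?f p \<omega>)"
        by (intro SUP_upper2[of "(y, z)" UNIV]) (auto simp: component_def)
    qed
    show "(SUP p. ?f p \<omega>) \<le> (SUP (y, z)\<in>component N a \<omega> x \<times> component N a \<omega> x. ereal (of_int (l1norm (y - z))))"
    proof (rule SUP_least)
      fix p
      show "?f p \<omega> \<le> (SUP (y, z)\<in>component N a \<omega> x \<times> component N a \<omega> x. ereal (of_int (l1norm (y - z))))"
        by (cases "connected_in N a \<omega> UNIV x (fst p) \<and> connected_in N a \<omega> UNIV x (snd p)")
          (auto simp: component_def case_prod_unfold mem_Times_iff intro!: SUP_upper2[of p])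
    qed
  qed
  then have "{\<omega> \<in> space Om. x \<in> clusters N a r \<omega>} = {\<omega> \<in> space Om. r \<le> (SUP p. ?f p \<omega>)}"
    by (simp add: clusters_def)
  also have "\<dots> \<in> sets Om"
    using f by (intro borel_measurable_le borel_measurable_SUP) auto
  finally show ?thesis .
qed

lemma cluster_closed: "\<omega> \<in> space Om \<Longrightarrow> x \<in> clusters N a r \<omega> \<Longrightarrow> 0 < conductance N a \<omega> x y \<Longrightarrow> y \<in> clusters N a r \<omega>"
  using clusters_connected[of N a \<omega> x y r] open_edges_iff[of \<omega> x y] by (auto simp: connected_in_def)

text \<open>A vertex without open edges forms a component of diameter 0. This provides a target for
  the chain also at h = 0, where the killing rate vanishes.\<close>

lemma infinite_cluster_nbr:
  assumes \<omega>: "\<omega> \<in> space Om" and x: "x \<in> infinite_cluster N a \<omega>"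
  shows "\<exists>y. 0 < conductance N a \<omega> x y"
proof (rule ccontr)
  assume neg: "\<not> ?thesis"
  have "component N a \<omega> x = {x}"
  proof -
    have "y = x" if "connected_in N a \<omega> UNIV x y" for y
      using that unfolding connected_in_def
    proof (cases rule: converse_rtranclE)
      case (step z)
      then show ?thesis using neg open_edges_iff[OF \<omega>] by auto
    qed simp
    then show ?thesis by (auto simp: component_def connected_in_def)
  qed
  then have "l1diam (component N a \<omega> x) = ereal 0" by (simp add: l1diam_def l1norm_def)
  then show False using x by (simp add: clusters_def)
qed

end


section \<open>Upper bounds for ergodic averages\<close>

text \<open>Greedy selection by decreasing radius. Only centres have to be covered, so doubling
  suffices: if the box of w meets the larger box of z, then w is within r z + r w <= 2 r z of
  z.\<close>

lemma vitali_covering_boxes: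
  fixes F :: "(int ^ 'd) set" and r :: "int ^ 'd \<Rightarrow> real"
  assumes "finite F" "\<And>z. z \<in> F \<Longrightarrow> 0 \<le> r z"
  shows "\<exists>G\<subseteq>F. (\<forall>z\<in>G. \<forall>w\<in>G. z \<noteq> w \<longrightarrow> Q z (r z) \<inter> Q w (r w) = {}) \<and> F \<subseteq> (\<Union>z\<in>G. Q z (2 * r z))"
  using assms
proof (induction "card F" arbitrary: F rule: less_induct)
  case less
  show ?case
  proof (cases "F = {}")
    case False
    have "Max (r ` F) \<in> r ` F" using less.prems False by (intro Max_in) auto
    then obtain z0 where z0: "z0 \<in> F" "r z0 = Max (r ` F)" by auto
    then have max: "r w \<le> r z0" if "w \<in> F" for w using that less.prems by simp
    define F' where "F' = {w \<in> F. Q w (r w) \<inter> Q z0 (r z0) = {}}"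
    have "z0 \<in> Q z0 (r z0) \<inter> Q z0 (r z0)" using less.prems(2)[OF z0(1)] by simp
    then have z0F': "z0 \<notin> F'" unfolding F'_def by blast
    moreover have "F' \<subseteq> F" by (auto simp: F'_def)
    ultimately have "F' \<subset> F" using z0(1) by blast
    then have "card F' < card F" using less.prems by (intro psubset_card_mono) auto
    then obtain G where G: "G \<subseteq> F'" "\<forall>z\<in>G. \<forall>w\<in>G. z \<noteq> w \<longrightarrow> Q z (r z) \<inter> Q w (r w) = {}" "F' \<subseteq> (\<Union>z\<in>G. Q z (2 * r z))"
      using less.hyps[of F'] less.prems by (auto simp: F'_def)
    have "F \<subseteq> (\<Union>z\<in>insert z0 G. Q z (2 * r z))"
    proof
      fix w assume w: "w \<in> F"
      show "w \<in> (\<Union>z\<in>insert z0 G. Q z (2 * r z))"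
      proof (cases "w \<in> F'")
        case False
        then obtain v where "v \<in> Q w (r w)" "v \<in> Q z0 (r z0)" using w by (auto simp: F'_def)
        then have "w \<in> Q z0 (r z0 + r w)" using Q_trans Q_sym by metis
        then have "w \<in> Q z0 (2 * r z0)" using Q_mono[of "r z0 + r w" "2 * r z0" z0] max[OF w] by auto
        then show ?thesis by simp
      qed (use G in auto)
    qed
    moreover have "\<forall>z\<in>insert z0 G. \<forall>w\<in>insert z0 G. z \<noteq> w \<longrightarrow> Q z (r z) \<inter> Q w (r w) = {}"
      using G by (auto simp: F'_def)
    ultimately show ?thesis using z0 G by (intro exI[of _ "insert z0 G"]) (auto simp: F'_def)
  qed auto
qed

locale stationary_ergodic = prob_space M
  for M :: "('e, 'v, 'd::finite) conf measure" +
  fixes ME :: "'e measure" and MV :: "'v measure"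
  assumes sets_M: "sets M = sets (Omega ME MV)"
    and stationary: "distr M (Omega ME MV) (shift x) = M"
    and ergodic: "x \<noteq> 0 \<Longrightarrow> A \<in> sets (Omega ME MV) \<Longrightarrow> shift x ` A = A \<Longrightarrow> measure M A \<in> {0, 1}"
begin

lemma space_M: "space M = space (Omega ME MV)"
  by (rule sets_eq_imp_space_eq[OF sets_M])

lemma measurable_shift_M: "shift z \<in> M \<rightarrow>\<^sub>M Omega ME MV"
  using measurable_shift measurable_cong_sets[OF sets_M refl] by blast

lemma nn_integral_shift:
  assumes "X \<in> borel_measurable (Omega ME MV)"
  shows "(\<integral>\<^sup>+\<omega>. X (shift z \<omega>) \<partial>M) = (\<integral>\<^sup>+\<omega>. X \<omega> \<partial>M)"
proof -
  have "X \<in> borel_measurable (distr M (Omega ME MV) (shift z))" using assms by simp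
  from nn_integral_distr[OF measurable_shift_M this] show ?thesis by (simp add: stationary)
qed

lemma prob_shift:
  assumes "{\<omega> \<in> space (Omega ME MV). P \<omega>} \<in> sets (Omega ME MV)"
  shows "measure M {\<omega> \<in> space M. P (shift z \<omega>)} = measure M {\<omega> \<in> space M. P \<omega>}"
proof -
  have "measure M {\<omega> \<in> space M. P \<omega>} = measure (distr M (Omega ME MV) (shift z)) {\<omega> \<in> space M. P \<omega>}"
    by (simp add: stationary)
  also have "\<dots> = measure M (shift z -` {\<omega> \<in> space M. P \<omega>} \<inter> space M)"
    using assms by (intro measure_distr measurable_shift_M) (simp add: space_M)
  also have "shift z -` {\<omega> \<in> space M. P \<omega>} \<inter> space M = {\<omega> \<in> space M. P (shift z \<omega>)}"
    using shift_in_space by (auto simp: space_M)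
  finally show ?thesis by simp
qed

lemma sum_shift_box:
  "(\<Sum>z\<in>Q x R. X (shift z (shift w \<omega>))) = (\<Sum>z\<in>Q (x + w) R. (X (shift z \<omega>) :: 'c :: comm_monoid_add))"
  unfolding Q_translate[of x w] by (simp add: sum.reindex shift_shift add.commute)

text \<open>The Hardy-Littlewood argument transferred to orbits: Vitali's covering is applied to the
  exceptional centres in Q 0 m, the outcome is integrated by stationarity, and (2 m + 1)^d is
  divided out. Of 10^d, the part 5^d comes from the doubled boxes and 2^d from boxes reaching into Q
  0 (2 m).\<close>

lemma maximal_inequality:
  fixes X :: "('e, 'v, 'd) conf \<Rightarrow> ennreal" and c :: real
  assumes X [measurable]: "X \<in> borel_measurable (Omega ME MV)" and c: "0 < c"
  shows "emeasure M {\<omega> \<in> space M. \<exists>R::nat. 1 \<le> R \<and> ennreal (c * real R ^ CARD('d)) < (\<Sum>z\<in>Q 0 (real R). X (shift z \<omega>))} * ennreal c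
    \<le> 10 ^ CARD('d) * (\<integral>\<^sup>+\<omega>. X \<omega> \<partial>M)"
proof -
  let ?S = "\<lambda>R \<omega>. (\<Sum>z\<in>Q 0 (real R). X (shift z \<omega>))"
  let ?E = "\<lambda>m. {\<omega> \<in> space M. \<exists>R::nat. 1 \<le> R \<and> R \<le> m \<and> ennreal (c * real R ^ CARD('d)) < ?S R \<omega>}"
  have Xs: "(\<lambda>\<omega>. X (shift z \<omega>)) \<in> borel_measurable M" for z
    by (rule measurable_compose[OF measurable_shift_M X])
  have S: "?S R \<in> borel_measurable M" for R using Xs by (intro borel_measurable_sum)
  have Esets: "?E m \<in> sets M" for m
  proof -
    have "?E m = (\<Union>R\<in>{1..m}. {\<omega> \<in> space M. ennreal (c * real R ^ CARD('d)) < ?S R \<omega>})" by auto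
    also have "\<dots> \<in> sets M" using S by (intro sets.finite_UN borel_measurable_less) auto
    finally show ?thesis .
  qed
  have key: "emeasure M (?E m) * ennreal c \<le> 10 ^ CARD('d) * (\<integral>\<^sup>+\<omega>. X \<omega> \<partial>M)" if m: "1 \<le> m" for m
  proof -
    let ?e = "\<lambda>\<omega>. indicator (?E m) \<omega> :: ennreal"
    have pt: "(\<Sum>z\<in>Q 0 (real m). ?e (shift z \<omega>)) * ennreal c \<le> 5 ^ CARD('d) * (\<Sum>w\<in>Q 0 (real (2 * m)). X (shift w \<omega>))"
      if \<omega>: "\<omega> \<in> space M" for \<omega>
    proof -
      define F where "F = {z \<in> Q 0 (real m). shift z \<omega> \<in> ?E m}"
      have finF: "finite F" by (simp add: F_def)
      have "\<exists>R. 1 \<le> R \<and> R \<le> m \<and> ennreal (c * real R ^ CARD('d)) < ?S R (shift z \<omega>)" if "z \<in> F" for z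
        using that by (auto simp: F_def)
      then obtain r where r: "\<And>z. z \<in> F \<Longrightarrow> 1 \<le> r z \<and> r z \<le> m \<and> ennreal (c * real (r z) ^ CARD('d)) < ?S (r z) (shift z \<omega>)"
        by metis
      obtain G where G: "G \<subseteq> F" "\<forall>z\<in>G. \<forall>w\<in>G. z \<noteq> w \<longrightarrow> Q z (real (r z)) \<inter> Q w (real (r w)) = {}"
        "F \<subseteq> (\<Union>z\<in>G. Q z (2 * real (r z)))"
        using vitali_covering_boxes[OF finF, of "\<lambda>z. real (r z)"] by auto
      have finG: "finite G" using G(1) finF by (rule finite_subset)
      have "(\<Sum>z\<in>Q 0 (real m). ?e (shift z \<omega>)) = of_nat (card F)"
      proof -
        have "(\<Sum>z\<in>Q 0 (real m). ?e (shift z \<omega>)) = (\<Sum>z\<in>Q 0 (real m). of_bool (shift z \<omega> \<in> ?E m))"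
          by (intro sum.cong) (auto simp: indicator_def)
        then show ?thesis by (simp add: F_def sum_of_bool_eq Int_def)
      qed
      also have "of_nat (card F) * ennreal c \<le> (\<Sum>z\<in>G. of_nat (5 ^ CARD('d) * r z ^ CARD('d))) * ennreal c"
      proof (rule mult_right_mono)
        have "card F \<le> card (\<Union>z\<in>G. Q z (2 * real (r z)))" using G finG by (intro card_mono) auto
        also have "\<dots> \<le> (\<Sum>z\<in>G. card (Q z (2 * real (r z))))" by (rule card_UN_le[OF finG])
        also have "\<dots> \<le> (\<Sum>z\<in>G. 5 ^ CARD('d) * r z ^ CARD('d))"
        proof (rule sum_mono)
          fix z assume "z \<in> G"
          then have "2 * (2 * r z) + 1 \<le> 5 * r z" using r[of z] G by force
          then have "(2 * (2 * r z) + 1) ^ CARD('d) \<le> (5 * r z) ^ CARD('d)" by (rule power_mono) simp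
          then show "card (Q z (2 * real (r z))) \<le> 5 ^ CARD('d) * r z ^ CARD('d)"
            using card_Q_nat[of z "2 * r z"] by (simp add: power_mult_distrib)
        qed
        finally show "of_nat (card F) \<le> (\<Sum>z\<in>G. of_nat (5 ^ CARD('d) * r z ^ CARD('d)) :: ennreal)"
          unfolding of_nat_sum[symmetric] by (rule of_nat_mono)
      qed simp
      also have "\<dots> = 5 ^ CARD('d) * (\<Sum>z\<in>G. ennreal (c * real (r z) ^ CARD('d)))"
        using c by (simp add: sum_distrib_left sum_distrib_right ennreal_mult' ennreal_of_nat_eq_real_of_nat mult_ac ennreal_power[symmetric])
      also have "\<dots> \<le> 5 ^ CARD('d) * (\<Sum>z\<in>G. \<Sum>w\<in>Q z (real (r z)). X (shift w \<omega>))"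
      proof (intro mult_left_mono sum_mono)
        fix z assume "z \<in> G"
        then have "z \<in> F" using G(1) by blast
        from r[OF this] have "ennreal (c * real (r z) ^ CARD('d)) \<le> ?S (r z) (shift z \<omega>)" by (simp add: less_imp_le)
        then show "ennreal (c * real (r z) ^ CARD('d)) \<le> (\<Sum>w\<in>Q z (real (r z)). X (shift w \<omega>))"
          by (simp only: sum_shift_box add_0_left)
      qed simp
      also have "(\<Sum>z\<in>G. \<Sum>w\<in>Q z (real (r z)). X (shift w \<omega>)) = (\<Sum>w\<in>(\<Union>z\<in>G. Q z (real (r z))). X (shift w \<omega>))"
        using G finG by (intro sum.UNION_disjoint[symmetric]) auto
      also have "\<dots> \<le> (\<Sum>w\<in>Q 0 (real (2 * m)). X (shift w \<omega>))"
      proof (rule sum_mono2)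
        show "(\<Union>z\<in>G. Q z (real (r z))) \<subseteq> Q 0 (real (2 * m))"
        proof safe
          fix z w assume z: "z \<in> G" and w: "w \<in> Q z (real (r z))"
          then have zm: "z \<in> Q 0 (real m)" "r z \<le> m" using G r[of z] by (auto simp: F_def)
          then show "w \<in> Q 0 (real (2 * m))"
            using Q_trans[OF zm(1) w] Q_mono[of "real m + real (r z)" "real (2 * m)" 0] by auto
        qed
      qed auto
      finally show ?thesis by (simp add: mult_left_mono)
    qed
    have "of_nat ((2 * m + 1) ^ CARD('d)) * (emeasure M (?E m) * ennreal c) = (\<integral>\<^sup>+\<omega>. (\<Sum>z\<in>Q 0 (real m). ?e (shift z \<omega>)) * ennreal c \<partial>M)"
    proof -
      have e: "?e \<in> borel_measurable (Omega ME MV)"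
        using Esets[of m] unfolding sets_M by (rule borel_measurable_indicator)
      have "(\<lambda>\<omega>. ?e (shift z \<omega>)) \<in> borel_measurable M" for z by (rule measurable_compose[OF measurable_shift_M e])
      then have "(\<integral>\<^sup>+\<omega>. (\<Sum>z\<in>Q 0 (real m). ?e (shift z \<omega>)) * ennreal c \<partial>M) = (\<Sum>z\<in>Q 0 (real m). (\<integral>\<^sup>+\<omega>. ?e (shift z \<omega>) \<partial>M)) * ennreal c"
        by (simp only: nn_integral_multc nn_integral_sum borel_measurable_sum)
      also have "(\<Sum>z\<in>Q 0 (real m). (\<integral>\<^sup>+\<omega>. ?e (shift z \<omega>) \<partial>M)) = of_nat ((2 * m + 1) ^ CARD('d)) * emeasure M (?E m)"
        unfolding nn_integral_shift[OF e] nn_integral_indicator[OF Esets] sum_constant card_Q_nat ..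
      finally show ?thesis by (simp add: mult.assoc)
    qed
    also have "\<dots> \<le> (\<integral>\<^sup>+\<omega>. 5 ^ CARD('d) * (\<Sum>w\<in>Q 0 (real (2 * m)). X (shift w \<omega>)) \<partial>M)"
      by (intro nn_integral_mono pt)
    also have "\<dots> = 5 ^ CARD('d) * (of_nat ((2 * (2 * m) + 1) ^ CARD('d)) * (\<integral>\<^sup>+\<omega>. X \<omega> \<partial>M))"
      by (simp only: nn_integral_cmult nn_integral_sum borel_measurable_sum Xs nn_integral_shift[OF X] sum_constant card_Q_nat)
    also have "\<dots> \<le> 5 ^ CARD('d) * (of_nat ((2 * (2 * m + 1)) ^ CARD('d)) * (\<integral>\<^sup>+\<omega>. X \<omega> \<partial>M))"
      by (intro mult_left_mono mult_right_mono of_nat_mono power_mono) auto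
    also have "\<dots> = of_nat ((2 * m + 1) ^ CARD('d)) * (10 ^ CARD('d) * (\<integral>\<^sup>+\<omega>. X \<omega> \<partial>M))"
    proof -
      have "(5::nat) ^ n * (2 * k) ^ n = k ^ n * 10 ^ n" for n k :: nat
      proof -
        have "5 * (2 * k) = k * 10" by simp
        then have "(5 * (2 * k)) ^ n = (k * 10) ^ n" by (simp only:)
        then show ?thesis by (simp only: power_mult_distrib)
      qed
      then have "(of_nat (5 ^ n * (2 * k) ^ n) :: ennreal) = of_nat (k ^ n * 10 ^ n)" for n k :: nat
        by (simp only:)
      then have "(5 :: ennreal) ^ n * of_nat ((2 * k) ^ n) = of_nat (k ^ n) * 10 ^ n" for n k :: nat
        by (simp only: of_nat_mult of_nat_power of_nat_numeral)
      then show ?thesis by (simp only: mult.assoc[symmetric])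
    qed
    finally show ?thesis
      by (subst (asm) ennreal_mult_le_mult_iff) (auto simp del: of_nat_power)
  qed
  have "emeasure M (\<Union>m. ?E (Suc m)) = (SUP m. emeasure M (?E (Suc m)))"
  proof (rule SUP_emeasure_incseq[symmetric])
    show "incseq (\<lambda>m. ?E (Suc m))" unfolding incseq_def by (blast intro: order_trans)
  qed (use Esets in blast)
  also have "(\<Union>m. ?E (Suc m)) = {\<omega> \<in> space M. \<exists>R::nat. 1 \<le> R \<and> ennreal (c * real R ^ CARD('d)) < ?S R \<omega>}"
    by (auto intro: le_SucI)
  finally have "emeasure M {\<omega> \<in> space M. \<exists>R::nat. 1 \<le> R \<and> ennreal (c * real R ^ CARD('d)) < ?S R \<omega>} * ennreal c
      = (SUP m. emeasure M (?E (Suc m)) * ennreal c)"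
    by (simp add: SUP_mult_right_ennreal)
  also have "\<dots> \<le> 10 ^ CARD('d) * (\<integral>\<^sup>+\<omega>. X \<omega> \<partial>M)" by (intro SUP_least key) simp
  finally show ?thesis .
qed

end


context stationary_ergodic begin

text \<open>The averages around some point being eventually at most \<open>c\<close> is a shift-invariant event; it has positive
  probability by the maximal inequality, hence probability one.\<close>

theorem ergodic_upper_bound:
  fixes X :: "('e, 'v, 'd) conf \<Rightarrow> ennreal"
  assumes X [measurable]: "X \<in> borel_measurable (Omega ME MV)" and fin: "(\<integral>\<^sup>+\<omega>. X \<omega> \<partial>M) < \<infinity>"
  shows "\<exists>c>0. AE \<omega> in M. \<forall>y. \<exists>R0. \<forall>R::real. R0 \<le> R \<longrightarrow> (\<Sum>z\<in>Q y R. X (shift z \<omega>)) \<le> ennreal (c * R ^ CARD('d))"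
proof -
  define J where "J = enn2real (\<integral>\<^sup>+\<omega>. X \<omega> \<partial>M)"
  have J: "(\<integral>\<^sup>+\<omega>. X \<omega> \<partial>M) = ennreal J" "0 \<le> J" using fin by (auto simp: J_def less_top)
  \<comment> \<open>Larger than 10^d J, so that the maximal inequality excludes that some average
    around 0 exceeds c with probability one.\<close>
  define c where "c = 2 * 10 ^ CARD('d) * J + 1"
  have c: "0 < c" using J by (simp add: c_def add_nonneg_pos)
  let ?S = "\<lambda>x R \<omega>. (\<Sum>z\<in>Q x (real R). X (shift z \<omega>))"
  define A where "A = {\<omega> \<in> space M. \<exists>x. \<exists>n. \<forall>R::nat. n \<le> R \<longrightarrow> ?S x R \<omega> \<le> ennreal (c * real R ^ CARD('d))}"
  have S: "?S x R \<in> borel_measurable M" for x R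
    by (intro borel_measurable_sum measurable_compose[OF measurable_shift_M X])
  have Aset: "A \<in> sets M"
    unfolding A_def using S
    by (intro sets.sets_Collect_countable_Ex sets.sets_Collect_countable_All sets.sets_Collect_imp
        sets.sets_Collect_const borel_measurable_le) auto
  have inv: "shift v \<omega> \<in> A" if "\<omega> \<in> A" for v \<omega>
  proof -
    obtain x n where xn: "\<forall>R::nat. n \<le> R \<longrightarrow> ?S x R \<omega> \<le> ennreal (c * real R ^ CARD('d))" and \<omega>: "\<omega> \<in> space M"
      using \<open>\<omega> \<in> A\<close> by (auto simp: A_def)
    have "?S (x - v) R (shift v \<omega>) = ?S x R \<omega>" for R by (simp add: sum_shift_box)
    then have "\<forall>R::nat. n \<le> R \<longrightarrow> ?S (x - v) R (shift v \<omega>) \<le> ennreal (c * real R ^ CARD('d))"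
      using xn by simp
    then show ?thesis using shift_in_space[of \<omega> ME MV v] \<omega> by (auto simp: A_def space_M)
  qed
  have "measure M A \<in> {0, 1}"
  proof (rule ergodic)
    \<comment> \<open>Any nonzero vector would do, since (P1) contains a zero-one law for each
      single translation.\<close>
    show "(\<chi> i. 1) \<noteq> (0 :: int ^ 'd)" by (simp add: vec_eq_iff)
    show "A \<in> sets (Omega ME MV)" using Aset by (simp add: sets_M)
    show "shift (\<chi> i. 1) ` A = A" by (rule shift_image_eq) (auto intro: inv)
  qed
  moreover have "measure M A \<noteq> 0"
  proof
    assume z: "measure M A = 0"
    let ?E = "{\<omega> \<in> space M. \<exists>R::nat. 1 \<le> R \<and> ennreal (c * real R ^ CARD('d)) < ?S 0 R \<omega>}"
    have Eset: "?E \<in> sets M"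
    proof -
      have "?E = (\<Union>R\<in>{1..}. {\<omega> \<in> space M. ennreal (c * real R ^ CARD('d)) < ?S 0 R \<omega>})" by auto
      also have "\<dots> \<in> sets M" using S
        by (intro sets.countable_UN image_subsetI borel_measurable_less) auto
      finally show ?thesis .
    qed
    have "space M - ?E \<subseteq> A"
    proof
      fix \<omega> assume "\<omega> \<in> space M - ?E"
      then have "\<omega> \<in> space M" "\<forall>R::nat. 1 \<le> R \<longrightarrow> ?S 0 R \<omega> \<le> ennreal (c * real R ^ CARD('d))"
        by (auto simp: not_less)
      then show "\<omega> \<in> A" unfolding A_def by blast
    qed
    then have "measure M (space M - ?E) \<le> 0" using finite_measure_mono[OF _ Aset] z by simp
    then have "1 - measure M ?E \<le> 0" using prob_compl[OF Eset] by simp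
    then have "measure M ?E = 1" using prob_le_1[of ?E] by linarith
    then have "emeasure M ?E = 1" by (simp add: emeasure_eq_measure)
    then have "ennreal c \<le> 10 ^ CARD('d) * ennreal J"
      using maximal_inequality[OF X c] J(1) by simp
    also have "\<dots> = ennreal (10 ^ CARD('d) * J)" using J(2) by (simp add: ennreal_mult' ennreal_power[symmetric])
    finally have "c \<le> 10 ^ CARD('d) * J" using J(2) by simp
    moreover have "0 \<le> 10 ^ CARD('d) * J" using J(2) by simp
    ultimately show False unfolding c_def by linarith
  qed
  ultimately have "measure M A = 1" by simp
  then have "AE \<omega> in M. \<omega> \<in> A" using Aset prob_eq_1 by blast
  \<comment> \<open>From an unspecified centre x to an arbitrary y, and from integer to real radii:
    Q y R lies in a box around x of radius at most 2 R, which costs the factor 2^d.\<close>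
  moreover have "\<exists>R0. \<forall>R::real. R0 \<le> R \<longrightarrow> (\<Sum>z\<in>Q y R. X (shift z \<omega>)) \<le> ennreal (c * 2 ^ CARD('d) * R ^ CARD('d))"
    if "\<omega> \<in> A" for \<omega> y
  proof -
    obtain x n where xn: "\<forall>R::nat. n \<le> R \<longrightarrow> ?S x R \<omega> \<le> ennreal (c * real R ^ CARD('d))"
      using \<open>\<omega> \<in> A\<close> by (auto simp: A_def)
    define k where "k = real_of_int (linfnorm (y - x))"
    have k0: "0 \<le> k" by (simp add: k_def)
    show ?thesis
    proof (intro exI allI impI)
      fix R :: real assume R: "real n + k + 2 \<le> R"
      define m where "m = nat \<lceil>R + k\<rceil>"
      have m: "R + k \<le> real m" "real m \<le> 2 * R" "n \<le> m" using R k0 unfolding m_def by linarith+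
      have "Q y R \<subseteq> Q x (real m)"
      proof
        fix z assume "z \<in> Q y R"
        then have "z \<in> Q x (k + R)" by (intro Q_trans[of y x k]) (auto simp: Q_iff k_def)
        then show "z \<in> Q x (real m)" using Q_mono[of "k + R" "real m" x] m by auto
      qed
      then have "(\<Sum>z\<in>Q y R. X (shift z \<omega>)) \<le> ?S x m \<omega>" by (intro sum_mono2) auto
      also have "\<dots> \<le> ennreal (c * real m ^ CARD('d))" using xn m by simp
      also have "\<dots> \<le> ennreal (c * (2 * R) ^ CARD('d))"
        using c m by (intro ennreal_leI mult_left_mono power_mono) auto
      finally show "(\<Sum>z\<in>Q y R. X (shift z \<omega>)) \<le> ennreal (c * 2 ^ CARD('d) * R ^ CARD('d))"
        by (simp add: power_mult_distrib mult.assoc)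
    qed
  qed
  ultimately show ?thesis using c by (intro exI[of _ "c * 2 ^ CARD('d)"]) (auto elim!: eventually_mono)
qed

end

text \<open>The exponent 1 + \<Delta> > 1 makes the error in (S1) smaller than every power, so that
  the connectivity scale has all moments.\<close>

lemma exp_neg_log_power_le:
  assumes "0 < \<Delta>" "0 < K"
  shows "\<exists>R1::real. \<forall>R\<ge>R1. exp (- (ln R powr (1 + \<Delta>))) \<le> R powr (- K)"
proof (intro exI allI impI)
  fix R assume R: "exp (max 1 (K powr (1 / \<Delta>))) \<le> R"
  then have R0: "0 < R" using exp_gt_zero less_le_trans by blast
  then have l: "max 1 (K powr (1 / \<Delta>)) \<le> ln R" using R by (metis exp_le_cancel_iff exp_ln)
  then have "(K powr (1 / \<Delta>)) powr \<Delta> \<le> ln R powr \<Delta>" using assms by (intro powr_mono2) auto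
  then have "K \<le> ln R powr \<Delta>" using assms by (simp add: powr_powr)
  then have "K * ln R \<le> ln R powr (1 + \<Delta>)" using l by (simp add: powr_add mult.commute mult_left_mono)
  then show "exp (- (ln R powr (1 + \<Delta>))) \<le> R powr (- K)" using R0 by (simp add: powr_def)
qed

section \<open>Connectivity scales and their moments\<close>

locale percolation_measure = percolation_model ME MV N a \<kappa> + stationary_ergodic M ME MV
  for ME :: "'e::order measure" and MV :: "'v::order measure" and N :: "'d::finite region"
    and a :: "('e, 'v, 'd) cond_fun" and \<kappa> :: "('e, 'v, 'd) kill_fun" and M :: "('e, 'v, 'd) conf measure" +
  fixes f :: "nat \<Rightarrow> real" and \<Delta> RS :: real
  assumes \<Delta>: "0 < \<Delta>" and f: "RS \<le> real R \<Longrightarrow> ln (real R) powr (1 + \<Delta>) \<le> f R"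
    and S1_exists: "1 \<le> R \<Longrightarrow> 1 - exp (- f R) \<le> measure M {\<omega> \<in> space M. clusters N a (ereal (real R)) \<omega> \<inter> Q 0 (real R) \<noteq> {}}"
    and S1_unique: "1 \<le> R \<Longrightarrow> 1 - exp (- f R) \<le> measure M {\<omega> \<in> space M.
        \<forall>x\<in>clusters N a (ereal (real R / 10)) \<omega> \<inter> Q 0 (real R). \<forall>y\<in>clusters N a (ereal (real R / 10)) \<omega> \<inter> Q 0 (real R).
          connected_in N a \<omega> (Q 0 (2 * real R)) x y}"
begin

definition good :: "nat \<Rightarrow> ('e, 'v, 'd) conf \<Rightarrow> bool" where
  "good R \<omega> \<longleftrightarrow> clusters N a (ereal (real R)) \<omega> \<inter> Q 0 (real R) \<noteq> {} \<and>
    (\<forall>x\<in>clusters N a (ereal (real R / 10)) \<omega> \<inter> Q 0 (real R). \<forall>y\<in>clusters N a (ereal (real R / 10)) \<omega> \<inter> Q 0 (real R).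
      connected_in N a \<omega> (Q 0 (2 * real R)) x y)"

text \<open>The radius 9 R is dictated by \<open>exists_geometry\<close>: if b lies in the path set
  of z and z has scale r >= 3, then |z - b| <= 2 (r + 2) <= 9 (r - 1), so failure of scale r - 1 at
  z makes r - 1 bad at b.\<close>

definition bad :: "nat \<Rightarrow> ('e, 'v, 'd) conf \<Rightarrow> bool" where
  "bad R \<omega> \<longleftrightarrow> (\<exists>z\<in>Q 0 (9 * real R). \<not> good R (shift z \<omega>))"

lemma sets_S1:
  "{\<omega> \<in> space M. clusters N a r \<omega> \<inter> Q 0 R \<noteq> {}} \<in> sets M"
  "{\<omega> \<in> space M. \<forall>x\<in>clusters N a r \<omega> \<inter> Q 0 R. \<forall>y\<in>clusters N a r \<omega> \<inter> Q 0 R. connected_in N a \<omega> (Q 0 R') x y} \<in> sets M"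
proof -
  have "{\<omega> \<in> space Om. \<exists>x\<in>Q 0 R. x \<in> clusters N a r \<omega>} \<in> sets Om"
    by (intro sets.sets_Collect_finite_Ex sets_clusters finite_Q)
  moreover have "{\<omega> \<in> space Om. \<exists>x\<in>Q 0 R. x \<in> clusters N a r \<omega>} = {\<omega> \<in> space M. clusters N a r \<omega> \<inter> Q 0 R \<noteq> {}}"
    by (auto simp: space_M)
  ultimately show "{\<omega> \<in> space M. clusters N a r \<omega> \<inter> Q 0 R \<noteq> {}} \<in> sets M" by (simp only: sets_M)
  have "{\<omega> \<in> space Om. \<forall>x\<in>Q 0 R. \<forall>y\<in>Q 0 R. x \<in> clusters N a r \<omega> \<and> y \<in> clusters N a r \<omega> \<longrightarrow> connected_in N a \<omega> (Q 0 R') x y} \<in> sets Om"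
    by (intro sets.sets_Collect_finite_All sets.sets_Collect_imp sets.sets_Collect_conj sets_clusters sets_connected_in finite_Q)
  moreover have "{\<omega> \<in> space Om. \<forall>x\<in>Q 0 R. \<forall>y\<in>Q 0 R. x \<in> clusters N a r \<omega> \<and> y \<in> clusters N a r \<omega> \<longrightarrow> connected_in N a \<omega> (Q 0 R') x y}
    = {\<omega> \<in> space M. \<forall>x\<in>clusters N a r \<omega> \<inter> Q 0 R. \<forall>y\<in>clusters N a r \<omega> \<inter> Q 0 R. connected_in N a \<omega> (Q 0 R') x y}"
    by (auto simp: space_M)
  ultimately show "{\<omega> \<in> space M. \<forall>x\<in>clusters N a r \<omega> \<inter> Q 0 R. \<forall>y\<in>clusters N a r \<omega> \<inter> Q 0 R. connected_in N a \<omega> (Q 0 R') x y} \<in> sets M"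
    by (simp only: sets_M)
qed

lemma sets_good: "{\<omega> \<in> space M. good R \<omega>} \<in> sets M"
  unfolding good_def by (intro sets.sets_Collect_conj sets_S1)

lemma sets_bad: "{\<omega> \<in> space M. bad R \<omega>} \<in> sets M"
proof -
  have "{\<omega> \<in> space M. \<not> good R (shift z \<omega>)} \<in> sets M" for z
  proof -
    have "{\<omega> \<in> space Om. \<not> good R \<omega>} \<in> sets Om"
      using sets_good[of R] sets.sets_Collect_neg by (simp add: sets_M space_M)
    from measurable_sets[OF measurable_shift_M this, of z] show ?thesis
      using shift_in_space by (auto simp: space_M vimage_def Int_def conj_commute elim!: back_subst[of "\<lambda>A. A \<in> sets M"])
  qed
  then show ?thesis unfolding bad_def by (intro sets.sets_Collect_finite_Ex finite_Q)
qed

lemma prob_bad_le: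
  assumes "1 \<le> R"
  shows "measure M {\<omega> \<in> space M. bad R \<omega>} \<le> (18 * real R + 1) ^ CARD('d) * (2 * exp (- f R))"
proof -
  have ng: "measure M {\<omega> \<in> space M. \<not> good R \<omega>} \<le> 2 * exp (- f R)"
  proof -
    let ?A = "{\<omega> \<in> space M. clusters N a (ereal (real R)) \<omega> \<inter> Q 0 (real R) \<noteq> {}}"
    let ?B = "{\<omega> \<in> space M. \<forall>x\<in>clusters N a (ereal (real R / 10)) \<omega> \<inter> Q 0 (real R). \<forall>y\<in>clusters N a (ereal (real R / 10)) \<omega> \<inter> Q 0 (real R).
          connected_in N a \<omega> (Q 0 (2 * real R)) x y}"
    have "{\<omega> \<in> space M. \<not> good R \<omega>} \<subseteq> (space M - ?A) \<union> (space M - ?B)" unfolding good_def by blast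
    then have "measure M {\<omega> \<in> space M. \<not> good R \<omega>} \<le> measure M ((space M - ?A) \<union> (space M - ?B))"
      using sets_S1 by (intro finite_measure_mono) blast+
    also have "\<dots> \<le> measure M (space M - ?A) + measure M (space M - ?B)"
      using sets_S1 by (intro measure_Un_le) blast+
    also have "\<dots> \<le> exp (- f R) + exp (- f R)"
      using S1_exists[OF assms] S1_unique[OF assms] prob_compl[OF sets_S1(1), of "ereal (real R)" "real R"]
        prob_compl[OF sets_S1(2), of "ereal (real R / 10)" "real R" "2 * real R"] by linarith
    finally show ?thesis by simp
  qed
  have "{\<omega> \<in> space M. bad R \<omega>} = (\<Union>z\<in>Q 0 (9 * real R). {\<omega> \<in> space M. \<not> good R (shift z \<omega>)})"
    by (auto simp: bad_def)
  also have "measure M \<dots> \<le> (\<Sum>z\<in>Q 0 (9 * real R). measure M {\<omega> \<in> space M. \<not> good R (shift z \<omega>)})"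
  proof (rule measure_UNION_le)
    fix z
    have "{\<omega> \<in> space Om. \<not> good R \<omega>} \<in> sets Om"
      using sets_good[of R] sets.sets_Collect_neg by (simp add: sets_M space_M)
    from measurable_sets[OF measurable_shift_M this, of z] show "{\<omega> \<in> space M. \<not> good R (shift z \<omega>)} \<in> sets M"
      using shift_in_space by (auto simp: space_M vimage_def Int_def conj_commute elim!: back_subst[of "\<lambda>A. A \<in> sets M"])
  qed simp
  also have "\<dots> = (\<Sum>z\<in>(Q 0 (9 * real R) :: (int ^ 'd) set). measure M {\<omega> \<in> space M. \<not> good R \<omega>})"
    using sets_good[of R] sets.sets_Collect_neg by (intro sum.cong refl prob_shift) (simp add: sets_M space_M)
  also have "\<dots> \<le> (18 * real R + 1) ^ CARD('d) * (2 * exp (- f R))"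
    unfolding sum_constant using card_Q_le[of "9 * real R" "0 :: int ^ 'd"] ng
    by (intro mult_mono) auto
  finally show ?thesis .
qed

text \<open>A measurable upper bound for the \<open>J\<close>-th power of the least scale beyond which there are no bad boxes.\<close>

definition scale_moment :: "nat \<Rightarrow> ('e, 'v, 'd) conf \<Rightarrow> ennreal" where
  "scale_moment J \<omega> = 2 ^ J + (\<Sum>R. (of_nat (R + 1)) ^ J * indicator {\<omega>. bad R \<omega>} \<omega>)"

lemma measurable_scale_moment [measurable]: "scale_moment J \<in> borel_measurable Om"
proof -
  have "(indicator {\<omega>. bad R \<omega>} :: _ \<Rightarrow> ennreal) \<in> borel_measurable M" for R
    using sets_bad[of R] by (intro borel_measurable_indicator_iff[THEN iffD2]) (simp add: Int_def conj_commute)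
  then have "(indicator {\<omega>. bad R \<omega>} :: _ \<Rightarrow> ennreal) \<in> borel_measurable Om" for R
    using measurable_cong_sets[OF sets_M refl] by blast
  then show ?thesis unfolding scale_moment_def by measurable
qed

lemma nn_integral_scale_moment: "(\<integral>\<^sup>+\<omega>. scale_moment J \<omega> \<partial>M) < \<infinity>"
proof -
  define b where "b R = (real R + 1) ^ J * measure M {\<omega> \<in> space M. bad R \<omega>}" for R
  have ind: "(indicator {\<omega>. bad R \<omega>} :: _ \<Rightarrow> ennreal) \<in> borel_measurable M" for R
    using sets_bad[of R] by (intro borel_measurable_indicator_iff[THEN iffD2]) (simp add: Int_def conj_commute)
  have "summable b"
  proof -
    \<comment> \<open>The power J is for the moment, d for the union over centres, and 2 is left
      over for summability.\<close>
    obtain R1 where R1: "\<And>R::real. R1 \<le> R \<Longrightarrow> exp (- (ln R powr (1 + \<Delta>))) \<le> R powr (- real (J + CARD('d) + 2))"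
      using exp_neg_log_power_le[OF \<Delta>, of "real (J + CARD('d) + 2)"] by auto
    define C where "C = 2 ^ J * 19 ^ CARD('d) * (2 :: real)"
    have bd: "norm (b R) \<le> C * (1 / real R ^ 2)" if R: "nat \<lceil>max 1 (max R1 RS)\<rceil> \<le> R" for R
    proof -
      have R': "1 \<le> real R" "R1 \<le> real R" "RS \<le> real R" using R by linarith+
      have "b R \<le> (2 * real R) ^ J * ((19 * real R) ^ CARD('d) * (2 * real R powr (- real (J + CARD('d) + 2))))"
        unfolding b_def
      proof (intro mult_mono power_mono)
        have "measure M {\<omega> \<in> space M. bad R \<omega>} \<le> (18 * real R + 1) ^ CARD('d) * (2 * exp (- f R))"
          using R' by (intro prob_bad_le) auto
        also have "\<dots> \<le> (19 * real R) ^ CARD('d) * (2 * real R powr (- real (J + CARD('d) + 2)))"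
        proof (intro mult_mono power_mono)
          have "exp (- f R) \<le> exp (- (ln (real R) powr (1 + \<Delta>)))" using f[OF R'(3)] by simp
          then show "exp (- f R) \<le> real R powr (- real (J + CARD('d) + 2))" using R1[OF R'(2)] by linarith
        qed (use R' in auto)
        finally show "measure M {\<omega> \<in> space M. bad R \<omega>} \<le> (19 * real R) ^ CARD('d) * (2 * real R powr (- real (J + CARD('d) + 2)))" .
      qed (use R' in auto)
      also have "real R powr (- real (J + CARD('d) + 2)) = inverse (real R ^ J * real R ^ CARD('d) * real R ^ 2)"
      proof -
        have "real R powr (- real (J + CARD('d) + 2)) = inverse (real R powr real (J + CARD('d) + 2))" by (rule powr_minus)
        also have "real R powr real (J + CARD('d) + 2) = real R ^ (J + CARD('d) + 2)" using R' by (intro powr_realpow) auto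
        finally show ?thesis by (simp only: power_add)
      qed
      also have "(2 * real R) ^ J * ((19 * real R) ^ CARD('d) * (2 * inverse (real R ^ J * real R ^ CARD('d) * real R ^ 2))) = C * (1 / real R ^ 2)"
        using R' by (simp add: C_def power_mult_distrib field_simps)
      finally show ?thesis by (simp add: b_def)
    qed
    have "summable (\<lambda>R. C * (1 / real R ^ 2))"
      using inverse_power_summable[of 2, where 'a = real] by (intro summable_mult) (simp add: inverse_eq_divide)
    then show ?thesis using bd by (rule summable_comparison_test')
  qed
  have "(\<integral>\<^sup>+\<omega>. scale_moment J \<omega> \<partial>M) = 2 ^ J + (\<Sum>R. (of_nat (R + 1)) ^ J * (\<integral>\<^sup>+\<omega>. indicator {\<omega>. bad R \<omega>} \<omega> \<partial>M))"
  proof -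
    have m: "(\<lambda>\<omega>. (of_nat (R + 1)) ^ J * indicator {\<omega>. bad R \<omega>} \<omega> :: ennreal) \<in> borel_measurable M" for R
      by (intro borel_measurable_times_ennreal ind measurable_const) simp
    have "(\<integral>\<^sup>+\<omega>. scale_moment J \<omega> \<partial>M) = (\<integral>\<^sup>+\<omega>. 2 ^ J \<partial>M) + (\<integral>\<^sup>+\<omega>. (\<Sum>R. (of_nat (R + 1)) ^ J * indicator {\<omega>. bad R \<omega>} \<omega>) \<partial>M)"
      unfolding scale_moment_def by (intro nn_integral_add borel_measurable_suminf_order m) simp
    also have "(\<integral>\<^sup>+\<omega>. 2 ^ J \<partial>M) = 2 ^ J" by (simp add: emeasure_space_1)
    also have "(\<integral>\<^sup>+\<omega>. (\<Sum>R. (of_nat (R + 1)) ^ J * indicator {\<omega>. bad R \<omega>} \<omega>) \<partial>M) = (\<Sum>R. \<integral>\<^sup>+\<omega>. (of_nat (R + 1)) ^ J * indicator {\<omega>. bad R \<omega>} \<omega> \<partial>M)"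
      by (intro nn_integral_suminf m)
    also have "\<dots> = (\<Sum>R. (of_nat (R + 1)) ^ J * (\<integral>\<^sup>+\<omega>. indicator {\<omega>. bad R \<omega>} \<omega> \<partial>M))"
      by (intro suminf_cong nn_integral_cmult ind)
    finally show ?thesis .
  qed
  also have "(\<Sum>R. (of_nat (R + 1)) ^ J * (\<integral>\<^sup>+\<omega>. indicator {\<omega>. bad R \<omega>} \<omega> \<partial>M)) = (\<Sum>R. ennreal (b R))"
  proof (rule suminf_cong)
    fix R
    have "(\<integral>\<^sup>+\<omega>. indicator {\<omega>. bad R \<omega>} \<omega> \<partial>M) = (\<integral>\<^sup>+\<omega>. indicator {\<omega> \<in> space M. bad R \<omega>} \<omega> \<partial>M)"
      by (intro nn_integral_cong) (auto split: split_indicator)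
    also have "\<dots> = ennreal (measure M {\<omega> \<in> space M. bad R \<omega>})" using sets_bad[of R] by (simp add: emeasure_eq_measure)
    finally show "(of_nat (R + 1)) ^ J * (\<integral>\<^sup>+\<omega>. indicator {\<omega>. bad R \<omega>} \<omega> \<partial>M) = ennreal (b R)"
      by (simp add: b_def ennreal_mult' ennreal_power[symmetric] ennreal_of_nat_eq_real_of_nat ennreal_plus add.commute)
  qed
  also have "(\<Sum>R. ennreal (b R)) = ennreal (\<Sum>R. b R)"
  proof (rule suminf_ennreal2[OF _ \<open>summable b\<close>])
    show "0 \<le> b R" for R by (simp add: b_def)
  qed
  also have "(2 :: ennreal) ^ J = ennreal (2 ^ J)" by (metis ennreal_numeral ennreal_power zero_le_numeral)
  finally show ?thesis by simp
qed

end


section \<open>Geometry of the infinite cluster\<close>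

context percolation_measure begin

definition eventually_not_bad :: "('e, 'v, 'd) conf \<Rightarrow> bool" where
  "eventually_not_bad \<omega> \<longleftrightarrow> (\<exists>n. 2 \<le> n \<and> (\<forall>R\<ge>n. \<not> bad R \<omega>))"

definition kscale :: "('e, 'v, 'd) conf \<Rightarrow> nat" where
  "kscale \<omega> = (LEAST n. 2 \<le> n \<and> (\<forall>R\<ge>n. \<not> bad R \<omega>))"

text \<open>This scale, taken at z, determines the size of the path set of z. In contrast,
  \<open>kscale\<close> at b controls the scales of all nearby z at once and hence the number of
  path sets that can contain b.\<close>

definition gscale :: "('e, 'v, 'd) conf \<Rightarrow> nat" where
  "gscale \<omega> = (LEAST n. 2 \<le> n \<and> (\<forall>R\<ge>n. good R \<omega>))"

lemma kscale: "eventually_not_bad \<omega> \<Longrightarrow> 2 \<le> kscale \<omega> \<and> (\<forall>R\<ge>kscale \<omega>. \<not> bad R \<omega>)"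
  unfolding eventually_not_bad_def kscale_def by (rule LeastI_ex)

text \<open>Every bad scale contributes at least 1 to the series, so only finitely many occur when
  its sum is finite.\<close>

lemma eventually_not_bad:
  assumes "scale_moment J \<omega> < \<infinity>"
  shows "eventually_not_bad \<omega>"
proof -
  have "finite {R. bad R \<omega>}"
  proof (rule ccontr)
    assume inf: "infinite {R. bad R \<omega>}"
    let ?s = "\<Sum>R. (of_nat (R + 1)) ^ J * indicator {\<omega>. bad R \<omega>} \<omega> :: ennreal"
    have "of_nat n \<le> ?s" for n
    proof -
      obtain F where F: "F \<subseteq> {R. bad R \<omega>}" "finite F" "card F = n"
        using infinite_arbitrarily_large[OF inf] by blast
      have "(of_nat n :: ennreal) = (\<Sum>R\<in>F. 1)" using F by simp
      also have "\<dots> \<le> (\<Sum>R\<in>F. (of_nat (R + 1)) ^ J * indicator {\<omega>. bad R \<omega>} \<omega>)"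
      proof (rule sum_mono)
        fix R assume "R \<in> F"
        then have "bad R \<omega>" using F by auto
        moreover have "(1 :: ennreal) \<le> (of_nat (R + 1)) ^ J" by (rule one_le_power) simp
        ultimately show "(1 :: ennreal) \<le> (of_nat (R + 1)) ^ J * indicator {\<omega>. bad R \<omega>} \<omega>" by simp
      qed
      also have "\<dots> \<le> ?s" using F by (intro sum_le_suminf) auto
      finally show ?thesis .
    qed
    then have "(SUP n. of_nat n) \<le> ?s" by (intro SUP_least)
    then have "?s = \<top>" by (simp only: ennreal_SUP_of_nat_eq_top top_unique)
    then show False using assms by (simp add: scale_moment_def)
  qed
  then obtain m where "\<forall>R\<in>{R. bad R \<omega>}. R \<le> m" using finite_nat_set_iff_bounded_le by auto
  then have "\<forall>R\<ge>m + 2. \<not> bad R \<omega>" by force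
  then show ?thesis unfolding eventually_not_bad_def by (intro exI[of _ "m + 2"]) auto
qed

text \<open>By minimality the scale \<open>kscale \<omega> - 1\<close> is bad, and the summand of
  that index is exactly the power in question; the constant 2^J covers the case that the minimum is
  2.\<close>

lemma kscale_power_le:
  assumes "eventually_not_bad \<omega>"
  shows "of_nat (kscale \<omega>) ^ J \<le> scale_moment J \<omega>"
proof (cases "kscale \<omega> = 2")
  case False
  then have k: "3 \<le> kscale \<omega>" using kscale[OF assms] by simp
  have "bad (kscale \<omega> - 1) \<omega>"
  proof (rule ccontr)
    assume nb: "\<not> bad (kscale \<omega> - 1) \<omega>"
    have "\<forall>R\<ge>kscale \<omega> - 1. \<not> bad R \<omega>"
    proof (intro allI impI)
      fix R assume "kscale \<omega> - 1 \<le> R"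
      then show "\<not> bad R \<omega>" using nb kscale[OF assms] by (cases "R = kscale \<omega> - 1") auto
    qed
    then have "2 \<le> kscale \<omega> - 1 \<and> (\<forall>R\<ge>kscale \<omega> - 1. \<not> bad R \<omega>)" using k by auto
    then have "(LEAST n. 2 \<le> n \<and> (\<forall>R\<ge>n. \<not> bad R \<omega>)) \<le> kscale \<omega> - 1" by (rule Least_le)
    then show False using k by (simp add: kscale_def)
  qed
  define g where "g R = (of_nat (R + 1)) ^ J * (indicator {\<omega>. bad R \<omega>} \<omega> :: ennreal)" for R
  have "of_nat (kscale \<omega>) ^ J = g (kscale \<omega> - 1)"
    using k \<open>bad (kscale \<omega> - 1) \<omega>\<close> by (simp add: g_def)
  also have "\<dots> \<le> suminf g" using sum_le_suminf[of g "{kscale \<omega> - 1}"] by simp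
  also have "\<dots> \<le> scale_moment J \<omega>" unfolding scale_moment_def g_def[symmetric] by simp
  finally show ?thesis .
qed (simp add: scale_moment_def)

lemma not_bad_good: "\<not> bad R \<omega> \<Longrightarrow> z \<in> Q 0 (9 * real R) \<Longrightarrow> good R (shift z \<omega>)"
  by (auto simp: bad_def)

lemma gscale:
  assumes "eventually_not_bad \<omega>"
  shows "2 \<le> gscale \<omega> \<and> (\<forall>R\<ge>gscale \<omega>. good R \<omega>)"
proof -
  have "good R \<omega>" if "\<not> bad R \<omega>" for R using not_bad_good[OF that, of 0] by simp
  then have "\<exists>n. 2 \<le> n \<and> (\<forall>R\<ge>n. good R \<omega>)" using assms unfolding eventually_not_bad_def by blast
  then show ?thesis unfolding gscale_def by (rule LeastI_ex)
qed

lemma gscale_minimal: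
  assumes "eventually_not_bad \<omega>" "3 \<le> gscale \<omega>"
  shows "\<not> good (gscale \<omega> - 1) \<omega>"
proof
  assume g: "good (gscale \<omega> - 1) \<omega>"
  have "\<forall>R\<ge>gscale \<omega> - 1. good R \<omega>"
  proof (intro allI impI)
    fix R assume "gscale \<omega> - 1 \<le> R"
    then show "good R \<omega>" using g gscale[OF assms(1)] by (cases "R = gscale \<omega> - 1") auto
  qed
  then have "2 \<le> gscale \<omega> - 1 \<and> (\<forall>R\<ge>gscale \<omega> - 1. good R \<omega>)" using assms by auto
  then have "(LEAST n. 2 \<le> n \<and> (\<forall>R\<ge>n. good R \<omega>)) \<le> gscale \<omega> - 1" by (rule Least_le)
  then show False using assms(2) by (simp add: gscale_def)
qed

lemma good_connects:
  assumes "good R (shift z \<omega>)" "x \<in> clusters N a (ereal (real R / 10)) \<omega>" "y \<in> clusters N a (ereal (real R / 10)) \<omega>"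
    "x \<in> Q z (real R)" "y \<in> Q z (real R)"
  shows "connected_in N a \<omega> (Q z (2 * real R)) x y"
proof -
  have "x - z \<in> clusters N a (ereal (real R / 10)) (shift z \<omega>) \<inter> Q 0 (real R)"
    "y - z \<in> clusters N a (ereal (real R / 10)) (shift z \<omega>) \<inter> Q 0 (real R)"
    using assms by (auto simp: clusters_shift Q_iff)
  then have "connected_in N a (shift z \<omega>) (Q 0 (2 * real R)) (x - z) (y - z)"
    using assms(1) by (auto simp: good_def)
  moreover have "(\<lambda>v. v + z) ` Q 0 (2 * real R) = Q z (2 * real R)"
    using Q_translate[of 0 z "2 * real R"] by (simp add: add.commute[of _ z] image_def)
  ultimately show ?thesis by (simp add: connected_in_shift)
qed

lemma good_exists:
  assumes "good R (shift z \<omega>)"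
  shows "\<exists>b\<in>Q z (real R). b \<in> clusters N a (ereal (real R)) \<omega>"
proof -
  obtain b where "b \<in> clusters N a (ereal (real R)) (shift z \<omega>)" "b \<in> Q 0 (real R)"
    using assms by (auto simp: good_def)
  then show ?thesis by (intro bexI[of _ "b + z"]) (auto simp: clusters_shift Q_iff)
qed

text \<open>A good scale R provides a cluster of diameter R, and uniqueness joins it to the cluster
  of b as soon as the latter has diameter R / 10. By doubling R, the cluster of b has diameter at
  least 2^j n for every j.\<close>

lemma infinite_cluster_near:
  assumes g: "\<forall>R\<ge>n. good R (shift z \<omega>)" and n: "2 \<le> n"
  shows "infinite_cluster N a \<omega> \<inter> Q z (real n) \<noteq> {}"
proof -
  obtain b where b: "b \<in> Q z (real n)" "b \<in> clusters N a (ereal (real n)) \<omega>"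
    using good_exists g by blast
  have "b \<in> clusters N a (ereal (real (2 ^ j * n))) \<omega>" for j
  proof (induction j)
    case (Suc j)
    let ?R = "2 ^ Suc j * n"
    have "1 * n \<le> ?R" by (intro mult_right_mono) auto
    then have R: "n \<le> ?R" by simp
    then have gR: "good ?R (shift z \<omega>)" using g by blast
    obtain b' where b': "b' \<in> Q z (real ?R)" "b' \<in> clusters N a (ereal (real ?R)) \<omega>" using good_exists[OF gR] by blast
    have "clusters N a (ereal (real (2 ^ j * n))) \<omega> \<subseteq> clusters N a (ereal (real ?R / 10)) \<omega>"
      by (rule clusters_mono) simp
    then have "b \<in> clusters N a (ereal (real ?R / 10)) \<omega>" using Suc by blast
    moreover have "b' \<in> clusters N a (ereal (real ?R / 10)) \<omega>"
      using b'(2) clusters_mono[of "ereal (real ?R / 10)" "ereal (real ?R)" N a \<omega>] by auto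
    moreover have "b \<in> Q z (real ?R)" using b(1) R Q_mono[of "real n" "real ?R" z] by (simp only: of_nat_le_iff) blast
    ultimately have "connected_in N a \<omega> (Q z (2 * real ?R)) b b'" using b'(1) by (intro good_connects[OF gR])
    then have "connected_in N a \<omega> UNIV b b'" by (rule connected_in_mono) simp
    then show ?case using clusters_connected b'(2) by blast
  qed (use b in simp)
  then have le: "ereal (real (2 ^ j * n)) \<le> l1diam (component N a \<omega> b)" for j by (simp only: clusters_def mem_Collect_eq)
  have "l1diam (component N a \<omega> b) = \<infinity>"
  proof (rule ccontr)
    assume "l1diam (component N a \<omega> b) \<noteq> \<infinity>"
    then obtain r where r: "l1diam (component N a \<omega> b) \<le> ereal r"
      by (metis ereal_top le_cases linear order_refl PInfty_neq_ereal(1) ereal_cases less_eq_ereal_def ereal_infty_less_eq2(2))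
    obtain j where "r < 2 ^ j" using real_arch_pow[of 2 r] by auto
    also have "(2 :: real) ^ j * 1 \<le> 2 ^ j * real n" using n by (intro mult_left_mono) auto
    finally have "r < real (2 ^ j * n)" by simp
    moreover have "ereal (real (2 ^ j * n)) \<le> ereal r" using le r order_trans by blast
    ultimately show False by simp
  qed
  then have "b \<in> infinite_cluster N a \<omega>" by (simp add: clusters_def)
  then show ?thesis using b(1) by blast
qed

lemma infinite_cluster_subset: "infinite_cluster N a \<omega> \<subseteq> clusters N a r \<omega>"
  by (rule clusters_mono) simp

lemma connected_within_cluster:
  assumes "\<omega> \<in> space Om" "connected_in N a \<omega> D p q" "p \<in> infinite_cluster N a \<omega>"
  shows "(p, q) \<in> {(v, w). v \<in> infinite_cluster N a \<omega> \<inter> D \<and> w \<in> infinite_cluster N a \<omega> \<inter> D \<and> 0 < conductance N a \<omega> v w}\<^sup>*"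
proof -
  let ?S = "{(v, w). v \<in> infinite_cluster N a \<omega> \<inter> D \<and> w \<in> infinite_cluster N a \<omega> \<inter> D \<and> 0 < conductance N a \<omega> v w}"
  have "(p, q) \<in> ?S\<^sup>* \<and> q \<in> infinite_cluster N a \<omega>"
    using assms(2) unfolding connected_in_def
  proof (induction rule: rtrancl_induct)
    case (step y z)
    then have "0 < conductance N a \<omega> y z" using open_edges_iff[OF assms(1)] by auto
    then show ?case using step cluster_closed[OF assms(1), of y \<infinity> z]
      by (auto intro: rtrancl_into_rtrancl)
  qed (use assms in simp)
  then show ?thesis by blast
qed

text \<open>\<pi> z is a nearest point of the infinite cluster; the scale of z bounds its distance
  and the size of a box in which projections of neighbours are joined. Conversely, b in B z forces z
  to lie within 4 \<open>kscale\<close> of b: a much larger scale at z would, by its minimality,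
  make a large scale bad at b.\<close>

theorem exists_geometry:
  assumes \<omega>: "\<omega> \<in> space Om" and fin: "\<And>z. eventually_not_bad (shift z \<omega>)"
  shows "\<exists>\<pi> B Z. (\<forall>z. z \<in> infinite_cluster N a \<omega> \<longrightarrow> \<pi> z = z) \<and> (\<forall>z. \<pi> z \<in> B z) \<and>
    (\<forall>z i. (\<pi> z, \<pi> (z + axis i 1)) \<in> {(v, w). v \<in> B z \<and> w \<in> B z \<and> 0 < conductance N a \<omega> v w}\<^sup>*) \<and>
    (\<forall>z. finite (B z)) \<and> (\<forall>b z. b \<in> B z \<longrightarrow> z \<in> Z b \<and> b \<in> infinite_cluster N a \<omega>) \<and>
    (\<forall>b. finite (Z b)) \<and> (\<forall>b. real (card (Z b)) \<le> (9 * real (kscale (shift b \<omega>))) ^ CARD('d))"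
proof -
  let ?C = "infinite_cluster N a \<omega>"
  define r where "r z = gscale (shift z \<omega>)" for z
  have r: "2 \<le> r z" "\<And>R. r z \<le> R \<Longrightarrow> good R (shift z \<omega>)" for z using gscale[OF fin] by (auto simp: r_def)
  have near: "?C \<inter> Q z (real (r z)) \<noteq> {}" for z
    using r[of z] by (intro infinite_cluster_near) auto
  define \<pi> where "\<pi> z = arg_min (\<lambda>p. nat (linfnorm (p - z))) (\<lambda>p. p \<in> ?C)" for z
  have \<pi>: "\<pi> z \<in> ?C" "\<And>p. p \<in> ?C \<Longrightarrow> linfnorm (\<pi> z - z) \<le> linfnorm (p - z)" for z
  proof -
    obtain p0 where "p0 \<in> ?C" using near by blast
    then have "\<pi> z \<in> ?C \<and> (\<forall>p. p \<in> ?C \<longrightarrow> nat (linfnorm (\<pi> z - z)) \<le> nat (linfnorm (p - z)))"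
      unfolding \<pi>_def by (rule arg_min_nat_lemma)
    then show "\<pi> z \<in> ?C" "\<And>p. p \<in> ?C \<Longrightarrow> linfnorm (\<pi> z - z) \<le> linfnorm (p - z)"
      by (blast, metis linfnorm_nonneg nat_le_eq_zle)
  qed
  have \<pi>_id: "\<pi> z = z" if "z \<in> ?C" for z
    using \<pi>(2)[OF that, of z] linfnorm_nonneg[of "\<pi> z - z"] by (simp add: antisym linfnorm_eq_0_iff[symmetric, of "\<pi> z - z"] del: linfnorm_nonneg)
  have \<pi>_near: "linfnorm (\<pi> z - z) \<le> int (r z)" for z
  proof -
    obtain p where "p \<in> ?C" "p \<in> Q z (real (r z))" using near[of z] by blast
    then show ?thesis using \<pi>(2)[of p z] by (simp add: Q_iff)
  qed
  \<comment> \<open>The projection of a neighbour of z is at distance at most r z + 2 from z, and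
    connections at a good scale use a box of twice the radius.\<close>
  define B where "B z = ?C \<inter> Q z (2 * real (r z + 2))" for z
  define Z where "Z b = Q b (4 * real (kscale (shift b \<omega>)))" for b
  have inB: "\<pi> z \<in> B z" for z
    using \<pi>(1)[of z] \<pi>_near[of z] by (simp add: B_def Q_iff)
  have paths: "(\<pi> z, \<pi> (z + axis i 1)) \<in> {(v, w). v \<in> B z \<and> w \<in> B z \<and> 0 < conductance N a \<omega> v w}\<^sup>*" for z i
  proof -
    have ax: "linfnorm (axis i 1 :: int ^ 'd) \<le> 1" by (auto simp: linfnorm_le_iff axis_def)
    let ?z = "z + axis i 1"
    have "linfnorm (\<pi> ?z - ?z) \<le> linfnorm (\<pi> z - ?z)" by (rule \<pi>(2)[OF \<pi>(1)])
    also have "\<dots> \<le> linfnorm (\<pi> z - z) + linfnorm (z - ?z)" by (rule linfnorm_triangle_diff)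
    also have "linfnorm (z - ?z) \<le> 1" using ax linfnorm_minus_commute[of z ?z] by simp
    finally have "linfnorm (\<pi> ?z - ?z) \<le> int (r z) + 1" using \<pi>_near[of z] by simp
    then have "linfnorm (\<pi> ?z - z) \<le> int (r z) + 2" using linfnorm_triangle_diff[of "\<pi> ?z" z ?z] ax by simp
    then have "real_of_int (linfnorm (\<pi> ?z - z)) \<le> real (r z + 2)" by linarith
    then have q: "\<pi> ?z \<in> Q z (real (r z + 2))" by (simp add: Q_iff)
    have "real_of_int (linfnorm (\<pi> z - z)) \<le> real (r z + 2)" using \<pi>_near[of z] by linarith
    then have p: "\<pi> z \<in> Q z (real (r z + 2))" by (simp add: Q_iff)
    have "connected_in N a \<omega> (Q z (2 * real (r z + 2))) (\<pi> z) (\<pi> ?z)"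
    proof (rule good_connects[OF _ _ _ p q])
      show "good (r z + 2) (shift z \<omega>)" by (rule r(2)) simp
      show "\<pi> z \<in> clusters N a (ereal (real (r z + 2) / 10)) \<omega>"
        by (rule subsetD[OF infinite_cluster_subset \<pi>(1)])
      show "\<pi> ?z \<in> clusters N a (ereal (real (r z + 2) / 10)) \<omega>"
        by (rule subsetD[OF infinite_cluster_subset \<pi>(1)])
    qed
    from connected_within_cluster[OF \<omega> this \<pi>(1)] show ?thesis by (simp add: B_def)
  qed
  have sub: "z \<in> Z b \<and> b \<in> ?C" if "b \<in> B z" for b z
  proof -
    have bC: "b \<in> ?C" and bz: "b \<in> Q z (2 * real (r z + 2))" using that by (auto simp: B_def)
    have K: "2 \<le> kscale (shift b \<omega>)" using kscale[OF fin] by blast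
    have "r z + 2 \<le> 2 * kscale (shift b \<omega>)"
    proof (cases "r z = 2")
      case False
      then have r3: "3 \<le> r z" using r(1)[of z] by simp
      have "\<not> good (r z - 1) (shift z \<omega>)" using gscale_minimal[OF fin] r3 by (simp add: r_def)
      moreover have "z - b \<in> Q 0 (9 * real (r z - 1))"
      proof -
        have "real_of_int (linfnorm (z - b)) \<le> 2 * real (r z + 2)" using bz by (simp add: Q_iff linfnorm_minus_commute)
        also have "\<dots> \<le> 9 * real (r z - 1)" using r3 by (simp add: of_nat_diff)
        finally show ?thesis by (simp add: Q_iff)
      qed
      ultimately have "bad (r z - 1) (shift b \<omega>)"
        unfolding bad_def by (intro bexI[of _ "z - b"]) (simp_all add: shift_shift)
      then have "r z - 1 < kscale (shift b \<omega>)" using kscale[OF fin, of b] not_less by blast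
      then show ?thesis using r(1)[of z] by linarith
    qed (use K in simp)
    then have "real (r z + 2) \<le> real (2 * kscale (shift b \<omega>))" by (simp only: of_nat_le_iff)
    then have "2 * real (r z + 2) \<le> 4 * real (kscale (shift b \<omega>))" by simp
    then have "z \<in> Z b" unfolding Z_def using bz Q_sym Q_mono by blast
    then show ?thesis using bC by simp
  qed
  have cZ: "real (card (Z b)) \<le> (9 * real (kscale (shift b \<omega>))) ^ CARD('d)" for b
  proof -
    have "real (card (Z b)) \<le> (2 * (4 * real (kscale (shift b \<omega>))) + 1) ^ CARD('d)"
      unfolding Z_def by (rule card_Q_le) simp
    also have "\<dots> \<le> (9 * real (kscale (shift b \<omega>))) ^ CARD('d)"
    proof (rule power_mono)
      have "2 \<le> kscale (shift b \<omega>)" using kscale[OF fin] by blast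
      then show "2 * (4 * real (kscale (shift b \<omega>))) + 1 \<le> 9 * real (kscale (shift b \<omega>))" by linarith
    qed simp
    finally show ?thesis .
  qed
  show ?thesis
  proof (rule exI[of _ \<pi>], rule exI[of _ B], rule exI[of _ Z], intro conjI allI impI)
    show "\<pi> z = z" if "z \<in> ?C" for z using that by (rule \<pi>_id)
    show "\<pi> z \<in> B z" for z by (rule inB)
    show "(\<pi> z, \<pi> (z + axis i 1)) \<in> {(v, w). v \<in> B z \<and> w \<in> B z \<and> 0 < conductance N a \<omega> v w}\<^sup>*" for z i by (rule paths)
    show "finite (B z)" for z by (simp add: B_def)
    show "z \<in> Z b" if "b \<in> B z" for b z using sub[OF that] by blast
    show "b \<in> ?C" if "b \<in> B z" for b z using sub[OF that] by blast
    show "finite (Z b)" for b by (simp add: Z_def)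
    show "real (card (Z b)) \<le> (9 * real (kscale (shift b \<omega>))) ^ CARD('d)" for b by (rule cZ)
  qed
qed

end


section \<open>First passage percolation\<close>

text \<open>\<open>slow t z L s\<close> says that the first passage time from \<open>z\<close> to distance \<open>L\<close> with edge weights \<open>t\<close>
  is at least \<open>s\<close>; it is stated in terms of a potential instead of paths.\<close>

definition slow :: "(int ^ 'd \<Rightarrow> int ^ 'd \<Rightarrow> real) \<Rightarrow> int ^ 'd::finite \<Rightarrow> nat \<Rightarrow> real \<Rightarrow> bool" where
  "slow t z L s \<longleftrightarrow> (\<exists>\<psi>. \<psi> z = 0 \<and> (\<forall>w. 0 \<le> \<psi> w \<and> \<psi> w \<le> s) \<and> (\<forall>w. int L \<le> linfnorm (w - z) \<longrightarrow> \<psi> w = s) \<and>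
    (\<forall>x y. {x, y} \<in> edges \<longrightarrow> x \<in> Q z L \<longrightarrow> y \<in> Q z L \<longrightarrow> \<bar>\<psi> x - \<psi> y\<bar> \<le> t x y))"

lemma Q_of_nat_iff: "x \<in> Q z (real L) \<longleftrightarrow> linfnorm (x - z) \<le> int L"
  unfolding Q_iff by linarith

lemma slow_mono:
  assumes "slow t z L s" "\<And>x y. {x, y} \<in> edges \<Longrightarrow> x \<in> Q z L \<Longrightarrow> y \<in> Q z L \<Longrightarrow> t x y \<le> t' x y"
  shows "slow t' z L s"
proof -
  obtain \<psi> where "\<psi> z = 0 \<and> (\<forall>w. 0 \<le> \<psi> w \<and> \<psi> w \<le> s) \<and> (\<forall>w. int L \<le> linfnorm (w - z) \<longrightarrow> \<psi> w = s) \<and>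
    (\<forall>x y. {x, y} \<in> edges \<longrightarrow> x \<in> Q z L \<longrightarrow> y \<in> Q z L \<longrightarrow> \<bar>\<psi> x - \<psi> y\<bar> \<le> t x y)" using assms(1) by (auto simp: slow_def)
  then show ?thesis unfolding slow_def using assms(2) by (intro exI[of _ \<psi>]) (meson order_trans)
qed

lemma slow_scale:
  assumes "slow t z L s" "0 \<le> s'" "s' \<le> s"
  shows "slow t z L s'"
proof (cases "s = 0")
  case False
  then have s: "0 < s" using assms by simp
  define k where "k = s' / s"
  have k: "0 \<le> k" "k \<le> 1" "k * s = s'" using assms s by (auto simp: k_def)
  obtain \<psi> where \<psi>: "\<psi> z = 0" "\<forall>w. 0 \<le> \<psi> w \<and> \<psi> w \<le> s" "\<forall>w. int L \<le> linfnorm (w - z) \<longrightarrow> \<psi> w = s"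
    "\<forall>x y. {x, y} \<in> edges \<longrightarrow> x \<in> Q z L \<longrightarrow> y \<in> Q z L \<longrightarrow> \<bar>\<psi> x - \<psi> y\<bar> \<le> t x y" using assms(1) by (auto simp: slow_def)
  have "\<bar>k * \<psi> x - k * \<psi> y\<bar> \<le> t x y" if "{x, y} \<in> edges" "x \<in> Q z L" "y \<in> Q z L" for x y
  proof -
    have "\<bar>k * \<psi> x - k * \<psi> y\<bar> = k * \<bar>\<psi> x - \<psi> y\<bar>" using k by (simp add: right_diff_distrib[symmetric] abs_mult)
    also have "\<dots> \<le> 1 * \<bar>\<psi> x - \<psi> y\<bar>" using k by (intro mult_right_mono) auto
    also have "\<dots> \<le> t x y" using \<psi>(4) that by simp
    finally show ?thesis .
  qed
  moreover have "0 \<le> k * \<psi> w \<and> k * \<psi> w \<le> s'" for w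
    using \<psi>(2) k mult_left_mono[of "\<psi> w" s k] by auto
  ultimately show ?thesis unfolding slow_def using \<psi> k by (intro exI[of _ "\<lambda>w. k * \<psi> w"]) auto
qed (use assms in auto)

lemma slow_base:
  assumes "\<And>x y. {x, y} \<in> edges \<Longrightarrow> x \<in> Q z L \<Longrightarrow> y \<in> Q z L \<Longrightarrow> s \<le> t x y" "0 \<le> s" "1 \<le> L"
  shows "slow t z L s"
  unfolding slow_def
proof (intro exI[of _ "\<lambda>w. if w = z then 0 else s"] conjI allI impI)
  fix x y assume e: "{x, y} \<in> edges" "x \<in> Q z L" "y \<in> Q z L"
  then show "\<bar>(if x = z then 0 else s) - (if y = z then 0 else s)\<bar> \<le> t x y"
    using assms(1)[OF e] assms(2) by auto
qed (use assms in auto)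

text \<open>The first passage potential from the sphere of radius j L: the minimum of the potentials
  of its points. Edges have length one, so none jumps over the sphere, and the function can be set
  to zero inside.\<close>

lemma shell_potential:
  fixes z :: "int ^ 'd::finite" and s s' :: real and t :: "int ^ 'd \<Rightarrow> int ^ 'd \<Rightarrow> real"
  assumes L: "1 \<le> L" and s: "0 \<le> s" and t: "\<And>x y. 0 \<le> t x y"
    and sl: "\<And>w. linfnorm (w - z) = int j * int L \<Longrightarrow> slow t w L s"
  shows "\<exists>\<phi>. (\<forall>v. 0 \<le> \<phi> v \<and> \<phi> v \<le> s) \<and> (\<forall>v. linfnorm (v - z) \<le> int j * int L \<longrightarrow> \<phi> v = 0) \<and>
    (\<forall>v. int (j + 1) * int L \<le> linfnorm (v - z) \<longrightarrow> \<phi> v = s) \<and>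
    (\<forall>x y. {x, y} \<in> edges \<longrightarrow> \<bar>\<phi> x - \<phi> y\<bar> \<le> t x y)"
proof -
  define S where "S = {w. linfnorm (w - z) = int j * int L}"
  have finS: "finite S"
    by (rule finite_subset[OF _ finite_Q[of z "real (j * L)"]]) (auto simp: S_def Q_iff)
  have "\<forall>w\<in>S. \<exists>\<psi>. \<psi> w = 0 \<and> (\<forall>v. 0 \<le> \<psi> v \<and> \<psi> v \<le> s) \<and> (\<forall>v. int L \<le> linfnorm (v - w) \<longrightarrow> \<psi> v = s) \<and>
    (\<forall>x y. {x, y} \<in> edges \<longrightarrow> x \<in> Q w L \<longrightarrow> y \<in> Q w L \<longrightarrow> \<bar>\<psi> x - \<psi> y\<bar> \<le> t x y)"
    using sl by (auto simp: S_def slow_def)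
  from bchoice[OF this] obtain \<psi> where P: "\<forall>w\<in>S. \<psi> w w = 0 \<and> (\<forall>v. 0 \<le> \<psi> w v \<and> \<psi> w v \<le> s) \<and> (\<forall>v. int L \<le> linfnorm (v - w) \<longrightarrow> \<psi> w v = s) \<and>
    (\<forall>x y. {x, y} \<in> edges \<longrightarrow> x \<in> Q w L \<longrightarrow> y \<in> Q w L \<longrightarrow> \<bar>\<psi> w x - \<psi> w y\<bar> \<le> t x y)" by blast
  have \<psi>: "\<And>w. w \<in> S \<Longrightarrow> \<psi> w w = 0" "\<And>w v. w \<in> S \<Longrightarrow> 0 \<le> \<psi> w v \<and> \<psi> w v \<le> s"
    "\<And>w v. w \<in> S \<Longrightarrow> int L \<le> linfnorm (v - w) \<Longrightarrow> \<psi> w v = s"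
    "\<And>w x y. w \<in> S \<Longrightarrow> {x, y} \<in> edges \<Longrightarrow> x \<in> Q w L \<Longrightarrow> y \<in> Q w L \<Longrightarrow> \<bar>\<psi> w x - \<psi> w y\<bar> \<le> t x y"
    using P by blast+
  have grad: "\<bar>\<psi> w x - \<psi> w y\<bar> \<le> t x y" if w: "w \<in> S" and e: "{x, y} \<in> edges" for w x y
  proof (cases "x \<in> Q w L \<and> y \<in> Q w L")
    case True
    then show ?thesis using \<psi>(4)[OF w e] by blast
  next
    case False
    have "linfnorm (x - w) \<le> linfnorm (x - y) + linfnorm (y - w)" "linfnorm (y - w) \<le> linfnorm (y - x) + linfnorm (x - w)"
      by (rule linfnorm_triangle_diff)+
    then have "int L \<le> linfnorm (x - w)" "int L \<le> linfnorm (y - w)"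
      using False edges_dist[OF e] linfnorm_minus_commute[of x y] by (auto simp: Q_of_nat_iff)
    then show ?thesis using \<psi>(3)[OF w] t[of x y] by simp
  qed
  \<comment> \<open>Inserting s caps the minimum and makes the set nonempty without an argument
    about the sphere.\<close>
  define m where "m v = Min (insert s ((\<lambda>w. \<psi> w v) ` S))" for v
  have m_le: "m v \<le> \<psi> w v" if "w \<in> S" for w v unfolding m_def using finS that by (intro Min_le) auto
  have m0: "0 \<le> m v \<and> m v \<le> s" for v
    unfolding m_def using finS s \<psi>(2) by (auto intro: Min_le)
  have m_grad1: "m x \<le> m y + t x y" if e: "{x, y} \<in> edges" for x y
  proof -
    have "m y \<in> insert s ((\<lambda>w. \<psi> w y) ` S)" unfolding m_def using finS by (intro Min_in) auto
    then show ?thesis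
    proof
      assume "m y = s" then show ?thesis using m0[of x] t[of x y] by linarith
    next
      assume "m y \<in> (\<lambda>w. \<psi> w y) ` S"
      then obtain w where "w \<in> S" "m y = \<psi> w y" by auto
      then show ?thesis using m_le[of w x] grad[OF \<open>w \<in> S\<close> e] by linarith
    qed
  qed
  have t_sym: "{x, y} \<in> edges \<Longrightarrow> {y, x} \<in> edges" for x y :: "int ^ 'd" by (simp add: insert_commute)
  define \<phi> where "\<phi> v = (if linfnorm (v - z) \<le> int j * int L then 0 else m v)" for v
  have far: "\<phi> v = s" if v: "int (j + 1) * int L \<le> linfnorm (v - z)" for v
  proof -
    have "\<psi> w v = s" if w: "w \<in> S" for w
    proof (rule \<psi>(3)[OF w])
      have "linfnorm (v - z) \<le> linfnorm (v - w) + linfnorm (w - z)" by (rule linfnorm_triangle_diff)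
      then show "int L \<le> linfnorm (v - w)" using v w by (simp add: S_def distrib_right)
    qed
    then have "(\<lambda>w. \<psi> w v) ` S \<subseteq> {s}" by auto
    then have "insert s ((\<lambda>w. \<psi> w v) ` S) = {s}" by auto
    then have "m v = Min {s}" unfolding m_def by (simp only:)
    then show ?thesis using v L by (simp add: \<phi>_def distrib_right)
  qed
  have one: "\<phi> y - \<phi> x \<le> t x y \<and> \<phi> y - \<phi> x \<le> t y x" if e: "{x, y} \<in> edges" for x y
  proof (cases "linfnorm (y - z) \<le> int j * int L")
    case True
    then show ?thesis using m0[of x] t[of x y] t[of y x] by (auto simp: \<phi>_def intro: order_trans[of _ 0])
  next
    case y: False
    show ?thesis
    proof (cases "linfnorm (x - z) \<le> int j * int L")
      case True
      have "linfnorm (y - z) \<le> linfnorm (y - x) + linfnorm (x - z)" by (rule linfnorm_triangle_diff)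
      \<comment> \<open>The inner end of an edge leaving the ball lies on the sphere itself, where
        its own potential starts from zero.\<close>
      then have xS: "x \<in> S" using True y edges_dist[OF t_sym[OF e]] by (simp add: S_def)
      then have "m y \<le> \<psi> x y" by (rule m_le)
      moreover have "\<bar>\<psi> x x - \<psi> x y\<bar> \<le> t x y" "\<bar>\<psi> x y - \<psi> x x\<bar> \<le> t y x" using grad[OF xS e] grad[OF xS t_sym[OF e]] by auto
      ultimately have "m y \<le> t x y" "m y \<le> t y x" using \<psi>(1)[OF xS] by linarith+
      then show ?thesis using True y by (simp add: \<phi>_def)
    next
      case False
      have "\<bar>m x - m y\<bar> \<le> t x y \<and> \<bar>m x - m y\<bar> \<le> t y x"
      proof -
        have g: "\<bar>m x - m y\<bar> \<le> u" if "\<And>w. w \<in> S \<Longrightarrow> \<bar>\<psi> w x - \<psi> w y\<bar> \<le> u" "0 \<le> u" for u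
        proof -
          have *: "m x \<le> m y + u" if "\<And>w. w \<in> S \<Longrightarrow> \<bar>\<psi> w x - \<psi> w y\<bar> \<le> u" for x y
          proof -
            have "m y \<in> insert s ((\<lambda>w. \<psi> w y) ` S)" unfolding m_def using finS by (intro Min_in) auto
            then show ?thesis
            proof
              assume "m y = s" then show ?thesis using m0[of x] \<open>0 \<le> u\<close> by linarith
            next
              assume "m y \<in> (\<lambda>w. \<psi> w y) ` S"
              then obtain w where "w \<in> S" "m y = \<psi> w y" by auto
              then show ?thesis using m_le[of w x] that[of w] by linarith
            qed
          qed
          have "m x \<le> m y + u" by (rule *) (rule that)
          moreover have "m y \<le> m x + u" by (rule *) (use that in \<open>simp add: abs_minus_commute\<close>)
          ultimately show ?thesis by linarith
        qed
        show ?thesis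
          using g[of "t x y"] g[of "t y x"] grad[OF _ e] grad[OF _ t_sym[OF e]] t by (simp add: abs_minus_commute)
      qed
      then have "m y - m x \<le> t x y" "m y - m x \<le> t y x" by linarith+
      then show ?thesis using y False by (simp add: \<phi>_def)
    qed
  qed
  have "\<bar>\<phi> x - \<phi> y\<bar> \<le> t x y" if e: "{x, y} \<in> edges" for x y
    using one[OF e] one[OF t_sym[OF e]] by linarith
  moreover have "0 \<le> \<phi> v \<and> \<phi> v \<le> s" for v using m0[of v] s by (simp add: \<phi>_def)
  ultimately show ?thesis using far by (intro exI[of _ \<phi>]) (auto simp: \<phi>_def)
qed

text \<open>An edge sees variation in one shell only, that of index min(norms of its ends) div L. So
  heights add up while gradients do not.\<close>

lemma glue_shells:
  fixes z :: "int ^ 'd::finite" and s s' :: real and t :: "int ^ 'd \<Rightarrow> int ^ 'd \<Rightarrow> real"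
  assumes L: "1 \<le> L" and s: "0 \<le> s" and t: "\<And>x y. 0 \<le> t x y" and J: "finite J"
    and sl: "\<And>j w. j \<in> J \<Longrightarrow> linfnorm (w - z) = int j * int L \<Longrightarrow> slow t w L s"
  shows "\<exists>\<Phi>. (\<forall>v. 0 \<le> \<Phi> v \<and> \<Phi> v \<le> card J * s) \<and>
    (\<forall>v. (\<forall>j\<in>J. linfnorm (v - z) \<le> int j * int L) \<longrightarrow> \<Phi> v = 0) \<and>
    (\<forall>v. (\<forall>j\<in>J. int (j + 1) * int L \<le> linfnorm (v - z)) \<longrightarrow> \<Phi> v = card J * s) \<and>
    (\<forall>x y. {x, y} \<in> edges \<longrightarrow> \<bar>\<Phi> x - \<Phi> y\<bar> \<le> t x y)"
proof -
  have "\<forall>j\<in>J. \<exists>\<phi>. (\<forall>v. 0 \<le> \<phi> v \<and> \<phi> v \<le> s) \<and> (\<forall>v. linfnorm (v - z) \<le> int j * int L \<longrightarrow> \<phi> v = 0) \<and>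
    (\<forall>v. int (j + 1) * int L \<le> linfnorm (v - z) \<longrightarrow> \<phi> v = s) \<and>
    (\<forall>x y. {x, y} \<in> edges \<longrightarrow> \<bar>\<phi> x - \<phi> y\<bar> \<le> t x y)"
  proof
    fix j assume "j \<in> J"
    show "\<exists>\<phi>. (\<forall>v. 0 \<le> \<phi> v \<and> \<phi> v \<le> s) \<and> (\<forall>v. linfnorm (v - z) \<le> int j * int L \<longrightarrow> \<phi> v = 0) \<and>
      (\<forall>v. int (j + 1) * int L \<le> linfnorm (v - z) \<longrightarrow> \<phi> v = s) \<and>
      (\<forall>x y. {x, y} \<in> edges \<longrightarrow> \<bar>\<phi> x - \<phi> y\<bar> \<le> t x y)"
      by (rule shell_potential) (use L s t sl \<open>j \<in> J\<close> in auto)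
  qed
  from bchoice[OF this] obtain \<phi> where P: "\<forall>j\<in>J. (\<forall>v. 0 \<le> \<phi> j v \<and> \<phi> j v \<le> s) \<and> (\<forall>v. linfnorm (v - z) \<le> int j * int L \<longrightarrow> \<phi> j v = 0) \<and>
    (\<forall>v. int (j + 1) * int L \<le> linfnorm (v - z) \<longrightarrow> \<phi> j v = s) \<and>
    (\<forall>x y. {x, y} \<in> edges \<longrightarrow> \<bar>\<phi> j x - \<phi> j y\<bar> \<le> t x y)" by blast
  have \<phi>: "\<And>j v. j \<in> J \<Longrightarrow> 0 \<le> \<phi> j v \<and> \<phi> j v \<le> s"
    "\<And>j v. j \<in> J \<Longrightarrow> linfnorm (v - z) \<le> int j * int L \<Longrightarrow> \<phi> j v = 0"
    "\<And>j v. j \<in> J \<Longrightarrow> int (j + 1) * int L \<le> linfnorm (v - z) \<Longrightarrow> \<phi> j v = s"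
    "\<And>j x y. j \<in> J \<Longrightarrow> {x, y} \<in> edges \<Longrightarrow> \<bar>\<phi> j x - \<phi> j y\<bar> \<le> t x y"
    using P by blast+
  define \<Phi> where "\<Phi> v = (\<Sum>j\<in>J. \<phi> j v)" for v
  have grad: "\<bar>\<Phi> x - \<Phi> y\<bar> \<le> t x y" if e: "{x, y} \<in> edges" for x y
  proof -
    let ?n = "\<lambda>v. linfnorm (v - z)"
    define k where "k = nat (min (?n x) (?n y) div int L)"
    have nxy: "\<bar>?n x - ?n y\<bar> \<le> 1"
      using linfnorm_triangle_diff[of x z y] linfnorm_triangle_diff[of y z x] edges_dist[OF e] linfnorm_minus_commute[of x y] by linarith
    have same: "\<phi> j x = \<phi> j y" if j: "j \<in> J" "j \<noteq> k" for j
    proof (cases "min (?n x) (?n y) < int j * int L")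
      case True
      then have "?n x \<le> int j * int L" "?n y \<le> int j * int L" using nxy by linarith+
      then show ?thesis using \<phi>(2)[OF j(1)] by simp
    next
      case False
      have "int (j + 1) * int L \<le> min (?n x) (?n y)"
      proof (rule ccontr)
        assume neg: "\<not> ?thesis"
        define m where "m = min (?n x) (?n y)"
        have m: "int j * int L \<le> m" "m < int j * int L + int L"
          using False neg unfolding m_def[symmetric] by (auto simp: distrib_right not_le not_less)
        then have "m div int L = int j"
          by (intro int_div_pos_eq[of _ _ _ "m - int j * int L"]) (auto simp: mult.commute)
        then show False using j by (simp add: k_def m_def)
      qed
      then have "int (j + 1) * int L \<le> ?n x" "int (j + 1) * int L \<le> ?n y" by linarith+
      then show ?thesis using \<phi>(3)[OF j(1)] by simp
    qed
    have "\<Phi> x - \<Phi> y = (\<Sum>j\<in>J. \<phi> j x - \<phi> j y)" by (simp add: \<Phi>_def sum_subtractf)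
    also have "\<dots> = (\<Sum>j\<in>J. if j = k then \<phi> k x - \<phi> k y else 0)" using same by (intro sum.cong) auto
    also have "\<dots> = (if k \<in> J then \<phi> k x - \<phi> k y else 0)" using J by (simp add: sum.delta)
    finally show ?thesis using \<phi>(4)[OF _ e, of k] t[of x y] by (auto split: if_splits)
  qed
  have "0 \<le> \<Phi> v" for v unfolding \<Phi>_def using \<phi>(1) by (intro sum_nonneg) blast
  moreover have "\<Phi> v \<le> card J * s" for v
    unfolding \<Phi>_def using \<phi>(1) by (intro sum_bounded_above) blast
  moreover have "\<Phi> v = 0" if "\<forall>j\<in>J. linfnorm (v - z) \<le> int j * int L" for v
    unfolding \<Phi>_def using \<phi>(2) that by (intro sum.neutral) blast
  moreover have "\<Phi> v = card J * s" if "\<forall>j\<in>J. int (j + 1) * int L \<le> linfnorm (v - z)" for v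
    unfolding \<Phi>_def using \<phi>(3) that by simp
  ultimately show ?thesis using grad by blast
qed

text \<open>If all points that are not slow lie close to a single one, then at most 13 of the \<open>M\<close> shells of radii \<open>j L\<close> are hit,
  and the potentials of the remaining shells add up.\<close>

lemma slow_recursion:
  fixes z :: "int ^ 'd::finite" and s s' :: real and t :: "int ^ 'd \<Rightarrow> int ^ 'd \<Rightarrow> real"
  assumes L: "1 \<le> L" and s: "0 \<le> s" and t: "\<And>x y. 0 \<le> t x y"
    and ns: "\<not> slow t z (M * L) s'" and s': "0 \<le> s'" "s' \<le> (real M - 13) * s"
  shows "\<exists>w1\<in>Q z (M * L). \<exists>w2\<in>Q z (M * L). \<not> slow t w1 L s \<and> \<not> slow t w2 L s \<and> 6 * int L \<le> linfnorm (w1 - w2)"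
proof (rule ccontr)
  assume neg: "\<not> ?thesis"
  obtain E where E: "E \<subseteq> {..<M}" "card E \<le> 13"
    and out: "\<And>j w. j \<in> {..<M} - E \<Longrightarrow> linfnorm (w - z) = int j * int L \<Longrightarrow> slow t w L s"
  proof (cases "\<exists>p\<in>Q z (M * L). \<not> slow t p L s")
    case False
    have "slow t w L s" if "j \<in> {..<M} - {}" "linfnorm (w - z) = int j * int L" for j w
    proof -
      have "int j * int L \<le> int M * int L" using that by (intro mult_right_mono) auto
      then have "w \<in> Q z (real (M * L))" using that unfolding Q_of_nat_iff by simp
      then show ?thesis using False by blast
    qed
    then show thesis using that[of "{}"] by auto
  next
    case True
    then obtain p where p: "p \<in> Q z (M * L)" "\<not> slow t p L s" by blast
    \<comment> \<open>A point on any other shell is at distance at least 6 L from p, hence slow by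
      the assumption to be refuted.\<close>
    define E where "E = {j. j < M \<and> \<bar>int j * int L - linfnorm (p - z)\<bar> < 6 * int L}"
    have "slow t w L s" if j: "j \<in> {..<M} - E" "linfnorm (w - z) = int j * int L" for j w
    proof (rule ccontr)
      assume nw: "\<not> slow t w L s"
      have "int j * int L \<le> int M * int L" using that by (intro mult_right_mono) auto
      then have "w \<in> Q z (real (M * L))" using that unfolding Q_of_nat_iff by simp
      then have "linfnorm (w - p) < 6 * int L" using neg p nw not_less by blast
      moreover have "linfnorm (w - z) \<le> linfnorm (w - p) + linfnorm (p - z)" "linfnorm (p - z) \<le> linfnorm (p - w) + linfnorm (w - z)"
        by (rule linfnorm_triangle_diff)+
      ultimately have "\<bar>linfnorm (w - z) - linfnorm (p - z)\<bar> < 6 * int L" using linfnorm_minus_commute[of w p] by linarith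
      then show False using j by (auto simp: E_def)
    qed
    moreover have "card E \<le> 13"
    proof -
      \<comment> \<open>The exceptional shells have indices between b - 6 and b + 6, which is the
        origin of 13.\<close>
      define b where "b = linfnorm (p - z) div int L"
      have b: "b * int L \<le> linfnorm (p - z)" "linfnorm (p - z) < (b + 1) * int L"
        unfolding b_def using L by (auto simp: div_mult_mod_eq distrib_right pos_mod_bound minus_mod_eq_div_mult[symmetric])
      have "int ` E \<subseteq> {b - 6 .. b + 6}"
      proof safe
        fix j assume "j \<in> E"
        then have "int j * int L < linfnorm (p - z) + 6 * int L" "linfnorm (p - z) - 6 * int L < int j * int L"
          by (auto simp: E_def)
        then have "int j * int L < (b + 7) * int L" "(b - 6) * int L < int j * int L"
          using b by (auto simp: algebra_simps)
        then have "int j < b + 7" "b - 6 < int j" using L by (auto simp: mult_less_cancel_right)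
        then show "int j \<in> {b - 6 .. b + 6}" by simp
      qed
      then have "card (int ` E) \<le> card {b - 6 .. b + 6}" by (intro card_mono) auto
      then show ?thesis by (simp add: card_image)
    qed
    ultimately show thesis using that[of E] by (auto simp: E_def)
  qed
  define J where "J = {..<M} - E"
  have J: "finite J" "real M - 13 \<le> real (card J)"
  proof -
    have "card J = M - card E" unfolding J_def using E by (simp add: card_Diff_subset finite_subset)
    then show "real M - 13 \<le> real (card J)" using E(2) by linarith
  qed (simp add: J_def)
  obtain \<Phi> where \<Phi>: "\<forall>v. 0 \<le> \<Phi> v \<and> \<Phi> v \<le> card J * s"
    "\<forall>v. (\<forall>j\<in>J. linfnorm (v - z) \<le> int j * int L) \<longrightarrow> \<Phi> v = 0"
    "\<forall>v. (\<forall>j\<in>J. int (j + 1) * int L \<le> linfnorm (v - z)) \<longrightarrow> \<Phi> v = card J * s"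
    "\<forall>x y. {x, y} \<in> edges \<longrightarrow> \<bar>\<Phi> x - \<Phi> y\<bar> \<le> t x y"
    using glue_shells[where t = t and z = z, OF L s t J(1)] out unfolding J_def by blast
  have far: "\<Phi> w = card J * s" if w: "int (M * L) \<le> linfnorm (w - z)" for w
  proof -
    have "int (j + 1) * int L \<le> linfnorm (w - z)" if "j \<in> J" for j
    proof -
      have "int (j + 1) * int L \<le> int M * int L" using that by (intro mult_right_mono) (auto simp: J_def)
      then show ?thesis using w by simp
    qed
    then show ?thesis using \<Phi>(3) by blast
  qed
  have "slow t z (M * L) (card J * s)"
    unfolding slow_def using \<Phi>(1,2,4) far by (intro exI[of _ \<Phi>]) auto
  then have "slow t z (M * L) s'"
    using s' J(2) s by (elim slow_scale) (auto intro: order_trans[OF s'(2)] mult_right_mono)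
  then show False using ns by blast
qed


text \<open>The condition \<open>slow\<close> quantifies over potentials; the Bellman--Ford iterates turn it into countably many
  conditions and so make it measurable.\<close>

primrec bellman_ford :: "(int ^ 'd \<Rightarrow> int ^ 'd \<Rightarrow> real) \<Rightarrow> int ^ 'd::finite \<Rightarrow> nat \<Rightarrow> real \<Rightarrow> nat \<Rightarrow> int ^ 'd \<Rightarrow> real" where
  "bellman_ford t z L s 0 w = (if w = z then 0 else s)"
| "bellman_ford t z L s (Suc n) w = Min ((\<lambda>y. if y = w then bellman_ford t z L s n w else bellman_ford t z L s n y + t y w) `
     insert w {y \<in> Q z L. {y, w} \<in> edges \<and> w \<in> Q z L})"

text \<open>Every admissible potential stays below all iterates, by induction. Conversely, the
  infimum of the iterates is itself admissible once its values at distance L do not fall below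
  s.\<close>

lemma slow_iff_bellman_ford:
  assumes s: "0 \<le> s" and t: "\<And>x y. 0 \<le> t x y" and sym: "\<And>x y. t x y = t y x"
  shows "slow t z L s \<longleftrightarrow> (\<forall>n. \<forall>w. int L \<le> linfnorm (w - z) \<longrightarrow> s \<le> bellman_ford t z L s n w)"
proof -
  let ?D = "bellman_ford t z L s"
  let ?N = "\<lambda>w. insert w {y \<in> Q z L. {y, w} \<in> edges \<and> w \<in> Q z L}"
  have fin: "finite (?N w)" for w by simp
  have le1: "?D (Suc n) w \<le> ?D n w" for n w
    unfolding bellman_ford.simps(2) using fin by (intro Min_le) auto
  have le2: "?D (Suc n) w \<le> ?D n y + t y w" if "{y, w} \<in> edges" "y \<in> Q z L" "w \<in> Q z L" for n y w
    unfolding bellman_ford.simps(2) using that edges_neq[OF that(1)] fin[of w] by (intro Min_le) auto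
  have ge: "u \<le> ?D (Suc n) w" if "u \<le> ?D n w" "\<And>y. {y, w} \<in> edges \<Longrightarrow> y \<in> Q z L \<Longrightarrow> w \<in> Q z L \<Longrightarrow> u \<le> ?D n y + t y w" for u n w
    unfolding bellman_ford.simps(2) using that fin by (subst Min_ge_iff) auto
  have D0: "0 \<le> ?D n w" for n w
  proof (induction n arbitrary: w)
    case (Suc n)
    show ?case by (rule ge) (use Suc t in \<open>auto intro: add_nonneg_nonneg\<close>)
  qed (use s in auto)
  have Ds: "?D n w \<le> s" for n w
  proof (induction n)
    case (Suc n) then show ?case using le1[of n w] by linarith
  qed (use s in auto)
  show ?thesis
  proof
    assume "slow t z L s"
    then obtain \<psi> where \<psi>: "\<psi> z = 0" "\<forall>w. 0 \<le> \<psi> w \<and> \<psi> w \<le> s" "\<forall>w. int L \<le> linfnorm (w - z) \<longrightarrow> \<psi> w = s"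
      "\<forall>x y. {x, y} \<in> edges \<longrightarrow> x \<in> Q z L \<longrightarrow> y \<in> Q z L \<longrightarrow> \<bar>\<psi> x - \<psi> y\<bar> \<le> t x y" by (auto simp: slow_def)
    have "\<psi> w \<le> ?D n w" for n w
    proof (induction n arbitrary: w)
      case (Suc n)
      show ?case
      proof (rule ge[OF Suc])
        fix y assume e: "{y, w} \<in> edges" "y \<in> Q z L" "w \<in> Q z L"
        then have "\<bar>\<psi> y - \<psi> w\<bar> \<le> t y w" using \<psi>(4) by blast
        then show "\<psi> w \<le> ?D n y + t y w" using Suc[of y] by linarith
      qed
    qed (use \<psi> in auto)
    then show "\<forall>n. \<forall>w. int L \<le> linfnorm (w - z) \<longrightarrow> s \<le> ?D n w" using \<psi>(3) by metis
  next
    assume H: "\<forall>n. \<forall>w. int L \<le> linfnorm (w - z) \<longrightarrow> s \<le> ?D n w"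
    define \<psi> where "\<psi> w = (INF n. ?D n w)" for w
    have bdd: "bdd_below (range (\<lambda>n. ?D n w))" for w by (rule bdd_belowI[of _ 0]) (use D0 in auto)
    have low: "\<psi> w \<le> ?D n w" for n w unfolding \<psi>_def by (rule cINF_lower[OF bdd]) simp
    have great: "u \<le> \<psi> w" if "\<And>n. u \<le> ?D n w" for u w unfolding \<psi>_def by (rule cINF_greatest) (use that in auto)
    have g1: "\<psi> x - \<psi> y \<le> t y x" if e: "{y, x} \<in> edges" "y \<in> Q z L" "x \<in> Q z L" for x y
    proof -
      have "\<psi> x - t y x \<le> \<psi> y" by (rule great) (use low[of x "Suc _"] le2[OF e] in \<open>smt (verit)\<close>)
      then show ?thesis by simp
    qed
    show "slow t z L s" unfolding slow_def
    proof (intro exI[of _ \<psi>] conjI allI impI)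
      have "\<psi> z \<le> 0" using low[of z 0] by simp
      moreover have "0 \<le> \<psi> z" by (rule great) (rule D0)
      ultimately show "\<psi> z = 0" by (rule antisym)
      show "0 \<le> \<psi> w" for w by (rule great) (rule D0)
      show "\<psi> w \<le> s" for w using low[of w 0] Ds[of 0 w] by linarith
      show "\<psi> w = s" if "int L \<le> linfnorm (w - z)" for w
      proof (rule antisym)
        show "\<psi> w \<le> s" using low[of w 0] Ds[of 0 w] by linarith
        show "s \<le> \<psi> w" by (rule great) (use H that in blast)
      qed
      show "\<bar>\<psi> x - \<psi> y\<bar> \<le> t x y" if "{x, y} \<in> edges" "x \<in> Q z L" "y \<in> Q z L" for x y
        using g1[of y x] g1[of x y] that sym[of x y] by (simp add: insert_commute abs_le_iff)
    qed
  qed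
qed

text \<open>Unlike in \<open>edge_weight\<close>, closed edges have weight 1 instead of \<open>\<infinity>\<close>. This keeps the direction of monotonicity,
  as open edges have weight at most 1.\<close>

definition passage_time :: "'d region \<Rightarrow> ('e, 'v, 'd) cond_fun \<Rightarrow> ('e, 'v, 'd) kill_fun \<Rightarrow> ('e, 'v, 'd) conf
    \<Rightarrow> int ^ 'd::finite \<Rightarrow> int ^ 'd \<Rightarrow> real" where
  "passage_time N a \<kappa> \<omega> x y = (if conductance N a \<omega> x y = 0 then 1
     else sqrt (min 1 (min (killing_rate N \<kappa> \<omega> x) (killing_rate N \<kappa> \<omega> y) / conductance N a \<omega> x y)))"

lemma passage_time_shift: "passage_time N a \<kappa> (shift v \<omega>) x y = passage_time N a \<kappa> \<omega> (x + v) (y + v)"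
  by (simp add: passage_time_def conductance_shift killing_rate_shift)

lemma slow_shift: "slow (passage_time N a \<kappa> (shift v \<omega>)) z L s \<longleftrightarrow> slow (passage_time N a \<kappa> \<omega>) (z + v) L s"
proof -
  have Qv: "x \<in> Q z R \<longleftrightarrow> x + v \<in> Q (z + v) R" for x R by (simp add: Q_iff)
  have ev: "{x, y} \<in> edges \<longleftrightarrow> {x + v, y + v} \<in> edges" for x y :: "int ^ 'a" by (simp add: edges_iff)
  have *: "slow (\<lambda>x y. t (x + v) (y + v)) z L s" if sl: "slow t (z + v) L s" for t and z v :: "int ^ 'a"
  proof -
    obtain \<psi> where \<psi>: "\<psi> (z + v) = 0" "\<forall>w. 0 \<le> \<psi> w \<and> \<psi> w \<le> s" "\<forall>w. int L \<le> linfnorm (w - (z + v)) \<longrightarrow> \<psi> w = s"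
      "\<forall>x y. {x, y} \<in> edges \<longrightarrow> x \<in> Q (z + v) L \<longrightarrow> y \<in> Q (z + v) L \<longrightarrow> \<bar>\<psi> x - \<psi> y\<bar> \<le> t x y" using sl by (auto simp: slow_def)
    show ?thesis unfolding slow_def
    proof (intro exI[of _ "\<lambda>w. \<psi> (w + v)"] conjI allI impI)
      show "\<psi> (w + v) = s" if "int L \<le> linfnorm (w - z)" for w using \<psi>(3)[rule_format, of "w + v"] that by simp
      show "\<bar>\<psi> (x + v) - \<psi> (y + v)\<bar> \<le> t (x + v) (y + v)" if "{x, y} \<in> edges" "x \<in> Q z L" "y \<in> Q z L" for x y
        using that by (intro \<psi>(4)[rule_format]) (auto simp: edges_iff Q_iff)
    qed (use \<psi> in auto)
  qed
  have eq: "passage_time N a \<kappa> (shift v \<omega>) = (\<lambda>x y. passage_time N a \<kappa> \<omega> (x + v) (y + v))"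
    by (simp add: fun_eq_iff passage_time_shift)
  show ?thesis
  proof
    assume "slow (passage_time N a \<kappa> \<omega>) (z + v) L s"
    then show "slow (passage_time N a \<kappa> (shift v \<omega>)) z L s" unfolding eq by (rule *)
  next
    assume "slow (passage_time N a \<kappa> (shift v \<omega>)) z L s"
    then have "slow (\<lambda>x y. passage_time N a \<kappa> \<omega> (x + v) (y + v)) ((z + v) + (- v)) L s" unfolding eq by simp
    from *[OF this] show "slow (passage_time N a \<kappa> \<omega>) (z + v) L s" by simp
  qed
qed

context percolation_model begin

abbreviation "tt \<equiv> passage_time N a \<kappa>"

text \<open>S contains every coordinate on which the passage times inside Q z L depend.\<close>

definition fits :: "'d region \<Rightarrow> int ^ 'd \<Rightarrow> nat \<Rightarrow> bool" where
  "fits S z L \<longleftrightarrow> (\<forall>x\<in>Q z L. region_le (translate_region x N) S) \<and> (\<forall>x\<in>Q z L. \<forall>y\<in>Q z L. {x, y} \<in> edges \<longrightarrow> {x, y} \<in> fst S)"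

lemma triple_in_space_on:
  assumes "\<eta> \<in> space (conf_space ME MV S)" "region_le (translate_region x N) S" "region_le (translate_region y N) S" "{x, y} \<in> fst S"
  shows "(env N \<eta> x, env N \<eta> y, fst \<eta> {x, y}) \<in> space (triple_space ME MV N)"
proof -
  have "(\<lambda>\<omega>. (env N \<omega> x, env N \<omega> y, fst \<omega> {x, y})) \<in> conf_space ME MV S \<rightarrow>\<^sub>M triple_space ME MV N"
    unfolding triple_space_def using assms
    by (intro measurable_Pair measurable_env measurable_fst_component) auto
  then show ?thesis using assms(1) by (rule measurable_space)
qed

lemma edge_values:
  assumes "\<eta> \<in> space (conf_space ME MV S)" "fits S z L" "x \<in> Q z L" "y \<in> Q z L" "{x, y} \<in> edges"
  shows "0 \<le> conductance N a \<eta> x y" "conductance N a \<eta> x y = conductance N a \<eta> y x"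
    "0 < killing_rate N \<kappa> \<eta> x" "0 < killing_rate N \<kappa> \<eta> y"
    "ereal (tt \<eta> x y) = min 1 (edge_weight a \<kappa> (env N \<eta> x) (env N \<eta> y) (fst \<eta> {x, y}))"
proof -
  have S: "region_le (translate_region x N) S" "region_le (translate_region y N) S" "{x, y} \<in> fst S"
    using assms by (auto simp: fits_def)
  note tr = triple_in_space_on[OF assms(1) S]
  have cs: "conductance N a \<eta> x y = a (env N \<eta> x) (env N \<eta> y) (fst \<eta> {x, y})"
    "conductance N a \<eta> y x = a (env N \<eta> y) (env N \<eta> x) (fst \<eta> {x, y})"
    using assms(5) by (simp_all add: conductance_def insert_commute)
  show c0: "0 \<le> conductance N a \<eta> x y" and "conductance N a \<eta> x y = conductance N a \<eta> y x"
    unfolding cs using tr cond_fun by (auto simp: conductance_function_def)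
  have "env N \<eta> x \<in> space (conf_space ME MV N)" "env N \<eta> y \<in> space (conf_space ME MV N)"
    using tr by (auto simp: triple_space_def space_pair_measure)
  then show "0 < killing_rate N \<kappa> \<eta> x" "0 < killing_rate N \<kappa> \<eta> y"
    using kill_fun by (auto simp: killing_rate_def killing_function_def)
  show "ereal (tt \<eta> x y) = min 1 (edge_weight a \<kappa> (env N \<eta> x) (env N \<eta> y) (fst \<eta> {x, y}))"
    unfolding passage_time_def edge_weight_def cs[symmetric] killing_rate_def one_ereal_def
    by (auto simp: min_def ereal_less_eq(3)[symmetric] simp del: ereal_less_eq(3)) (auto simp: real_sqrt_le_1_iff)
qed

lemma passage_time_pos:
  assumes "\<eta> \<in> space (conf_space ME MV S)" "fits S z L" "x \<in> Q z L" "y \<in> Q z L" "{x, y} \<in> edges"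
  shows "0 < tt \<eta> x y"
  using edge_values(1,3,4)[OF assms] by (auto simp: passage_time_def)

lemma fits_full: "fits full_region z L"
  unfolding fits_def using region_le_full[OF N_edges] by (auto simp: full_region_def)

lemma passage_time_facts:
  assumes "\<omega> \<in> space Om" "{x, y} \<in> edges"
  shows "0 < tt \<omega> x y" "tt \<omega> x y \<le> 1" "conductance N a \<omega> x y * (tt \<omega> x y)\<^sup>2 \<le> min (killing_rate N \<kappa> \<omega> x) (killing_rate N \<kappa> \<omega> y)"
    "tt \<omega> x y = tt \<omega> y x"
proof -
  have "y \<in> Q x 1" using edges_dist[OF assms(2)] by (simp add: Q_iff linfnorm_minus_commute)
  then show "0 < tt \<omega> x y" using passage_time_pos[OF assms(1) fits_full, of x x 1 y] assms(2) by simp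
  show "tt \<omega> x y \<le> 1" by (simp add: passage_time_def real_sqrt_le_1_iff)
  show "tt \<omega> x y = tt \<omega> y x" using conductance_sym[OF assms(1), of x y] by (simp add: passage_time_def min.commute)
  let ?k = "min (killing_rate N \<kappa> \<omega> x) (killing_rate N \<kappa> \<omega> y)" and ?c = "conductance N a \<omega> x y"
  have k: "0 < ?k" using killing_rate_pos[OF assms(1)] by simp
  show "?c * (tt \<omega> x y)\<^sup>2 \<le> ?k"
  proof (cases "?c = 0")
    case False
    then have c: "0 < ?c" using conductance_nonneg[OF assms(1), of x y] by simp
    have "(tt \<omega> x y)\<^sup>2 = min 1 (?k / ?c)" using c k by (simp add: passage_time_def)
    also have "\<dots> \<le> ?k / ?c" by simp
    finally show ?thesis using c by (simp add: field_simps)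
  qed (use k in simp)
qed

lemma slow_cong:
  assumes "\<And>x y. {x, y} \<in> edges \<Longrightarrow> x \<in> Q z L \<Longrightarrow> y \<in> Q z L \<Longrightarrow> t x y = t' x y"
  shows "slow t z L s \<longleftrightarrow> slow t' z L s"
  using slow_mono[of t z L s t'] slow_mono[of t' z L s t] assms by auto

lemma sets_slow:
  assumes S: "fits S z L" and s: "0 \<le> s"
  shows "{\<eta> \<in> space (conf_space ME MV S). slow (tt \<eta>) z L s} \<in> sets (conf_space ME MV S)"
proof -
  \<comment> \<open>Weights off the box are replaced by 0; then all weights are measurable over S,
    nonnegative and symmetric, as Bellman-Ford requires for arbitrary pairs.\<close>
  define t where "t \<eta> x y = (if {x, y} \<in> edges \<and> x \<in> Q z L \<and> y \<in> Q z L then tt \<eta> x y else 0)" for \<eta> x y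
  have meas_t: "(\<lambda>\<eta>. t \<eta> x y) \<in> borel_measurable (conf_space ME MV S)" for x y
  proof (cases "{x, y} \<in> edges \<and> x \<in> Q z L \<and> y \<in> Q z L")
    case True
    then have "(\<lambda>\<eta>. conductance N a \<eta> x y) \<in> borel_measurable (conf_space ME MV S)"
      "(\<lambda>\<eta>. killing_rate N \<kappa> \<eta> x) \<in> borel_measurable (conf_space ME MV S)" "(\<lambda>\<eta>. killing_rate N \<kappa> \<eta> y) \<in> borel_measurable (conf_space ME MV S)"
      using S by (auto simp: fits_def intro!: measurable_conductance_on measurable_killing_rate_on)
    then have "(\<lambda>\<eta>. tt \<eta> x y) \<in> borel_measurable (conf_space ME MV S)" unfolding passage_time_def by measurable
    then show ?thesis using True by (simp add: t_def)
  next
    case False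
    then have "(\<lambda>\<eta>. t \<eta> x y) = (\<lambda>_. 0)" by (auto simp: t_def)
    then show ?thesis by simp
  qed
  have D: "(\<lambda>\<eta>. bellman_ford (t \<eta>) z L s n w) \<in> borel_measurable (conf_space ME MV S)" for n w
  proof (induction n arbitrary: w)
    case (Suc n)
    have "(\<lambda>\<eta>. Min ((\<lambda>y. if y = w then bellman_ford (t \<eta>) z L s n w else bellman_ford (t \<eta>) z L s n y + t \<eta> y w) `
     insert w {y \<in> Q z L. {y, w} \<in> edges \<and> w \<in> Q z L})) \<in> borel_measurable (conf_space ME MV S)"
    proof (rule borel_measurable_Min)
      show "(\<lambda>\<eta>. if y = w then bellman_ford (t \<eta>) z L s n w else bellman_ford (t \<eta>) z L s n y + t \<eta> y w) \<in> borel_measurable (conf_space ME MV S)" for y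
        by (cases "y = w") (use Suc meas_t in \<open>auto intro!: borel_measurable_add\<close>)
    qed simp
    then show ?case by simp
  qed simp
  have "slow (tt \<eta>) z L s \<longleftrightarrow> (\<forall>n. \<forall>w. int L \<le> linfnorm (w - z) \<longrightarrow> s \<le> bellman_ford (t \<eta>) z L s n w)"
    if \<eta>: "\<eta> \<in> space (conf_space ME MV S)" for \<eta>
  proof -
    have "slow (tt \<eta>) z L s \<longleftrightarrow> slow (t \<eta>) z L s" by (rule slow_cong) (simp add: t_def)
    also have "\<dots> \<longleftrightarrow> (\<forall>n. \<forall>w. int L \<le> linfnorm (w - z) \<longrightarrow> s \<le> bellman_ford (t \<eta>) z L s n w)"
    proof (rule slow_iff_bellman_ford[OF s])
      show "0 \<le> t \<eta> x y" for x y using passage_time_pos[OF \<eta> S, of x y] by (simp add: t_def less_imp_le)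
      show "t \<eta> x y = t \<eta> y x" for x y
        using edge_values(2)[OF \<eta> S, of x y] by (auto simp: t_def passage_time_def insert_commute min.commute)
    qed
    finally show ?thesis .
  qed
  then have "{\<eta> \<in> space (conf_space ME MV S). slow (tt \<eta>) z L s}
    = {\<eta> \<in> space (conf_space ME MV S). \<forall>n. \<forall>w. int L \<le> linfnorm (w - z) \<longrightarrow> s \<le> bellman_ford (t \<eta>) z L s n w}" by auto
  also have "\<dots> \<in> sets (conf_space ME MV S)"
    by (intro sets.sets_Collect_countable_All sets.sets_Collect_imp sets.sets_Collect_const borel_measurable_le D measurable_const) auto
  finally show ?thesis .
qed

lemma env_restr: "region_le (translate_region x N) S \<Longrightarrow> env N (restr S \<omega>) x = env N \<omega> x"
  unfolding env_def restr_def shift_def fst_conv snd_conv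
  by (intro arg_cong2[where f = Pair] ext) (auto simp: region_le_def translate_region_def restrict_def)

lemma slow_restr:
  assumes "fits S z L"
  shows "slow (tt (restr S \<omega>)) z L s \<longleftrightarrow> slow (tt \<omega>) z L s"
proof (rule slow_cong)
  fix x y assume e: "{x, y} \<in> edges" "x \<in> Q z L" "y \<in> Q z L"
  then have r: "region_le (translate_region x N) S" "region_le (translate_region y N) S" "{x, y} \<in> fst S"
    using assms by (auto simp: fits_def)
  have "fst (restr S \<omega>) {x, y} = fst \<omega> {x, y}" using r by (simp add: restr_def)
  then show "tt (restr S \<omega>) x y = tt \<omega> x y"
    unfolding passage_time_def conductance_def killing_rate_def by (simp add: env_restr r)
qed

lemma conf_le_env: "conf_le S \<eta> \<eta>' \<Longrightarrow> region_le (translate_region x N) S \<Longrightarrow> conf_le N (env N \<eta> x) (env N \<eta>' x)"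
  by (auto simp: conf_le_def env_def restr_def shift_def region_le_def translate_region_def)

lemma slow_monotone:
  assumes m: "monotone_on (space (triple_space ME MV N)) (triple_le N) r (\<lambda>(s, t, e). edge_weight a \<kappa> s t e)"

    and S: "fits S z L" and \<eta>: "\<eta> \<in> space (conf_space ME MV S)" "\<eta>' \<in> space (conf_space ME MV S)" "conf_le S \<eta> \<eta>'"
  shows "r = (\<le>) \<Longrightarrow> slow (tt \<eta>) z L s \<Longrightarrow> slow (tt \<eta>') z L s" "r = (\<ge>) \<Longrightarrow> slow (tt \<eta>') z L s \<Longrightarrow> slow (tt \<eta>) z L s"
proof -
  have key: "r (edge_weight a \<kappa> (env N \<eta> x) (env N \<eta> y) (fst \<eta> {x, y})) (edge_weight a \<kappa> (env N \<eta>' x) (env N \<eta>' y) (fst \<eta>' {x, y}))"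
    if e: "{x, y} \<in> edges" "x \<in> Q z L" "y \<in> Q z L" for x y
  proof -
    have rg: "region_le (translate_region x N) S" "region_le (translate_region y N) S" "{x, y} \<in> fst S"
      using e S by (auto simp: fits_def)
    have "triple_le N (env N \<eta> x, env N \<eta> y, fst \<eta> {x, y}) (env N \<eta>' x, env N \<eta>' y, fst \<eta>' {x, y})"
      using conf_le_env[OF \<eta>(3)] rg \<eta>(3) by (auto simp: conf_le_def)
    from monotone_onD[OF m triple_in_space_on[OF \<eta>(1) rg] triple_in_space_on[OF \<eta>(2) rg] this] show ?thesis by simp
  qed
  show "slow (tt \<eta>') z L s" if r: "r = (\<le>)" and sl: "slow (tt \<eta>) z L s"
  proof (rule slow_mono[OF sl])
    fix x y assume e: "{x, y} \<in> edges" "x \<in> Q z L" "y \<in> Q z L"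
    have "ereal (tt \<eta> x y) \<le> ereal (tt \<eta>' x y)"
      unfolding edge_values(5)[OF \<eta>(1) S e(2,3,1)] edge_values(5)[OF \<eta>(2) S e(2,3,1)]
      using key[OF e] r by (intro min.mono) auto
    then show "tt \<eta> x y \<le> tt \<eta>' x y" by simp
  qed
  show "slow (tt \<eta>) z L s" if r: "r = (\<ge>)" and sl: "slow (tt \<eta>') z L s"
  proof (rule slow_mono[OF sl])
    fix x y assume e: "{x, y} \<in> edges" "x \<in> Q z L" "y \<in> Q z L"
    have "ereal (tt \<eta>' x y) \<le> ereal (tt \<eta> x y)"
      unfolding edge_values(5)[OF \<eta>(1) S e(2,3,1)] edge_values(5)[OF \<eta>(2) S e(2,3,1)]
      using key[OF e] r by (intro min.mono) auto
    then show "tt \<eta>' x y \<le> tt \<eta> x y" by simp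
  qed
qed

end


section \<open>Decoupling of fast crossings in distant boxes\<close>

lemma region_vertices_Qbar: "region_vertices (Qbar x r) = Q x r"
  by (auto simp: region_vertices_def Qbar_def)

lemma region_dist_Qbar_ge:
  assumes "b + 2 * r \<le> real_of_int (linfnorm (x1 - x2))" "0 \<le> r"
  shows "b \<le> region_dist (Qbar x1 r) (Qbar x2 r)"
  unfolding region_dist_def region_vertices_Qbar
proof (rule cINF_greatest)
  have "(x1, x2) \<in> Q x1 r \<times> Q x2 r" using assms(2) by simp
  then show "Q x1 r \<times> Q x2 r \<noteq> {}" by blast
  fix p assume "p \<in> Q x1 r \<times> Q x2 r"
  then obtain v1 v2 where p: "p = (v1, v2)" "v1 \<in> Q x1 r" "v2 \<in> Q x2 r" by auto
  have "linfnorm (x1 - x2) \<le> linfnorm (x1 - v1) + (linfnorm (v1 - v2) + linfnorm (v2 - x2))"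
    using linfnorm_triangle_diff[of x1 x2 v1] linfnorm_triangle_diff[of v1 x2 v2] by linarith
  then have "real_of_int (linfnorm (x1 - x2)) \<le> real_of_int (linfnorm (x1 - v1)) + (real_of_int (linfnorm (v1 - v2)) + real_of_int (linfnorm (v2 - x2)))"
    by (metis of_int_add of_int_le_iff)
  then show "b \<le> (case p of (x, y) \<Rightarrow> real_of_int (linfnorm (x - y)))"
    using p assms(1) by (simp add: Q_iff linfnorm_minus_commute[of x1 v1])
qed

context percolation_model begin

definition fast_pair :: "'d region \<Rightarrow> 'd region \<Rightarrow> int ^ 'd \<Rightarrow> int ^ 'd \<Rightarrow> nat \<Rightarrow> real \<Rightarrow> (('e, 'v, 'd) conf \<times> ('e, 'v, 'd) conf) set" where
  "fast_pair S1 S2 w1 w2 L s = {\<eta> \<in> space (conf_space ME MV S1). \<not> slow (tt \<eta>) w1 L s} \<times> {\<eta> \<in> space (conf_space ME MV S2). \<not> slow (tt \<eta>) w2 L s}"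

lemma sets_not_slow:
  assumes "fits S z L" "0 \<le> s"
  shows "{\<eta> \<in> space (conf_space ME MV S). \<not> slow (tt \<eta>) z L s} \<in> sets (conf_space ME MV S)"
  by (rule sets.sets_Collect_neg) (rule sets_slow[OF assms])

text \<open>If weights decrease in the configuration, a fast crossing is an increasing event, and if
  they increase, a decreasing one. This selects the half of (P3) that applies.\<close>

lemma fast_pair_events:
  assumes S: "fits S1 w1 L" "fits S2 w2 L" and s: "0 \<le> s"
  shows "monotone_on (space (triple_space ME MV N)) (triple_le N) (\<ge>) (\<lambda>(s, t, e). edge_weight a \<kappa> s t e) \<Longrightarrow>
      fast_pair S1 S2 w1 w2 L s \<in> increasing_events ME MV S1 S2"
    "monotone_on (space (triple_space ME MV N)) (triple_le N) (\<le>) (\<lambda>(s, t, e). edge_weight a \<kappa> s t e) \<Longrightarrow>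
      fast_pair S1 S2 w1 w2 L s \<in> decreasing_events ME MV S1 S2"
proof -
  have A: "fast_pair S1 S2 w1 w2 L s \<in> sets (conf_space ME MV S1 \<Otimes>\<^sub>M conf_space ME MV S2)"
    unfolding fast_pair_def by (intro pair_measureI sets_not_slow S s)
  show "fast_pair S1 S2 w1 w2 L s \<in> increasing_events ME MV S1 S2"
    if m: "monotone_on (space (triple_space ME MV N)) (triple_le N) (\<ge>) (\<lambda>(s, t, e). edge_weight a \<kappa> s t e)"
    unfolding increasing_events_def
  proof (intro CollectI conjI A monotone_onI)
    fix p p' assume p: "p \<in> space (conf_space ME MV S1 \<Otimes>\<^sub>M conf_space ME MV S2)" "p' \<in> space (conf_space ME MV S1 \<Otimes>\<^sub>M conf_space ME MV S2)" "pair_le S1 S2 p p'"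
    then have "fst p \<in> space (conf_space ME MV S1)" "snd p \<in> space (conf_space ME MV S2)" "fst p' \<in> space (conf_space ME MV S1)" "snd p' \<in> space (conf_space ME MV S2)"
      "conf_le S1 (fst p) (fst p')" "conf_le S2 (snd p) (snd p')" by (auto simp: space_pair_measure pair_le_def)
    then have "p \<in> fast_pair S1 S2 w1 w2 L s \<Longrightarrow> p' \<in> fast_pair S1 S2 w1 w2 L s"
      using slow_monotone(2)[OF m S(1), of "fst p" "fst p'" s] slow_monotone(2)[OF m S(2), of "snd p" "snd p'" s]
      by (auto simp: fast_pair_def mem_Times_iff)
    then show "indicat_real (fast_pair S1 S2 w1 w2 L s) p \<le> indicat_real (fast_pair S1 S2 w1 w2 L s) p'"
      by (auto simp: indicator_def)
  qed
  show "fast_pair S1 S2 w1 w2 L s \<in> decreasing_events ME MV S1 S2"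
    if m: "monotone_on (space (triple_space ME MV N)) (triple_le N) (\<le>) (\<lambda>(s, t, e). edge_weight a \<kappa> s t e)"
    unfolding decreasing_events_def
  proof (intro CollectI conjI A monotone_onI)
    fix p p' assume p: "p \<in> space (conf_space ME MV S1 \<Otimes>\<^sub>M conf_space ME MV S2)" "p' \<in> space (conf_space ME MV S1 \<Otimes>\<^sub>M conf_space ME MV S2)" "pair_le S1 S2 p p'"
    then have "fst p \<in> space (conf_space ME MV S1)" "snd p \<in> space (conf_space ME MV S2)" "fst p' \<in> space (conf_space ME MV S1)" "snd p' \<in> space (conf_space ME MV S2)"
      "conf_le S1 (fst p) (fst p')" "conf_le S2 (snd p) (snd p')" by (auto simp: space_pair_measure pair_le_def)
    then have "p' \<in> fast_pair S1 S2 w1 w2 L s \<Longrightarrow> p \<in> fast_pair S1 S2 w1 w2 L s"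
      using slow_monotone(1)[OF m S(1), of "fst p" "fst p'" s] slow_monotone(1)[OF m S(2), of "snd p" "snd p'" s]
      by (auto simp: fast_pair_def mem_Times_iff)
    then show "indicat_real (fast_pair S1 S2 w1 w2 L s) p \<ge> indicat_real (fast_pair S1 S2 w1 w2 L s) p'"
      by (auto simp: indicator_def)
  qed
qed

text \<open>Off B the probability \<delta> is paid; on B the comparison is with two independent
  copies, for which the event is a product.\<close>

lemma decoupled_bound:
  fixes M M2 :: "('e, 'v, 'd) conf measure" and X :: "'x itself"
  assumes dec: "decoupled X M M2 S1 S2 \<A> \<delta>" and A: "fast_pair S1 S2 w1 w2 L s \<in> \<A>"
    and M: "prob_space M" "sets M = sets Om" and M2: "prob_space M2" "sets M2 = sets Om"
    and S: "fits S1 w1 L" "fits S2 w2 L" "region_le S1 full_region" "region_le S2 full_region" and s: "0 \<le> s"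
  shows "measure M {\<omega> \<in> space M. \<not> slow (tt \<omega>) w1 L s \<and> \<not> slow (tt \<omega>) w2 L s}
    \<le> measure M2 {\<omega> \<in> space M2. \<not> slow (tt \<omega>) w1 L s} * measure M2 {\<omega> \<in> space M2. \<not> slow (tt \<omega>) w2 L s} + \<delta>"
proof -
  interpret M2: prob_space M2 by (rule M2)
  have sp: "space M = space Om" "space M2 = space Om" using M(2) M2(2) sets_eq_imp_space_eq by blast+
  obtain M' :: "'x measure" and \<pi> B where B: "B \<in> sets M'" and ext: "extension_of M' \<pi> M" and Bc: "measure M' (space M' - B) \<le> \<delta>"
    and le: "\<forall>A\<in>\<A>. measure M' {\<xi> \<in> space M'. \<xi> \<in> B \<and> (restr S1 (\<pi> \<xi>), restr S2 (\<pi> \<xi>)) \<in> A}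
           \<le> measure (M2 \<Otimes>\<^sub>M M2) {(\<omega>1, \<omega>2) \<in> space (M2 \<Otimes>\<^sub>M M2). (restr S1 \<omega>1, restr S2 \<omega>2) \<in> A}"
    using dec unfolding decoupled_def by (elim exE bexE conjE) (rule that, assumption+)
  interpret M': prob_space M' using ext by (simp add: extension_of_def)
  have \<pi>: "\<pi> \<in> M' \<rightarrow>\<^sub>M M" "distr M' M \<pi> = M" using ext by (auto simp: extension_of_def)
  have ns: "{\<omega> \<in> space Om. \<not> slow (tt \<omega>) w L s} \<in> sets Om" for w by (rule sets_not_slow[OF fits_full s])
  let ?E = "{\<omega> \<in> space M. \<not> slow (tt \<omega>) w1 L s \<and> \<not> slow (tt \<omega>) w2 L s}"
  have E: "?E \<in> sets M"
    using sets.sets_Collect_conj[OF ns ns, of w1 w2] by (simp only: sp M(2))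
  have mem: "(restr S1 \<omega>1, restr S2 \<omega>2) \<in> fast_pair S1 S2 w1 w2 L s \<longleftrightarrow> \<not> slow (tt \<omega>1) w1 L s \<and> \<not> slow (tt \<omega>2) w2 L s"
    if "\<omega>1 \<in> space Om" "\<omega>2 \<in> space Om" for \<omega>1 \<omega>2
    using measurable_space[OF measurable_restr[OF S(3)] that(1)] measurable_space[OF measurable_restr[OF S(4)] that(2)]
    by (simp add: fast_pair_def slow_restr S)
  have \<pi>_space: "\<pi> \<xi> \<in> space Om" if "\<xi> \<in> space M'" for \<xi> using measurable_space[OF \<pi>(1) that] by (simp add: sp)
  have PE: "\<pi> -` ?E \<inter> space M' \<in> sets M'" using measurable_sets[OF \<pi>(1) E] .
  have "measure M ?E = measure (distr M' M \<pi>) ?E" using \<pi> by simp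
  also have "\<dots> = measure M' (\<pi> -` ?E \<inter> space M')" by (rule measure_distr[OF \<pi>(1) E])
  also have "\<dots> \<le> measure M' ((\<pi> -` ?E \<inter> space M') \<inter> B \<union> (space M' - B))"
    using PE B by (intro M'.finite_measure_mono) auto
  also have "\<dots> \<le> measure M' ((\<pi> -` ?E \<inter> space M') \<inter> B) + measure M' (space M' - B)"
    using PE B by (intro measure_Un_le) auto
  also have "(\<pi> -` ?E \<inter> space M') \<inter> B = {\<xi> \<in> space M'. \<xi> \<in> B \<and> (restr S1 (\<pi> \<xi>), restr S2 (\<pi> \<xi>)) \<in> fast_pair S1 S2 w1 w2 L s}"
    using mem[OF \<pi>_space \<pi>_space] \<pi>_space sp by auto
  also have "measure M' \<dots> \<le> measure (M2 \<Otimes>\<^sub>M M2) {(\<omega>1, \<omega>2) \<in> space (M2 \<Otimes>\<^sub>M M2). (restr S1 \<omega>1, restr S2 \<omega>2) \<in> fast_pair S1 S2 w1 w2 L s}"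
    by (rule bspec[OF le A])
  also have "{(\<omega>1, \<omega>2) \<in> space (M2 \<Otimes>\<^sub>M M2). (restr S1 \<omega>1, restr S2 \<omega>2) \<in> fast_pair S1 S2 w1 w2 L s}
      = {\<omega> \<in> space M2. \<not> slow (tt \<omega>) w1 L s} \<times> {\<omega> \<in> space M2. \<not> slow (tt \<omega>) w2 L s}"
    using mem by (auto simp: space_pair_measure sp)
  also have "measure (M2 \<Otimes>\<^sub>M M2) \<dots> = measure M2 {\<omega> \<in> space M2. \<not> slow (tt \<omega>) w1 L s} * measure M2 {\<omega> \<in> space M2. \<not> slow (tt \<omega>) w2 L s}"
  proof -
    have "{\<omega> \<in> space M2. \<not> slow (tt \<omega>) w L s} \<in> sets M2" for w using ns[of w] by (simp only: sp M2(2))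
    then show ?thesis by (simp add: measure_def M2.emeasure_pair_measure_Times enn2real_mult)
  qed
  finally show ?thesis using Bc by linarith
qed

lemma fits_Qbar:
  assumes "snd N \<subseteq> Q 0 (real n0)" "\<And>e. e \<in> fst N \<Longrightarrow> e \<subseteq> Q 0 (real n0)"
  shows "fits (Qbar z (real L + real n0)) z L"
proof -
  have *: "y + x \<in> Q z (real L + real n0)" if "x \<in> Q z L" "y \<in> Q 0 (real n0)" for x y
  proof -
    have "y + x \<in> Q x (real n0)" using that(2) by (simp add: Q_iff)
    with that(1) show ?thesis by (rule Q_trans)
  qed
  have "region_le (translate_region x N) (Qbar z (real L + real n0))" if x: "x \<in> Q z L" for x
    unfolding region_le_def translate_region_def Qbar_def fst_conv snd_conv
  proof (intro conjI subsetI)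
    fix e assume "e \<in> (\<lambda>e. (\<lambda>y. y + x) ` e) ` fst N"
    then obtain e' where e': "e' \<in> fst N" "e = (\<lambda>y. y + x) ` e'" by auto
    then show "e \<in> {e \<in> edges. e \<subseteq> Q z (real L + real n0)}" using N_edges assms(2)[OF e'(1)] *[OF x] by (auto simp: edges_translate)
  next
    fix v assume "v \<in> (\<lambda>y. y + x) ` snd N"
    then show "v \<in> Q z (real L + real n0)" using assms(1) *[OF x] by auto
  qed
  moreover have "{x, y} \<in> fst (Qbar z (real L + real n0))" if "x \<in> Q z L" "y \<in> Q z L" "{x, y} \<in> edges" for x y
    using that Q_mono[of "real L" "real L + real n0" z] by (auto simp: Qbar_def)
  ultimately show ?thesis unfolding fits_def by blast
qed

lemma exists_radius:
  assumes "finite (fst N)" "finite (snd N)"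
  shows "\<exists>n0::nat. snd N \<subseteq> Q 0 (real n0) \<and> (\<forall>e\<in>fst N. e \<subseteq> Q 0 (real n0))"
proof -
  define V where "V = snd N \<union> \<Union> (fst N)"
  have "finite e" if "e \<in> edges" for e :: "(int ^ 'd) set" using that by (auto simp: edges_def)
  then have "finite V" unfolding V_def using assms N_edges by blast
  then have fin: "finite (linfnorm ` V)" by simp
  define n0 where "n0 = nat (Max (insert 0 (linfnorm ` V)))"
  have "v \<in> Q 0 (real n0)" if "v \<in> V" for v
  proof -
    have "linfnorm v \<le> Max (insert 0 (linfnorm ` V))" using fin that by (intro Max_ge) auto
    then have "linfnorm v \<le> int n0" unfolding n0_def by simp
    then show ?thesis unfolding Q_of_nat_iff by simp
  qed
  then show ?thesis by (intro exI[of _ n0]) (auto simp: V_def)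
qed

text \<open>By \<open>slow_recursion\<close> a fast crossing at scale K L forces two fast crossings
  at scale L with centres at distance at least 6 L. A union bound over the two centres, decoupling
  and stationarity of M2 square the probability.\<close>

lemma not_slow_step:
  fixes M M2 :: "('e, 'v, 'd) conf measure" and X :: "'x itself"
  assumes N0: "snd N \<subseteq> Q 0 (real n0)" "\<And>e. e \<in> fst N \<Longrightarrow> e \<subseteq> Q 0 (real n0)"
    and M: "prob_space M" "sets M = sets Om" and M2: "prob_space M2" "sets M2 = sets Om" "\<And>x. distr M2 Om (shift x) = M2"
    and L: "1 \<le> L" "n0 \<le> L" and s: "0 \<le> s" "0 \<le> s'" "s' \<le> (real K - 13) * s"
    and dec: "\<And>w1 w2 :: int ^ 'd. 6 * int L \<le> linfnorm (w1 - w2) \<Longrightarrow> \<exists>\<A>.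
      fast_pair (Qbar w1 (real L + real n0)) (Qbar w2 (real L + real n0)) w1 w2 L s \<in> \<A> \<and>
      decoupled X M M2 (Qbar w1 (real L + real n0)) (Qbar w2 (real L + real n0)) \<A> \<delta>"
  shows "measure M {\<omega> \<in> space M. \<not> slow (tt \<omega>) 0 (K * L) s'}
    \<le> (2 * real (K * L) + 1) ^ (2 * CARD('d)) * ((measure M2 {\<omega> \<in> space M2. \<not> slow (tt \<omega>) 0 L s})\<^sup>2 + \<delta>)"
proof -
  interpret M: prob_space M by (rule M)
  interpret M2: prob_space M2 by (rule M2)
  have sp: "space M = space Om" "space M2 = space Om" using M(2) M2(2) sets_eq_imp_space_eq by blast+
  have ns: "{\<omega> \<in> space Om. \<not> slow (tt \<omega>) w L s} \<in> sets Om" for w by (rule sets_not_slow[OF fits_full s(1)])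
  define p where "p = measure M2 {\<omega> \<in> space M2. \<not> slow (tt \<omega>) 0 L s}"
  have stat: "measure M2 {\<omega> \<in> space M2. \<not> slow (tt \<omega>) w L s} = p" for w
  proof -
    have sh: "shift w \<in> M2 \<rightarrow>\<^sub>M Om" using measurable_shift measurable_cong_sets[OF M2(2) refl] by blast
    have "p = measure (distr M2 Om (shift w)) {\<omega> \<in> space Om. \<not> slow (tt \<omega>) 0 L s}" by (simp add: p_def M2(3) sp)
    also have "\<dots> = measure M2 (shift w -` {\<omega> \<in> space Om. \<not> slow (tt \<omega>) 0 L s} \<inter> space M2)"
      by (rule measure_distr[OF sh ns])
    also have "shift w -` {\<omega> \<in> space Om. \<not> slow (tt \<omega>) 0 L s} \<inter> space M2 = {\<omega> \<in> space M2. \<not> slow (tt \<omega>) w L s}"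
      using shift_in_space[of _ ME MV w] by (auto simp: sp slow_shift)
    finally show ?thesis by simp
  qed
  define D where "D = {q \<in> Q 0 (real (K * L)) \<times> Q 0 (real (K * L)). 6 * int L \<le> linfnorm (fst q - snd q :: int ^ 'd)}"
  define E where "E q = {\<omega> \<in> space M. \<not> slow (tt \<omega>) (fst q) L s \<and> \<not> slow (tt \<omega>) (snd q) L s}" for q
  have finD: "finite D" by (simp add: D_def)
  have Eset: "E q \<in> sets M" for q
    unfolding E_def using sets.sets_Collect_conj[OF ns ns] by (simp only: sp M(2))
  have \<delta>: "0 \<le> p\<^sup>2 + \<delta>" if "q \<in> D" for q
  proof -
    have "6 * int L \<le> linfnorm (fst q - snd q)" using that by (simp add: D_def)
    then obtain \<A> where "decoupled X M M2 (Qbar (fst q) (real L + real n0)) (Qbar (snd q) (real L + real n0)) \<A> \<delta>"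
      using dec by blast
    then obtain M' :: "'x measure" and B where "measure M' (space M' - B) \<le> \<delta>"
        unfolding decoupled_def by (elim exE bexE conjE) (rule that, assumption+)
    then have "0 \<le> \<delta>" using measure_nonneg order_trans by blast
    then show ?thesis by simp
  qed
  have "{\<omega> \<in> space M. \<not> slow (tt \<omega>) 0 (K * L) s'} \<subseteq> (\<Union>q\<in>D. E q)"
  proof
    fix \<omega> assume "\<omega> \<in> {\<omega> \<in> space M. \<not> slow (tt \<omega>) 0 (K * L) s'}"
    then have \<omega>: "\<omega> \<in> space Om" "\<not> slow (tt \<omega>) 0 (K * L) s'" by (auto simp: sp)
    \<comment> \<open>Values off the edges are set to 0 because \<open>slow_recursion\<close> asks
      for nonnegativity everywhere.\<close>
    define t where "t x y = (if {x, y} \<in> edges then tt \<omega> x y else 0)" for x y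
    have t0: "0 \<le> t x y" for x y using passage_time_facts(1)[OF \<omega>(1)] by (simp add: t_def less_imp_le)
    have tc: "slow t z L' r \<longleftrightarrow> slow (tt \<omega>) z L' r" for z L' r by (rule slow_cong) (simp add: t_def)
    have "\<not> slow t 0 (K * L) s'" using \<omega>(2) tc by blast
    from slow_recursion[where t = t, OF L(1) s(1) t0 this s(2,3)]
    obtain w1 w2 where "w1 \<in> Q 0 (real (K * L))" "w2 \<in> Q 0 (real (K * L))" "\<not> slow t w1 L s" "\<not> slow t w2 L s" "6 * int L \<le> linfnorm (w1 - w2)"
      by blast
    then have "(w1, w2) \<in> D" "\<omega> \<in> E (w1, w2)" using \<omega> by (auto simp: D_def E_def tc sp)
    then show "\<omega> \<in> (\<Union>q\<in>D. E q)" by blast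
  qed
  then have "measure M {\<omega> \<in> space M. \<not> slow (tt \<omega>) 0 (K * L) s'} \<le> measure M (\<Union>q\<in>D. E q)"
    by (rule M.finite_measure_mono) (intro sets.finite_UN finD Eset)
  also have "\<dots> \<le> (\<Sum>q\<in>D. measure M (E q))" by (rule measure_UNION_le[OF finD Eset])
  also have "\<dots> \<le> (\<Sum>q\<in>D. p\<^sup>2 + \<delta>)"
  proof (rule sum_mono)
    fix q assume "q \<in> D"
    then have "6 * int L \<le> linfnorm (fst q - snd q)" by (simp add: D_def)
    then obtain \<A> where A: "fast_pair (Qbar (fst q) (real L + real n0)) (Qbar (snd q) (real L + real n0)) (fst q) (snd q) L s \<in> \<A>"
      "decoupled X M M2 (Qbar (fst q) (real L + real n0)) (Qbar (snd q) (real L + real n0)) \<A> \<delta>" using dec by blast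
    have "region_le (Qbar z (real L + real n0)) full_region" for z :: "int ^ 'd" by (auto simp: region_le_def Qbar_def full_region_def)
    then show "measure M (E q) \<le> p\<^sup>2 + \<delta>"
      using decoupled_bound[OF A(2,1) M M2(1,2) fits_Qbar[OF N0] fits_Qbar[OF N0] _ _ s(1)]
      by (simp add: E_def stat power2_eq_square)
  qed
  also have "\<dots> \<le> (2 * real (K * L) + 1) ^ (2 * CARD('d)) * (p\<^sup>2 + \<delta>)"
  proof (cases "D = {}")
    case False
    then have nn: "0 \<le> p\<^sup>2 + \<delta>" using \<delta> by blast
    have "real (card D) \<le> real (card (Q 0 (real (K * L)) \<times> Q 0 (real (K * L)) :: ((int ^ 'd) \<times> (int ^ 'd)) set))"
      unfolding D_def of_nat_le_iff by (rule card_mono) (simp, blast)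
    also have "\<dots> = (2 * real (K * L) + 1) ^ CARD('d) * (2 * real (K * L) + 1) ^ CARD('d)"
      unfolding card_cartesian_product card_Q_nat by (simp add: add.commute)
    also have "\<dots> = (2 * real (K * L) + 1) ^ (2 * CARD('d))" by (simp only: power_add[symmetric] mult_2)
    finally have c: "real (card D) \<le> (2 * real (K * L) + 1) ^ (2 * CARD('d))" .
    show ?thesis unfolding sum_constant by (rule mult_right_mono[OF c nn])
  next
    case True
    \<comment> \<open>Without far pairs in the box the union bound is an empty sum, and \<delta> >=
      0 is read off from the decoupling of another pair at distance 6 L.\<close>
    have "0 \<le> \<delta>"
    proof -
      have "6 * int L \<le> linfnorm ((\<chi> i. 6 * int L) - 0 :: int ^ 'd)" using linfnorm_ge[of "(\<chi> i. 6 * int L) :: int ^ 'd"] by simp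
      then obtain \<A> where "decoupled X M M2 (Qbar (\<chi> i. 6 * int L) (real L + real n0)) (Qbar 0 (real L + real n0)) \<A> \<delta>"
        using dec by blast
      then obtain M' :: "'x measure" and B where "measure M' (space M' - B) \<le> \<delta>"
        unfolding decoupled_def by (elim exE bexE conjE) (rule that, assumption+)
      then show "0 \<le> \<delta>" using measure_nonneg order_trans by blast
    qed
    then have "0 \<le> (2 * real (K * L) + 1) ^ (2 * CARD('d)) * (p\<^sup>2 + \<delta>)"
      by (intro mult_nonneg_nonneg) auto
    then show ?thesis using True by simp
  qed
  finally show ?thesis by (simp add: p_def)
qed

end


section \<open>Renormalisation of the passage times\<close>

text \<open>The ratios 2^(m + k) of consecutive scales grow with k, so the fractions 13 / 2^(m + k)
  of lost shells are summable and the speed stays positive. The start 4 m keeps the fourth power of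
  the ratio below the scale, which makes the union bound affordable.\<close>

primrec scale_exponent :: "nat \<Rightarrow> nat \<Rightarrow> nat" where
  "scale_exponent m 0 = 4 * m"
| "scale_exponent m (Suc k) = scale_exponent m k + (m + k)"

definition scale :: "nat \<Rightarrow> nat \<Rightarrow> nat" where
  "scale m k = 2 ^ scale_exponent m k"

lemma scale_Suc: "scale m (Suc k) = 2 ^ (m + k) * scale m k"
  by (simp add: scale_def power_add)

lemma scale_pos: "0 < scale m k" "1 \<le> scale m k"
  by (simp_all add: scale_def)

lemma scale_exponent_ge: "4 \<le> m \<Longrightarrow> 4 * (m + k) \<le> scale_exponent m k" "4 * m + k * m \<le> scale_exponent m k"
  by (induction k) auto

lemma scale_mono: "scale m 0 \<le> scale m k"
proof -
  have "4 * m \<le> scale_exponent m k" using scale_exponent_ge(2)[of m k] by linarith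
  then show ?thesis by (simp add: scale_def)
qed

lemma scale_ratio: "4 \<le> m \<Longrightarrow> (2 ^ (m + k)) ^ 4 \<le> scale m k"
  using scale_exponent_ge(1)[of m k] by (simp add: scale_def power_mult[symmetric] mult.commute)

text \<open>(P3) speaks of boxes of radius l^\<xi> at distance R l. With l = L^(1/\<xi>) and R =
  L^(1 - 1/\<xi>) both lengths equal L. The changes R^(-\<eta>) of the parameter have to add up to
  at most \<delta>, and the doubly exponential error has to beat the polynomial union bound; both
  hold for large m.\<close>

lemma sprinkling_scales:
  fixes n0 D :: nat and RP LP \<xi> \<epsilon> aP C \<eta> \<delta> :: real
  assumes "1 < \<xi>" "0 < \<epsilon>" "0 < aP" "0 < C" "0 < \<eta>" "0 < \<delta>"
  shows "\<exists>m\<ge>6. n0 \<le> scale m 0 \<and> (\<forall>k. let L = real (scale m k) + real n0 in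
    1 \<le> L powr (1 / \<xi>) \<and> LP \<le> L powr (1 / \<xi>) \<and> RP \<le> L powr (1 - 1 / \<xi>) \<and>
    (L powr (1 - 1 / \<xi>)) powr (- \<eta>) \<le> \<delta> / 2 ^ (k + 1) \<and>
    2 * 9 ^ D * real (scale m k) ^ (8 * D) * exp (- C * exp (aP * ln (L powr (1 / \<xi>)) powr \<epsilon>)) \<le> 1)"
proof -
  have \<xi>: "0 < 1 / \<xi>" "0 < 1 - 1 / \<xi>" using assms(1) by auto
  have e1: "\<forall>\<^sub>F L :: real in at_top. 1 \<le> L powr (1 / \<xi>)" "\<forall>\<^sub>F L :: real in at_top. LP \<le> L powr (1 / \<xi>)" "\<forall>\<^sub>F L :: real in at_top. RP \<le> L powr (1 - 1 / \<xi>)"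
    using filterlim_at_top[THEN iffD1, OF real_powr_at_top[OF \<xi>(1)]] filterlim_at_top[THEN iffD1, OF real_powr_at_top[OF \<xi>(2)]] by blast+
  define \<alpha> where "\<alpha> = aP * (1 / \<xi>) powr \<epsilon>"
  have \<alpha>: "0 < \<alpha>" using assms by (simp add: \<alpha>_def)
  \<comment> \<open>In terms of y = ln L: the error exp(-C exp(\<alpha> y^\<epsilon>)) against the
    power exp(8 D y).\<close>
  have "filterlim (\<lambda>y. C * exp (\<alpha> * y powr \<epsilon>) - real (8 * D) * y) at_top at_top"
    using \<alpha> assms by real_asymp
  then have "\<forall>\<^sub>F y in at_top. ln (2 * 9 ^ D) \<le> C * exp (\<alpha> * y powr \<epsilon>) - real (8 * D) * y"
    unfolding filterlim_at_top by blast
  from eventually_compose_filterlim[OF this ln_at_top]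
  have e2: "\<forall>\<^sub>F L :: real in at_top. ln (2 * 9 ^ D) \<le> C * exp (\<alpha> * ln L powr \<epsilon>) - real (8 * D) * ln L" .
  have "\<forall>\<^sub>F L :: real in at_top. 1 \<le> L powr (1 / \<xi>) \<and> LP \<le> L powr (1 / \<xi>) \<and> RP \<le> L powr (1 - 1 / \<xi>) \<and>
      ln (2 * 9 ^ D) \<le> C * exp (\<alpha> * ln L powr \<epsilon>) - real (8 * D) * ln L"
    by (intro eventually_conj e1 e2)
  then obtain L0 :: real where L0: "1 \<le> L powr (1 / \<xi>)" "LP \<le> L powr (1 / \<xi>)" "RP \<le> L powr (1 - 1 / \<xi>)"
      "ln (2 * 9 ^ D) \<le> C * exp (\<alpha> * ln L powr \<epsilon>) - real (8 * D) * ln L" if "L0 \<le> L" for L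
    unfolding eventually_at_top_linorder by blast
  define \<gamma> where "\<gamma> = (1 - 1 / \<xi>) * \<eta>"
  have \<gamma>: "0 < \<gamma>" using \<xi> assms by (simp add: \<gamma>_def)
  \<comment> \<open>Besides n0 and L0: 1 <= \<gamma> m makes the exponent gain at least k at step k,
    and the last entry provides for the constant 2 / \<delta>.\<close>
  define m where "m = max 6 (max n0 (max (nat \<lceil>L0\<rceil>) (max (nat \<lceil>1 / \<gamma>\<rceil>) (nat \<lceil>(1 + log 2 (1 / \<delta>)) / (4 * \<gamma>)\<rceil>))))"
  have m: "6 \<le> m" "n0 \<le> m" "L0 \<le> m" "1 / \<gamma> \<le> m" "(1 + log 2 (1 / \<delta>)) / (4 * \<gamma>) \<le> m" unfolding m_def by linarith+
  have "m \<le> 2 ^ (4 * m)" by (metis less_exp less_imp_le mult.commute mult_le_mono2 one_le_numeral order_trans nat_mult_1_right)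
  then have sm: "m \<le> scale m k" for k using scale_mono[of m k] unfolding scale_def scale_exponent.simps by (rule order_trans)
  have "n0 \<le> scale m 0" using m(2) sm[of 0] by linarith
  moreover have "let L = real (scale m k) + real n0 in
    1 \<le> L powr (1 / \<xi>) \<and> LP \<le> L powr (1 / \<xi>) \<and> RP \<le> L powr (1 - 1 / \<xi>) \<and>
    (L powr (1 - 1 / \<xi>)) powr (- \<eta>) \<le> \<delta> / 2 ^ (k + 1) \<and>
    2 * 9 ^ D * real (scale m k) ^ (8 * D) * exp (- C * exp (aP * ln (L powr (1 / \<xi>)) powr \<epsilon>)) \<le> 1" for k
  proof -
    define L where "L = real (scale m k) + real n0"
    have "real m \<le> real (scale m k)" using sm by (simp only: of_nat_le_iff)
    then have L: "L0 \<le> L" "real (scale m k) \<le> L" unfolding L_def using m(3) by linarith+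
    have sp: "1 \<le> real (scale m k)" using scale_pos by (simp add: Suc_le_eq)
    have Lp: "1 \<le> L" using L sp by linarith
    have "(L powr (1 - 1 / \<xi>)) powr (- \<eta>) = L powr (- \<gamma>)" by (simp add: powr_powr \<gamma>_def)
    also have "\<dots> \<le> real (scale m k) powr (- \<gamma>)" using L sp \<gamma> by (intro powr_mono2') auto
    also have "\<dots> = 2 powr (- \<gamma> * real (scale_exponent m k))"
      by (simp add: scale_def powr_realpow[symmetric] powr_powr mult.commute)
    also have "\<dots> \<le> 2 powr (- (real k + 1 + log 2 (1 / \<delta>)))"
    proof (rule powr_mono)
      have "real (4 * m + k * m) \<le> real (scale_exponent m k)" using scale_exponent_ge(2) by (simp only: of_nat_le_iff)
      then have "\<gamma> * (4 * real m + real k * real m) \<le> \<gamma> * real (scale_exponent m k)" using \<gamma> by simp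
      moreover have "1 + log 2 (1 / \<delta>) \<le> 4 * \<gamma> * real m" using m(5) \<gamma> by (simp add: field_simps)
      moreover have "real k * 1 \<le> real k * (\<gamma> * real m)" using m(4) \<gamma> by (intro mult_left_mono) (simp_all add: field_simps)
      ultimately show "- \<gamma> * real (scale_exponent m k) \<le> - (real k + 1 + log 2 (1 / \<delta>))" by (simp add: algebra_simps)
    qed simp
    also have "\<dots> = \<delta> / 2 ^ (k + 1)"
    proof -
      have "2 powr (- (real k + 1 + log 2 (1 / \<delta>))) = 2 powr (log 2 \<delta> - real (k + 1))"
        using assms by (simp add: log_divide algebra_simps)
      also have "\<dots> = \<delta> / 2 ^ (k + 1)" using assms by (simp only: powr_diff powr_realpow) (simp add: powr_realpow)
      finally show ?thesis .
    qed
    finally have a: "(L powr (1 - 1 / \<xi>)) powr (- \<eta>) \<le> \<delta> / 2 ^ (k + 1)" .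
    have "ln (L powr (1 / \<xi>)) = (1 / \<xi>) * ln L" using Lp by (simp add: ln_powr)
    then have "aP * ln (L powr (1 / \<xi>)) powr \<epsilon> = \<alpha> * ln L powr \<epsilon>"
      using powr_mult[of "1 / \<xi>" "ln L" \<epsilon>] by (simp only: \<alpha>_def mult.assoc)
    then have b: "exp (- C * exp (aP * ln (L powr (1 / \<xi>)) powr \<epsilon>)) = exp (- C * exp (\<alpha> * ln L powr \<epsilon>))" by simp
    have "2 * 9 ^ D * real (scale m k) ^ (8 * D) \<le> 2 * 9 ^ D * L ^ (8 * D)"
      using L by (intro mult_left_mono power_mono) auto
    also have "\<dots> = exp (ln (2 * 9 ^ D) + real (8 * D) * ln L)"
      using Lp by (simp add: exp_add ln_realpow[symmetric] exp_of_nat_mult[symmetric] del: of_nat_mult)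
    also have "\<dots> \<le> exp (C * exp (\<alpha> * ln L powr \<epsilon>))" using L0(4)[OF L(1)] by simp
    finally have "2 * 9 ^ D * real (scale m k) ^ (8 * D) * exp (- C * exp (\<alpha> * ln L powr \<epsilon>)) \<le> exp (C * exp (\<alpha> * ln L powr \<epsilon>)) * exp (- C * exp (\<alpha> * ln L powr \<epsilon>))"
      by (rule mult_right_mono) simp
    also have "\<dots> = 1" by (simp add: exp_add[symmetric])
    finally show ?thesis unfolding Let_def L_def[symmetric] b using L0[OF L(1)] a by blast
  qed
  ultimately show ?thesis using m(1) by blast
qed

text \<open>Write M for the ratio of the scales. Squaring gains L^(-8D), the union bound costs (M
  L)^(2D), and the target is (M L)^(-4D). So 9^D (M L)^(6D) must be at most L^(8D) / 2, which
  follows from M^4 <= L and M >= 64; the other half is left for \<delta>.\<close>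

lemma scale_recursion:
  fixes p p' \<delta> :: real
  assumes m: "6 \<le> m" and p: "0 \<le> p" "p \<le> 1 / real (scale m k) ^ (4 * D)" and D: "0 < D"
    and \<delta>: "2 * 9 ^ D * real (scale m k) ^ (8 * D) * \<delta> \<le> 1" "0 \<le> \<delta>"
    and p': "p' \<le> (2 * real (scale m (Suc k)) + 1) ^ (2 * D) * (p\<^sup>2 + \<delta>)"
  shows "p' \<le> 1 / real (scale m (Suc k)) ^ (4 * D)"
proof -
  define L M where "L = real (scale m k)" and "M = (2 ^ (m + k) :: real)"
  have L': "real (scale m (Suc k)) = M * L" by (simp add: scale_Suc L_def M_def)
  have L1: "1 \<le> L" unfolding L_def using scale_pos by (simp add: Suc_le_eq)
  have "(2::real) ^ 6 \<le> 2 ^ (m + k)" by (rule power_increasing) (use m in auto)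
  then have M: "64 \<le> M" by (simp add: M_def)
  have "real ((2 ^ (m + k)) ^ 4) \<le> real (scale m k)" using scale_ratio[of m k] m by (simp only: of_nat_le_iff)
  then have MleL: "M ^ 4 \<le> L" by (simp add: L_def M_def)
  have one_le: "1 \<le> M * L" using mult_mono[of 1 M 1 L] M L1 by linarith
  have "(2 * (M * L) + 1) ^ (2 * D) \<le> (3 * (M * L)) ^ (2 * D)" using one_le by (intro power_mono) linarith+
  also have "\<dots> = 9 ^ D * (M * L) ^ (2 * D)" by (simp add: power_mult power_mult_distrib)
  finally have c: "(2 * (M * L) + 1) ^ (2 * D) \<le> 9 ^ D * (M * L) ^ (2 * D)" .
  have "p' \<le> 9 ^ D * (M * L) ^ (2 * D) * (p\<^sup>2 + \<delta>)"
    using p' mult_right_mono[OF c, of "p\<^sup>2 + \<delta>"] \<delta>(2) by (simp add: L')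
  then have "(M * L) ^ (4 * D) * p' \<le> (M * L) ^ (4 * D) * (9 ^ D * (M * L) ^ (2 * D) * (p\<^sup>2 + \<delta>))"
    using one_le by (intro mult_left_mono) auto
  also have "\<dots> = 9 ^ D * (M * L) ^ (6 * D) * p\<^sup>2 + 9 ^ D * (M * L) ^ (6 * D) * \<delta>"
  proof -
    have "(M * L) ^ (6 * D) = (M * L) ^ (4 * D) * (M * L) ^ (2 * D)" by (simp add: power_add[symmetric])
    then show ?thesis by (simp only: algebra_simps)
  qed
  also have "\<dots> \<le> 1 / 2 + 1 / 2"
  proof (rule add_mono)
    have M8: "M ^ 8 \<le> L ^ 2" using power_mono[OF MleL, of 2] by (simp add: power_mult[symmetric])
    have "9 * M ^ 6 * L ^ 6 \<le> 1 / 2 * L ^ 8"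
    proof -
      have "18 * M ^ 6 \<le> M ^ 2 * M ^ 6" using M power_mono[of 64 M 2] by (intro mult_right_mono) auto
      also have "\<dots> \<le> L ^ 2" using M8 by (simp add: power_add[symmetric])
      finally have "18 * M ^ 6 * L ^ 6 \<le> L ^ 2 * L ^ 6" using L1 by (intro mult_right_mono) auto
      then show ?thesis by (simp add: power_add[symmetric])
    qed
    then have "(9 * M ^ 6 * L ^ 6) ^ D \<le> (1 / 2 * L ^ 8) ^ D" using M L1 by (intro power_mono) auto
    also have "\<dots> \<le> 1 / 2 * L ^ (8 * D)"
    proof -
      have "(1 / 2 :: real) ^ D \<le> (1 / 2) ^ 1" using D by (intro power_decreasing) auto
      then have "(1 / 2) ^ D * (L ^ 8) ^ D \<le> (1 / 2) ^ 1 * (L ^ 8) ^ D" using L1 by (intro mult_right_mono) auto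
      then show ?thesis by (simp only: power_mult_distrib power_mult power_one_right)
    qed
    finally have k1: "9 ^ D * (M * L) ^ (6 * D) \<le> 1 / 2 * L ^ (8 * D)"
      by (simp add: power_mult_distrib power_mult[symmetric])
    have "p\<^sup>2 \<le> (1 / L ^ (4 * D))\<^sup>2" using p by (intro power_mono) (auto simp: L_def)
    also have "\<dots> = 1 / L ^ (8 * D)" by (simp add: power_divide power_mult[symmetric])
    finally have "9 ^ D * (M * L) ^ (6 * D) * p\<^sup>2 \<le> 1 / 2 * L ^ (8 * D) * (1 / L ^ (8 * D))"
      using L1 by (intro mult_mono[OF k1]) auto
    then show "9 ^ D * (M * L) ^ (6 * D) * p\<^sup>2 \<le> 1 / 2" using L1 by simp
    have "M ^ 6 * L ^ 6 \<le> L ^ 8"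
    proof -
      have "M ^ 6 \<le> M ^ 8" using M by (intro power_increasing) auto
      then have "M ^ 6 * L ^ 6 \<le> L ^ 2 * L ^ 6" using M8 L1 by (intro mult_right_mono) auto
      then show ?thesis by (simp add: power_add[symmetric])
    qed
    then have "(M ^ 6 * L ^ 6) ^ D \<le> (L ^ 8) ^ D" using M L1 by (intro power_mono) auto
    then have "(M * L) ^ (6 * D) \<le> L ^ (8 * D)" by (simp add: power_mult_distrib power_mult[symmetric])
    then have "9 ^ D * (M * L) ^ (6 * D) * \<delta> \<le> 9 ^ D * L ^ (8 * D) * \<delta>"
      using \<delta>(2) by (intro mult_right_mono mult_left_mono) auto
    then show "9 ^ D * (M * L) ^ (6 * D) * \<delta> \<le> 1 / 2" using \<delta>(1) unfolding L_def[symmetric] by linarith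
  qed
  finally have "(M * L) ^ (4 * D) * p' \<le> 1" by simp
  moreover have "0 < (M * L) ^ (4 * D)" using one_le by (intro zero_less_power) linarith
  ultimately show ?thesis unfolding L' by (metis pos_le_divide_eq mult.commute)
qed


context percolation_model begin

lemma exists_slow_base:
  fixes M :: "('e, 'v, 'd) conf measure"
  assumes "prob_space M" "sets M = sets Om" "1 \<le> L" "0 < \<epsilon>"
  shows "\<exists>s>0. measure M {\<omega> \<in> space M. \<not> slow (tt \<omega>) 0 L s} \<le> \<epsilon>"
proof -
  interpret M: prob_space M by (rule assms)
  have sp: "space M = space Om" using assms(2) sets_eq_imp_space_eq by blast
  define A where "A n = {\<omega> \<in> space M. \<not> slow (tt \<omega>) 0 L (1 / real (Suc n))}" for n
  have A: "A n \<in> sets M" for n unfolding A_def sp assms(2) by (rule sets_not_slow[OF fits_full]) simp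
  have "decseq A"
  proof (intro decseq_SucI subsetI)
    fix n \<omega> assume "\<omega> \<in> A (Suc n)"
    then show "\<omega> \<in> A n" unfolding A_def using slow_scale[of "tt \<omega>" 0 L "1 / real (Suc n)" "1 / real (Suc (Suc n))"]
      by (auto simp: field_simps)
  qed
  moreover have "(\<Inter>n. A n) = {}"
  proof (rule ccontr)
    assume "(\<Inter>n. A n) \<noteq> {}"
    then obtain \<omega> where \<omega>: "\<omega> \<in> A n" for n by blast
    then have sp\<omega>: "\<omega> \<in> space Om" using \<omega>[of 0] by (simp add: A_def sp)
    define V where "V = (\<lambda>(x, y). tt \<omega> x y) ` {(x, y) \<in> Q 0 (real L) \<times> Q 0 (real L). {x, y} \<in> edges}"
    have fin: "finite (insert 1 V)" unfolding V_def by (intro finite.insertI finite_imageI finite_subset[OF _ finite_cartesian_product[OF finite_Q finite_Q]]) auto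
    define t where "t = Min (insert 1 V)"
    have "0 < t" unfolding t_def using fin passage_time_facts(1)[OF sp\<omega>] by (subst Min_gr_iff) (auto simp: V_def)
    then obtain n where n: "1 / real (Suc n) < t" using nat_approx_posE by metis
    have "slow (tt \<omega>) 0 L (1 / real (Suc n))"
    proof (rule slow_base)
      fix x y :: "int ^ 'd" assume "{x, y} \<in> edges" "x \<in> Q 0 (real L)" "y \<in> Q 0 (real L)"
      then have "tt \<omega> x y \<in> insert 1 V" unfolding V_def by (intro insertI2 image_eqI[of _ _ "(x, y)"]) auto
      then have "t \<le> tt \<omega> x y" unfolding t_def using fin by (intro Min_le)
      then show "1 / real (Suc n) \<le> tt \<omega> x y" using n by linarith
    qed (use assms in auto)
    with \<omega>[of n] show False by (simp add: A_def)
  qed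
  ultimately have "(\<lambda>n. measure M (A n)) \<longlonglongrightarrow> measure M {}"
    using M.finite_Lim_measure_decseq[of A] A by (metis image_subsetI)
  then have "\<forall>\<^sub>F n in sequentially. measure M (A n) < \<epsilon>" using assms(4) by (intro order_tendstoD) auto
  then obtain n where "measure M (A n) < \<epsilon>" unfolding eventually_sequentially by blast
  then show ?thesis unfolding A_def by (intro exI[of _ "1 / real (Suc n)"]) auto
qed

text \<open>The parameters v k approach u without reaching it. The bound at u comes from one last
  step that leads from v k straight to u, so it is stated for scale Suc k.\<close>

lemma slow_passage_probability:
  fixes P :: "real \<Rightarrow> ('e, 'v, 'd) conf measure" and X :: "'x itself"
  assumes N_fin: "finite (fst N)" "finite (snd N)"
    and I: "open I" "u \<in> I"
    and prob: "\<And>v. v \<in> I \<Longrightarrow> prob_space (P v)" and sets_P: "\<And>v. v \<in> I \<Longrightarrow> sets (P v) = sets Om"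
    and stat: "\<And>v x. v \<in> I \<Longrightarrow> distr (P v) Om (shift x) = P v"
    and P3: "cond_P3 X ME MV I P"
    and mono: "monotone_either (space (triple_space ME MV N)) (triple_le N) (\<lambda>(s, t, e). edge_weight a \<kappa> s t e)"
  shows "\<exists>m \<sigma>. 6 \<le> m \<and> 0 < \<sigma> \<and> (\<forall>k. measure (P u) {\<omega> \<in> space (P u). \<not> slow (tt \<omega>) 0 (scale m (Suc k)) (\<sigma> * real (scale m (Suc k)))}
    \<le> 1 / real (scale m (Suc k)) ^ (4 * CARD('d)))"
proof -
  obtain n0 :: nat where n0: "snd N \<subseteq> Q 0 (real n0)" "\<And>e. e \<in> fst N \<Longrightarrow> e \<subseteq> Q 0 (real n0)"
    using exists_radius[OF N_fin] by blast
  obtain RP LP \<xi> \<epsilon> aP C \<eta> :: real and f :: "real \<Rightarrow> real" where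
    c: "1 < \<xi>" "0 < \<epsilon>" "0 < aP" "0 < C" "0 < \<eta>" and f': "\<forall>L\<ge>1. exp (aP * ln L powr \<epsilon>) \<le> f L"
    and dc: "\<forall>R\<ge>RP. \<forall>L\<ge>LP. \<forall>x1 x2 :: int ^ 'd.
           let Q1 = Qbar x1 (L powr \<xi>); Q2 = Qbar x2 (L powr \<xi>) in
           R * L \<le> region_dist Q1 Q2 \<longrightarrow>
           (\<forall>u\<in>I. \<forall>u'\<in>I. u' + R powr (- \<eta>) \<le> u \<longrightarrow>
              decoupled X (P u') (P u) Q1 Q2 (increasing_events ME MV Q1 Q2) (exp (- C * f L)) \<and>
              decoupled X (P u) (P u') Q1 Q2 (decreasing_events ME MV Q1 Q2) (exp (- C * f L)))"
    using P3 unfolding cond_P3_def by (elim exE conjE) (rule that, assumption+)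
  have f: "\<And>L. L \<ge> 1 \<Longrightarrow> exp (aP * ln L powr \<epsilon>) \<le> f L" using f' by blast
  \<comment> \<open>\<tau> = 1 if weights decrease in the configuration: fast crossings are then
    increasing, (P3) bounds them at a lower parameter by those at a higher one, and u is approached
    from above.\<close>
  obtain \<tau> :: real where \<tau>: "\<tau> = 1 \<or> \<tau> = -1"
    and m1: "\<tau> = 1 \<Longrightarrow> monotone_on (space (triple_space ME MV N)) (triple_le N) (\<ge>) (\<lambda>(s, t, e). edge_weight a \<kappa> s t e)"
    and m2: "\<tau> = -1 \<Longrightarrow> monotone_on (space (triple_space ME MV N)) (triple_le N) (\<le>) (\<lambda>(s, t, e). edge_weight a \<kappa> s t e)"
  proof -
    have one: "(1::real) \<noteq> -1" by simp
    from mono show ?thesis unfolding monotone_either_def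
    proof
      assume "monotone_on (space (triple_space ME MV N)) (triple_le N) (\<le>) (\<lambda>(s, t, e). edge_weight a \<kappa> s t e)"
      then show ?thesis using one by (intro that[of "-1"]) auto
    next
      assume "monotone_on (space (triple_space ME MV N)) (triple_le N) (\<ge>) (\<lambda>(s, t, e). edge_weight a \<kappa> s t e)"
      then show ?thesis using one by (intro that[of 1]) auto
    qed
  qed
  obtain \<delta> where \<delta>: "0 < \<delta>" "\<And>v. dist v u \<le> \<delta> \<Longrightarrow> v \<in> I" using I by (metis open_contains_cball mem_cball dist_commute subsetD)
  obtain m where m: "6 \<le> m" "n0 \<le> scale m 0" and
    sc: "\<forall>k. let L = real (scale m k) + real n0 in
    1 \<le> L powr (1 / \<xi>) \<and> LP \<le> L powr (1 / \<xi>) \<and> RP \<le> L powr (1 - 1 / \<xi>) \<and>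
    (L powr (1 - 1 / \<xi>)) powr (- \<eta>) \<le> \<delta> / 2 ^ (k + 1) \<and>
    2 * 9 ^ CARD('d) * real (scale m k) ^ (8 * CARD('d)) * exp (- C * exp (aP * ln (L powr (1 / \<xi>)) powr \<epsilon>)) \<le> 1"
    using sprinkling_scales[OF c \<delta>(1), where RP = RP and LP = LP and D = "CARD('d)" and ?n0.0 = n0] by blast
  define v where "v k = u + \<tau> * (\<delta> / 2 ^ k)" for k :: nat
  have v: "v k \<in> I" for k
  proof (rule \<delta>)
    have "(1::real) \<le> 2 ^ k" by simp
    then have "\<delta> / 2 ^ k \<le> \<delta> / 1" using \<delta> by (intro divide_left_mono) auto
    then show "dist (v k) u \<le> \<delta>" using \<tau> \<delta> by (auto simp: v_def dist_real_def)
  qed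
  obtain s0 where s0: "0 < s0" "measure (P (v 0)) {\<omega> \<in> space (P (v 0)). \<not> slow (tt \<omega>) 0 (scale m 0) s0} \<le> 1 / real (scale m 0) ^ (4 * CARD('d))"
    using exists_slow_base[OF prob[OF v] sets_P[OF v], of "scale m 0" "1 / real (scale m 0) ^ (4 * CARD('d))" 0] scale_pos[of m 0] by auto
  \<comment> \<open>The last factor lets the speed drop from its initial value to one half of it,
    which makes room for the lost shells.\<close>
  define s where "s k = s0 * (real (scale m k) / real (scale m 0)) * (1 / 2 + (1 / 2) ^ (k + 1))" for k
  have s_nn: "0 \<le> s k" for k using s0 by (simp add: s_def)
  have s_Suc: "s (Suc k) \<le> (real (2 ^ (m + k)) - 13) * s k" for k
  proof -
    define x where "x = (1 / 2 :: real) ^ (k + 1)"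
    define M where "M = (2 ^ (m + k) :: real)"
    have "(2::real) ^ 4 \<le> 2 ^ (m - 2)" by (rule power_increasing) (use m in auto)
    moreover have "M * x = 2 * 2 ^ (m - 2)"
    proof -
      have "M = 2 ^ (m - 2) * 2 ^ 2 * 2 ^ k" unfolding M_def power_add[symmetric] using m(1) by (intro arg_cong[of _ _ "power 2"]) linarith
      then show ?thesis by (simp add: x_def power_one_over field_simps)
    qed
    \<comment> \<open>For x <= 1/2 the loss of 13 shells is compensated as soon as M x >= 26; m >= 6
      gives 32.\<close>
    ultimately have Mx: "32 \<le> M * x" by simp
    have x: "x \<le> 1 / 2" unfolding x_def using power_decreasing[of 1 "k + 1" "1 / 2 :: real"] by simp
    have "M * (1 / 2 + x / 2) \<le> (M - 13) * (1 / 2 + x)" using Mx x by (simp add: algebra_simps)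
    then have "s0 * (real (scale m k) / real (scale m 0)) * (M * (1 / 2 + x / 2)) \<le> s0 * (real (scale m k) / real (scale m 0)) * ((M - 13) * (1 / 2 + x))"
      using s0 by (intro mult_left_mono) auto
    moreover have "s (Suc k) = s0 * (real (scale m k) / real (scale m 0)) * (M * (1 / 2 + x / 2))"
      by (simp add: s_def scale_Suc x_def M_def)
    moreover have "(real (2 ^ (m + k)) - 13) * s k = s0 * (real (scale m k) / real (scale m 0)) * ((M - 13) * (1 / 2 + x))"
      by (simp add: s_def x_def M_def)
    ultimately show ?thesis by simp
  qed
  have step: "measure (P w') {\<omega> \<in> space (P w'). \<not> slow (tt \<omega>) 0 (scale m (Suc k)) (s (Suc k))} \<le> 1 / real (scale m (Suc k)) ^ (4 * CARD('d))"
    if w: "w \<in> I" "w' \<in> I" "\<delta> / 2 ^ (k + 1) \<le> \<tau> * (w - w')"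
      and pk: "measure (P w) {\<omega> \<in> space (P w). \<not> slow (tt \<omega>) 0 (scale m k) (s k)} \<le> 1 / real (scale m k) ^ (4 * CARD('d))" for w w' k
  proof (rule scale_recursion[OF m(1) measure_nonneg pk])
    define L where "L = real (scale m k) + real n0"
    define ll where "ll = L powr (1 / \<xi>)"
    define R where "R = L powr (1 - 1 / \<xi>)"
    have l: "1 \<le> ll" "LP \<le> ll" "RP \<le> R" "R powr (- \<eta>) \<le> \<delta> / 2 ^ (k + 1)"
      "2 * 9 ^ CARD('d) * real (scale m k) ^ (8 * CARD('d)) * exp (- C * exp (aP * ln ll powr \<epsilon>)) \<le> 1"
      using sc unfolding Let_def L_def ll_def R_def by blast+
    have Lp: "1 \<le> L" unfolding L_def using scale_pos(2)[of m k] by linarith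
    have lx: "ll powr \<xi> = L" using Lp c by (simp add: ll_def powr_powr)
    have Rl: "R * ll = L" using Lp by (simp add: R_def ll_def powr_add[symmetric])
    show "0 < CARD('d)" by simp
    show "0 \<le> exp (- C * f ll)" by simp
    have "exp (- C * f ll) \<le> exp (- C * exp (aP * ln ll powr \<epsilon>))" using f[OF l(1)] c by simp
    then have "2 * 9 ^ CARD('d) * real (scale m k) ^ (8 * CARD('d)) * exp (- C * f ll) \<le> 2 * 9 ^ CARD('d) * real (scale m k) ^ (8 * CARD('d)) * exp (- C * exp (aP * ln ll powr \<epsilon>))"
      by (intro mult_left_mono) auto
    then show "2 * 9 ^ CARD('d) * real (scale m k) ^ (8 * CARD('d)) * exp (- C * f ll) \<le> 1" using l(5) by linarith
    have n0L: "n0 \<le> scale m k" using m(2) scale_mono[of m k] by linarith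
    show "measure (P w') {\<omega> \<in> space (P w'). \<not> slow (tt \<omega>) 0 (scale m (Suc k)) (s (Suc k))}
      \<le> (2 * real (scale m (Suc k)) + 1) ^ (2 * CARD('d)) * ((measure (P w) {\<omega> \<in> space (P w). \<not> slow (tt \<omega>) 0 (scale m k) (s k)})\<^sup>2 + exp (- C * f ll))"
      unfolding scale_Suc
    proof (rule not_slow_step[OF n0 prob[OF w(2)] sets_P[OF w(2)] prob[OF w(1)] sets_P[OF w(1)] stat[OF w(1)] scale_pos(2) n0L s_nn s_nn s_Suc, where X = X])
      fix w1 w2 :: "int ^ 'd" assume far: "6 * int (scale m k) \<le> linfnorm (w1 - w2)"
      have "real_of_int (6 * int (scale m k)) \<le> real_of_int (linfnorm (w1 - w2))" using far by (simp only: of_int_le_iff)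
      then have "L + 2 * L \<le> real_of_int (linfnorm (w1 - w2))" using n0L by (simp add: L_def)
      then have "R * ll \<le> region_dist (Qbar w1 (ll powr \<xi>)) (Qbar w2 (ll powr \<xi>))"
        unfolding lx Rl using Lp by (intro region_dist_Qbar_ge) auto
      then have D: "\<forall>u\<in>I. \<forall>u'\<in>I. u' + R powr (- \<eta>) \<le> u \<longrightarrow>
              decoupled X (P u') (P u) (Qbar w1 L) (Qbar w2 L) (increasing_events ME MV (Qbar w1 L) (Qbar w2 L)) (exp (- C * f ll)) \<and>
              decoupled X (P u) (P u') (Qbar w1 L) (Qbar w2 L) (decreasing_events ME MV (Qbar w1 L) (Qbar w2 L)) (exp (- C * f ll))"
        using dc l(2,3) lx unfolding Let_def by (metis (no_types, lifting))
      have F: "fits (Qbar z L) z (scale m k)" for z unfolding L_def by (rule fits_Qbar[OF n0])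
      from \<tau> show "\<exists>\<A>. fast_pair (Qbar w1 (real (scale m k) + real n0)) (Qbar w2 (real (scale m k) + real n0)) w1 w2 (scale m k) (s k) \<in> \<A> \<and>
        decoupled X (P w') (P w) (Qbar w1 (real (scale m k) + real n0)) (Qbar w2 (real (scale m k) + real n0)) \<A> (exp (- C * f ll))"
      proof
        assume t: "\<tau> = 1"
        then have "w' + R powr (- \<eta>) \<le> w" using w(3) l(4) by simp
        then have dd: "decoupled X (P w') (P w) (Qbar w1 L) (Qbar w2 L) (increasing_events ME MV (Qbar w1 L) (Qbar w2 L)) (exp (- C * f ll))"
          using bspec[OF bspec[OF D w(1)] w(2)] by simp
        show ?thesis unfolding L_def[symmetric] by (rule exI, rule conjI, rule fast_pair_events(1)[OF F F s_nn m1[OF t]], rule dd)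
      next
        assume t: "\<tau> = -1"
        then have "w + R powr (- \<eta>) \<le> w'" using w(3) l(4) by simp
        then have dd: "decoupled X (P w') (P w) (Qbar w1 L) (Qbar w2 L) (decreasing_events ME MV (Qbar w1 L) (Qbar w2 L)) (exp (- C * f ll))"
          using bspec[OF bspec[OF D w(2)] w(1)] by simp
        show ?thesis unfolding L_def[symmetric] by (rule exI, rule conjI, rule fast_pair_events(2)[OF F F s_nn m2[OF t]], rule dd)
      qed
    qed
  qed
  have vk: "measure (P (v k)) {\<omega> \<in> space (P (v k)). \<not> slow (tt \<omega>) 0 (scale m k) (s k)} \<le> 1 / real (scale m k) ^ (4 * CARD('d))" for k
  proof (induction k)
    case 0
    have "s 0 = s0" using scale_pos[of m 0] by (simp add: s_def)
    then show ?case using s0 by simp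
  next
    case (Suc k)
    have "\<tau> * (v k - v (Suc k)) = \<delta> / 2 ^ (k + 1)" using \<tau> by (auto simp: v_def field_simps)
    then show ?case by (intro step[OF v v _ Suc]) simp
  qed
  define \<sigma> where "\<sigma> = s0 / (2 * real (scale m 0))"
  have "measure (P u) {\<omega> \<in> space (P u). \<not> slow (tt \<omega>) 0 (scale m (Suc k)) (\<sigma> * real (scale m (Suc k)))} \<le> 1 / real (scale m (Suc k)) ^ (4 * CARD('d))" for k
  proof -
    interpret Pu: prob_space "P u" using prob[OF I(2)] .
    have sp: "space (P u) = space Om" using sets_P[OF I(2)] sets_eq_imp_space_eq by blast
    have "\<sigma> * real (scale m (Suc k)) = s0 * (real (scale m (Suc k)) / real (scale m 0)) * (1 / 2)" by (simp add: \<sigma>_def)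
    also have "\<dots> \<le> s (Suc k)" unfolding s_def using s0 by (intro mult_left_mono) auto
    finally have le: "\<sigma> * real (scale m (Suc k)) \<le> s (Suc k)" .
    have \<sigma>0: "0 \<le> \<sigma> * real (scale m (Suc k))" using s0 by (simp add: \<sigma>_def)
    have "measure (P u) {\<omega> \<in> space (P u). \<not> slow (tt \<omega>) 0 (scale m (Suc k)) (\<sigma> * real (scale m (Suc k)))}
      \<le> measure (P u) {\<omega> \<in> space (P u). \<not> slow (tt \<omega>) 0 (scale m (Suc k)) (s (Suc k))}"
    proof (rule Pu.finite_measure_mono)
      show "{\<omega> \<in> space (P u). \<not> slow (tt \<omega>) 0 (scale m (Suc k)) (s (Suc k))} \<in> Pu.events"
        unfolding sp sets_P[OF I(2)] by (rule sets_not_slow[OF fits_full s_nn])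
    qed (use slow_scale[OF _ \<sigma>0 le] in blast)
    also have "\<dots> \<le> 1 / real (scale m (Suc k)) ^ (4 * CARD('d))"
    proof (rule step[OF v I(2) _ vk])
      have "\<delta> / 2 ^ (k + 1) \<le> \<delta> / 2 ^ k" using \<delta> by (intro divide_left_mono) auto
      then show "\<delta> / 2 ^ (k + 1) \<le> \<tau> * (v k - u)" using \<tau> by (auto simp: v_def)
    qed
    finally show ?thesis .
  qed
  moreover have "0 < \<sigma>" using s0 scale_pos by (simp add: \<sigma>_def)
  ultimately show ?thesis using m(1) by blast
qed

end


section \<open>Potentials of linear growth\<close>

lemma potential_from_slow:
  fixes t :: "int ^ 'd \<Rightarrow> int ^ 'd \<Rightarrow> real" and \<sigma> R :: real
  assumes L: "1 \<le> L" and \<sigma>: "0 < \<sigma>" and t: "\<And>x y. 0 \<le> t x y" and R: "4 * real L \<le> R"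
    and sl: "\<And>w. real_of_int (linfnorm (w - x)) \<le> 2 * R \<Longrightarrow> slow t w L (\<sigma> * real L)"
  shows "\<exists>\<psi>. (\<forall>z\<in>Q x R. \<psi> z = 0) \<and> (\<forall>z. z \<notin> Q x (2 * R) \<longrightarrow> \<sigma> / 2 * R \<le> \<psi> z) \<and>
    (\<forall>y z. {y, z} \<in> edges \<longrightarrow> \<bar>\<psi> y - \<psi> z\<bar> \<le> t y z)"
proof -
  define r where "r = R / real L"
  have Lp: "0 < real L" using L by simp
  have r: "4 \<le> r" "R = r * real L" using R Lp by (simp_all add: r_def field_simps)
  \<comment> \<open>The full shells of thickness L between R and 2 R; their number is at least r -
    2, hence at least r / 2 because r >= 4.\<close>
  define lo hi where "lo = nat \<lceil>r\<rceil>" and "hi = nat \<lfloor>2 * r\<rfloor>"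
  have lo: "r \<le> real lo" "real lo \<le> r + 1" and hi: "real hi \<le> 2 * r" "2 * r - 1 \<le> real hi"
    using r unfolding lo_def hi_def by linarith+
  define J where "J = {lo..<hi}"
  have cJ: "r / 2 \<le> real (card J)" unfolding J_def using lo hi r by (simp add: of_nat_diff)
  have J: "R \<le> real j * real L" "(real j + 1) * real L \<le> 2 * R" if "j \<in> J" for j
  proof -
    have "r \<le> real j" "real j + 1 \<le> 2 * r" proof -
      have "lo \<le> j" "Suc j \<le> hi" using that by (auto simp: J_def)
      then have "real lo \<le> real j" "real (Suc j) \<le> real hi" by (simp_all only: of_nat_le_iff)
      then show "r \<le> real j" "real j + 1 \<le> 2 * r" using lo hi by simp_all
    qed
    then show "R \<le> real j * real L" "(real j + 1) * real L \<le> 2 * R"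
      unfolding r(2) using Lp by (simp_all add: mult_right_mono mult.assoc[symmetric] del: mult.assoc)
  qed
  have sJ: "slow t w L (\<sigma> * real L)" if "j \<in> J" "linfnorm (w - x) = int j * int L" for j w
  proof (rule sl)
    have "real j * real L \<le> (real j + 1) * real L" using Lp by simp
    then show "real_of_int (linfnorm (w - x)) \<le> 2 * R" using J(2)[OF that(1)] that(2) by simp
  qed
  have s0: "0 \<le> \<sigma> * real L" using \<sigma> by simp
  have fJ: "finite J" by (simp add: J_def)
  have G: "\<exists>\<Phi>. (\<forall>v. 0 \<le> \<Phi> v \<and> \<Phi> v \<le> card J * (\<sigma> * real L)) \<and>
    (\<forall>v. (\<forall>j\<in>J. linfnorm (v - x) \<le> int j * int L) \<longrightarrow> \<Phi> v = 0) \<and>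
    (\<forall>v. (\<forall>j\<in>J. int (j + 1) * int L \<le> linfnorm (v - x)) \<longrightarrow> \<Phi> v = card J * (\<sigma> * real L)) \<and>
    (\<forall>x y. {x, y} \<in> edges \<longrightarrow> \<bar>\<Phi> x - \<Phi> y\<bar> \<le> t x y)"
    by (rule glue_shells[OF L s0 t fJ]) (rule sJ)
  obtain \<Phi> where \<Phi>: "\<forall>v. (\<forall>j\<in>J. linfnorm (v - x) \<le> int j * int L) \<longrightarrow> \<Phi> v = 0"
    "\<forall>v. (\<forall>j\<in>J. int (j + 1) * int L \<le> linfnorm (v - x)) \<longrightarrow> \<Phi> v = card J * (\<sigma> * real L)"
    "\<forall>x y. {x, y} \<in> edges \<longrightarrow> \<bar>\<Phi> x - \<Phi> y\<bar> \<le> t x y" using G by (elim exE conjE) (rule that, assumption+)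
  have "\<Phi> z = 0" if "z \<in> Q x R" for z
  proof (rule \<Phi>(1)[rule_format])
    fix j assume "j \<in> J"
    then have "real_of_int (linfnorm (z - x)) \<le> real_of_int (int j * int L)" using J(1) that by (force simp: Q_iff)
    then show "linfnorm (z - x) \<le> int j * int L" by (simp only: of_int_le_iff)
  qed
  moreover have "\<sigma> / 2 * R \<le> \<Phi> z" if "z \<notin> Q x (2 * R)" for z
  proof -
    have "\<Phi> z = card J * (\<sigma> * real L)"
    proof (rule \<Phi>(2)[rule_format])
      fix j assume "j \<in> J"
      then have "real_of_int (int (j + 1) * int L) \<le> real_of_int (linfnorm (z - x))" using J(2)[of j] that by (simp add: Q_iff add.commute)
      then show "int (j + 1) * int L \<le> linfnorm (z - x)" by (simp only: of_int_le_iff)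
    qed
    moreover have "r / 2 * (\<sigma> * real L) \<le> card J * (\<sigma> * real L)" using cJ s0 by (rule mult_right_mono)
    ultimately show ?thesis by (simp add: r(2) mult_ac)
  qed
  ultimately show ?thesis using \<Phi>(3) by blast
qed

context percolation_measure begin

text \<open>Borel-Cantelli over the scales, after a union over all starting points in a box of the
  next scale. Each large R lies between 4 L k and 4 L (Suc k) for some k, and all starting points
  within 2 R of x are then slow at scale k.\<close>

lemma AE_potentials:
  assumes m: "6 \<le> m" and \<sigma>: "0 < \<sigma>"
    and small: "\<And>k. measure M {\<omega> \<in> space M. \<not> slow (tt \<omega>) 0 (scale m (Suc k)) (\<sigma> * real (scale m (Suc k)))} \<le> 1 / real (scale m (Suc k)) ^ (4 * CARD('d))"
  shows "AE \<omega> in M. \<forall>x. \<exists>R0. \<forall>R::real. R0 \<le> R \<longrightarrow> (\<exists>\<psi>. (\<forall>z\<in>Q x R. \<psi> z = 0) \<and> (\<forall>z. z \<notin> Q x (2 * R) \<longrightarrow> \<sigma> / 2 * R \<le> \<psi> z) \<and>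
    (\<forall>y z. {y, z} \<in> edges \<longrightarrow> \<bar>\<psi> y - \<psi> z\<bar> \<le> tt \<omega> y z))"
proof -
  define L where "L k = scale m (Suc k)" for k
  define F where "F k w = {\<omega> \<in> space M. \<not> slow (tt \<omega>) w (L k) (\<sigma> * real (L k))}" for k and w :: "int ^ 'd"
  \<comment> \<open>12 = 8 + 4: the starting points are within 2 R < 8 L (Suc k) of x, and |x| <= R
    < 4 L (Suc k).\<close>
  define A where "A k = (\<Union>w\<in>Q 0 (real (12 * L (Suc k))). F k w)" for k
  have F0: "F k w \<in> sets M" for k w
    unfolding F_def space_M sets_M by (rule sets_not_slow[OF fits_full]) (use \<sigma> in simp)
  have A0: "A k \<in> sets M" for k unfolding A_def by (intro sets.finite_UN F0) simp
  have Fw: "measure M (F k w) = measure M (F k 0)" for k w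
  proof -
    have ns: "F k 0 \<in> sets Om" using F0 sets_M by blast
    have "measure M (F k 0) = measure (distr M Om (shift w)) (F k 0)" using stationary by simp
    also have "\<dots> = measure M (shift w -` F k 0 \<inter> space M)"
      by (rule measure_distr[OF measurable_shift_M ns])
    also have "shift w -` F k 0 \<inter> space M = F k w"
      using shift_in_space[of _ ME MV w] by (auto simp: F_def space_M slow_shift)
    finally show ?thesis by simp
  qed
  have L_ge: "2 ^ k \<le> L k" "k \<le> L k" for k
  proof -
    have "k \<le> scale_exponent m (Suc k)" using scale_exponent_ge(1)[of m "Suc k"] m by simp
    then show *: "2 ^ k \<le> L k" unfolding L_def scale_def by (intro power_increasing) auto
    show "k \<le> L k" using * less_exp[of k] by linarith
  qed
  have mA: "measure M (A k) \<le> (1 / 2) ^ k" for k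
  proof -
    define l where "l = real (L k)"
    define M' where "M' = (2 ^ (m + Suc k) :: real)"
    have L': "real (L (Suc k)) = M' * l" by (simp add: L_def M'_def l_def scale_Suc[of m "Suc k"])
    have "real ((2 ^ (m + Suc k)) ^ 4) \<le> real (L k)" unfolding L_def of_nat_le_iff by (rule scale_ratio) (use m in simp)
    then have M4: "M' ^ 4 \<le> l" by (simp add: M'_def l_def)
    have "(2::real) ^ 6 \<le> 2 ^ (m + Suc k)" by (rule power_increasing) (use m in auto)
    then have M1: "64 \<le> M'" by (simp add: M'_def)
    have "M' ^ 1 \<le> M' ^ 4" using M1 by (intro power_increasing) auto
    then have Ml: "M' \<le> l" using M4 by simp
    have Ml1: "1 \<le> M' * l" using mult_mono[of 1 M' 1 l] M1 Ml by linarith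
    have "measure M (A k) \<le> (\<Sum>w\<in>Q 0 (real (12 * L (Suc k))). measure M (F k w))"
      unfolding A_def by (intro measure_UNION_le F0) simp
    also have "\<dots> = real (card (Q 0 (real (12 * L (Suc k))) :: (int ^ 'd) set)) * measure M (F k 0)" unfolding sum_constant[symmetric] by (intro sum.cong refl Fw)
    also have "\<dots> \<le> (25 * (M' * l)) ^ CARD('d) * (1 / l ^ (4 * CARD('d)))"
    proof (rule mult_mono)
      have "real (card (Q 0 (real (12 * L (Suc k))) :: (int ^ 'd) set)) = (24 * (M' * l) + 1) ^ CARD('d)"
        unfolding card_Q_nat using L' by (simp add: add.commute)
      also have "\<dots> \<le> (25 * (M' * l)) ^ CARD('d)" using Ml1 by (intro power_mono) linarith+
      finally show "real (card (Q 0 (real (12 * L (Suc k))) :: (int ^ 'd) set)) \<le> (25 * (M' * l)) ^ CARD('d)" .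
      show "measure M (F k 0) \<le> 1 / l ^ (4 * CARD('d))" using small[of k] by (simp add: F_def L_def l_def)
    qed (use Ml1 in \<open>auto intro: zero_le_power\<close>)
    also have "\<dots> = (25 * (M' * l) / l ^ 4) ^ CARD('d)" by (simp only: power_divide power_mult) simp
    also have "\<dots> \<le> (1 / l) ^ CARD('d)"
    proof (rule power_mono)
      have "25 * M' \<le> l * l" using mult_mono[of 25 l M' l] M1 Ml by linarith
      then have "25 * M' * l * l \<le> l * l * l * l" using M1 Ml by (intro mult_right_mono) auto
      then show "25 * (M' * l) / l ^ 4 \<le> 1 / l" using M1 Ml by (simp add: field_simps power4_eq_xxxx)
      show "0 \<le> 25 * (M' * l) / l ^ 4" using M1 Ml by simp
    qed
    also have "\<dots> \<le> (1 / l) ^ 1" using M1 Ml by (intro power_decreasing) auto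
    also have "\<dots> \<le> (1 / 2) ^ k"
    proof -
      have "real (2 ^ k) \<le> l" unfolding l_def of_nat_le_iff by (rule L_ge)
      then show ?thesis by (simp add: power_one_over field_simps) (use M1 Ml in \<open>simp add: field_simps\<close>)
    qed
    finally show ?thesis .
  qed
  have "summable (\<lambda>k. measure M (A k))"
    by (rule summable_comparison_test'[of "\<lambda>k. (1 / 2) ^ k" 0]) (use mA in \<open>auto simp: summable_geometric_iff\<close>)
  then have "AE \<omega> in M. \<forall>\<^sub>F k in sequentially. \<omega> \<in> space M - A k"
    using A0 by (intro borel_cantelli_AE1) (auto simp: emeasure_eq_measure)
  then show ?thesis
  proof (rule AE_mp, intro AE_I2 impI allI)
    fix \<omega> and x :: "int ^ 'd"
    assume \<omega>: "\<omega> \<in> space M" and "\<forall>\<^sub>F k in sequentially. \<omega> \<in> space M - A k"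
    then obtain k0 where k0: "\<And>k. k0 \<le> k \<Longrightarrow> \<omega> \<notin> A k" unfolding eventually_sequentially by blast
    have \<omega>': "\<omega> \<in> space Om" using \<omega> by (simp add: space_M)
    define t where "t y z = (if {y, z} \<in> edges then tt \<omega> y z else 0)" for y z
    have t0: "0 \<le> t y z" for y z using passage_time_facts(1)[OF \<omega>'] by (simp add: t_def less_imp_le)
    have tc: "slow t z L' r \<longleftrightarrow> slow (tt \<omega>) z L' r" for z L' r by (rule slow_cong) (simp add: t_def)
    show "\<exists>R0. \<forall>R::real. R0 \<le> R \<longrightarrow> (\<exists>\<psi>. (\<forall>z\<in>Q x R. \<psi> z = 0) \<and> (\<forall>z. z \<notin> Q x (2 * R) \<longrightarrow> \<sigma> / 2 * R \<le> \<psi> z) \<and>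
      (\<forall>y z. {y, z} \<in> edges \<longrightarrow> \<bar>\<psi> y - \<psi> z\<bar> \<le> tt \<omega> y z))"
    proof (intro exI[of _ "max (4 * real (L k0)) (real_of_int (linfnorm x))"] allI impI)
      fix R :: real assume R: "max (4 * real (L k0)) (real_of_int (linfnorm x)) \<le> R"
      define K where "K = {k. 4 * real (L k) \<le> R}"
      have "k \<le> nat \<lceil>R\<rceil>" if "k \<in> K" for k
      proof -
        have "real k \<le> real (L k)" using L_ge(2) by simp
        then show ?thesis using that unfolding K_def by simp linarith
      qed
      then have finK: "finite K" by (meson finite_nat_set_iff_bounded_le)
      have "k0 \<in> K" using R by (simp add: K_def)
      define k where "k = Max K"
      have "k \<in> K" unfolding k_def using finK \<open>k0 \<in> K\<close> by (intro Max_in) auto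
      have "k0 \<le> k" unfolding k_def using finK \<open>k0 \<in> K\<close> by simp
      have "Suc k \<notin> K" using Max_ge[OF finK, of "Suc k"] by (auto simp: k_def)
      then have R': "R < 4 * real (L (Suc k))" by (simp add: K_def)
      have "\<exists>\<psi>. (\<forall>z\<in>Q x R. \<psi> z = 0) \<and> (\<forall>z. z \<notin> Q x (2 * R) \<longrightarrow> \<sigma> / 2 * R \<le> \<psi> z) \<and>
        (\<forall>y z. {y, z} \<in> edges \<longrightarrow> \<bar>\<psi> y - \<psi> z\<bar> \<le> t y z)"
      proof (rule potential_from_slow[OF _ \<sigma> t0, where L = "L k"])
        show "1 \<le> L k" unfolding L_def by (rule scale_pos)
        show "4 * real (L k) \<le> R" using \<open>k \<in> K\<close> by (simp add: K_def)
        fix w assume w: "real_of_int (linfnorm (w - x)) \<le> 2 * R"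
        have "linfnorm w \<le> linfnorm (w - x) + linfnorm x" using linfnorm_triangle_diff[of w 0 x] by simp
        then have "real_of_int (linfnorm w) \<le> real_of_int (linfnorm (w - x)) + real_of_int (linfnorm x)" by linarith
        then have "w \<in> Q 0 (real (12 * L (Suc k)))" using w R R' by (simp add: Q_iff)
        then have "\<omega> \<notin> F k w" using k0[OF \<open>k0 \<le> k\<close>] by (auto simp: A_def)
        then show "slow t w (L k) (\<sigma> * real (L k))" using \<omega> by (simp add: F_def tc)
      qed
      moreover have "\<forall>y z. {y, z} \<in> edges \<longrightarrow> t y z = tt \<omega> y z" by (simp add: t_def)
      ultimately show "\<exists>\<psi>. (\<forall>z\<in>Q x R. \<psi> z = 0) \<and> (\<forall>z. z \<notin> Q x (2 * R) \<longrightarrow> \<sigma> / 2 * R \<le> \<psi> z) \<and>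
        (\<forall>y z. {y, z} \<in> edges \<longrightarrow> \<bar>\<psi> y - \<psi> z\<bar> \<le> tt \<omega> y z)" by (metis (no_types, lifting))
    qed
  qed
qed

end


section \<open>Moments and ergodic averages\<close>

lemma finite_moment_nn_integral:
  fixes r :: real
  assumes fm: "finite_moment M p X" and M: "prob_space M" and X: "X \<in> borel_measurable M" "AE \<omega> in M. 0 \<le> X \<omega>"
    and r: "1 \<le> r" "ereal r \<le> p"
  shows "(\<integral>\<^sup>+\<omega>. ennreal (X \<omega> powr r) \<partial>M) < \<infinity>"
proof -
  interpret prob_space M by (rule M)
  show ?thesis
  proof (cases "p = \<infinity>")
    case True
    have "AE \<omega> in M. ereal (X \<omega>) \<le> esssup M (\<lambda>\<omega>. ereal (X \<omega>))" by (rule esssup_AE) (use X in measurable)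
    moreover have fin: "esssup M (\<lambda>\<omega>. ereal (X \<omega>)) < \<infinity>" using fm True by (simp add: finite_moment_def)
    ultimately obtain K :: real where K: "AE \<omega> in M. X \<omega> \<le> K"
    proof (cases "esssup M (\<lambda>\<omega>. ereal (X \<omega>))")
      case (real K)
      then show ?thesis using \<open>AE \<omega> in M. ereal (X \<omega>) \<le> esssup M (\<lambda>\<omega>. ereal (X \<omega>))\<close> that[of K] by simp
    next
      case MInf
      then show ?thesis using \<open>AE \<omega> in M. ereal (X \<omega>) \<le> esssup M (\<lambda>\<omega>. ereal (X \<omega>))\<close> that[of 0] by simp
    qed auto
    have "(\<integral>\<^sup>+\<omega>. ennreal (X \<omega> powr r) \<partial>M) \<le> (\<integral>\<^sup>+\<omega>. ennreal (K powr r) \<partial>M)"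
    proof (rule nn_integral_mono_AE)
      show "AE \<omega> in M. ennreal (X \<omega> powr r) \<le> ennreal (K powr r)"
        using K X(2) by eventually_elim (use r in \<open>auto intro!: ennreal_leI powr_mono2\<close>)
    qed
    also have "\<dots> < \<infinity>" by (simp add: emeasure_space_1)
    finally show ?thesis .
  next
    case False
    define p' where "p' = real_of_ereal p"
    have p: "p = ereal p'" using False r(2) unfolding p'_def by (cases p) auto
    have rp: "r \<le> p'" using r(2) p by simp
    have int: "integrable M (\<lambda>\<omega>. X \<omega> powr p')" using fm False by (simp add: finite_moment_def p'_def)
    have "(\<integral>\<^sup>+\<omega>. ennreal (X \<omega> powr r) \<partial>M) \<le> (\<integral>\<^sup>+\<omega>. 1 + ennreal (X \<omega> powr p') \<partial>M)"
    proof (rule nn_integral_mono_AE)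
      have "X \<omega> powr r \<le> 1 + X \<omega> powr p'" if "0 \<le> X \<omega>" for \<omega>
      proof (cases "X \<omega> \<le> 1")
        case True
        then have "X \<omega> powr r \<le> 1 powr r" using that r by (intro powr_mono2) auto
        then show ?thesis by (simp add: add_increasing2)
      next
        case False
        then have "X \<omega> powr r \<le> X \<omega> powr p'" using rp by (intro powr_mono) auto
        then show ?thesis by simp
      qed
      then show "AE \<omega> in M. ennreal (X \<omega> powr r) \<le> 1 + ennreal (X \<omega> powr p')"
        using X(2) by (elim AE_mp, intro AE_I2) (auto simp: ennreal_plus[symmetric] ennreal_1[symmetric] simp del: ennreal_1 ennreal_plus intro!: ennreal_leI)
    qed
    also have "\<dots> = 1 + (\<integral>\<^sup>+\<omega>. ennreal (X \<omega> powr p') \<partial>M)"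
      using X by (subst nn_integral_add) (auto simp: emeasure_space_1)
    also have "\<dots> < \<infinity>" using int by (simp add: integrable_iff_bounded less_top)
    finally show ?thesis .
  qed
qed

lemma nn_integral_uniform_measure_finite:
  assumes f: "f \<in> borel_measurable M" and E: "E \<in> sets M" "emeasure M E \<noteq> 0" "emeasure M E \<noteq> \<infinity>"
    and fin: "(\<integral>\<^sup>+\<omega>. f \<omega> \<partial>uniform_measure M E) < \<infinity>"
  shows "(\<integral>\<^sup>+\<omega>. f \<omega> * indicator E \<omega> \<partial>M) < \<infinity>"
proof (rule ccontr)
  assume "\<not> (\<integral>\<^sup>+\<omega>. f \<omega> * indicator E \<omega> \<partial>M) < \<infinity>"
  then have "(\<integral>\<^sup>+\<omega>. f \<omega> * indicator E \<omega> \<partial>M) = \<infinity>" by (simp add: less_top[symmetric])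
  moreover have "(\<integral>\<^sup>+\<omega>. f \<omega> \<partial>uniform_measure M E) = (\<integral>\<^sup>+\<omega>. f \<omega> * indicator E \<omega> \<partial>M) / emeasure M E"
    by (rule nn_integral_uniform_measure[OF f E(1)])
  ultimately show False using fin E by (simp add: ennreal_top_divide)
qed

text \<open>An infinite exponent is traded for a large finite one at the cost of \<epsilon>, after
  which essential suprema no longer occur.\<close>

lemma exists_finite_exponent:
  fixes p :: ereal and \<epsilon> :: real
  assumes "1 < p" "0 < \<epsilon>"
  shows "\<exists>r>1. ereal r \<le> p \<and> ereal (1 / r) \<le> 1 / p + ereal \<epsilon>"
proof (cases p)
  case (real r)
  then show ?thesis using assms by (intro exI[of _ r]) (auto simp: one_ereal_def)
next
  case PInf
  define r where "r = 2 + 1 / \<epsilon>"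
  have "1 / r \<le> \<epsilon>" unfolding r_def using assms(2) by (simp add: field_simps)
  moreover have "1 < r" unfolding r_def using assms(2) by (simp add: add_pos_nonneg less_add_same_cancel1)
  ultimately show ?thesis using PInf by (intro exI[of _ r]) (auto simp: divide_ereal_def)
qed (use assms in simp)

text \<open>The strict inequality leaves 5 \<epsilon>. Four are spent: on finite exponents in place
  of p and q, on q' < q0, which is the room needed to separate T from nu, and on 2 / (d m).\<close>

lemma exists_exponents:
  fixes p q :: ereal and d :: real
  assumes "1 < p" "1 < q" "1 / p + 1 / q < ereal (2 / d)" "0 < d"
  shows "\<exists>p0 q0 q' m :: real. 1 < p0 \<and> ereal p0 \<le> p \<and> 1 < q' \<and> q' < q0 \<and> ereal q0 \<le> q \<and> 1 < m \<and>
    1 / p0 + 1 / q' + 2 / (d * m) < 2 / d"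
proof -
  have ge0: "0 \<le> 1 / p" "0 \<le> 1 / q" using assms(1,2) by (cases p; cases q; auto)+
  obtain a b where ab: "1 / p = ereal a" "1 / q = ereal b"
    using assms(3) ge0 by (cases "1 / p"; cases "1 / q") auto
  define \<epsilon> where "\<epsilon> = (2 / d - a - b) / 5"
  have e: "0 < \<epsilon>" using assms(3) ab by (simp add: \<epsilon>_def)
  obtain p0 where p0: "1 < p0" "ereal p0 \<le> p" "1 / p0 \<le> a + \<epsilon>"
    using exists_finite_exponent[OF assms(1) e] ab by auto
  obtain q0 where q0: "1 < q0" "ereal q0 \<le> q" "1 / q0 \<le> b + \<epsilon>"
    using exists_finite_exponent[OF assms(2) e] ab by auto
  define r where "r = min (1 / q0 + \<epsilon>) ((1 / q0 + 1) / 2)"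
  define q' where "q' = 1 / r"
  have iq: "0 < 1 / q0" "1 / q0 < 1" using q0 by auto
  have mn: "w < min (w + \<epsilon>) ((w + 1) / 2)" "min (w + \<epsilon>) ((w + 1) / 2) < 1" if "w < 1" for w :: real
    using that e by (auto simp: min_less_iff_disj)
  have r: "1 / q0 < r" "r < 1" "r \<le> 1 / q0 + \<epsilon>" unfolding r_def by (rule mn[OF iq(2)])+ (rule min.cobounded1)
  have "0 < r" using r(1) iq(1) by linarith
  then have q': "1 < q'" "q' < q0" unfolding q'_def using r q0(1) by (simp_all add: field_simps)
  define m where "m = 2 + 2 / (d * \<epsilon>)"
  have de: "0 < 2 / (d * \<epsilon>)" using assms(4) e by simp
  have m: "1 < m" unfolding m_def using de by linarith
  have "2 / (d * m) \<le> \<epsilon>"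
  proof -
    have "2 \<le> \<epsilon> * (d * m)" unfolding m_def using assms(4) e by (simp add: field_simps)
    then show ?thesis using assms(4) m by (simp add: field_simps)
  qed
  moreover have "1 / q' = r" by (simp add: q'_def)
  ultimately have "1 / p0 + 1 / q' + 2 / (d * m) \<le> a + b + 4 * \<epsilon>" using p0(3) q0(3) r(3) by linarith
  also have "\<dots> < 2 / d"
  proof -
    have "a + b + 4 * ((x - a - b) / 5) < x" if "0 < (x - a - b) / 5" for x :: real using that by (simp add: field_simps)
    then show ?thesis using e unfolding \<epsilon>_def by blast
  qed
  finally show ?thesis using p0 q0 q' m by blast
qed

text \<open>Whichever of T^2 and v^((q0 - q) / q) is larger absorbs the other. This separates v,
  whose exponent may grow only to q0, from T, which has moments of every order.\<close>

lemma young_power: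
  fixes T v q q0 :: real
  assumes "1 \<le> T" "0 \<le> v" "1 < q" "q < q0" "2 * q * q0 / (q0 - q) \<le> real n"
  shows "(T\<^sup>2 * v) powr q \<le> v powr q0 + T ^ n"
proof (cases "T\<^sup>2 \<le> v powr ((q0 - q) / q)")
  case True
  have "(T\<^sup>2 * v) powr q \<le> (v powr ((q0 - q) / q) * v) powr q"
    using True assms by (intro powr_mono2 mult_right_mono) auto
  also have "\<dots> = v powr q0"
  proof (cases "v = 0")
    case False
    have "v powr ((q0 - q) / q) * v = v powr ((q0 - q) / q + 1)" using False assms by (simp add: powr_add)
    also have "(q0 - q) / q + 1 = q0 / q" using assms by (simp add: field_simps)
    finally show ?thesis using assms by (simp add: powr_powr)
  qed (use assms in simp)
  finally show ?thesis using assms by (simp add: add_increasing2)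
next
  case False
  have "v = (v powr ((q0 - q) / q)) powr (q / (q0 - q))" using assms by (simp add: powr_powr)
  also have "\<dots> \<le> (T\<^sup>2) powr (q / (q0 - q))" using False assms by (intro powr_mono2) auto
  finally have v: "v \<le> (T\<^sup>2) powr (q / (q0 - q))" .
  have "(T\<^sup>2 * v) powr q \<le> (T\<^sup>2 * (T\<^sup>2) powr (q / (q0 - q))) powr q"
    using v assms by (intro powr_mono2 mult_left_mono mult_nonneg_nonneg) auto
  also have "T\<^sup>2 = T powr 2" using assms by (simp add: powr_realpow[of T 2])
  also have "(T powr 2 * (T powr 2) powr (q / (q0 - q))) powr q = T powr ((2 + 2 * (q / (q0 - q))) * q)"
    by (simp only: powr_powr powr_add[symmetric])
  also have "(2 + 2 * (q / (q0 - q))) * q = 2 * q * q0 / (q0 - q)" using assms by (simp add: field_simps)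
  also have "T powr (2 * q * q0 / (q0 - q)) \<le> T powr real n" using assms by (intro powr_mono) auto
  also have "\<dots> = T ^ n" using assms by (simp add: powr_realpow)
  finally have "(T\<^sup>2 * v) powr q \<le> T ^ n" using assms by simp
  then show ?thesis by (simp add: add_increasing)
qed

context percolation_model begin

lemma mu_shift: "\<omega> \<in> space Om \<Longrightarrow> mu N a (shift z \<omega>) 0 = mu N a \<omega> z"
  unfolding mu_eq mu_eq[OF shift_in_space] conductance_shift
  by (rule sum.reindex_bij_witness[where i = "\<lambda>y. y - z" and j = "\<lambda>y. y + z"]) (auto simp: Q_iff)

lemma nu_shift: "\<omega> \<in> space Om \<Longrightarrow> nu N a (shift z \<omega>) 0 = nu N a \<omega> z"
  unfolding nu_eq nu_eq[OF shift_in_space] conductance_shift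
  by (rule sum.reindex_bij_witness[where i = "\<lambda>y. y - z" and j = "\<lambda>y. y + z"]) (auto simp: Q_iff)

lemma mu_nonneg: "\<omega> \<in> space Om \<Longrightarrow> 0 \<le> mu N a \<omega> x"
  unfolding mu_eq by (intro sum_nonneg conductance_nonneg)

lemma nu_nonneg: "\<omega> \<in> space Om \<Longrightarrow> 0 \<le> nu N a \<omega> x"
  unfolding nu_eq by (intro sum_nonneg) auto

end

context percolation_measure begin

text \<open>Conditioning divides by a positive probability, so conditional moments are moments
  restricted to the event, to which stationarity of M applies.\<close>

lemma finite_conditioned_moment:
  assumes pos: "0 < measure M {\<omega> \<in> space M. 0 \<in> infinite_cluster N a \<omega>}"
    and fm: "finite_moment (conditioned N a M) p X" and r: "1 \<le> r" "ereal r \<le> p"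
    and X: "X \<in> borel_measurable Om" "\<And>\<omega>. \<omega> \<in> space Om \<Longrightarrow> 0 \<le> X \<omega>"
  shows "(\<integral>\<^sup>+\<omega>. ennreal (X \<omega> powr r) * indicator {\<omega> \<in> space M. 0 \<in> infinite_cluster N a \<omega>} \<omega> \<partial>M) < \<infinity>"
proof -
  let ?E = "{\<omega> \<in> space M. 0 \<in> infinite_cluster N a \<omega>}"
  have E: "?E \<in> sets M" using sets_clusters[of 0 "\<infinity>"] by (simp only: space_M sets_M)
  have Ee: "emeasure M ?E \<noteq> 0" "emeasure M ?E \<noteq> \<infinity>" using pos by (auto simp: emeasure_eq_measure)
  have XM: "X \<in> borel_measurable M" using X(1) measurable_cong_sets[OF sets_M refl] by blast
  have sp: "space (conditioned N a M) = space Om" "sets (conditioned N a M) = sets Om" by (simp_all add: conditioned_def space_M sets_M)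
  have Xc: "X \<in> borel_measurable (conditioned N a M)" using X(1) measurable_cong_sets[OF sp(2) refl] by blast
  have "prob_space (conditioned N a M)" unfolding conditioned_def by (rule prob_space_uniform_measure[OF Ee])
  moreover have "AE \<omega> in conditioned N a M. 0 \<le> X \<omega>" using X(2) by (intro AE_I2) (simp add: sp)
  ultimately have "(\<integral>\<^sup>+\<omega>. ennreal (X \<omega> powr r) \<partial>conditioned N a M) < \<infinity>"
    using finite_moment_nn_integral[OF fm _ Xc _ r] by blast
  then
  have "(\<integral>\<^sup>+\<omega>. ennreal (X \<omega> powr r) \<partial>uniform_measure M ?E) < \<infinity>" by (simp only: conditioned_def)
  then show ?thesis using XM by (intro nn_integral_uniform_measure_finite E Ee) auto
qed

text \<open>The average is taken of g times the indicator that 0 is in the infinite cluster; shifted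
  by z, the indicator says that z is in it, so sums over the cluster appear.\<close>

lemma AE_cluster_average:
  assumes g: "g \<in> borel_measurable Om" "\<And>\<omega>. \<omega> \<in> space Om \<Longrightarrow> 0 \<le> g \<omega>"
    and fin: "(\<integral>\<^sup>+\<omega>. ennreal (g \<omega>) * indicator {\<omega> \<in> space M. 0 \<in> infinite_cluster N a \<omega>} \<omega> \<partial>M) < \<infinity>"
  shows "\<exists>c>0. AE \<omega> in M. \<forall>y. \<exists>R0. \<forall>R::real. R0 \<le> R \<longrightarrow>
    (\<Sum>z\<in>infinite_cluster N a \<omega> \<inter> Q y R. g (shift z \<omega>)) \<le> c * R ^ CARD('d)"
proof -
  let ?E = "{\<omega> \<in> space M. 0 \<in> infinite_cluster N a \<omega>}"
  have E: "?E \<in> sets Om" using sets_clusters[of 0 "\<infinity>"] by (simp only: space_M)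
  have "(\<lambda>\<omega>. ennreal (g \<omega>) * indicator ?E \<omega>) \<in> borel_measurable Om" using g E by measurable
  from ergodic_upper_bound[OF this fin] obtain c where c: "0 < c"
    "AE \<omega> in M. \<forall>y. \<exists>R0. \<forall>R::real. R0 \<le> R \<longrightarrow> (\<Sum>z\<in>Q y R. ennreal (g (shift z \<omega>)) * indicator ?E (shift z \<omega>)) \<le> ennreal (c * R ^ CARD('d))"
    by blast
  have "AE \<omega> in M. \<forall>y. \<exists>R0. \<forall>R::real. R0 \<le> R \<longrightarrow> (\<Sum>z\<in>infinite_cluster N a \<omega> \<inter> Q y R. g (shift z \<omega>)) \<le> c * R ^ CARD('d)"
    using c(2)
  proof (rule AE_mp, intro AE_I2 impI allI)
    fix \<omega> and y :: "int ^ 'd"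
    assume \<omega>: "\<omega> \<in> space M" and A: "\<forall>y. \<exists>R0. \<forall>R::real. R0 \<le> R \<longrightarrow> (\<Sum>z\<in>Q y R. ennreal (g (shift z \<omega>)) * indicator ?E (shift z \<omega>)) \<le> ennreal (c * R ^ CARD('d))"
    then obtain R0 where R0: "\<And>R::real. R0 \<le> R \<Longrightarrow> (\<Sum>z\<in>Q y R. ennreal (g (shift z \<omega>)) * indicator ?E (shift z \<omega>)) \<le> ennreal (c * R ^ CARD('d))" by blast
    have sh: "shift z \<omega> \<in> space Om" for z using \<omega> by (simp add: space_M shift_in_space)
    show "\<exists>R0. \<forall>R::real. R0 \<le> R \<longrightarrow> (\<Sum>z\<in>infinite_cluster N a \<omega> \<inter> Q y R. g (shift z \<omega>)) \<le> c * R ^ CARD('d)"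
    proof (intro exI[of _ "max R0 0"] allI impI)
      fix R :: real assume R: "max R0 0 \<le> R"
      have "(\<Sum>z\<in>Q y R. ennreal (g (shift z \<omega>)) * indicator ?E (shift z \<omega>)) = (\<Sum>z\<in>infinite_cluster N a \<omega> \<inter> Q y R. ennreal (g (shift z \<omega>)))"
        using sh by (intro sum.mono_neutral_cong_right) (auto simp: space_M clusters_shift indicator_def split: if_splits)
      also have "\<dots> = ennreal (\<Sum>z\<in>infinite_cluster N a \<omega> \<inter> Q y R. g (shift z \<omega>))"
        using g(2)[OF sh] by (intro sum_ennreal)
      finally have "ennreal (\<Sum>z\<in>infinite_cluster N a \<omega> \<inter> Q y R. g (shift z \<omega>)) \<le> ennreal (c * R ^ CARD('d))"
        using R0[of R] R by simp
      then show "(\<Sum>z\<in>infinite_cluster N a \<omega> \<inter> Q y R. g (shift z \<omega>)) \<le> c * R ^ CARD('d)"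
        using c(1) R by (subst (asm) ennreal_le_iff) auto
    qed
  qed
  then show ?thesis using c(1) by blast
qed

lemma AE_scale_average:
  "\<exists>c>0. AE \<omega> in M. (\<forall>z. eventually_not_bad (shift z \<omega>)) \<and> (\<forall>y. \<exists>R0. \<forall>R::real. R0 \<le> R \<longrightarrow>
    (\<Sum>z\<in>infinite_cluster N a \<omega> \<inter> Q y R. real (kscale (shift z \<omega>)) ^ J) \<le> c * R ^ CARD('d))"
proof -
  from ergodic_upper_bound[OF measurable_scale_moment nn_integral_scale_moment] obtain c where c: "0 < c"
    "AE \<omega> in M. \<forall>y. \<exists>R0. \<forall>R::real. R0 \<le> R \<longrightarrow> (\<Sum>z\<in>Q y R. scale_moment J (shift z \<omega>)) \<le> ennreal (c * R ^ CARD('d))"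
    by blast
  have "AE \<omega> in M. (\<forall>z. eventually_not_bad (shift z \<omega>)) \<and> (\<forall>y. \<exists>R0. \<forall>R::real. R0 \<le> R \<longrightarrow>
    (\<Sum>z\<in>infinite_cluster N a \<omega> \<inter> Q y R. real (kscale (shift z \<omega>)) ^ J) \<le> c * R ^ CARD('d))"
    using c(2)
  proof (rule AE_mp, intro AE_I2 impI)
    fix \<omega>
    assume A: "\<forall>y. \<exists>R0. \<forall>R::real. R0 \<le> R \<longrightarrow> (\<Sum>z\<in>Q y R. scale_moment J (shift z \<omega>)) \<le> ennreal (c * R ^ CARD('d))"
    have en: "eventually_not_bad (shift z \<omega>)" for z
    proof (rule eventually_not_bad)
      obtain R0 where R0: "\<And>R::real. R0 \<le> R \<Longrightarrow> (\<Sum>z\<in>Q z R. scale_moment J (shift z \<omega>)) \<le> ennreal (c * R ^ CARD('d))" using A by blast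
      have "scale_moment J (shift z \<omega>) \<le> (\<Sum>z\<in>Q z (max R0 0). scale_moment J (shift z \<omega>))"
        by (rule member_le_sum) auto
      also have "\<dots> \<le> ennreal (c * max R0 0 ^ CARD('d))" by (rule R0) simp
      also have "\<dots> < \<infinity>" by simp
      finally show "scale_moment J (shift z \<omega>) < \<infinity>" .
    qed
    show "(\<forall>z. eventually_not_bad (shift z \<omega>)) \<and> (\<forall>y. \<exists>R0. \<forall>R::real. R0 \<le> R \<longrightarrow>
      (\<Sum>z\<in>infinite_cluster N a \<omega> \<inter> Q y R. real (kscale (shift z \<omega>)) ^ J) \<le> c * R ^ CARD('d))"
    proof (intro conjI allI en)
      fix y :: "int ^ 'd"
      obtain R0 where R0: "\<And>R::real. R0 \<le> R \<Longrightarrow> (\<Sum>z\<in>Q y R. scale_moment J (shift z \<omega>)) \<le> ennreal (c * R ^ CARD('d))" using A by blast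
      show "\<exists>R0. \<forall>R::real. R0 \<le> R \<longrightarrow> (\<Sum>z\<in>infinite_cluster N a \<omega> \<inter> Q y R. real (kscale (shift z \<omega>)) ^ J) \<le> c * R ^ CARD('d)"
      proof (intro exI[of _ "max R0 0"] allI impI)
        fix R :: real assume R: "max R0 0 \<le> R"
        have "ennreal (\<Sum>z\<in>infinite_cluster N a \<omega> \<inter> Q y R. real (kscale (shift z \<omega>)) ^ J)
            = (\<Sum>z\<in>infinite_cluster N a \<omega> \<inter> Q y R. of_nat (kscale (shift z \<omega>)) ^ J)"
          by (simp add: sum_ennreal[symmetric] ennreal_power[symmetric] ennreal_of_nat_eq_real_of_nat)
        also have "\<dots> \<le> (\<Sum>z\<in>infinite_cluster N a \<omega> \<inter> Q y R. scale_moment J (shift z \<omega>))"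
          by (intro sum_mono kscale_power_le en)
        also have "\<dots> \<le> (\<Sum>z\<in>Q y R. scale_moment J (shift z \<omega>))" by (rule sum_mono2) auto
        also have "\<dots> \<le> ennreal (c * R ^ CARD('d))" using R0 R by simp
        finally show "(\<Sum>z\<in>infinite_cluster N a \<omega> \<inter> Q y R. real (kscale (shift z \<omega>)) ^ J) \<le> c * R ^ CARD('d)"
          using c(1) R by (subst (asm) ennreal_le_iff) auto
      qed
    qed
  qed
  then show ?thesis using c(1) by blast
qed

end


section \<open>Decay of Green's function\<close>

text \<open>All estimates use the sup norm, which lies between |.|_1 / d and |.|_1. The change of
  norm costs d^(d-2) in the constant and a factor 1/d in the rate.\<close>

lemma l1norm_bound_of_linfnorm_bound:
  fixes x y :: "int ^ 'd::finite" and G r h :: real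
  assumes d: "2 \<le> d" "d = real CARD('d)" and G: "0 \<le> G" and r: "0 \<le> r" and h: "0 \<le> h" and xy: "0 < linfnorm (y - x)"
  shows "G * real_of_int (linfnorm (y - x)) powr (2 - d) * exp (- r * sqrt h * real_of_int (linfnorm (y - x)))
    \<le> G * d powr (d - 2) * real_of_int (l1norm (x - y)) powr (2 - d) * exp (- (r / d) * sqrt h * real_of_int (l1norm (x - y)))"
proof -
  define n l where "n = real_of_int (linfnorm (y - x))" and "l = real_of_int (l1norm (x - y))"
  have "l1norm (x - y) \<le> int CARD('d) * linfnorm (y - x)" using l1norm_le[of "x - y"] by (simp add: linfnorm_minus_commute)
  then have "l \<le> real_of_int (int CARD('d) * linfnorm (y - x))" unfolding l_def by (simp only: of_int_le_iff)
  then have ln: "l \<le> d * n" by (simp add: d n_def)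
  have n0: "0 < n" using xy by (simp add: n_def)
  have "linfnorm (y - x) \<le> l1norm (x - y)" using linfnorm_le_l1norm[of "x - y"] by (simp add: linfnorm_minus_commute)
  then have nl: "n \<le> l" unfolding n_def l_def by (simp only: of_int_le_iff)
  have "n powr (2 - d) \<le> (l / d) powr (2 - d)"
    using ln nl n0 d(1) by (intro powr_mono2') (auto simp: field_simps)
  also have "\<dots> = d powr (d - 2) * l powr (2 - d)"
  proof -
    have "(l / d) powr (2 - d) = l powr (2 - d) / d powr (2 - d)" by (rule powr_divide)
    also have "d powr (2 - d) = inverse (d powr (d - 2))" by (simp add: powr_minus[symmetric])
    finally show ?thesis by (simp add: divide_inverse mult.commute)
  qed
  finally have 1: "n powr (2 - d) \<le> d powr (d - 2) * l powr (2 - d)" .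
  have "l / d \<le> n" using ln d(1) by (simp add: field_simps)
  then have "r * sqrt h * (l / d) \<le> r * sqrt h * n" using r h by (intro mult_left_mono) auto
  then have 2: "exp (- r * sqrt h * n) \<le> exp (- (r / d) * sqrt h * l)" by simp
  have "G * n powr (2 - d) * exp (- r * sqrt h * n) \<le> G * (d powr (d - 2) * l powr (2 - d)) * exp (- (r / d) * sqrt h * l)"
    using 1 2 G by (intro mult_mono mult_left_mono) auto
  then show ?thesis by (simp add: n_def l_def mult.assoc)
qed

context percolation_model begin

lemma jump_rates_walk:
  assumes \<omega>: "\<omega> \<in> space Om" and x: "x \<in> infinite_cluster N a \<omega>" and h: "0 \<le> h"
  shows "jump_rates (walk_rates N a \<kappa> \<omega> h) (infinite_cluster N a \<omega>) x"
proof
  have sub: "{t. 0 < walk_rates N a \<kappa> \<omega> h z t} \<subseteq> insert None (Some ` Q z 1)" for z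
  proof
    fix t assume t: "t \<in> {t. 0 < walk_rates N a \<kappa> \<omega> h z t}"
    then show "t \<in> insert None (Some ` Q z 1)"
      using conductance_eq_0[OF \<omega>, of _ z] by (cases t) (auto simp: walk_rates_def, metis image_eqI less_irrefl)
  qed
  show "finite {t. 0 < walk_rates N a \<kappa> \<omega> h z t}" for z by (rule finite_subset[OF sub]) simp
  show "{t. 0 < walk_rates N a \<kappa> \<omega> h z t} \<noteq> {}" if z: "z \<in> infinite_cluster N a \<omega>" for z
  proof -
    obtain w where "0 < conductance N a \<omega> z w" using infinite_cluster_nbr[OF \<omega> z] by blast
    then have "Some w \<in> {t. 0 < walk_rates N a \<kappa> \<omega> h z t}" by (simp add: walk_rates_def)
    then show ?thesis by blast
  qed
  show "y \<in> infinite_cluster N a \<omega>" if "z \<in> infinite_cluster N a \<omega>" "0 < walk_rates N a \<kappa> \<omega> h z (Some y)" for z y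
    using cluster_closed[OF \<omega> that(1)] that(2) by (simp add: walk_rates_def)
  have "{z \<in> infinite_cluster N a \<omega>. 0 < walk_rates N a \<kappa> \<omega> h z (Some y)} \<subseteq> Q y 1" for y
  proof
    fix z assume "z \<in> {z \<in> infinite_cluster N a \<omega>. 0 < walk_rates N a \<kappa> \<omega> h z (Some y)}"
    then show "z \<in> Q y 1" using conductance_eq_0[OF \<omega>, of z y] conductance_sym[OF \<omega>, of z y] by (auto simp: walk_rates_def intro: ccontr)
  qed
  then show "finite {z \<in> infinite_cluster N a \<omega>. 0 < walk_rates N a \<kappa> \<omega> h z (Some y)}" for y
    by (rule finite_subset) simp
qed (rule x)

lemma green_function_bound:
  fixes p q m s c R0 cpsi d :: real
  assumes \<omega>: "\<omega> \<in> space Om"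
    and env: "good_environment (conductance N a \<omega>) (killing_rate N \<kappa> \<omega>) (infinite_cluster N a \<omega>) T \<pi> B Z x c R0 m p q s cpsi d"
    and x: "x \<in> infinite_cluster N a \<omega>" and y: "y \<in> infinite_cluster N a \<omega>" and h: "0 \<le> h" "h \<le> 1"
    and far: "16 * R0 \<le> real_of_int (linfnorm (y - x))"
  shows "green_function N a \<kappa> h \<omega> x y \<le> ennreal (decay_const d c s p cpsi * real_of_int (linfnorm (y - x)) powr (2 - d)
      * exp (- decay_rate d cpsi * sqrt h * real_of_int (linfnorm (y - x))))"
proof -
  let ?q = "walk_rates N a \<kappa> \<omega> h" and ?C = "infinite_cluster N a \<omega>" and ?A = "conductance N a \<omega>"
  interpret jump_rates ?q ?C x by (rule jump_rates_walk[OF \<omega> x h(1)])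
  have tr: "total_rate z = (\<Sum>w\<in>Q z 1. ?A z w) + h * killing_rate N \<kappa> \<omega> z" for z
  proof -
    have "total_rate z = sum (?q z) (insert None (Some ` Q z 1))"
    proof (rule sum.mono_neutral_left)
      show "{t. 0 < ?q z t} \<subseteq> insert None (Some ` Q z 1)"
      proof
        fix t assume "t \<in> {t. 0 < ?q z t}"
        then show "t \<in> insert None (Some ` Q z 1)"
          using conductance_eq_0[OF \<omega>, of _ z] by (cases t) (auto simp: walk_rates_def, metis image_eqI less_irrefl)
      qed
      have "0 \<le> ?q z t" for t
        using conductance_nonneg[OF \<omega>] killing_rate_pos[OF \<omega>, of z] h by (simp add: walk_rates_def split: option.split)
      then show "\<forall>i\<in>insert None (Some ` Q z 1) - {t. 0 < ?q z t}. ?q z i = 0" by (auto intro: antisym simp: not_less)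
    qed simp
    also have "\<dots> = ?q z None + (\<Sum>w\<in>Q z 1. ?q z (Some w))" by (simp add: sum.reindex)
    finally show ?thesis by (simp add: walk_rates_def)
  qed
  have ks: "killed_subsolution ?A (killing_rate N \<kappa> \<omega>) ?C T \<pi> B Z x c R0 m p q s cpsi d (green_upto n) h" for n
  proof (intro killed_subsolution.intro env killed_subsolution_axioms.intro green_upto_nonneg finite_green_upto_support h(1))
    show "z \<in> ?C" if "green_upto n z \<noteq> 0" for z using that green_upto_eq_0 by blast
    show "(\<Sum>w\<in>Q z 1. ?A z w * (green_upto n z - green_upto n w)) + h * killing_rate N \<kappa> \<omega> z * green_upto n z \<le> of_bool (z = x)" for z
    proof -
      have e: "(\<Sum>w\<in>Q z 1. ?A z w * (green_upto n z - green_upto n w)) + h * killing_rate N \<kappa> \<omega> z * green_upto n z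
          = total_rate z * green_upto n z - (\<Sum>w\<in>Q z 1. ?A z w * green_upto n w)"
        by (simp add: tr right_diff_distrib sum_subtractf sum_distrib_right distrib_right)
      show ?thesis
      proof (cases "z \<in> ?C")
        case True
        \<comment> \<open>Symmetry of the conductances turns the incoming rates of
          \<open>green_upto_subsolution\<close> into outgoing ones, and extending the sum to the
          whole box only enlarges it.\<close>
        have "(\<Sum>w\<in>{w \<in> ?C. 0 < ?q w (Some z)}. ?q w (Some z) * green_upto n w) \<le> (\<Sum>w\<in>Q z 1. ?A z w * green_upto n w)"
        proof -
          have "(\<Sum>w\<in>{w \<in> ?C. 0 < ?q w (Some z)}. ?q w (Some z) * green_upto n w) = (\<Sum>w\<in>{w \<in> ?C. 0 < ?q w (Some z)}. ?A z w * green_upto n w)"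
            using conductance_sym[OF \<omega>, of z] by (intro sum.cong) (auto simp: walk_rates_def)
          also have "\<dots> \<le> (\<Sum>w\<in>Q z 1. ?A z w * green_upto n w)"
          proof (rule sum_mono2)
            show "{w \<in> ?C. 0 < ?q w (Some z)} \<subseteq> Q z 1"
            proof
              fix w assume "w \<in> {w \<in> ?C. 0 < ?q w (Some z)}"
              then show "w \<in> Q z 1" using conductance_eq_0[OF \<omega>, of w z] conductance_sym[OF \<omega>, of w z] by (auto simp: walk_rates_def intro: ccontr)
            qed
          qed (auto intro!: mult_nonneg_nonneg conductance_nonneg[OF \<omega>])
          finally show ?thesis .
        qed
        then show ?thesis using green_upto_subsolution[OF True, of n] unfolding e by linarith
      next
        case False
        have "0 \<le> (\<Sum>w\<in>Q z 1. ?A z w * green_upto n w)" by (intro sum_nonneg mult_nonneg_nonneg conductance_nonneg[OF \<omega>] green_upto_nonneg)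
        moreover have "(0::real) \<le> of_bool (z = x)" by simp
        ultimately show ?thesis unfolding e unfolding green_upto_eq_0[OF False, of n] by linarith
      qed
    qed
  qed
  have "green_function N a \<kappa> h \<omega> x y \<le> (SUP n. ennreal (green_upto n y))"
    unfolding green_function_def by (rule green_le_SUP[OF y])
  also have "\<dots> \<le> ennreal (decay_const d c s p cpsi * real_of_int (linfnorm (y - x)) powr (2 - d)
      * exp (- decay_rate d cpsi * sqrt h * real_of_int (linfnorm (y - x))))"
    by (intro SUP_least ennreal_leI killed_subsolution.exponential_decay[OF ks far h(2)])
  finally show ?thesis .
qed

end

context percolation_measure begin

theorem AE_green_function_bound:
  fixes p q q' m \<sigma> :: real
  assumes dim: "3 \<le> CARD('d)"
    and ex: "1 < p" "1 < q'" "q' < q" "1 < m" "1 / p + 1 / q' + 2 / (real CARD('d) * m) < 2 / real CARD('d)"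
    and mom: "(\<integral>\<^sup>+\<omega>. ennreal (mu N a \<omega> 0 powr p) * indicator {\<omega> \<in> space M. 0 \<in> infinite_cluster N a \<omega>} \<omega> \<partial>M) < \<infinity>"
      "(\<integral>\<^sup>+\<omega>. ennreal (nu N a \<omega> 0 powr q) * indicator {\<omega> \<in> space M. 0 \<in> infinite_cluster N a \<omega>} \<omega> \<partial>M) < \<infinity>"
      "(\<integral>\<^sup>+\<omega>. ennreal (inverse (killing_rate N \<kappa> \<omega> 0)) * indicator {\<omega> \<in> space M. 0 \<in> infinite_cluster N a \<omega>} \<omega> \<partial>M) < \<infinity>"
    and \<sigma>: "0 < \<sigma>"
    and pot: "AE \<omega> in M. \<forall>x. \<exists>R0. \<forall>R::real. R0 \<le> R \<longrightarrow> (\<exists>\<psi>. (\<forall>z\<in>Q x R. \<psi> z = 0) \<and> (\<forall>z. z \<notin> Q x (2 * R) \<longrightarrow> \<sigma> * R \<le> \<psi> z) \<and>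
      (\<forall>y z. {y, z} \<in> edges \<longrightarrow> \<bar>\<psi> y - \<psi> z\<bar> \<le> tt \<omega> y z))"
  shows "\<exists>c27>0. \<exists>c28>0. AE \<omega> in M. \<forall>x\<in>infinite_cluster N a \<omega>. \<exists>R0 :: real. \<forall>y\<in>infinite_cluster N a \<omega>.
    R0 < real_of_int (l1norm (x - y)) \<longrightarrow> (\<forall>h\<in>{0..1}. green_function N a \<kappa> h \<omega> x y
      \<le> ennreal (c27 * real_of_int (l1norm (x - y)) powr (2 - real CARD('d)) * exp (- c28 * sqrt h * real_of_int (l1norm (x - y)))))"
proof -
  define d where "d = real CARD('d)"
  define s where "s = 1 + 1 / q' - 2 / real CARD('d) + 2 / (real CARD('d) * m)"
  \<comment> \<open>Large enough for T^n to dominate both T^m and the remainder in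
    \<open>young_power\<close>.\<close>
  define n where "n = nat \<lceil>max m (2 * q' * q / (q - q'))\<rceil>"
  have n: "m \<le> real n" "2 * q' * q / (q - q') \<le> real n" unfolding n_def by linarith+
  obtain c1 where c1: "0 < c1" "AE \<omega> in M. (\<forall>z. eventually_not_bad (shift z \<omega>)) \<and> (\<forall>y. \<exists>R0. \<forall>R::real. R0 \<le> R \<longrightarrow>
    (\<Sum>z\<in>infinite_cluster N a \<omega> \<inter> Q y R. real (kscale (shift z \<omega>)) ^ (CARD('d) * n)) \<le> c1 * R ^ CARD('d))"
    using AE_scale_average by blast
  obtain c2 where c2: "0 < c2" "AE \<omega> in M. \<forall>y. \<exists>R0. \<forall>R::real. R0 \<le> R \<longrightarrow>
    (\<Sum>z\<in>infinite_cluster N a \<omega> \<inter> Q y R. mu N a (shift z \<omega>) 0 powr p) \<le> c2 * R ^ CARD('d)"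
    using AE_cluster_average[OF _ _ mom(1)] by auto
  obtain c3 where c3: "0 < c3" "AE \<omega> in M. \<forall>y. \<exists>R0. \<forall>R::real. R0 \<le> R \<longrightarrow>
    (\<Sum>z\<in>infinite_cluster N a \<omega> \<inter> Q y R. nu N a (shift z \<omega>) 0 powr q) \<le> c3 * R ^ CARD('d)"
    using AE_cluster_average[OF _ _ mom(2)] by auto
  obtain c4 where c4: "0 < c4" "AE \<omega> in M. \<forall>y. \<exists>R0. \<forall>R::real. R0 \<le> R \<longrightarrow>
    (\<Sum>z\<in>infinite_cluster N a \<omega> \<inter> Q y R. inverse (killing_rate N \<kappa> (shift z \<omega>) 0)) \<le> c4 * R ^ CARD('d)"
    using AE_cluster_average[OF _ _ mom(3)] killing_rate_pos by (auto simp: less_imp_le)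
  define b where "b = (9::real) ^ (CARD('d) * n)"
  have b: "1 \<le> b" by (simp add: b_def)
  \<comment> \<open>One deterministic constant for all averages; the configuration and x enter only
    through the radius R0. The factor b converts moments of \<open>kscale\<close> into moments of
    T.\<close>
  define c where "c = 1 + b * c1 + c2 + c3 + c4"
  have bc1: "0 < b * c1" using b c1(1) by simp
  have c: "1 \<le> c" "b * c1 \<le> c" "c3 + b * c1 \<le> c" "c2 \<le> c" "c4 \<le> c"
    using bc1 c2(1) c3(1) c4(1) unfolding c_def by linarith+
  define G where "G = decay_const d c s p \<sigma>"
  define r where "r = decay_rate d \<sigma>"
  have G: "0 < G" unfolding G_def by (rule decay_const_pos) (use c in simp)
  have r: "0 < r" using \<sigma> by (simp add: r_def decay_rate_def)
  have d: "3 \<le> d" using dim by (simp add: d_def)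
  have "AE \<omega> in M. \<forall>x\<in>infinite_cluster N a \<omega>. \<exists>R0 :: real. \<forall>y\<in>infinite_cluster N a \<omega>.
    R0 < real_of_int (l1norm (x - y)) \<longrightarrow> (\<forall>h\<in>{0..1}. green_function N a \<kappa> h \<omega> x y
      \<le> ennreal ((G * d powr (d - 2)) * real_of_int (l1norm (x - y)) powr (2 - real CARD('d)) * exp (- (r / d) * sqrt h * real_of_int (l1norm (x - y)))))"
    using c1(2) c2(2) c3(2) c4(2) pot AE_space
  proof eventually_elim
    case (elim \<omega>)
    have \<omega>: "\<omega> \<in> space Om" using elim(6) by (simp add: space_M)
    let ?C = "infinite_cluster N a \<omega>" and ?A = "conductance N a \<omega>"
    have enb: "eventually_not_bad (shift z \<omega>)" for z using elim(1) by blast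
    obtain \<pi> B Z where geo': "\<forall>z. z \<in> ?C \<longrightarrow> \<pi> z = z" "\<forall>z. \<pi> z \<in> B z"
      "\<forall>z i. (\<pi> z, \<pi> (z + axis i 1)) \<in> {(v, w). v \<in> B z \<and> w \<in> B z \<and> 0 < ?A v w}\<^sup>*"
      "\<forall>z. finite (B z)" "\<forall>b z. b \<in> B z \<longrightarrow> z \<in> Z b \<and> b \<in> ?C" "\<forall>b. finite (Z b)"
      "\<forall>b. real (card (Z b)) \<le> (9 * real (kscale (shift b \<omega>))) ^ CARD('d)"
      using exists_geometry[OF \<omega> enb] by (elim exE conjE) (rule that, assumption+)
    note geo = geo'[rule_format]
    define T where "T z = (9 * real (kscale (shift z \<omega>))) ^ CARD('d)" for z
    have T1: "1 \<le> T z" for z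
      unfolding T_def using kscale[OF enb, of z] by (intro one_le_power) linarith
    have Tn: "T z ^ n = b * real (kscale (shift z \<omega>)) ^ (CARD('d) * n)" for z
      by (simp add: T_def b_def power_mult power_mult_distrib)
    show ?case
    proof
      fix x assume x: "x \<in> ?C"
      obtain R1 where R1: "\<And>R::real. R1 \<le> R \<Longrightarrow> (\<Sum>z\<in>?C \<inter> Q x R. real (kscale (shift z \<omega>)) ^ (CARD('d) * n)) \<le> c1 * R ^ CARD('d)"
        using elim(1) by blast
      obtain R2 where R2: "\<And>R::real. R2 \<le> R \<Longrightarrow> (\<Sum>z\<in>?C \<inter> Q x R. mu N a (shift z \<omega>) 0 powr p) \<le> c2 * R ^ CARD('d)"
        using elim(2) by blast
      obtain R3 where R3: "\<And>R::real. R3 \<le> R \<Longrightarrow> (\<Sum>z\<in>?C \<inter> Q x R. nu N a (shift z \<omega>) 0 powr q) \<le> c3 * R ^ CARD('d)"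
        using elim(3) by blast
      obtain R4 where R4: "\<And>R::real. R4 \<le> R \<Longrightarrow> (\<Sum>z\<in>?C \<inter> Q x R. inverse (killing_rate N \<kappa> (shift z \<omega>) 0)) \<le> c4 * R ^ CARD('d)"
        using elim(4) by blast
      obtain R5 where R5: "\<And>R::real. R5 \<le> R \<Longrightarrow> (\<exists>\<psi>. (\<forall>z\<in>Q x R. \<psi> z = 0) \<and> (\<forall>z. z \<notin> Q x (2 * R) \<longrightarrow> \<sigma> * R \<le> \<psi> z) \<and>
        (\<forall>y z. {y, z} \<in> edges \<longrightarrow> \<bar>\<psi> y - \<psi> z\<bar> \<le> tt \<omega> y z))"
        using elim(5) by blast
      define R0 where "R0 = max 4 (max R1 (max R2 (max R3 (max R4 R5))))"
      have R0: "4 \<le> R0" "R1 \<le> R0" "R2 \<le> R0" "R3 \<le> R0" "R4 \<le> R0" "R5 \<le> R0" unfolding R0_def by linarith+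
      have mult_le: "k * R ^ CARD('d) \<le> c * R ^ CARD('d)" if "k \<le> c" "R0 \<le> R" for k R :: real
        using that R0 by (intro mult_right_mono) auto
      have sumTn: "(\<Sum>z\<in>?C \<inter> Q x R. T z ^ n) \<le> b * c1 * R ^ CARD('d)" if "R0 \<le> R" for R
      proof -
        have "(\<Sum>z\<in>?C \<inter> Q x R. T z ^ n) = b * (\<Sum>z\<in>?C \<inter> Q x R. real (kscale (shift z \<omega>)) ^ (CARD('d) * n))"
          by (simp add: Tn sum_distrib_left)
        also have "\<dots> \<le> b * (c1 * R ^ CARD('d))" using R1[of R] R0 that b by (intro mult_left_mono) auto
        finally show ?thesis by (simp add: mult.assoc)
      qed
      have env: "good_environment ?A (killing_rate N \<kappa> \<omega>) ?C T \<pi> B Z x c R0 m p q' s \<sigma> d"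
      proof
        show "d = real CARD('d)" by (rule d_def)
        show "?A z w = ?A w z" for z w by (rule conductance_sym[OF \<omega>])
        show "0 \<le> ?A z w" for z w by (rule conductance_nonneg[OF \<omega>])
        show "linfnorm (z - w) \<le> 1" if "0 < ?A z w" for z w using edges_dist[OF conductance_pos_edge[OF that]] .
        show "w \<in> ?C" if "z \<in> ?C" "0 < ?A z w" for z w using cluster_closed[OF \<omega> that] .
        show "0 < killing_rate N \<kappa> \<omega> z" for z by (rule killing_rate_pos[OF \<omega>])
        show "\<pi> z = z" if "z \<in> ?C" for z by (rule geo(1)[OF that])
        show "\<pi> z \<in> B z" for z by (rule geo)
        show "(\<pi> z, \<pi> (z + axis i 1)) \<in> {(v, w). v \<in> B z \<and> w \<in> B z \<and> 0 < ?A v w}\<^sup>*" for z i by (rule geo)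
        show "finite (B z)" for z by (rule geo)
        show "z \<in> Z b \<and> b \<in> ?C" if "b \<in> B z" for b z by (rule geo(5)[OF that])
        show "finite (Z b)" if "b \<in> ?C" for b by (rule geo)
        show "real (card (Z b)) \<le> T b" if "b \<in> ?C" for b unfolding T_def by (rule geo)
        show "1 \<le> T b" if "b \<in> ?C" for b by (rule T1)
        show "3 \<le> CARD('d)" by (rule dim)
        show "1 < m" "1 < p" "1 < q'" by (rule ex)+
        show "s = 1 + 1 / q' - 2 / real CARD('d) + 2 / (real CARD('d) * m)" by (rule s_def)
        show "s < 1 - 1 / p" using ex(5) unfolding s_def by simp
        show "1 \<le> c" by (rule c)
        show "4 \<le> R0" by (rule R0)
        show "0 < \<sigma>" by (rule \<sigma>)
        show "(\<Sum>z\<in>?C \<inter> Q x R. T z powr m) \<le> c * R ^ CARD('d)" if R: "R0 \<le> R" for R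
        proof -
          have "T z powr m \<le> T z ^ n" for z
          proof -
            have "T z powr m \<le> T z powr real n" using T1[of z] n by (intro powr_mono) auto
            then show ?thesis using T1[of z] by (simp add: powr_realpow)
          qed
          then have "(\<Sum>z\<in>?C \<inter> Q x R. T z powr m) \<le> (\<Sum>z\<in>?C \<inter> Q x R. T z ^ n)" by (rule sum_mono)
          also have "\<dots> \<le> b * c1 * R ^ CARD('d)" by (rule sumTn[OF R])
          also have "\<dots> \<le> c * R ^ CARD('d)" by (rule mult_le[OF c(2) R])
          finally show ?thesis .
        qed
        show "(\<Sum>z\<in>?C \<inter> Q x R. ((T z)\<^sup>2 * (\<Sum>w\<in>Q z 1. if 0 < ?A z w then inverse (?A z w) else 0)) powr q') \<le> c * R ^ CARD('d)"
          if R: "R0 \<le> R" for R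
        proof -
          have "((T z)\<^sup>2 * (\<Sum>w\<in>Q z 1. if 0 < ?A z w then inverse (?A z w) else 0)) powr q' \<le> nu N a (shift z \<omega>) 0 powr q + T z ^ n" for z
            unfolding nu_eq[OF \<omega>, symmetric] nu_shift[OF \<omega>]
            by (rule young_power[OF T1 nu_nonneg[OF \<omega>] ex(2,3) n(2)])
          then have "(\<Sum>z\<in>?C \<inter> Q x R. ((T z)\<^sup>2 * (\<Sum>w\<in>Q z 1. if 0 < ?A z w then inverse (?A z w) else 0)) powr q')
              \<le> (\<Sum>z\<in>?C \<inter> Q x R. nu N a (shift z \<omega>) 0 powr q + T z ^ n)" by (rule sum_mono)
          also have "\<dots> \<le> c3 * R ^ CARD('d) + b * c1 * R ^ CARD('d)"
            unfolding sum.distrib using R3[of R] R0 R sumTn[OF R] by (intro add_mono) auto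
          also have "\<dots> = (c3 + b * c1) * R ^ CARD('d)" by (simp add: distrib_right)
          also have "\<dots> \<le> c * R ^ CARD('d)" by (rule mult_le[OF c(3) R])
          finally show ?thesis .
        qed
        show "(\<Sum>z\<in>?C \<inter> Q x R. (\<Sum>w\<in>Q z 1. ?A z w) powr p) \<le> c * R ^ CARD('d)" if R: "R0 \<le> R" for R
        proof -
          have "(\<Sum>z\<in>?C \<inter> Q x R. (\<Sum>w\<in>Q z 1. ?A z w) powr p) = (\<Sum>z\<in>?C \<inter> Q x R. mu N a (shift z \<omega>) 0 powr p)"
            unfolding mu_eq[OF \<omega>, symmetric] mu_shift[OF \<omega>] ..
          also have "\<dots> \<le> c2 * R ^ CARD('d)" using R2[of R] R0 R by simp
          also have "\<dots> \<le> c * R ^ CARD('d)" by (rule mult_le[OF c(4) R])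
          finally show ?thesis .
        qed
        show "(\<Sum>z\<in>?C \<inter> Q x R. inverse (killing_rate N \<kappa> \<omega> z)) \<le> c * R ^ CARD('d)" if R: "R0 \<le> R" for R
        proof -
          have "(\<Sum>z\<in>?C \<inter> Q x R. inverse (killing_rate N \<kappa> \<omega> z)) \<le> c4 * R ^ CARD('d)"
            using R4[of R] R0 R by (simp add: killing_rate_shift)
          also have "\<dots> \<le> c * R ^ CARD('d)" by (rule mult_le[OF c(5) R])
          finally show ?thesis .
        qed
        show "\<exists>\<psi>. (\<forall>z\<in>Q x R. \<psi> z = 0) \<and> (\<forall>z. z \<notin> Q x (2 * R) \<longrightarrow> \<sigma> * R \<le> \<psi> z) \<and>
          (\<forall>z w. 0 < ?A z w \<longrightarrow> \<bar>\<psi> z - \<psi> w\<bar> \<le> 1 \<and> ?A z w * (\<psi> z - \<psi> w)\<^sup>2 \<le> min (killing_rate N \<kappa> \<omega> z) (killing_rate N \<kappa> \<omega> w))"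
          if R: "R0 \<le> R" for R
        proof -
          obtain \<psi> where \<psi>: "\<forall>z\<in>Q x R. \<psi> z = 0" "\<forall>z. z \<notin> Q x (2 * R) \<longrightarrow> \<sigma> * R \<le> \<psi> z"
            "\<And>y z. {y, z} \<in> edges \<Longrightarrow> \<bar>\<psi> y - \<psi> z\<bar> \<le> tt \<omega> y z" using R5[of R] R0 R by auto
          have "\<bar>\<psi> z - \<psi> w\<bar> \<le> 1 \<and> ?A z w * (\<psi> z - \<psi> w)\<^sup>2 \<le> min (killing_rate N \<kappa> \<omega> z) (killing_rate N \<kappa> \<omega> w)" if A: "0 < ?A z w" for z w
          proof -
            have e: "{z, w} \<in> edges" by (rule conductance_pos_edge[OF A])
            note pt = passage_time_facts[OF \<omega> e]
            have "(\<psi> z - \<psi> w)\<^sup>2 \<le> (tt \<omega> z w)\<^sup>2" using \<psi>(3)[OF e] pt(1) by (simp add: abs_le_square_iff[symmetric])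
            then have "?A z w * (\<psi> z - \<psi> w)\<^sup>2 \<le> ?A z w * (tt \<omega> z w)\<^sup>2" using A by simp
            then show ?thesis using \<psi>(3)[OF e] pt(2,3) by linarith
          qed
          then show ?thesis using \<psi>(1,2) by blast
        qed
      qed
      show "\<exists>R0 :: real. \<forall>y\<in>?C. R0 < real_of_int (l1norm (x - y)) \<longrightarrow> (\<forall>h\<in>{0..1}. green_function N a \<kappa> h \<omega> x y
        \<le> ennreal ((G * d powr (d - 2)) * real_of_int (l1norm (x - y)) powr (2 - real CARD('d)) * exp (- (r / d) * sqrt h * real_of_int (l1norm (x - y)))))"
      \<comment> \<open>The factor d carries the threshold 16 R0 from the sup norm to the l1
        norm.\<close>
      proof (intro exI[of _ "16 * R0 * d"] ballI impI)
        fix y h assume y: "y \<in> ?C" and far: "16 * R0 * d < real_of_int (l1norm (x - y))" and "h \<in> {0..1::real}"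
        then have h: "0 \<le> h" "h \<le> 1" by auto
        have "l1norm (x - y) \<le> int CARD('d) * linfnorm (y - x)" using l1norm_le[of "x - y"] by (simp add: linfnorm_minus_commute)
        then have "real_of_int (l1norm (x - y)) \<le> real_of_int (int CARD('d) * linfnorm (y - x))" by (simp only: of_int_le_iff)
        moreover have "real_of_int (int CARD('d) * linfnorm (y - x)) = real_of_int (linfnorm (y - x)) * d" by (simp add: d_def)
        ultimately have "16 * R0 * d < real_of_int (linfnorm (y - x)) * d" using far by linarith
        then have far': "16 * R0 < real_of_int (linfnorm (y - x))" using d by simp
        then have pos: "0 < linfnorm (y - x)" using R0 by linarith
        have "green_function N a \<kappa> h \<omega> x y \<le> ennreal (G * real_of_int (linfnorm (y - x)) powr (2 - d) * exp (- r * sqrt h * real_of_int (linfnorm (y - x))))"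
          unfolding G_def r_def using green_function_bound[OF \<omega> env x y h] far' by simp
        also have "\<dots> \<le> ennreal ((G * d powr (d - 2)) * real_of_int (l1norm (x - y)) powr (2 - real CARD('d)) * exp (- (r / d) * sqrt h * real_of_int (l1norm (x - y))))"
          unfolding d_def[symmetric] by (intro ennreal_leI l1norm_bound_of_linfnorm_bound) (use d d_def G r h pos in auto)
        finally show "green_function N a \<kappa> h \<omega> x y \<le> ennreal ((G * d powr (d - 2)) * real_of_int (l1norm (x - y)) powr (2 - real CARD('d)) * exp (- (r / d) * sqrt h * real_of_int (l1norm (x - y))))" .
      qed
    qed
  qed
  moreover have "0 < G * d powr (d - 2)" "0 < r / d" using G r d by auto
  ultimately show ?thesis by blast
qed

end

theorem theorem3p10:
  fixes ME :: "'e::order measure" and MV :: "'v::order measure"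
    and N :: "'d::finite region"
    and a :: "('e, 'v, 'd) cond_fun" and \<kappa> :: "('e, 'v, 'd) kill_fun"
    and I :: "real set" and P :: "real \<Rightarrow> ('e, 'v, 'd) conf measure"
  assumes "CARD('d) \<ge> 3"
    and "finite (fst N)" "fst N \<subseteq> edges" "finite (snd N)"
    and "open I" "is_interval I"
    and "\<And>u. u \<in> I \<Longrightarrow> prob_space (P u)"
    and "\<And>u. u \<in> I \<Longrightarrow> sets (P u) = sets (Omega ME MV)"
    and "conductance_function ME MV N a"
    and "killing_function ME MV N \<kappa>"
    and "cond_P1 ME MV I P"
    and "cond_P2 ME MV I P"
    and "cond_P3 TYPE('x) ME MV I P"
    and "cond_S1 N a I P"
    and "cond_S2 N a I P"
    and "cond_K ME MV N a \<kappa> I P"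
    and "u \<in> I"
  shows "\<exists>c\<^sub>2\<^sub>7 > 0. \<exists>c\<^sub>2\<^sub>8 > 0. AE \<omega> in P u. \<forall>x \<in> infinite_cluster N a \<omega>.
           \<exists>N\<^sub>1\<^sub>2 :: real. \<forall>y \<in> infinite_cluster N a \<omega>. real_of_int (l1norm (x - y)) > N\<^sub>1\<^sub>2 \<longrightarrow>
             (\<forall>h \<in> {0..1}. green_function N a \<kappa> h \<omega> x y
                \<le> ennreal (c\<^sub>2\<^sub>7 * real_of_int (l1norm (x - y)) powr (2 - real CARD('d))
                     * exp (- c\<^sub>2\<^sub>8 * sqrt h * real_of_int (l1norm (x - y)))))"
proof -
  interpret percolation_model ME MV N a \<kappa>
    by (intro percolation_model.intro assms)
  obtain fS :: "real \<Rightarrow> nat \<Rightarrow> real" where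
    fS: "\<forall>u\<in>I. \<exists>\<Delta>>0. \<exists>RS::real. \<forall>R::nat. RS \<le> real R \<longrightarrow> ln (real R) powr (1 + \<Delta>) \<le> fS u R"
    and S1: "\<forall>u\<in>I. \<forall>R\<ge>1.
           1 - exp (- fS u R)
             \<le> measure (P u) {\<omega> \<in> space (P u). clusters N a (ereal (real R)) \<omega> \<inter> Q 0 (real R) \<noteq> {}} \<and>
           1 - exp (- fS u R)
             \<le> measure (P u) {\<omega> \<in> space (P u).
                  \<forall>x\<in>clusters N a (ereal (real R / 10)) \<omega> \<inter> Q 0 (real R).
                  \<forall>y\<in>clusters N a (ereal (real R / 10)) \<omega> \<inter> Q 0 (real R).
                    connected_in N a \<omega> (Q 0 (2 * real R)) x y}"
    using assms(14) unfolding cond_S1_def by (elim exE conjE) (rule that, assumption+)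
  obtain \<Delta> RS :: real where \<Delta>: "0 < \<Delta>" "\<forall>R::nat. RS \<le> real R \<longrightarrow> ln (real R) powr (1 + \<Delta>) \<le> fS u R"
    using bspec[OF fS assms(17)] by (elim exE conjE) (rule that, assumption+)
  have P1: "distr (P v) (Omega ME MV) (shift x) = P v"
      "x \<noteq> 0 \<Longrightarrow> A \<in> sets (Omega ME MV) \<Longrightarrow> shift x ` A = A \<Longrightarrow> measure (P v) A \<in> {0, 1}" if "v \<in> I" for v x A
    using assms(11) that unfolding cond_P1_def by simp_all
  interpret percolation_measure ME MV N a \<kappa> "P u" "fS u" \<Delta> RS
  proof (intro percolation_measure.intro stationary_ergodic.intro stationary_ergodic_axioms.intro percolation_measure_axioms.intro)
    show "percolation_model ME MV N a \<kappa>" by (rule percolation_model_axioms)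
  qed (use assms(7,8,17) P1 \<Delta> S1 in auto)
  obtain p q :: ereal where pq: "1 < p" "1 < q" "1 / p + 1 / q < ereal (2 / real CARD('d))"
    and K: "\<And>u. u \<in> I \<Longrightarrow> finite_moment (conditioned N a (P u)) p (\<lambda>\<omega>. mu N a \<omega> 0) \<and>
           finite_moment (conditioned N a (P u)) q (\<lambda>\<omega>. nu N a \<omega> 0) \<and>
           integrable (conditioned N a (P u)) (\<lambda>\<omega>. killing_rate N \<kappa> \<omega> 0) \<and>
           integrable (conditioned N a (P u)) (\<lambda>\<omega>. inverse (killing_rate N \<kappa> \<omega> 0))"
    and mono: "monotone_either (space (triple_space ME MV N)) (triple_le N) (\<lambda>(s, t, e). edge_weight a \<kappa> s t e)"
    using assms(16) unfolding cond_K_def by blast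
  obtain p0 q0 q' m :: real where ex: "1 < p0" "ereal p0 \<le> p" "1 < q'" "q' < q0" "ereal q0 \<le> q" "1 < m"
      "1 / p0 + 1 / q' + 2 / (real CARD('d) * m) < 2 / real CARD('d)"
    using exists_exponents[OF pq] by (auto simp: zero_less_card_finite)
  have pos: "0 < measure (P u) {\<omega> \<in> space (P u). 0 \<in> infinite_cluster N a \<omega>}"
    using assms(15,17) unfolding cond_S2_def by blast
  note Ku = K[OF assms(17)]
  have mom_mu: "(\<integral>\<^sup>+\<omega>. ennreal (mu N a \<omega> 0 powr p0) * indicator {\<omega> \<in> space (P u). 0 \<in> infinite_cluster N a \<omega>} \<omega> \<partial>P u) < \<infinity>"
    by (rule finite_conditioned_moment[OF pos conjunct1[OF Ku] _ ex(2)]) (use ex mu_nonneg in auto)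
  have mom_nu: "(\<integral>\<^sup>+\<omega>. ennreal (nu N a \<omega> 0 powr q0) * indicator {\<omega> \<in> space (P u). 0 \<in> infinite_cluster N a \<omega>} \<omega> \<partial>P u) < \<infinity>"
    by (rule finite_conditioned_moment[OF pos conjunct1[OF conjunct2[OF Ku]] _ ex(5)]) (use ex nu_nonneg in auto)
  have kp: "0 < killing_rate N \<kappa> \<omega> 0" if "\<omega> \<in> space (P u)" for \<omega> using that killing_rate_pos by (simp add: space_M)
  \<comment> \<open>The inverse killing rate is treated as a moment of exponent 1; positivity is
    what makes its power 1 equal to itself.\<close>
  have "integrable (conditioned N a (P u)) (\<lambda>\<omega>. inverse (killing_rate N \<kappa> \<omega> 0) powr 1)
      = integrable (conditioned N a (P u)) (\<lambda>\<omega>. inverse (killing_rate N \<kappa> \<omega> 0))"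
    using kp by (intro Bochner_Integration.integrable_cong) (simp_all add: conditioned_def less_imp_le)
  then have "finite_moment (conditioned N a (P u)) 1 (\<lambda>\<omega>. inverse (killing_rate N \<kappa> \<omega> 0))"
    using Ku by (simp add: finite_moment_def one_ereal_def)
  then have "(\<integral>\<^sup>+\<omega>. ennreal (inverse (killing_rate N \<kappa> \<omega> 0) powr 1) * indicator {\<omega> \<in> space (P u). 0 \<in> infinite_cluster N a \<omega>} \<omega> \<partial>P u) < \<infinity>"
    by (rule finite_conditioned_moment[OF pos]) (use killing_rate_pos in \<open>auto simp: less_imp_le\<close>)
  moreover have "(\<integral>\<^sup>+\<omega>. ennreal (inverse (killing_rate N \<kappa> \<omega> 0) powr 1) * indicator {\<omega> \<in> space (P u). 0 \<in> infinite_cluster N a \<omega>} \<omega> \<partial>P u)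
      = (\<integral>\<^sup>+\<omega>. ennreal (inverse (killing_rate N \<kappa> \<omega> 0)) * indicator {\<omega> \<in> space (P u). 0 \<in> infinite_cluster N a \<omega>} \<omega> \<partial>P u)"
    using kp by (intro nn_integral_cong) (simp add: less_imp_le)
  ultimately have mom_kappa: "(\<integral>\<^sup>+\<omega>. ennreal (inverse (killing_rate N \<kappa> \<omega> 0)) * indicator {\<omega> \<in> space (P u). 0 \<in> infinite_cluster N a \<omega>} \<omega> \<partial>P u) < \<infinity>"
    by simp
  obtain l \<sigma> where l: "6 \<le> l" "0 < \<sigma>" and slow: "\<And>k. measure (P u) {\<omega> \<in> space (P u). \<not> slow (tt \<omega>) 0 (scale l (Suc k)) (\<sigma> * real (scale l (Suc k)))}
      \<le> 1 / real (scale l (Suc k)) ^ (4 * CARD('d))"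
    using slow_passage_probability[OF assms(2,4,5,17,7,8) P1(1) assms(13) mono] by blast
  have "0 < \<sigma> / 2" using l(2) by simp
  from AE_green_function_bound[OF assms(1) ex(1,3,4,6,7) mom_mu mom_nu mom_kappa this AE_potentials[OF l slow]]
  show ?thesis by simp
qed

end
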